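(* Let $k\ge 0$ be an integer and let $(\mathcal M_h)_h$ be a regular sequence of polygonal meshes of $\Omega$ with regularity parameter $\varrho$. There exists a constant $C>0$, depending only on $\Omega$, $\varrho$ and $k$ (in particular independent of $h$), such that for every mesh of the sequence and every $\underline{\boldsymbol\phi}_h\in \underline H^{k+1}_{1,0}(\mathcal T_h)^2$, $$\big\|\underline{\boldsymbol G}^{k+1}_{1,h}\underline{\boldsymbol\phi}_h\big\|_{\mathbf{rot},h}^2\le C\Big(\big\|\boldsymbol G^{k+1}_{1,s,h}\underline{\boldsymbol\phi}_h\big\|_{L^2(\Omega)^{2\times2}}^2+\sum_{T\in\mathcal T_h}h_T^{-2}\,s_{1,T}(\underline{\boldsymbol\phi}_T,\underline{\boldsymbol\phi}_T)\Big).$$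
   Context: **Mesh.** $\Omega\subset\mathbb R^2$ is a bounded polygonal domain. A polygonal mesh is $\mathcal M_h=(\mathcal T_h,\mathcal E_h,\mathcal V_h)$: $\mathcal T_h$ is a finite set of pairwise disjoint open polygons $T$ (elements) of diameter $h_T$ with $\overline\Omega=\bigcup_T\overline T$; $h=\max_T h_T$; $\mathcal E_h$ is the set of (pairwise disjoint, open, straight) edges $E$ of length $h_E$; $\mathcal V_h$ is the set of vertices $V$, with position $\boldsymbol x_V$. Every edge lies either in $\partial\Omega$ (boundary edge) or in the common boundary of exactly two elements (interior edge); for each $T$, $\partial T$ is the union of the closures of the edges in a subset $\mathcal E_T\subset\mathcal E_h$ (a straight side of $T$ may be split into several edges). For $Y\in\mathcal T_h\cup\mathcal E_h$, $\mathcal V_Y$ is the set of its vertices. $\mathcal E_h^{\rm b},\mathcal V_h^{\rm b}$ are the edges/vertices lying on $\partial\Omega$. Each $E$ has a fixed unit tangent $\boldsymbol t_E$ and the unit normal $\boldsymbol n_E$ such that $(\boldsymbol t_E,\boldsymbol n_E)$ is positively oriented; $\omega_{TE}\in\{-1,1\}$ is such that $\omega_{TE}\boldsymbol n_E$ points out of $T$; $\omega_{EV}\in\{-1,1\}$ is such that $\omega_{EV}\boldsymbol t_E$ points towards $V\in\mathcal V_E$. The sequence is regular with parameter $\varrho\in(0,1)$: each mesh admits a matching simplicial submesh (each element a union of submesh triangles, each mesh edge a union of submesh edges) whose triangles $\tau$ have inradius $\ge\varrho h_\tau$ ($h_\tau$ the diameter of $\tau$) and satisfy $h_\tau\ge\varrho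 h_T$ whenever $\tau\subset T$, and each $T$ is star-shaped with respect to every point of a ball of radius $\varrho h_T$. For each $T$ a point $\boldsymbol x_T\in T$ is fixed such that $T$ contains a ball centred at $\boldsymbol x_T$ of diameter comparable to $h_T$ uniformly in the mesh sequence. **Polynomials.** $\mathcal P^\ell(Y)$ is the space of restrictions to $Y$ of bivariate polynomials of total degree $\le\ell$, with $\mathcal P^\ell(Y)=\{0\}$ for $\ell\le-1$. $\pi^\ell_{\mathcal P,Y}$ is the $L^2(Y)$-orthogonal projector on it, also applied component-wise. $\mathcal P^\ell_{\rm c}(\mathcal E_T)$: continuous functions on $\partial T$ whose restriction to each $E\in\mathcal E_T$ is in $\mathcal P^\ell(E)$. $\mathbf{curl}\,q=(\partial_2q,-\partial_1q)^\top$; $\mathcal R^\ell(T)=\mathbf{curl}\,\mathcal P^{\ell+1}(T)$, $\mathcal R^{{\rm c},\ell}(T)=(\boldsymbol x-\boldsymbol x_T)\mathcal P^{\ell-1}(T)$. $\boldsymbol\pi^{\ell}_{\mathcal R,T}$ and $\boldsymbol\pi^{{\rm c},\ell}_{\mathcal R,T}$ are the $L^2$-orthogonal projectors on these spaces. For tensors, $\mathcal R^\ell(T)^2$, $\mathcal R^{{\rm c},\ell}(T)^2$ denote tensor fields whose rows are in these spaces, and projectors, $\operatorname{div}$, $\mathbf{curl}$ (of vectors) and gradients (of vectors) act row-wise. **Discrete $H_1$ space.** $\underline H^{k+1}_1(\mathcal T_h)^2$ is the set of $\underline{\boldsymbol v}_h=((\boldsymbol v_T)_{T\in\mathcal T_h},(\boldsymbol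 v_E)_{E\in\mathcal E_h},(\boldsymbol v_V)_{V\in\mathcal V_h})$ with $\boldsymbol v_T\in\mathcal P^k(T)^2$, $\boldsymbol v_E\in\mathcal P^k(E)^2$, $\boldsymbol v_V\in\mathbb R^2$. $\underline H^{k+1}_{1,0}(\mathcal T_h)^2$ is its subspace with $\boldsymbol v_E=\boldsymbol0$ for $E\in\mathcal E_h^{\rm b}$ and $\boldsymbol v_V=\boldsymbol0$ for $V\in\mathcal V_h^{\rm b}$. $\underline{\boldsymbol v}_T$ (resp. $\underline{\boldsymbol v}_E$) is the restriction to the components on $T$ (resp. $E$) and its boundary entities. Trace: $\boldsymbol\gamma^{k+2}_{1,\partial T}\underline{\boldsymbol v}_T\in\mathcal P^{k+2}_{\rm c}(\mathcal E_T)^2$ is such that $\pi^k_{\mathcal P,E}(\boldsymbol\gamma^{k+2}_{1,\partial T}\underline{\boldsymbol v}_T)=\boldsymbol v_E$ for all $E\in\mathcal E_T$ and its value at $\boldsymbol x_V$ is $\boldsymbol v_V$ for all $V\in\mathcal V_T$. Edge gradient $\boldsymbol G^{k+1}_{1,E}\underline{\boldsymbol v}_E\in\mathcal P^{k+1}(E)^2$: $\int_E\boldsymbol G^{k+1}_{1,E}\underline{\boldsymbol v}_E\cdot\boldsymbol w=-\int_E\boldsymbol v_E\cdot\partial_{\boldsymbol t_E}\boldsymbol w+\sum_{V\in\mathcal V_E}\omega_{EV}\boldsymbol v_V\cdot\boldsymbol w(\boldsymbol x_V)$ for all $\boldsymbol w\in\mathcal P^{k+1}(E)^2$. Element gradient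 $\boldsymbol G^{k+1}_{1,T}\underline{\boldsymbol v}_T\in\mathcal P^{k+1}(T)^{2\times2}$: $\int_T\boldsymbol G^{k+1}_{1,T}\underline{\boldsymbol v}_T:\boldsymbol\zeta=-\int_T\boldsymbol v_T\cdot\operatorname{div}\boldsymbol\zeta+\sum_{E\in\mathcal E_T}\omega_{TE}\int_E\boldsymbol\gamma^{k+2}_{1,\partial T}\underline{\boldsymbol v}_T\cdot(\boldsymbol\zeta\boldsymbol n_E)$ for all $\boldsymbol\zeta\in\mathcal P^{k+1}(T)^{2\times2}$. $\boldsymbol G^{k+1}_{1,s,T}\underline{\boldsymbol v}_T$ is its symmetric part, and $(\boldsymbol G^{k+1}_{1,s,h}\underline{\boldsymbol v}_h)_{|T}=\boldsymbol G^{k+1}_{1,s,T}\underline{\boldsymbol v}_T$. Potential $\boldsymbol P^{k+2}_{\mathbf{grad},T}\underline{\boldsymbol v}_T\in\mathcal P^{k+2}(T)^2$: $\int_T\boldsymbol P^{k+2}_{\mathbf{grad},T}\underline{\boldsymbol v}_T\cdot\operatorname{div}\boldsymbol\chi=-\int_T\boldsymbol G^{k+1}_{1,T}\underline{\boldsymbol v}_T:\boldsymbol\chi+\sum_{E\in\mathcal E_T}\omega_{TE}\int_E\boldsymbol\gamma^{k+2}_{1,\partial T}\underline{\boldsymbol v}_T\cdot(\boldsymbol\chi\boldsymbol n_E)$ for all $\boldsymbol\chi\in\mathcal R^{{\rm c},k+3}(T)^2$. Stabilisation: $s_{1,T}(\underline{\boldsymbol v}_T,\underline{\boldsymbol w}_T)=\sum_{E\in\mathcal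 E_T}h_E\int_E(\boldsymbol P^{k+2}_{\mathbf{grad},T}\underline{\boldsymbol v}_T-\boldsymbol\gamma^{k+2}_{1,\partial T}\underline{\boldsymbol v}_T)\cdot(\boldsymbol P^{k+2}_{\mathbf{grad},T}\underline{\boldsymbol w}_T-\boldsymbol\gamma^{k+2}_{1,\partial T}\underline{\boldsymbol w}_T)$. **Discrete $\boldsymbol H_{\mathbf{rot}}$ space.** $\underline{\boldsymbol H}^{k+1}_{\mathbf{rot}}(\mathcal T_h)$ is the set of $\underline{\boldsymbol\tau}_h=((\boldsymbol\tau_{\mathcal R,T},\boldsymbol\tau^{\rm c}_{\mathcal R,T})_{T},(\boldsymbol\tau_E)_{E})$ with $\boldsymbol\tau_{\mathcal R,T}\in\mathcal R^k(T)^2$, $\boldsymbol\tau^{\rm c}_{\mathcal R,T}\in\mathcal R^{{\rm c},k+1}(T)^2$, $\boldsymbol\tau_E\in\mathcal P^{k+1}(E)^2$. The discrete gradient is $$\underline{\boldsymbol G}^{k+1}_{1,h}\underline{\boldsymbol v}_h=\big((\boldsymbol\pi^k_{\mathcal R,T}\boldsymbol G^{k+1}_{1,T}\underline{\boldsymbol v}_T,\boldsymbol\pi^{{\rm c},k+1}_{\mathcal R,T}\boldsymbol G^{k+1}_{1,T}\underline{\boldsymbol v}_T)_{T\in\mathcal T_h},(\boldsymbol G^{k+1}_{1,E}\underline{\boldsymbol v}_E)_{E\in\mathcal E_h}\big)\in\underline{\boldsymbol H}^{k+1}_{\mathbf{rot}}(\mathcal T_h).$$ Discrete rotor $\boldsymbol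 R_T\underline{\boldsymbol\tau}_T\in\mathcal P^{k+1}(T)^2$: $\int_T\boldsymbol R_T\underline{\boldsymbol\tau}_T\cdot\boldsymbol r=\int_T\boldsymbol\tau_{\mathcal R,T}:\mathbf{curl}\,\boldsymbol r-\sum_{E\in\mathcal E_T}\omega_{TE}\int_E\boldsymbol\tau_E\cdot\boldsymbol r$ for all $\boldsymbol r\in\mathcal P^{k+1}(T)^2$. Potential $\boldsymbol P^{k+1}_{\mathbf{rot},T}\underline{\boldsymbol\tau}_T\in\mathcal P^{k+1}(T)^{2\times2}$: for all $(\boldsymbol r,\boldsymbol\zeta)\in\mathcal P^{k+2}(T)^2\times\mathcal R^{{\rm c},k+1}(T)^2$, $\int_T\boldsymbol P^{k+1}_{\mathbf{rot},T}\underline{\boldsymbol\tau}_T:(\mathbf{curl}\,\boldsymbol r+\boldsymbol\zeta)=\int_T\boldsymbol R_T\underline{\boldsymbol\tau}_T\cdot\boldsymbol r+\sum_{E\in\mathcal E_T}\omega_{TE}\int_E\boldsymbol\tau_E\cdot\boldsymbol r+\int_T\boldsymbol\tau^{\rm c}_{\mathcal R,T}:\boldsymbol\zeta$. Stabilisation $s_{\mathbf{rot},T}(\underline{\boldsymbol\tau}_T,\underline{\boldsymbol\sigma}_T)=\sum_{E\in\mathcal E_T}h_E\int_E(\boldsymbol P^{k+1}_{\mathbf{rot},T}\underline{\boldsymbol\tau}_T\boldsymbol t_E-\boldsymbol\tau_E)\cdot(\boldsymbol P^{k+1}_{\mathbf{rot},T}\underline{\boldsymbol\sigma}_T\boldsymbol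 t_E-\boldsymbol\sigma_E)$. Norms: $\|\underline{\boldsymbol\tau}_T\|_{\mathbf{rot},T}^2=\|\boldsymbol P^{k+1}_{\mathbf{rot},T}\underline{\boldsymbol\tau}_T\|_{L^2(T)^{2\times2}}^2+s_{\mathbf{rot},T}(\underline{\boldsymbol\tau}_T,\underline{\boldsymbol\tau}_T)$ and $\|\underline{\boldsymbol\tau}_h\|_{\mathbf{rot},h}^2=\sum_{T\in\mathcal T_h}\|\underline{\boldsymbol\tau}_T\|_{\mathbf{rot},T}^2$. *)

theory Defs
  imports "HOL-Analysis.Analysis"
begin

section \<open>Polygonal meshes\<close>

definition open_polygon :: "(real^2) set \<Rightarrow> bool" where
  "open_polygon A \<longleftrightarrow> A \<noteq> {} \<and> connected A \<and>
     (\<exists>F. finite F \<and> (\<forall>\<tau>\<in>F. 2 simplex \<tau>) \<and> A = interior (\<Union>F))"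

text \<open>
  An edge with its fixed unit tangent is encoded as the ordered pair of its endpoints, the tangent
  pointing from the first to the second. Vertices are identified with their positions.
\<close>

type_synonym edge = "(real^2) \<times> (real^2)"

definition seg :: "edge \<Rightarrow> (real^2) set" where
  "seg E = open_segment (fst E) (snd E)"

definition edge_length :: "edge \<Rightarrow> real" where
  "edge_length E = dist (fst E) (snd E)"

definition tangent :: "edge \<Rightarrow> real^2" where
  "tangent E = (snd E - fst E) /\<^sub>R edge_length E"

definition normal :: "edge \<Rightarrow> real^2" where
  "normal E = vector [- tangent E $ 2, tangent E $ 1]"

record mesh =
  elems :: "(real^2) set set"
  edges :: "edge set"
  verts :: "(real^2) set"
  centre :: "(real^2) set \<Rightarrow> real^2"

definition edges_of :: "mesh \<Rightarrow> (real^2) set \<Rightarrow> edge set" where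
  "edges_of M T = {E \<in> edges M. seg E \<subseteq> frontier T}"

definition verts_of_edge :: "edge \<Rightarrow> (real^2) set" where
  "verts_of_edge E = {fst E, snd E}"

definition verts_of_elem :: "mesh \<Rightarrow> (real^2) set \<Rightarrow> (real^2) set" where
  "verts_of_elem M T = (\<Union>E\<in>edges_of M T. verts_of_edge E)"

definition polygonal_mesh :: "(real^2) set \<Rightarrow> mesh \<Rightarrow> bool" where
  "polygonal_mesh \<Omega> M \<longleftrightarrow>
     finite (elems M) \<and> (\<forall>T\<in>elems M. open_polygon T) \<and> pairwise disjnt (elems M) \<and>
     closure \<Omega> = (\<Union>T\<in>elems M. closure T) \<and>
     finite (edges M) \<and> (\<forall>E\<in>edges M. fst E \<noteq> snd E) \<and>
     pairwise (\<lambda>E E'. disjnt (seg E) (seg E')) (edges M) \<and>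
     verts M = (\<Union>E\<in>edges M. verts_of_edge E) \<and>
     (\<forall>E\<in>edges M. seg E \<subseteq> frontier \<Omega> \<or> card {T \<in> elems M. seg E \<subseteq> frontier T} = 2) \<and>
     (\<forall>T\<in>elems M. frontier T = (\<Union>E\<in>edges_of M T. closure (seg E))) \<and>
     (\<forall>T\<in>elems M. centre M T \<in> T)"

text \<open>\<open>sign_TE T E\<close> is \<open>\<omega>\<^sub>T\<^sub>E\<close> (for \<open>E\<close> in the boundary of \<open>T\<close>) and \<open>sign_EV E V\<close> is \<open>\<omega>\<^sub>E\<^sub>V\<close>.\<close>

definition sign_TE :: "(real^2) set \<Rightarrow> edge \<Rightarrow> real" where
  "sign_TE T E =
     (if \<forall>x\<in>seg E. \<forall>\<^sub>F s in at_right 0. x + s *\<^sub>R normal E \<notin> T then 1 else - 1)"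

definition sign_EV :: "edge \<Rightarrow> real^2 \<Rightarrow> real" where
  "sign_EV E V = (if V = snd E then 1 else - 1)"

definition inradius :: "(real^2) set \<Rightarrow> real" where
  "inradius \<tau> = Sup {r. 0 \<le> r \<and> (\<exists>x. cball x r \<subseteq> \<tau>)}"

text \<open>The simplices of the submesh are closed; its edges and vertices are members of \<open>S\<close> as well.\<close>

definition matching_submesh :: "(real^2) set \<Rightarrow> mesh \<Rightarrow> (real^2) set set \<Rightarrow> bool" where
  "matching_submesh \<Omega> M S \<longleftrightarrow> simplicial_complex S \<and> \<Union>S = closure \<Omega> \<and>
     (\<forall>T\<in>elems M. closure T = \<Union>{\<tau> \<in> S. 2 simplex \<tau> \<and> \<tau> \<subseteq> closure T}) \<and>
     (\<forall>E\<in>edges M. closure (seg E) = \<Union>{e \<in> S. 1 simplex e \<and> e \<subseteq> closure (seg E)})"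

definition regular_mesh :: "(real^2) set \<Rightarrow> real \<Rightarrow> mesh \<Rightarrow> bool" where
  "regular_mesh \<Omega> \<rho> M \<longleftrightarrow>
     (\<exists>S. matching_submesh \<Omega> M S \<and>
        (\<forall>\<tau>\<in>S. 2 simplex \<tau> \<longrightarrow> \<rho> * diameter \<tau> \<le> inradius \<tau> \<and>
           (\<forall>T\<in>elems M. \<tau> \<subseteq> closure T \<longrightarrow> \<rho> * diameter T \<le> diameter \<tau>))) \<and>
     (\<forall>T\<in>elems M. \<exists>z. \<forall>y\<in>ball z (\<rho> * diameter T). \<forall>x\<in>T. closed_segment y x \<subseteq> T)"

definition regular_mesh_sequence :: "(real^2) set \<Rightarrow> real \<Rightarrow> (nat \<Rightarrow> mesh) \<Rightarrow> bool" where
  "regular_mesh_sequence \<Omega> \<rho> \<M> \<longleftrightarrow>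
     (\<forall>n. polygonal_mesh \<Omega> (\<M> n) \<and> regular_mesh \<Omega> \<rho> (\<M> n)) \<and>
     (\<exists>c>0. \<forall>n. \<forall>T\<in>elems (\<M> n). ball (centre (\<M> n) T) (c * diameter T / 2) \<subseteq> T)"


section \<open>Integrals, row-wise operators, differential operators\<close>

definition edge_integral :: "edge \<Rightarrow> (real^2 \<Rightarrow> real) \<Rightarrow> real" where
  "edge_integral E f = edge_length E * integral {0..1} (\<lambda>s. f (linepath (fst E) (snd E) s))"

definition l2norm :: "(real^2) set \<Rightarrow> (real^2 \<Rightarrow> 'b::real_normed_vector) \<Rightarrow> real" where
  "l2norm A f = sqrt (integral A (\<lambda>x. (norm (f x))\<^sup>2))"

text \<open>
  For a space \<open>S\<close>, \<open>by_rows S\<close> is \<open>S\<^sup>2\<close>: vector fields with components in \<open>S\<close>, or tensor fields with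
  rows in \<open>S\<close> (\<open>Z $ i\<close> is row \<open>i\<close> of \<open>Z\<close>). The inner product and the norm of type \<open>real^2^2\<close> are the
  Frobenius ones.
\<close>

definition by_rows :: "(real^2 \<Rightarrow> 'a) set \<Rightarrow> (real^2 \<Rightarrow> 'a^2) set" where
  "by_rows S = {f. \<forall>i. (\<lambda>x. f x $ i) \<in> S}"

definition rowwise :: "((real^2 \<Rightarrow> 'a) \<Rightarrow> real^2 \<Rightarrow> 'b) \<Rightarrow> (real^2 \<Rightarrow> 'a^2) \<Rightarrow> real^2 \<Rightarrow> 'b^2" where
  "rowwise F f x = (\<chi> i. F (\<lambda>y. f y $ i) x)"

definition dir_deriv :: "real^2 \<Rightarrow> (real^2 \<Rightarrow> 'b::real_normed_vector) \<Rightarrow> real^2 \<Rightarrow> 'b" where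
  "dir_deriv t f x = vector_derivative (\<lambda>s. f (x + s *\<^sub>R t)) (at 0)"

abbreviation partial :: "2 \<Rightarrow> (real^2 \<Rightarrow> real) \<Rightarrow> real^2 \<Rightarrow> real" where
  "partial j \<equiv> dir_deriv (axis j 1)"

definition curl :: "(real^2 \<Rightarrow> real) \<Rightarrow> real^2 \<Rightarrow> real^2" where
  "curl q x = vector [partial 2 q x, - partial 1 q x]"

definition divergence :: "(real^2 \<Rightarrow> real^2) \<Rightarrow> real^2 \<Rightarrow> real" where
  "divergence u x = (\<Sum>j\<in>UNIV. partial j (\<lambda>y. u y $ j) x)"


section \<open>Polynomial spaces and projectors\<close>

definition bipoly :: "int \<Rightarrow> (real^2 \<Rightarrow> real) set" where
  "bipoly l = {p. \<exists>c. \<forall>x. p x =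
     (\<Sum>(i, j) \<in> {(i, j). int i + int j \<le> l}. c i j * x $ 1 ^ i * x $ 2 ^ j)}"

text \<open>
  Functions on \<open>Y\<close> (an element or an edge) are represented by their continuous extension to the
  closure of \<open>Y\<close>, set to zero elsewhere. Thus polynomials on an element can be evaluated on its
  edges and polynomials on an edge at its vertices, and two polynomials that agree on \<open>Y\<close> are equal
  as functions.
\<close>

definition restr :: "(real^2) set \<Rightarrow> (real^2 \<Rightarrow> 'b::zero) \<Rightarrow> real^2 \<Rightarrow> 'b" where
  "restr Y f x = (if x \<in> closure Y then f x else 0)"

definition polys :: "int \<Rightarrow> (real^2) set \<Rightarrow> (real^2 \<Rightarrow> real) set" where
  "polys l Y = restr Y ` bipoly l"

definition cont_polys :: "int \<Rightarrow> mesh \<Rightarrow> (real^2) set \<Rightarrow> (real^2 \<Rightarrow> real) set" where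
  "cont_polys l M T = {g. continuous_on (frontier T) g \<and> (\<forall>x. x \<notin> frontier T \<longrightarrow> g x = 0) \<and>
     (\<forall>E\<in>edges_of M T. restr (seg E) g \<in> polys l (seg E))}"

definition R_space :: "int \<Rightarrow> (real^2) set \<Rightarrow> (real^2 \<Rightarrow> real^2) set" where
  "R_space l T = (\<lambda>q. restr T (curl q)) ` bipoly (l + 1)"

definition Rc_space :: "int \<Rightarrow> mesh \<Rightarrow> (real^2) set \<Rightarrow> (real^2 \<Rightarrow> real^2) set" where
  "Rc_space l M T = (\<lambda>p x. p x *\<^sub>R (x - centre M T)) ` polys (l - 1) T"

text \<open>
  Orthogonal projector on \<open>S\<close> for the \<open>L\<^sup>2\<close> product given by the integration functional \<open>I\<close>.
\<close>

definition l2_proj ::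
    "((real^2 \<Rightarrow> real) \<Rightarrow> real) \<Rightarrow> (real^2 \<Rightarrow> 'a::real_inner) set \<Rightarrow> (real^2 \<Rightarrow> 'a) \<Rightarrow> real^2 \<Rightarrow> 'a" where
  "l2_proj I S f = (THE p. p \<in> S \<and> (\<forall>q\<in>S. I (\<lambda>x. (f x - p x) \<bullet> q x) = 0))"


section \<open>The discrete \<open>H\<^sup>1\<close> space\<close>

text \<open>
  All operators on an element \<open>T\<close> take the global vector of unknowns but read only the components
  attached to \<open>T\<close>, to its edges and to its vertices; likewise for operators on an edge.
\<close>

record h1_vec =
  h1_elem :: "(real^2) set \<Rightarrow> real^2 \<Rightarrow> real^2"
  h1_edge :: "edge \<Rightarrow> real^2 \<Rightarrow> real^2"
  h1_vert :: "real^2 \<Rightarrow> real^2"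

definition H1 :: "nat \<Rightarrow> mesh \<Rightarrow> h1_vec set" where
  "H1 k M = {v. (\<forall>T\<in>elems M. h1_elem v T \<in> by_rows (polys (int k) T)) \<and>
                (\<forall>E\<in>edges M. h1_edge v E \<in> by_rows (polys (int k) (seg E)))}"

definition H1_0 :: "(real^2) set \<Rightarrow> nat \<Rightarrow> mesh \<Rightarrow> h1_vec set" where
  "H1_0 \<Omega> k M = {v \<in> H1 k M.
     (\<forall>E\<in>edges M. seg E \<subseteq> frontier \<Omega> \<longrightarrow> h1_edge v E = (\<lambda>x. 0)) \<and>
     (\<forall>V\<in>verts M. V \<in> frontier \<Omega> \<longrightarrow> h1_vert v V = 0)}"

definition bd_trace :: "nat \<Rightarrow> mesh \<Rightarrow> (real^2) set \<Rightarrow> h1_vec \<Rightarrow> real^2 \<Rightarrow> real^2" where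
  "bd_trace k M T v = (THE g. g \<in> by_rows (cont_polys (int k + 2) M T) \<and>
     (\<forall>E\<in>edges_of M T.
        rowwise (l2_proj (edge_integral E) (polys (int k) (seg E))) g = h1_edge v E) \<and>
     (\<forall>V\<in>verts_of_elem M T. g V = h1_vert v V))"

definition grad_edge :: "nat \<Rightarrow> edge \<Rightarrow> h1_vec \<Rightarrow> real^2 \<Rightarrow> real^2" where
  "grad_edge k E v = (THE G. G \<in> by_rows (polys (int k + 1) (seg E)) \<and>
     (\<forall>w\<in>by_rows (polys (int k + 1) (seg E)).
        edge_integral E (\<lambda>x. G x \<bullet> w x) =
        - edge_integral E (\<lambda>x. h1_edge v E x \<bullet> dir_deriv (tangent E) w x)
        + (\<Sum>V\<in>verts_of_edge E. sign_EV E V * (h1_vert v V \<bullet> w V))))"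

definition grad_elem :: "nat \<Rightarrow> mesh \<Rightarrow> (real^2) set \<Rightarrow> h1_vec \<Rightarrow> real^2 \<Rightarrow> real^2^2" where
  "grad_elem k M T v = (THE G. G \<in> by_rows (by_rows (polys (int k + 1) T)) \<and>
     (\<forall>Z\<in>by_rows (by_rows (polys (int k + 1) T)).
        integral T (\<lambda>x. G x \<bullet> Z x) =
        - integral T (\<lambda>x. h1_elem v T x \<bullet> rowwise divergence Z x)
        + (\<Sum>E\<in>edges_of M T. sign_TE T E *
             edge_integral E (\<lambda>x. bd_trace k M T v x \<bullet> (Z x *v normal E)))))"

definition sym_grad_elem :: "nat \<Rightarrow> mesh \<Rightarrow> (real^2) set \<Rightarrow> h1_vec \<Rightarrow> real^2 \<Rightarrow> real^2^2" where
  "sym_grad_elem k M T v x = (grad_elem k M T v x + transpose (grad_elem k M T v x)) /\<^sub>R 2"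

definition sym_grad :: "nat \<Rightarrow> mesh \<Rightarrow> h1_vec \<Rightarrow> real^2 \<Rightarrow> real^2^2" where
  "sym_grad k M v x = (\<Sum>T\<in>elems M. indicator T x *\<^sub>R sym_grad_elem k M T v x)"

definition pot_grad :: "nat \<Rightarrow> mesh \<Rightarrow> (real^2) set \<Rightarrow> h1_vec \<Rightarrow> real^2 \<Rightarrow> real^2" where
  "pot_grad k M T v = (THE P. P \<in> by_rows (polys (int k + 2) T) \<and>
     (\<forall>X\<in>by_rows (Rc_space (int k + 3) M T).
        integral T (\<lambda>x. P x \<bullet> rowwise divergence X x) =
        - integral T (\<lambda>x. grad_elem k M T v x \<bullet> X x)
        + (\<Sum>E\<in>edges_of M T. sign_TE T E *
             edge_integral E (\<lambda>x. bd_trace k M T v x \<bullet> (X x *v normal E)))))"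

definition stab1 :: "nat \<Rightarrow> mesh \<Rightarrow> (real^2) set \<Rightarrow> h1_vec \<Rightarrow> h1_vec \<Rightarrow> real" where
  "stab1 k M T v w = (\<Sum>E\<in>edges_of M T. edge_length E * edge_integral E
     (\<lambda>x. (pot_grad k M T v x - bd_trace k M T v x) \<bullet> (pot_grad k M T w x - bd_trace k M T w x)))"


section \<open>The discrete \<open>H(rot)\<close> space\<close>

record hrot_vec =
  rot_R :: "(real^2) set \<Rightarrow> real^2 \<Rightarrow> real^2^2"
  rot_Rc :: "(real^2) set \<Rightarrow> real^2 \<Rightarrow> real^2^2"
  rot_edge :: "edge \<Rightarrow> real^2 \<Rightarrow> real^2"

definition discrete_grad :: "nat \<Rightarrow> mesh \<Rightarrow> h1_vec \<Rightarrow> hrot_vec" where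
  "discrete_grad k M v = \<lparr>
     rot_R = (\<lambda>T. rowwise (l2_proj (integral T) (R_space (int k) T)) (grad_elem k M T v)),
     rot_Rc = (\<lambda>T. rowwise (l2_proj (integral T) (Rc_space (int k + 1) M T)) (grad_elem k M T v)),
     rot_edge = (\<lambda>E. grad_edge k E v)\<rparr>"

definition rotor :: "nat \<Rightarrow> mesh \<Rightarrow> (real^2) set \<Rightarrow> hrot_vec \<Rightarrow> real^2 \<Rightarrow> real^2" where
  "rotor k M T \<tau> = (THE R. R \<in> by_rows (polys (int k + 1) T) \<and>
     (\<forall>r\<in>by_rows (polys (int k + 1) T).
        integral T (\<lambda>x. R x \<bullet> r x) =
        integral T (\<lambda>x. rot_R \<tau> T x \<bullet> rowwise curl r x)
        - (\<Sum>E\<in>edges_of M T. sign_TE T E * edge_integral E (\<lambda>x. rot_edge \<tau> E x \<bullet> r x))))"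

definition pot_rot :: "nat \<Rightarrow> mesh \<Rightarrow> (real^2) set \<Rightarrow> hrot_vec \<Rightarrow> real^2 \<Rightarrow> real^2^2" where
  "pot_rot k M T \<tau> = (THE P. P \<in> by_rows (by_rows (polys (int k + 1) T)) \<and>
     (\<forall>r\<in>by_rows (polys (int k + 2) T). \<forall>Z\<in>by_rows (Rc_space (int k + 1) M T).
        integral T (\<lambda>x. P x \<bullet> (rowwise curl r x + Z x)) =
        integral T (\<lambda>x. rotor k M T \<tau> x \<bullet> r x)
        + (\<Sum>E\<in>edges_of M T. sign_TE T E * edge_integral E (\<lambda>x. rot_edge \<tau> E x \<bullet> r x))
        + integral T (\<lambda>x. rot_Rc \<tau> T x \<bullet> Z x)))"

definition stab_rot :: "nat \<Rightarrow> mesh \<Rightarrow> (real^2) set \<Rightarrow> hrot_vec \<Rightarrow> hrot_vec \<Rightarrow> real" where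
  "stab_rot k M T \<tau> \<sigma> = (\<Sum>E\<in>edges_of M T. edge_length E * edge_integral E
     (\<lambda>x. (pot_rot k M T \<tau> x *v tangent E - rot_edge \<tau> E x) \<bullet>
           (pot_rot k M T \<sigma> x *v tangent E - rot_edge \<sigma> E x)))"

definition rot_norm_elem :: "nat \<Rightarrow> mesh \<Rightarrow> (real^2) set \<Rightarrow> hrot_vec \<Rightarrow> real" where
  "rot_norm_elem k M T \<tau> = sqrt ((l2norm T (pot_rot k M T \<tau>))\<^sup>2 + stab_rot k M T \<tau> \<tau>)"

definition rot_norm :: "nat \<Rightarrow> mesh \<Rightarrow> hrot_vec \<Rightarrow> real" where
  "rot_norm k M \<tau> = sqrt (\<Sum>T\<in>elems M. (rot_norm_elem k M T \<tau>)\<^sup>2)"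

end

theory Submission
  imports Defs "HOL-Library.Function_Algebras"
begin

text \<open>
  Write \<open>\<gamma>\<close> for the boundary trace, \<open>P\<close> for the potential and \<open>G\<close> for the element gradient of \<open>\<phi>\<close>. The
  complex property makes the rotor of the discrete gradient vanish, so that its potential is \<open>G\<close>, and its
  edge components are \<open>\<partial>\<^sub>t \<gamma>\<close>. Testing \<open>G - \<nabla>P\<close> with itself and integrating by parts leaves only
  boundary terms in \<open>\<delta> = P - \<gamma>\<close>, since \<open>P\<close> has the same moments as the element unknown; discrete trace and
  inverse inequalities then bound everything except \<open>\<nabla>P\<close> by the stabilisation.

  For \<open>\<nabla>P\<close> use \<open>|A|\<^sup>2 \<le> 2 |sym A|\<^sup>2 + 2 det A\<close>. The integral of \<open>det \<nabla>P\<close> over an element is the boundary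
  term \<open>- \<integral> P\<^sub>1 \<partial>\<^sub>t P\<^sub>2\<close>; replacing \<open>P\<close> by \<open>\<gamma>\<close> costs terms in \<open>\<delta>\<close> that can be absorbed, and the sum over all elements
  of \<open>\<integral> \<gamma>\<^sub>1 \<partial>\<^sub>t \<gamma>\<^sub>2\<close> is zero because \<open>\<gamma>\<close> is single-valued and vanishes on the boundary of the domain.
  The constant therefore depends on the mesh regularity and the degree only.

  An element is star-shaped with respect to a ball, so it is the union of triangles with apex in the
  centre of that ball, and Green's formula reduces to these triangles. Uniformity of the
  discrete inequalities comes from rescaling to a fixed square, on which all norms of a finite-dimensional
  space of polynomials are equivalent.
\<close>

section \<open>Finite-dimensional spaces of functions\<close>

text \<open>Every reconstruction is a definite description, so it has to be shown well-posed before
  anything can be estimated. A finite-dimensional Riesz argument serves for all of them; afterwards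
  each operator is traded for a polynomial on the whole plane, where calculus is free of
  restrictions and boundary cases.

  The trace is polynomial only edge by edge, so \<delta> has no extension to the element; its
  tangential derivative must be handled by an inverse inequality on single edges. The circulation of
  the trace cannot be bounded locally. It is carried through the element estimate as an exact term
  and removed only by summing over the mesh.

  The simplicial submesh enters through a lower bound for edge lengths. The trace inequality has
  another source: a pointwise bound of polynomials on a large disk by their integral over a small
  square, times a bound for the perimeter that follows from the divergence theorem. Absorption works
  because the weights in Young's inequality are tuned to the trace constant.\<close>

instantiation "fun" :: (type, real_vector) real_vector
begin

definition scaleR_fun :: "real \<Rightarrow> ('a \<Rightarrow> 'b) \<Rightarrow> 'a \<Rightarrow> 'b" where
  "scaleR_fun r f = (\<lambda>x. r *\<^sub>R f x)"

instance
  by standard (auto simp: fun_eq_iff scaleR_fun_def algebra_simps)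

end

lemma scaleR_fun_apply [simp]: "(r *\<^sub>R f) x = r *\<^sub>R f x"
  by (simp add: scaleR_fun_def)

lemma sum_fun_apply: "(\<Sum>i\<in>A. f i) x = (\<Sum>i\<in>A. f i x)"
  by (induction A rule: infinite_finite_induct) auto

text \<open>The axioms are relative to \<open>V\<close>: integrals are additive and definite only on
  functions with some regularity, never on a whole function type.\<close>

locale inner_product_on =
  fixes V :: "'a::real_vector set" and b :: "'a \<Rightarrow> 'a \<Rightarrow> real"
  assumes V: "subspace V"
    and add: "\<And>x y z. x \<in> V \<Longrightarrow> y \<in> V \<Longrightarrow> z \<in> V \<Longrightarrow> b (x + y) z = b x z + b y z"
    and scale: "\<And>r x z. x \<in> V \<Longrightarrow> z \<in> V \<Longrightarrow> b (r *\<^sub>R x) z = r * b x z"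
    and sym: "\<And>x y. x \<in> V \<Longrightarrow> y \<in> V \<Longrightarrow> b x y = b y x"
    and nonneg: "\<And>x. x \<in> V \<Longrightarrow> 0 \<le> b x x"
    and definite: "\<And>x. x \<in> V \<Longrightarrow> b x x = 0 \<Longrightarrow> x = 0"
begin

text \<open>Gram-Schmidt as an induction: the hypothesis, applied to the functional
  \<open>b a\<close>, yields the projection \<open>a0\<close> of the new vector, and the residual is
  orthogonal to the old span.\<close>

lemma Riesz_representation:
  assumes "finite S" and "S \<subseteq> V"
    and l_add: "\<And>x y. x \<in> span S \<Longrightarrow> y \<in> span S \<Longrightarrow> l (x + y) = l x + l y"
    and l_scale: "\<And>r x. x \<in> span S \<Longrightarrow> l (r *\<^sub>R x) = r * l x"
  shows "\<exists>q\<in>span S. \<forall>p\<in>span S. b q p = l p"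
  using assms
proof (induction S arbitrary: l rule: finite_induct)
  case empty
  have "l (0 *\<^sub>R 0) = 0 * l 0"
    by (rule empty.prems) simp
  then have "l 0 = 0" by simp
  moreover have "b (0 *\<^sub>R 0) 0 = 0 * b 0 0"
    by (rule scale) (use V in \<open>simp_all add: subspace_0\<close>)
  ultimately show ?case by simp
next
  case (insert a S)
  have sub: "x \<in> V" if "x \<in> span (insert a S)" for x
    using that V insert.prems(1) by (metis span_minimal subsetD)
  have mono: "x \<in> span (insert a S)" if "x \<in> span S" for x
    using that span_mono[of S "insert a S"] by auto
  note span_rules = span_add span_scale span_diff
  have aV: "a \<in> V" and SV: "S \<subseteq> V"
    using insert.prems(1) by auto
  have addr: "b z (x + y) = b z x + b z y" if "x \<in> V" "y \<in> V" "z \<in> V" for x y z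
    using that add sym V by (metis subspace_add)
  have scaler: "b z (r *\<^sub>R x) = r * b z x" if "x \<in> V" "z \<in> V" for r x z
    using that scale sym V by (metis subspace_scale)
  have "\<exists>q\<in>span S. \<forall>p\<in>span S. b q p = b a p"
    by (rule insert.IH) (use SV aV sub mono addr scaler in auto)
  then obtain a0 where a0: "a0 \<in> span S" "\<And>p. p \<in> span S \<Longrightarrow> b a0 p = b a p"
    by auto
  have "\<exists>q\<in>span S. \<forall>p\<in>span S. b q p = l p"
    by (rule insert.IH) (use SV mono insert.prems in auto)
  then obtain q where q: "q \<in> span S" "\<And>p. p \<in> span S \<Longrightarrow> b q p = l p"
    by auto
  define a' where "a' = a - a0"
  have a'_span: "a' \<in> span (insert a S)"
    unfolding a'_def using span_diff[OF span_base[of a "insert a S"] mono[OF a0(1)]] by simp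
  have a'V: "a' \<in> V"
    using a'_span sub by auto
  have diffl: "b (x - y) z = b x z - b y z" if "x \<in> V" "y \<in> V" "z \<in> V" for x y z
    using add[of "x - y" y z] that V by (simp add: subspace_diff)
  have orth: "b a' p = 0" if "p \<in> span S" for p
    unfolding a'_def using diffl[of a a0 p] a0 that aV sub mono by auto
  have decomp: "\<exists>p0\<in>span S. \<exists>c. p = p0 + c *\<^sub>R a'" if p: "p \<in> span (insert a S)" for p
  proof -
    obtain c where c: "p - c *\<^sub>R a \<in> span S"
      using span_breakdown_eq[THEN iffD1, OF p] by blast
    have "p = (p - c *\<^sub>R a + c *\<^sub>R a0) + c *\<^sub>R a'"
      by (simp add: a'_def algebra_simps)
    then show ?thesis
      using c a0 by (metis span_add span_scale)
  qed
  \<comment> \<open>\<open>S\<close> may be dependent. If the residual is zero, division by zero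
    makes \<alpha> zero and \<open>l\<close> vanishes on the residual as well, so \<open>la'\<close>
    covers both cases.\<close>
  define \<alpha> where "\<alpha> = l a' / b a' a'"
  have la': "\<alpha> * b a' a' = l a'"
  proof (cases "b a' a' = 0")
    case True
    then have "a' = 0 *\<^sub>R a'" using definite a'V by simp
    then have "l a' = 0"
      using insert.prems(3)[OF a'_span, of 0] by simp
    then show ?thesis using True by simp
  qed (simp add: \<alpha>_def)
  show ?case
  proof (intro bexI ballI)
    show "q + \<alpha> *\<^sub>R a' \<in> span (insert a S)"
      using q mono a'_span by (intro span_add span_scale) auto
    fix p assume "p \<in> span (insert a S)"
    then obtain p0 c where p0: "p0 \<in> span S" and p: "p = p0 + c *\<^sub>R a'"
      using decomp by blast
    have V': "q \<in> V" "p0 \<in> V" "\<alpha> *\<^sub>R a' \<in> V" "c *\<^sub>R a' \<in> V"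
      using q p0 sub mono a'V V by (auto intro: subspace_scale)
    have "b (q + \<alpha> *\<^sub>R a') p = b q p0 + c * b q a' + \<alpha> * (b a' p0 + c * b a' a')"
      unfolding p using V' a'V V by (simp add: add addr scale scaler subspace_add algebra_simps)
    also have "\<dots> = l p0 + c * l a'"
      using q p0 orth[OF p0] orth[OF q(1)] sym[OF V'(1) a'V] la' by (simp add: algebra_simps)
    also have "\<dots> = l p"
      unfolding p using insert.prems(2)[OF mono[OF p0] span_scale[OF a'_span]]
        insert.prems(3)[OF a'_span] by simp
    finally show "b (q + \<alpha> *\<^sub>R a') p = l p" .
  qed
qed

lemma Cauchy_Schwarz:
  assumes q: "q \<in> V" and p: "p \<in> V"
  shows "(b q p)\<^sup>2 \<le> b q q * b p p"
proof (cases "b q q = 0")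
  case True
  then have "q = 0 *\<^sub>R q" using definite q by simp
  then have "b q p = 0" using scale[OF q p, of 0] by simp
  then show ?thesis using True by simp
next
  case False
  then have pos: "b q q > 0" using nonneg[OF q] by simp
  \<comment> \<open>The minimiser of the quadratic form along
    \<open>p + t *\<^sub>R q\<close>.\<close>
  define t where "t = - (b q p / b q q)"
  have tq: "t *\<^sub>R q \<in> V" and ptq: "p + t *\<^sub>R q \<in> V"
    using V p q by (auto intro: subspace_add subspace_scale)
  have "0 \<le> b (p + t *\<^sub>R q) (p + t *\<^sub>R q)"
    by (rule nonneg[OF ptq])
  also have "\<dots> = b p (p + t *\<^sub>R q) + t * b q (p + t *\<^sub>R q)"
    using add[OF p tq ptq] scale[OF q ptq] by simp
  also have "\<dots> = b p p + t * b q p + t * (b q p + t * b q q)"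
    unfolding sym[OF p ptq] sym[OF q ptq] add[OF p tq p] add[OF p tq q] scale[OF q p] scale[OF q q] sym[OF p q] ..
  also have "\<dots> = b p p - (b q p)\<^sup>2 / b q q"
    using pos by (simp add: t_def field_simps power2_eq_square)
  finally show ?thesis
    using pos by (simp add: field_simps)
qed

text \<open>Norm equivalence: coordinates in a basis chosen inside \<open>S\<close> are linear
  functionals, Riesz represents each by a vector, and Cauchy-Schwarz bounds it. Spanning vectors
  outside the basis get coefficient 0, so the sum may run over all of \<open>S\<close>.\<close>

lemma coefficient_bound:
  assumes S: "finite S" "S \<subseteq> V"
  shows "\<exists>C\<ge>0. \<forall>p\<in>span S. \<exists>c. p = (\<Sum>x\<in>S. c x *\<^sub>R x) \<and> (\<forall>x\<in>S. (c x)\<^sup>2 \<le> C * b p p)"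
proof -
  obtain B where B: "B \<subseteq> S" "independent B" "S \<subseteq> span B"
    using maximal_independent_subset[of S] by metis
  have fB: "finite B" and BV: "B \<subseteq> V"
    using B S finite_subset by auto
  have spB: "span S = span B"
    using B by (metis span_mono span_span subset_antisym span_minimal subspace_span)
  have "\<exists>C\<ge>0. \<forall>p\<in>span B. (representation B p x)\<^sup>2 \<le> C * b p p" for x
  proof -
    have "\<exists>q\<in>span B. \<forall>p\<in>span B. b q p = representation B p x"
      by (rule Riesz_representation[OF fB BV])
        (simp_all add: representation_add[OF B(2)] representation_scale[OF B(2)])
    then obtain q where q: "q \<in> span B" "\<And>p. p \<in> span B \<Longrightarrow> b q p = representation B p x"
      by blast
    have sub: "p \<in> V" if "p \<in> span B" for p
      using that BV V by (metis span_minimal subsetD)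
    show ?thesis
      using Cauchy_Schwarz[OF sub[OF q(1)] sub] q(2) nonneg[OF sub[OF q(1)]]
      by (intro exI[of _ "b q q"]) auto
  qed
  then obtain C where C: "\<And>x. C x \<ge> 0" "\<And>x p. p \<in> span B \<Longrightarrow> (representation B p x)\<^sup>2 \<le> C x * b p p"
    by metis
  show ?thesis
  proof (intro exI conjI ballI)
    show "0 \<le> (\<Sum>x\<in>S. C x)"
      using C by (simp add: sum_nonneg)
    fix p assume p: "p \<in> span S"
    show "p = (\<Sum>x\<in>S. representation B p x *\<^sub>R x)"
      using sum_representation_eq[OF B(2) _ S(1) B(1), of p] p spB by simp
    fix x assume x: "x \<in> S"
    have "0 \<le> b p p"
      using p S V nonneg by (metis span_minimal subsetD)
    moreover have "C x \<le> (\<Sum>x\<in>S. C x)"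
      using C x S by (intro member_le_sum) auto
    ultimately show "(representation B p x)\<^sup>2 \<le> (\<Sum>x\<in>S. C x) * b p p"
      using C(2)[of p x] p spB by (smt (verit) mult_right_mono)
  qed
qed

text \<open>\<open>L x\<close> stands for evaluation at x of a function or of its derivative. One
  constant serves all x in \<open>K\<close> because each spanning function is bounded there
  uniformly.\<close>

lemma evaluation_bound:
  fixes L :: "'c \<Rightarrow> 'a \<Rightarrow> real"
  assumes S: "finite S" "S \<subseteq> V"
    and L_sum: "\<And>x c. x \<in> K \<Longrightarrow> L x (\<Sum>s\<in>S. c s *\<^sub>R s) = (\<Sum>s\<in>S. c s * L x s)"
    and L_bound: "\<And>s. s \<in> S \<Longrightarrow> \<exists>M. \<forall>x\<in>K. \<bar>L x s\<bar> \<le> M"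
  shows "\<exists>C\<ge>0. \<forall>p\<in>span S. \<forall>x\<in>K. (L x p)\<^sup>2 \<le> C * b p p"
proof -
  obtain C where C: "C \<ge> 0"
    "\<And>p. p \<in> span S \<Longrightarrow> \<exists>c. p = (\<Sum>x\<in>S. c x *\<^sub>R x) \<and> (\<forall>x\<in>S. (c x)\<^sup>2 \<le> C * b p p)"
    using coefficient_bound[OF S] by blast
  from bchoice[of S "\<lambda>s M. \<forall>x\<in>K. \<bar>L x s\<bar> \<le> M"] L_bound
  obtain M where M: "\<And>s x. s \<in> S \<Longrightarrow> x \<in> K \<Longrightarrow> \<bar>L x s\<bar> \<le> M s"
    by blast
  show ?thesis
  proof (intro exI conjI ballI)
    show "0 \<le> C * (\<Sum>s\<in>S. M s)\<^sup>2"
      using C by simp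
    fix p x assume p: "p \<in> span S" and x: "x \<in> K"
    obtain c where c: "p = (\<Sum>x\<in>S. c x *\<^sub>R x)" "\<And>x. x \<in> S \<Longrightarrow> (c x)\<^sup>2 \<le> C * b p p"
      using C(2)[OF p] by blast
    have "\<bar>L x p\<bar> \<le> (\<Sum>s\<in>S. \<bar>c s * L x s\<bar>)"
      unfolding arg_cong[OF c(1), of "L x"] L_sum[OF x] by (rule sum_abs)
    also have "\<dots> \<le> (\<Sum>s\<in>S. sqrt (C * b p p) * M s)"
    proof (rule sum_mono)
      fix s assume s: "s \<in> S"
      have "\<bar>c s\<bar> \<le> sqrt (C * b p p)"
        using c(2)[OF s] real_le_rsqrt by (metis power2_abs)
      then show "\<bar>c s * L x s\<bar> \<le> sqrt (C * b p p) * M s"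
        using M[OF s x] by (simp add: abs_mult mult_mono')
    qed
    also have "\<dots> = sqrt (C * b p p) * (\<Sum>s\<in>S. M s)"
      by (simp add: sum_distrib_left)
    finally have "\<bar>L x p\<bar>\<^sup>2 \<le> (sqrt (C * b p p) * (\<Sum>s\<in>S. M s))\<^sup>2"
      by (intro power_mono) auto
    also have "\<dots> = C * b p p * (\<Sum>s\<in>S. M s)\<^sup>2"
    proof -
      have "0 \<le> b p p"
        using p S V nonneg by (metis span_minimal subsetD)
      then show ?thesis using C(1) by (simp add: power_mult_distrib)
    qed
    finally show "(L x p)\<^sup>2 \<le> C * (\<Sum>s\<in>S. M s)\<^sup>2 * b p p"
      by (simp add: mult_ac)
  qed
qed

end

text \<open>Common interface of integrals over an element, integrals along an edge and
  bubble-weighted edge integrals. Continuity is asked on the closure, where polynomials get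
  evaluated, while sign and agreement are tested on \<open>Y\<close> alone, since its boundary does
  not contribute.\<close>

locale l2_functional =
  fixes Y :: "(real^2) set" and I :: "(real^2 \<Rightarrow> real) \<Rightarrow> real"
  assumes I_add: "\<And>f g. continuous_on (closure Y) f \<Longrightarrow> continuous_on (closure Y) g \<Longrightarrow>
      I (\<lambda>x. f x + g x) = I f + I g"
    and I_scale: "\<And>f c. continuous_on (closure Y) f \<Longrightarrow> I (\<lambda>x. c * f x) = c * I f"
    and I_nonneg: "\<And>f. continuous_on (closure Y) f \<Longrightarrow> (\<And>x. x \<in> Y \<Longrightarrow> 0 \<le> f x) \<Longrightarrow> 0 \<le> I f"
    and I_cong: "\<And>f g. (\<And>x. x \<in> Y \<Longrightarrow> f x = g x) \<Longrightarrow> I f = I g"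
    and I_definite: "\<And>f x. continuous_on (closure Y) f \<Longrightarrow> (\<And>x. x \<in> Y \<Longrightarrow> 0 \<le> f x) \<Longrightarrow> I f = 0 \<Longrightarrow>
      x \<in> Y \<Longrightarrow> f x = 0"
begin

lemma I_diff:
  assumes "continuous_on (closure Y) f" "continuous_on (closure Y) g"
  shows "I (\<lambda>x. f x - g x) = I f - I g"
  using I_add[OF assms(1) continuous_on_mult_left[OF assms(2), of "-1"]] I_scale[OF assms(2), of "-1"]
  by simp

lemma I_mono:
  assumes "continuous_on (closure Y) f" "continuous_on (closure Y) g" "\<And>x. x \<in> Y \<Longrightarrow> f x \<le> g x"
  shows "I f \<le> I g"
  using I_nonneg[of "\<lambda>x. g x - f x"] I_diff[of g f] assms by (simp add: continuous_on_diff)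

lemma I_sum:
  assumes "finite A" "\<And>i. i \<in> A \<Longrightarrow> continuous_on (closure Y) (f i)"
  shows "I (\<lambda>x. \<Sum>i\<in>A. f i x) = (\<Sum>i\<in>A. I (f i))"
  using assms
proof (induction A rule: finite_induct)
  case empty
  show ?case using I_scale[of "\<lambda>x. 0" 0] by simp
next
  case (insert i A)
  then show ?case by (simp add: I_add continuous_on_sum)
qed

lemma I_abs:
  assumes "continuous_on (closure Y) f"
  shows "\<bar>I f\<bar> \<le> I (\<lambda>x. \<bar>f x\<bar>)"
proof -
  have a: "continuous_on (closure Y) (\<lambda>x. \<bar>f x\<bar>)" "continuous_on (closure Y) (\<lambda>x. - 1 * f x)"
    using assms continuous_on_mult_left[OF assms, of "-1"] by (simp_all add: continuous_on_rabs)
  have "I f \<le> I (\<lambda>x. \<bar>f x\<bar>)" "I (\<lambda>x. - 1 * f x) \<le> I (\<lambda>x. \<bar>f x\<bar>)"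
    by (rule I_mono[OF assms a(1)] I_mono[OF a(2,1)]; simp)+
  then show ?thesis
    using I_scale[OF assms, of "-1"] by simp
qed

lemma zero_on_closure:
  fixes f :: "real^2 \<Rightarrow> 'b::real_inner"
  assumes cont: "continuous_on (closure Y) f" and "I (\<lambda>x. f x \<bullet> f x) = 0" and x: "x \<in> closure Y"
  shows "f x = 0"
proof -
  have "f x \<bullet> f x = 0" if "x \<in> Y" for x
    by (rule I_definite[where f = "\<lambda>x. f x \<bullet> f x"]) (use assms that in \<open>auto intro: continuous_intros\<close>)
  then show ?thesis
    using continuous_constant_on_closure[OF cont _ x, of 0] by auto
qed

text \<open>Extension by zero turns equality on the closure into equality of functions; the
  uniqueness parts of the definite descriptions rest on this.\<close>

definition cfun :: "(real^2 \<Rightarrow> 'b::real_inner) set" where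
  "cfun = {f. continuous_on (closure Y) f \<and> (\<forall>x. x \<notin> closure Y \<longrightarrow> f x = 0)}"

lemma subspace_cfun: "subspace cfun"
  unfolding cfun_def by (auto intro!: subspaceI continuous_intros simp: plus_fun_def scaleR_fun_def zero_fun_def)

lemma cfun_D: "f \<in> cfun \<Longrightarrow> continuous_on (closure Y) f"
  by (simp add: cfun_def)

lemma cfun_span: "B \<subseteq> cfun \<Longrightarrow> f \<in> span B \<Longrightarrow> f \<in> cfun"
  using span_minimal[OF _ subspace_cfun] by blast

lemma I_inner_add:
  fixes x y z :: "real^2 \<Rightarrow> 'b::real_inner"
  assumes "continuous_on (closure Y) x" "continuous_on (closure Y) y" "continuous_on (closure Y) z"
  shows "I (\<lambda>p. (x p + y p) \<bullet> z p) = I (\<lambda>p. x p \<bullet> z p) + I (\<lambda>p. y p \<bullet> z p)"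
  using assms by (simp add: inner_add_left I_add continuous_on_inner)

lemma I_inner_diff:
  fixes x y z :: "real^2 \<Rightarrow> 'b::real_inner"
  assumes "continuous_on (closure Y) x" "continuous_on (closure Y) y" "continuous_on (closure Y) z"
  shows "I (\<lambda>p. (x p - y p) \<bullet> z p) = I (\<lambda>p. x p \<bullet> z p) - I (\<lambda>p. y p \<bullet> z p)"
  using assms by (simp add: inner_diff_left I_diff continuous_on_inner)

lemma I_inner_scale:
  fixes x z :: "real^2 \<Rightarrow> 'b::real_inner"
  assumes "continuous_on (closure Y) x" "continuous_on (closure Y) z"
  shows "I (\<lambda>p. (r *\<^sub>R x p) \<bullet> z p) = r * I (\<lambda>p. x p \<bullet> z p)"
  using assms by (simp add: I_scale continuous_on_inner)

lemma cfun_definite: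
  assumes "f \<in> cfun" "I (\<lambda>x. f x \<bullet> f x) = 0"
  shows "f = 0"
proof
  fix x
  show "f x = 0 x"
    using assms zero_on_closure[of f x] by (cases "x \<in> closure Y") (auto simp: cfun_def)
qed

lemma inner_product_on_cfun: "inner_product_on cfun (\<lambda>q p :: real^2 \<Rightarrow> 'b::real_inner. I (\<lambda>x. q x \<bullet> p x))"
proof (unfold_locales; (rule subspace_cfun)?)
  fix x y z :: "real^2 \<Rightarrow> 'b" and r
  assume c: "x \<in> cfun"
  show "0 \<le> I (\<lambda>p. x p \<bullet> x p)"
    using c[THEN cfun_D] by (intro I_nonneg continuous_on_inner) auto
  show "x = 0" if "I (\<lambda>p. x p \<bullet> x p) = 0"
    using cfun_definite c that by blast
  show "I (\<lambda>p. x p \<bullet> z p) = I (\<lambda>p. z p \<bullet> x p)"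
    by (simp only: inner_commute)
  assume z: "z \<in> cfun"
  show "I (\<lambda>p. (r *\<^sub>R x) p \<bullet> z p) = r * I (\<lambda>p. x p \<bullet> z p)"
    using I_inner_scale c[THEN cfun_D] z[THEN cfun_D] by simp
  assume "y \<in> cfun"
  then show "I (\<lambda>p. (x + y) p \<bullet> z p) = I (\<lambda>p. x p \<bullet> z p) + I (\<lambda>p. y p \<bullet> z p)"
    using I_inner_add c[THEN cfun_D] z[THEN cfun_D] cfun_D[of y] by simp
qed

lemmas Riesz = inner_product_on.Riesz_representation[OF inner_product_on_cfun]

lemma Riesz_unique:
  fixes B :: "(real^2 \<Rightarrow> 'b::real_inner) set"
  assumes "B \<subseteq> cfun" "q \<in> span B" "q' \<in> span B"
    and eq: "\<And>p. p \<in> span B \<Longrightarrow> I (\<lambda>x. q x \<bullet> p x) = I (\<lambda>x. q' x \<bullet> p x)"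
  shows "q = q'"
proof -
  have d: "q - q' \<in> span B" by (intro span_diff assms)
  have "I (\<lambda>x. (q x - q' x) \<bullet> (q - q') x) = I (\<lambda>x. q x \<bullet> (q - q') x) - I (\<lambda>x. q' x \<bullet> (q - q') x)"
    using cfun_span[OF assms(1), THEN cfun_D] assms(2,3) d by (intro I_inner_diff) blast+
  then have "I (\<lambda>x. (q - q') x \<bullet> (q - q') x) = 0"
    using eq[OF d] by simp
  then show ?thesis
    using cfun_definite[of "q - q'"] cfun_span assms d by auto
qed

text \<open>Serves equations in which the unknown is tested with \<open>A p\<close> instead of p;
  for the potential, \<open>A\<close> takes the divergence of a radial tensor field with coefficient
  p.\<close>

lemma Riesz_precomp:
  fixes B :: "(real^2 \<Rightarrow> 'b::real_inner) set"
  assumes B: "finite B" "B \<subseteq> cfun"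
    and A_add: "\<And>x y. x \<in> W \<Longrightarrow> y \<in> W \<Longrightarrow> A (x + y) = A x + A y"
    and A_scale: "\<And>r x. x \<in> W \<Longrightarrow> A (r *\<^sub>R x) = r *\<^sub>R A x"
    and W: "subspace W" and A: "bij_betw A W (span B)"
    and l_add: "\<And>x y. x \<in> W \<Longrightarrow> y \<in> W \<Longrightarrow> l (x + y) = l x + l y"
    and l_scale: "\<And>r x. x \<in> W \<Longrightarrow> l (r *\<^sub>R x) = r * l x"
  shows "\<exists>q\<in>span B. \<forall>p\<in>W. I (\<lambda>x. q x \<bullet> A p x) = l p"
proof -
  define A' where "A' = inv_into W A"
  have A': "A' x \<in> W" "A (A' x) = x" if "x \<in> span B" for x
    unfolding A'_def using that A by (auto simp: bij_betw_def inv_into_into f_inv_into_f)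
  have A'_A: "A' (A p) = p" "A p \<in> span B" if "p \<in> W" for p
    unfolding A'_def using that A by (auto simp: bij_betw_def)
  have A'_add: "A' (x + y) = A' x + A' y" if "x \<in> span B" "y \<in> span B" for x y
    using that A' A'_A(1)[of "A' x + A' y"] A_add W by (auto simp: subspace_add)
  have A'_scale: "A' (r *\<^sub>R x) = r *\<^sub>R A' x" if "x \<in> span B" for x r
    using that A' A'_A(1)[of "r *\<^sub>R A' x"] A_scale W by (auto simp: subspace_scale)
  have "\<exists>q\<in>span B. \<forall>p\<in>span B. I (\<lambda>x. q x \<bullet> p x) = l (A' p)"
    by (rule Riesz[OF B]) (auto simp: A'_add A'_scale A' l_add l_scale)
  then show ?thesis
    using A'_A by metis
qed

lemma l2_proj_unique:
  assumes "B \<subseteq> cfun" "continuous_on (closure Y) f"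
    "p \<in> span B" "\<And>q. q \<in> span B \<Longrightarrow> I (\<lambda>x. (f x - p x) \<bullet> q x) = 0"
  shows "l2_proj I (span B) f = p"
  unfolding l2_proj_def
proof (rule the_equality)
  show "p \<in> span B \<and> (\<forall>q\<in>span B. I (\<lambda>x. (f x - p x) \<bullet> q x) = 0)"
    using assms by auto
  fix p' assume p': "p' \<in> span B \<and> (\<forall>q\<in>span B. I (\<lambda>x. (f x - p' x) \<bullet> q x) = 0)"
  show "p' = p"
  proof (rule Riesz_unique[OF assms(1)])
    fix q assume q: "q \<in> span B"
    have c: "continuous_on (closure Y) q" "continuous_on (closure Y) p" "continuous_on (closure Y) p'"
      using q p' assms cfun_span cfun_D by blast+
    show "I (\<lambda>x. p' x \<bullet> q x) = I (\<lambda>x. p x \<bullet> q x)"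
      using I_inner_diff[of f p q] I_inner_diff[of f p' q] c assms p' q by auto
  qed (use p' assms in auto)
qed

lemma l2_proj_exists:
  assumes "finite B" "B \<subseteq> cfun" "continuous_on (closure Y) f"
  shows "l2_proj I (span B) f \<in> span B"
    and "\<And>q. q \<in> span B \<Longrightarrow> I (\<lambda>x. l2_proj I (span B) f x \<bullet> q x) = I (\<lambda>x. f x \<bullet> q x)"
proof -
  have "\<exists>p\<in>span B. \<forall>q\<in>span B. I (\<lambda>x. p x \<bullet> q x) = I (\<lambda>x. f x \<bullet> q x)"
  proof (rule Riesz[OF assms(1,2)])
    fix x y assume xy: "x \<in> span B" "y \<in> span B"
    note c = xy[THEN cfun_span[OF assms(2)], THEN cfun_D] assms(3)
    show "I (\<lambda>p. f p \<bullet> (x + y) p) = I (\<lambda>p. f p \<bullet> x p) + I (\<lambda>p. f p \<bullet> y p)"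
      using I_inner_add[OF c] by (simp add: inner_commute)
  next
    fix r x assume x: "x \<in> span B"
    show "I (\<lambda>p. f p \<bullet> (r *\<^sub>R x) p) = r * I (\<lambda>p. f p \<bullet> x p)"
      using I_inner_scale[OF cfun_D[OF cfun_span[OF assms(2) x]] assms(3), of r]
      by (simp add: inner_commute[of "f _"])
  qed
  then obtain p where p: "p \<in> span B" "\<And>q. q \<in> span B \<Longrightarrow> I (\<lambda>x. p x \<bullet> q x) = I (\<lambda>x. f x \<bullet> q x)"
    by auto
  have "l2_proj I (span B) f = p"
  proof (rule l2_proj_unique[OF assms(2,3) p(1)])
    fix q assume q: "q \<in> span B"
    show "I (\<lambda>x. (f x - p x) \<bullet> q x) = 0"
      using I_inner_diff[OF assms(3) p(1)[THEN cfun_span[OF assms(2)], THEN cfun_D]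
          q[THEN cfun_span[OF assms(2)], THEN cfun_D]] p(2)[OF q] by simp
  qed
  then show "l2_proj I (span B) f \<in> span B"
    "\<And>q. q \<in> span B \<Longrightarrow> I (\<lambda>x. l2_proj I (span B) f x \<bullet> q x) = I (\<lambda>x. f x \<bullet> q x)"
    using p by auto
qed

end

section \<open>Polynomials\<close>

definition monomial2 :: "nat \<Rightarrow> nat \<Rightarrow> real^2 \<Rightarrow> real" where
  "monomial2 i j x = x $ 1 ^ i * x $ 2 ^ j"

definition monomials2 :: "int \<Rightarrow> (real^2 \<Rightarrow> real) set" where
  "monomials2 l = (\<lambda>(i, j). monomial2 i j) ` {(i, j). int i + int j \<le> l}"

lemma finite_degree_set: "finite {(i, j). int i + int j \<le> l}"
  by (rule finite_subset[of _ "{..nat l} \<times> {..nat l}"]) auto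

lemma finite_monomials2: "finite (monomials2 l)"
  unfolding monomials2_def using finite_degree_set by simp

lemma subspace_bipoly: "subspace (bipoly l)"
proof (rule subspaceI)
  show "0 \<in> bipoly l"
    unfolding bipoly_def by (auto intro!: exI[of _ "\<lambda>i j. 0"])
  show "p + q \<in> bipoly l" if pq: "p \<in> bipoly l" "q \<in> bipoly l" for p q
  proof -
    obtain c d where c: "\<And>x. p x = (\<Sum>(i, j) \<in> {(i, j). int i + int j \<le> l}. c i j * x $ 1 ^ i * x $ 2 ^ j)"
      and d: "\<And>x. q x = (\<Sum>(i, j) \<in> {(i, j). int i + int j \<le> l}. d i j * x $ 1 ^ i * x $ 2 ^ j)"
      using pq unfolding bipoly_def by blast
    show ?thesis
      unfolding bipoly_def by (auto intro!: exI[of _ "\<lambda>i j. c i j + d i j"]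
          simp: c d sum.distrib[symmetric] case_prod_beta algebra_simps)
  qed
  show "r *\<^sub>R p \<in> bipoly l" if p: "p \<in> bipoly l" for r p
  proof -
    obtain c where c: "\<And>x. p x = (\<Sum>(i, j) \<in> {(i, j). int i + int j \<le> l}. c i j * x $ 1 ^ i * x $ 2 ^ j)"
      using p unfolding bipoly_def by blast
    show ?thesis
      unfolding bipoly_def mem_Collect_eq
      by (intro exI[of _ "\<lambda>i j. r * c i j"] allI) (simp add: c sum_distrib_left case_prod_beta mult.assoc)
  qed
qed

lemma monomial2_in_bipoly:
  assumes "int i + int j \<le> l"
  shows "monomial2 i j \<in> bipoly l"
proof -
  have "monomial2 i j x = (\<Sum>(i', j') \<in> {(i, j). int i + int j \<le> l}.
      (if i' = i \<and> j' = j then 1 else 0) * x $ 1 ^ i' * x $ 2 ^ j')" for x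
  proof -
    have "(\<Sum>(i', j') \<in> {(i, j). int i + int j \<le> l}.
        (if i' = i \<and> j' = j then 1 else 0) * x $ 1 ^ i' * x $ 2 ^ j')
      = (\<Sum>q \<in> {(i, j). int i + int j \<le> l}. if q = (i, j) then x $ 1 ^ i * x $ 2 ^ j else 0)"
      by (intro sum.cong) (simp_all split: prod.split)
    also have "\<dots> = x $ 1 ^ i * x $ 2 ^ j"
      using assms by (simp add: sum.delta finite_degree_set)
    finally show ?thesis by (simp add: monomial2_def)
  qed
  then show ?thesis
    unfolding bipoly_def by (auto intro!: exI[of _ "\<lambda>i' j'. if i' = i \<and> j' = j then 1 else 0"])
qed

lemma bipoly_eq_span: "bipoly l = span (monomials2 l)"
proof
  show "span (monomials2 l) \<subseteq> bipoly l"
    by (rule span_minimal) (auto simp: monomials2_def subspace_bipoly intro: monomial2_in_bipoly)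
  show "bipoly l \<subseteq> span (monomials2 l)"
  proof
    fix p assume "p \<in> bipoly l"
    then obtain c where c: "\<And>x. p x = (\<Sum>(i, j) \<in> {(i, j). int i + int j \<le> l}. c i j * x $ 1 ^ i * x $ 2 ^ j)"
      unfolding bipoly_def by blast
    have p: "p = (\<Sum>q \<in> {(i, j). int i + int j \<le> l}. c (fst q) (snd q) *\<^sub>R monomial2 (fst q) (snd q))"
      by (auto simp: fun_eq_iff c sum_fun_apply monomial2_def case_prod_beta algebra_simps)
    show "p \<in> span (monomials2 l)"
      unfolding p monomials2_def by (intro span_sum span_scale span_base) force
  qed
qed

lemma bipoly_induct [consumes 1, case_names monomial zero add scale]:
  assumes "p \<in> bipoly l"
    and "\<And>i j. int i + int j \<le> l \<Longrightarrow> P (monomial2 i j)"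
    and "P (\<lambda>x. 0)" and "\<And>p q. P p \<Longrightarrow> P q \<Longrightarrow> P (\<lambda>x. p x + q x)"
    and "\<And>c p. P p \<Longrightarrow> P (\<lambda>x. c * p x)"
  shows "P p"
  using assms(1) unfolding bipoly_eq_span
proof (rule span_induct[where P = P])
  show "P p" if "p \<in> monomials2 l" for p
    using that assms(2) by (auto simp: monomials2_def)
  show "subspace {p. P p}"
    using assms(3-) by (intro subspaceI) (simp_all add: plus_fun_def scaleR_fun_def zero_fun_def)
qed

lemma bipoly_zero: "(\<lambda>x. 0) \<in> bipoly l"
  using subspace_0[OF subspace_bipoly] by (simp add: zero_fun_def)

lemma bipoly_add: "p \<in> bipoly l \<Longrightarrow> q \<in> bipoly l \<Longrightarrow> (\<lambda>x. p x + q x) \<in> bipoly l"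
  using subspace_add[OF subspace_bipoly] by (simp add: plus_fun_def)

lemma bipoly_diff: "p \<in> bipoly l \<Longrightarrow> q \<in> bipoly l \<Longrightarrow> (\<lambda>x. p x - q x) \<in> bipoly l"
  using subspace_diff[OF subspace_bipoly] by (simp add: fun_diff_def)

lemma bipoly_scale: "p \<in> bipoly l \<Longrightarrow> (\<lambda>x. c * p x) \<in> bipoly l"
  using subspace_scale[OF subspace_bipoly] by (simp add: scaleR_fun_def)

lemma bipoly_uminus: "p \<in> bipoly l \<Longrightarrow> (\<lambda>x. - p x) \<in> bipoly l"
  using bipoly_scale[of p l "-1"] by simp

lemma bipoly_mono: "l \<le> m \<Longrightarrow> p \<in> bipoly l \<Longrightarrow> p \<in> bipoly m"
  unfolding bipoly_eq_span by (rule subsetD[OF span_mono]) (auto simp: monomials2_def)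

lemma bipoly_const: "0 \<le> l \<Longrightarrow> (\<lambda>x. c) \<in> bipoly l"
  using bipoly_scale[OF monomial2_in_bipoly[of 0 0 l], of c] by (simp add: monomial2_def)

lemma bipoly_coord: "1 \<le> l \<Longrightarrow> (\<lambda>x. x $ i) \<in> bipoly l"
  using monomial2_in_bipoly[of 1 0 l] monomial2_in_bipoly[of 0 1 l] exhaust_2[of i]
  by (auto simp: monomial2_def[abs_def])

lemma bipoly_mult:
  assumes p: "p \<in> bipoly l" and q: "q \<in> bipoly m"
  shows "(\<lambda>x. p x * q x) \<in> bipoly (l + m)"
  using p
proof (induction rule: bipoly_induct)
  case (monomial i j)
  note ij = this
  show ?case
    using q
  proof (induction rule: bipoly_induct)
    case (monomial i' j')
    have "(\<lambda>x. monomial2 i j x * monomial2 i' j' x) = monomial2 (i + i') (j + j')"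
      by (auto simp: monomial2_def power_add)
    then show ?case
      using monomial2_in_bipoly[of "i + i'" "j + j'" "l + m"] ij monomial by simp
  qed (use bipoly_add bipoly_scale bipoly_zero in \<open>fastforce simp: algebra_simps\<close>)+
next
  case (add p p')
  then show ?case using bipoly_add[OF add] by (simp add: algebra_simps)
next
  case (scale c p)
  then show ?case using bipoly_scale[OF scale, of c] by (simp add: algebra_simps)
qed (use bipoly_zero in simp)

lemma bipoly_affine:
  assumes "p \<in> bipoly l"
  shows "(\<lambda>x. p (r *\<^sub>R x + c)) \<in> bipoly l"
  using assms
proof (induction rule: bipoly_induct)
  case (monomial i j)
  have coord: "(\<lambda>x. (r *\<^sub>R x + c) $ i) \<in> bipoly 1" for i
    using bipoly_add[OF bipoly_scale[OF bipoly_coord[of 1 i], of r] bipoly_const[of 1 "c $ i"]] by simp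
  have pow: "(\<lambda>x. (r *\<^sub>R x + c) $ i ^ n) \<in> bipoly (int n)" for i n
  proof (induction n)
    case (Suc n)
    then show ?case using bipoly_mult[OF coord[of i] Suc] by simp
  qed (simp add: bipoly_const)
  show ?case
    using bipoly_mono[OF monomial bipoly_mult[OF pow[of 1 i] pow[of 2 j]]] by (simp add: monomial2_def)
qed (auto intro: bipoly_add bipoly_scale bipoly_zero)

lemma monomial2_has_derivative:
  "(monomial2 i j has_derivative (\<lambda>h. h $ 1 * (real i * monomial2 (i - 1) j x)
      + h $ 2 * (real j * monomial2 i (j - 1) x))) (at x)"
  unfolding monomial2_def[abs_def]
  by (rule derivative_eq_intros bounded_linear.has_derivative[OF bounded_linear_vec_nth] refl)+
    (auto simp: fun_eq_iff algebra_simps)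

lemma bipoly_has_derivative_ex:
  assumes "p \<in> bipoly l"
  shows "\<exists>p1\<in>bipoly (l - 1). \<exists>p2\<in>bipoly (l - 1).
    \<forall>x. (p has_derivative (\<lambda>h. h $ 1 * p1 x + h $ 2 * p2 x)) (at x)"
  using assms
proof (induction rule: bipoly_induct)
  case (monomial i j)
  have "(\<lambda>x. real i * monomial2 (i - 1) j x) \<in> bipoly (l - 1)"
  \<comment> \<open>For i = 0 the truncated \<open>i - 1\<close> would keep the degree at j,
    possibly above \<open>l - 1\<close>; the coefficient \<open>real i\<close> is then zero.\<close>
  proof (cases "i = 0")
    case False
    then show ?thesis using monomial by (intro bipoly_scale monomial2_in_bipoly) auto
  qed (simp add: bipoly_zero)
  moreover have "(\<lambda>x. real j * monomial2 i (j - 1) x) \<in> bipoly (l - 1)"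
  proof (cases "j = 0")
    case False
    then show ?thesis using monomial by (intro bipoly_scale monomial2_in_bipoly) auto
  qed (simp add: bipoly_zero)
  ultimately show ?case
    using monomial2_has_derivative[of i j] by (intro bexI[where x = "\<lambda>x. real i * monomial2 (i - 1) j x"] bexI[where x = "\<lambda>x. real j * monomial2 i (j - 1) x"] allI)
next
  case zero
  show ?case using bipoly_zero by (intro bexI[of _ "\<lambda>x. 0"]) auto
next
  case (add p q)
  then obtain p1 p2 q1 q2 where *: "p1 \<in> bipoly (l - 1)" "p2 \<in> bipoly (l - 1)" "q1 \<in> bipoly (l - 1)" "q2 \<in> bipoly (l - 1)"
    "\<And>x. (p has_derivative (\<lambda>h. h $ 1 * p1 x + h $ 2 * p2 x)) (at x)"
    "\<And>x. (q has_derivative (\<lambda>h. h $ 1 * q1 x + h $ 2 * q2 x)) (at x)"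
    by blast
  have "((\<lambda>x. p x + q x) has_derivative (\<lambda>h. h $ 1 * (p1 x + q1 x) + h $ 2 * (p2 x + q2 x))) (at x)" for x
    using has_derivative_add[OF *(5,6)[of x]] by (simp add: algebra_simps)
  then show ?case
    using bipoly_add[OF *(1,3)] bipoly_add[OF *(2,4)] by (intro bexI[where x = "\<lambda>x. p1 x + q1 x"] bexI[where x = "\<lambda>x. p2 x + q2 x"] allI)
next
  case (scale c p)
  then obtain p1 p2 where *: "p1 \<in> bipoly (l - 1)" "p2 \<in> bipoly (l - 1)"
    "\<And>x. (p has_derivative (\<lambda>h. h $ 1 * p1 x + h $ 2 * p2 x)) (at x)"
    by blast
  have "((\<lambda>x. c * p x) has_derivative (\<lambda>h. h $ 1 * (c * p1 x) + h $ 2 * (c * p2 x))) (at x)" for x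
    using has_derivative_mult_right[OF *(3)[of x], of c] by (simp add: algebra_simps)
  then show ?case
    using bipoly_scale[OF *(1), of c] bipoly_scale[OF *(2), of c] by (intro bexI[where x = "\<lambda>x. c * p1 x"] bexI[where x = "\<lambda>x. c * p2 x"] allI)
qed

section \<open>Directional derivatives and vector-valued polynomials\<close>

lemma dir_deriv_eq:
  assumes "(f has_derivative D) (at x)"
  shows "dir_deriv t f x = D t"
proof -
  have "((\<lambda>s. f (x + s *\<^sub>R t)) has_derivative (\<lambda>s. D (s *\<^sub>R t))) (at 0)"
    by (rule has_derivative_compose[where f = "\<lambda>s. x + s *\<^sub>R t" and g = f, simplified])
      (use assms in \<open>auto intro!: derivative_eq_intros\<close>)
  then have "((\<lambda>s. f (x + s *\<^sub>R t)) has_vector_derivative D t) (at 0)"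
    unfolding has_vector_derivative_def using has_derivative_linear[OF assms] by (simp add: linear_scale)
  then show ?thesis
    unfolding dir_deriv_def by (rule vector_derivative_at)
qed

text \<open>Only the values on the line through x in direction t count, so a function cut off
  outside an edge can still be differentiated along the edge.\<close>

lemma dir_deriv_cong:
  assumes "\<forall>\<^sub>F s in nhds 0. f (x + s *\<^sub>R t) = g (x + s *\<^sub>R t)"
  shows "dir_deriv t f x = dir_deriv t g x"
  unfolding dir_deriv_def by (rule vector_derivative_cong_eq) (use assms in auto)

lemma dir_deriv_cong_open:
  assumes "open A" "x \<in> A" "\<And>y. y \<in> A \<Longrightarrow> f y = g y"
  shows "dir_deriv t f x = dir_deriv t g x"
proof (rule dir_deriv_cong)
  have "((\<lambda>s. x + s *\<^sub>R t) \<longlongrightarrow> x + 0 *\<^sub>R t) (nhds 0)"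
    by (intro tendsto_intros filterlim_ident)
  then have "\<forall>\<^sub>F s in nhds 0. x + s *\<^sub>R t \<in> A"
    using assms by (intro topological_tendstoD) auto
  then show "\<forall>\<^sub>F s in nhds 0. f (x + s *\<^sub>R t) = g (x + s *\<^sub>R t)"
    by eventually_elim (use assms in auto)
qed

text \<open>One space for scalars, vectors and tensors at once; on vectors and tensors it agrees
  with iterated \<open>by_rows\<close>.\<close>

definition vpoly :: "int \<Rightarrow> (real^2 \<Rightarrow> 'b::euclidean_space) set" where
  "vpoly l = {f. \<forall>b\<in>Basis. (\<lambda>x. f x \<bullet> b) \<in> bipoly l}"

definition vmonomials :: "int \<Rightarrow> (real^2 \<Rightarrow> 'b::euclidean_space) set" where
  "vmonomials l = (\<lambda>(p, b) x. p x *\<^sub>R b) ` (monomials2 l \<times> Basis)"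

lemma finite_vmonomials: "finite (vmonomials l)"
  unfolding vmonomials_def using finite_monomials2 by simp

lemma vpoly_real: "vpoly l = bipoly l"
  by (auto simp: vpoly_def)

lemma vpoly_inner: 
  assumes "f \<in> vpoly l" 
  shows "(\<lambda>x. f x \<bullet> v) \<in> bipoly l"
proof -
  have "(\<lambda>x. f x \<bullet> v) = (\<Sum>b\<in>Basis. (v \<bullet> b) *\<^sub>R (\<lambda>x. f x \<bullet> b))"
    by (subst euclidean_representation[of v, symmetric])
      (auto simp: sum_fun_apply inner_sum_right fun_eq_iff)
  then show ?thesis
    using assms by (simp add: vpoly_def subspace_sum subspace_bipoly subspace_scale)
qed

lemma subspace_vpoly: "subspace (vpoly l)"
proof (rule subspaceI)
  show "0 \<in> vpoly l" by (auto simp: vpoly_def bipoly_zero)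
  show "f + g \<in> vpoly l" if "f \<in> vpoly l" "g \<in> vpoly l" for f g
    using that by (auto simp: vpoly_def inner_add_left intro: bipoly_add)
  show "c *\<^sub>R f \<in> vpoly l" if "f \<in> vpoly l" for f c
    using that by (auto simp: vpoly_def intro: bipoly_scale)
qed

lemma vpoly_add: "f \<in> vpoly l \<Longrightarrow> g \<in> vpoly l \<Longrightarrow> (\<lambda>x. f x + g x) \<in> vpoly l"
  using subspace_add[OF subspace_vpoly] by (simp add: plus_fun_def)

lemma vpoly_diff: "f \<in> vpoly l \<Longrightarrow> g \<in> vpoly l \<Longrightarrow> (\<lambda>x. f x - g x) \<in> vpoly l"
  using subspace_diff[OF subspace_vpoly] by (simp add: fun_diff_def)

lemma vpoly_scale: "f \<in> vpoly l \<Longrightarrow> (\<lambda>x. c *\<^sub>R f x) \<in> vpoly l"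
  using subspace_scale[OF subspace_vpoly] by (simp add: scaleR_fun_def)

lemma vpoly_mono: "l \<le> m \<Longrightarrow> f \<in> vpoly l \<Longrightarrow> f \<in> vpoly m"
  by (auto simp: vpoly_def intro: bipoly_mono)

lemma vpoly_scaleR: "p \<in> bipoly l \<Longrightarrow> f \<in> vpoly m \<Longrightarrow> (\<lambda>x. p x *\<^sub>R f x) \<in> vpoly (l + m)"
  by (auto simp: vpoly_def intro: bipoly_mult)

lemma vpoly_const: "0 \<le> l \<Longrightarrow> (\<lambda>x. c) \<in> vpoly l"
  by (auto simp: vpoly_def intro: bipoly_const)

lemma vpoly_scaleR_const: "p \<in> bipoly l \<Longrightarrow> (\<lambda>x. p x *\<^sub>R b) \<in> vpoly l"
  using vpoly_scaleR[of p l "\<lambda>x. b" 0] vpoly_const[of 0 b] by simp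

lemma vpoly_eq_span: "(vpoly l :: (real^2 \<Rightarrow> 'a::euclidean_space) set) = span (vmonomials l)"
proof
  show "span (vmonomials l) \<subseteq> (vpoly l :: (real^2 \<Rightarrow> 'a) set)"
    by (rule span_minimal)
      (auto simp: vmonomials_def subspace_vpoly bipoly_eq_span intro!: vpoly_scaleR_const span_base)
  show "(vpoly l :: (real^2 \<Rightarrow> 'a) set) \<subseteq> span (vmonomials l)"
  proof
    fix f :: "real^2 \<Rightarrow> 'a" assume f: "f \<in> vpoly l"
    have *: "(\<lambda>x. p x *\<^sub>R b) \<in> span (vmonomials l)" if p: "p \<in> bipoly l" and b: "b \<in> Basis" for p and b :: 'a
      using p
    proof (induction rule: bipoly_induct)
      case (monomial i j)
      then show ?case using b
        by (intro span_base) (force simp: vmonomials_def monomials2_def)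
    next
      case zero
      show ?case using span_zero[of "vmonomials l"] by (simp add: zero_fun_def)
    next
      case (add p q)
      then show ?case using span_add[OF add] by (simp add: plus_fun_def algebra_simps)
    next
      case (scale c p)
      then show ?case using span_scale[OF scale, of c] by (simp add: scaleR_fun_def)
    qed
    have "f = (\<Sum>b\<in>Basis. (\<lambda>x. (f x \<bullet> b) *\<^sub>R b))"
      by (auto simp: fun_eq_iff sum_fun_apply euclidean_representation)
    also have "\<dots> \<in> span (vmonomials l)"
      by (intro span_sum *) (use f in \<open>auto simp: vpoly_def\<close>)
    finally show "f \<in> span (vmonomials l)" .
  qed
qed

lemma by_rows_vpoly: "by_rows (vpoly l) = vpoly l"
  by (auto simp: by_rows_def vpoly_def Basis_vec_def inner_axis)

lemma by_rows_bipoly: "by_rows (bipoly l) = vpoly l"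
  using by_rows_vpoly[where 'a = real] by (simp add: vpoly_real)

lemma vpoly_component: "f \<in> vpoly l \<Longrightarrow> (\<lambda>x. f x $ i) \<in> vpoly l" for f :: "real^2 \<Rightarrow> 'a::euclidean_space^2"
  using by_rows_vpoly[of l, where 'a = 'a] by (auto simp: by_rows_def)

lemma vpoly_rowsI: "(\<And>i. (\<lambda>x. f x $ i) \<in> vpoly l) \<Longrightarrow> f \<in> vpoly l" for f :: "real^2 \<Rightarrow> 'a::euclidean_space^2"
  using by_rows_vpoly[of l, where 'a = 'a] by (auto simp: by_rows_def)

lemma vpoly_has_derivative_ex:
  fixes f :: "real^2 \<Rightarrow> 'a::euclidean_space"
  assumes "f \<in> vpoly l"
  shows "\<exists>f1\<in>vpoly (l - 1). \<exists>f2\<in>vpoly (l - 1).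
    \<forall>x. (f has_derivative (\<lambda>h. h $ 1 *\<^sub>R f1 x + h $ 2 *\<^sub>R f2 x)) (at x)"
proof -
  have "\<forall>b\<in>Basis. \<exists>p. fst p \<in> bipoly (l - 1) \<and> snd p \<in> bipoly (l - 1) \<and>
    (\<forall>x. ((\<lambda>x. f x \<bullet> b) has_derivative (\<lambda>h. h $ 1 * fst p x + h $ 2 * snd p x)) (at x))"
    using bipoly_has_derivative_ex assms unfolding vpoly_def by force
  from bchoice[OF this] obtain p where *: "\<forall>b\<in>Basis. fst (p b) \<in> bipoly (l - 1) \<and> snd (p b) \<in> bipoly (l - 1) \<and>
    (\<forall>x. ((\<lambda>x. f x \<bullet> b) has_derivative (\<lambda>h. h $ 1 * fst (p b) x + h $ 2 * snd (p b) x)) (at x))" ..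
  then have p: "\<And>b. b \<in> Basis \<Longrightarrow> fst (p b) \<in> bipoly (l - 1)" "\<And>b. b \<in> Basis \<Longrightarrow> snd (p b) \<in> bipoly (l - 1)"
    "\<And>b x. b \<in> Basis \<Longrightarrow> ((\<lambda>x. f x \<bullet> b) has_derivative (\<lambda>h. h $ 1 * fst (p b) x + h $ 2 * snd (p b) x)) (at x)"
    by blast+
  define f1 where "f1 = (\<lambda>x. \<Sum>b\<in>Basis. fst (p b) x *\<^sub>R b)"
  define f2 where "f2 = (\<lambda>x. \<Sum>b\<in>Basis. snd (p b) x *\<^sub>R b)"
  have f12: "f1 x \<bullet> b = fst (p b) x" "f2 x \<bullet> b = snd (p b) x" if "b \<in> Basis" for x b
    using that by (auto simp: f1_def f2_def inner_sum_left inner_Basis if_distrib cong: if_cong)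
  have "f1 \<in> vpoly (l - 1)" "f2 \<in> vpoly (l - 1)"
    using p(1,2) by (auto simp: vpoly_def f12)
  moreover have "(f has_derivative (\<lambda>h. h $ 1 *\<^sub>R f1 x + h $ 2 *\<^sub>R f2 x)) (at x)" for x
    by (subst has_derivative_componentwise_within) (use p(3) f12 in \<open>auto simp: inner_add_left\<close>)
  ultimately show ?thesis by blast
qed

lemma
  fixes f :: "real^2 \<Rightarrow> 'a::euclidean_space"
  assumes f: "f \<in> vpoly l"
  shows vpoly_has_derivative: "(f has_derivative (\<lambda>h. dir_deriv h f x)) (at x)"
    and vpoly_dir_deriv: "dir_deriv t f \<in> vpoly (l - 1)"
    and dir_deriv_linear: "dir_deriv t f x = t $ 1 *\<^sub>R dir_deriv (axis 1 1) f x + t $ 2 *\<^sub>R dir_deriv (axis 2 1) f x"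
proof -
  obtain f1 f2 where f1: "f1 \<in> vpoly (l - 1)" "f2 \<in> vpoly (l - 1)"
    "\<And>x. (f has_derivative (\<lambda>h. h $ 1 *\<^sub>R f1 x + h $ 2 *\<^sub>R f2 x)) (at x)"
    using vpoly_has_derivative_ex[OF f] by blast
  note d = dir_deriv_eq[OF f1(3)]
  show "(f has_derivative (\<lambda>h. dir_deriv h f x)) (at x)"
    unfolding d by (rule f1)
  show "dir_deriv t f \<in> vpoly (l - 1)"
    unfolding d[abs_def] by (intro vpoly_add vpoly_scale f1)
  show "dir_deriv t f x = t $ 1 *\<^sub>R dir_deriv (axis 1 1) f x + t $ 2 *\<^sub>R dir_deriv (axis 2 1) f x"
    unfolding d by (simp add: axis_def)
qed

lemma vpoly_continuous: "f \<in> vpoly l \<Longrightarrow> continuous_on A f"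
  by (rule continuous_at_imp_continuous_on) (auto dest: vpoly_has_derivative has_derivative_continuous)

lemmas bipoly_continuous = vpoly_continuous[where 'a = real, unfolded vpoly_real]
lemmas bipoly_has_derivative = vpoly_has_derivative[where 'a = real, unfolded vpoly_real]
lemmas bipoly_dir_deriv = vpoly_dir_deriv[where 'a = real, unfolded vpoly_real]

lemma dir_deriv_component:
  fixes f :: "real^2 \<Rightarrow> 'a::euclidean_space^2"
  assumes f: "f \<in> vpoly l"
  shows "dir_deriv t f x $ i = dir_deriv t (\<lambda>y. f y $ i) x"
  using dir_deriv_eq[OF bounded_linear.has_derivative[OF bounded_linear_vec_nth vpoly_has_derivative[OF f]], of t i x]
  by simp

lemma dir_deriv_diff:
  assumes f: "f \<in> vpoly l" and g: "g \<in> vpoly m"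
  shows "dir_deriv t (\<lambda>y. f y - g y) x = dir_deriv t f x - dir_deriv t g x"
  by (rule dir_deriv_eq[OF has_derivative_diff[OF vpoly_has_derivative[OF f] vpoly_has_derivative[OF g]]])

lemma vpoly_linepath_derivative:
  assumes f: "f \<in> vpoly l"
  shows "((\<lambda>s. f (linepath a b s)) has_vector_derivative dir_deriv (b - a) f (linepath a b s)) (at s within S)"
proof -
  have l: "(linepath a b has_derivative (\<lambda>s. s *\<^sub>R (b - a))) (at s within S)"
    using has_vector_derivative_linepath_within[of a b s S] by (simp add: has_vector_derivative_def)
  have "((\<lambda>s. f (linepath a b s)) has_derivative (\<lambda>s'. dir_deriv (s' *\<^sub>R (b - a)) f (linepath a b s))) (at s within S)"
    by (rule has_derivative_compose[OF l vpoly_has_derivative[OF f]])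
  then show ?thesis
    unfolding has_vector_derivative_def
    using linear_scale[OF has_derivative_linear[OF vpoly_has_derivative[OF f, of "linepath a b s"]], of _ "b - a"]
    by simp
qed

text \<open>The operator \<open>q \<mapsto> m q + (x - c) \<cdot> \<nabla> q\<close> is diagonal on the monomials centred at \<open>c\<close>.\<close>

definition euler :: "real \<Rightarrow> real^2 \<Rightarrow> (real^2 \<Rightarrow> real) \<Rightarrow> real^2 \<Rightarrow> real" where
  "euler m c q x = m * q x + dir_deriv (x - c) q x"

lemma euler_add: "p \<in> bipoly l \<Longrightarrow> q \<in> bipoly l \<Longrightarrow> euler m c (p + q) = euler m c p + euler m c q"
  using dir_deriv_eq[OF has_derivative_add[OF bipoly_has_derivative bipoly_has_derivative]]
  by (auto simp: euler_def fun_eq_iff plus_fun_def algebra_simps)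

lemma euler_scale: "p \<in> bipoly l \<Longrightarrow> euler m c (r *\<^sub>R p) = r *\<^sub>R euler m c p"
  using dir_deriv_eq[OF has_derivative_mult_right[OF bipoly_has_derivative]]
  by (auto simp: euler_def fun_eq_iff scaleR_fun_def algebra_simps)

lemma euler_expand: "q \<in> bipoly l \<Longrightarrow> euler m c q x = m * q x + (x - c) $ 1 * partial 1 q x + (x - c) $ 2 * partial 2 q x"
  using dir_deriv_linear[of q l "x - c" x] by (auto simp: euler_def vpoly_real)

lemma euler_bipoly:
  assumes q: "q \<in> bipoly l"
  shows "euler m c q \<in> bipoly l"
proof -
  have *: "(\<lambda>x. (x - c) $ i * partial j q x) \<in> bipoly l" for i j
    using bipoly_mult[OF bipoly_diff[OF bipoly_coord[of 1 i] bipoly_const[of 1 "c $ i"]] bipoly_dir_deriv[OF q]]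
    by simp
  show ?thesis
    unfolding euler_expand[OF q, abs_def] by (intro bipoly_add bipoly_scale q *)
qed

lemma euler_surj:
  assumes m: "m \<ge> 1" and p: "p \<in> bipoly l"
  shows "\<exists>q\<in>bipoly l. euler m c q = p"
proof -
  \<comment> \<open>Centre 0 first, where the monomials are eigenfunctions; translation by c
    intertwines the operators with centres 0 and c.\<close>
  have "\<exists>q\<in>bipoly l. euler m 0 q = p" if "p \<in> bipoly l" for p
    using that
  proof (induction rule: bipoly_induct)
    case (monomial i j)
    \<comment> \<open>The eigenvalue \<open>m + i + j\<close> is positive because m is at least
      1.\<close>
    define q where "q = (1 / (m + i + j)) *\<^sub>R monomial2 i j"
    have "euler m 0 (monomial2 i j) = (m + i + j) *\<^sub>R monomial2 i j"
    proof
      fix x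
      have "x $ 1 * (real i * monomial2 (i - 1) j x) = real i * monomial2 i j x"
        by (cases i) (auto simp: monomial2_def)
      moreover have "x $ 2 * (real j * monomial2 i (j - 1) x) = real j * monomial2 i j x"
        by (cases j) (auto simp: monomial2_def)
      ultimately show "euler m 0 (monomial2 i j) x = ((m + i + j) *\<^sub>R monomial2 i j) x"
        unfolding euler_def dir_deriv_eq[OF monomial2_has_derivative]
        by (simp only: diff_zero scaleR_fun_apply real_scaleR_def ring_distribs)
    qed
    then have "euler m 0 q = monomial2 i j"
      unfolding q_def using m by (subst euler_scale[OF monomial2_in_bipoly[OF monomial]]) (auto simp: fun_eq_iff)
    then show ?case
      using subspace_scale[OF subspace_bipoly monomial2_in_bipoly[OF monomial]] unfolding q_def by blast
  next
    case zero
    then show ?case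
      by (intro bexI[of _ "\<lambda>x. 0"]) (auto simp: euler_def fun_eq_iff bipoly_zero dir_deriv_def)
  next
    case (add p q)
    then obtain p' q' where "p' \<in> bipoly l" "q' \<in> bipoly l" "euler m 0 p' = p" "euler m 0 q' = q"
      by blast
    then show ?case
      using euler_add[of p' l q'] subspace_add[OF subspace_bipoly] by (metis plus_fun_def)
  next
    case (scale r p)
    then obtain p' where "p' \<in> bipoly l" "euler m 0 p' = p"
      by blast
    then show ?case
      using euler_scale[of p' l] subspace_scale[OF subspace_bipoly] by (metis scaleR_fun_def real_scaleR_def)
  qed
  moreover have p': "(\<lambda>x. p (x + c)) \<in> bipoly l"
    using bipoly_affine[OF p, of 1 c] by simp
  ultimately obtain q where q: "q \<in> bipoly l" "euler m 0 q = (\<lambda>x. p (x + c))"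
    by blast
  have q': "(\<lambda>x. q (x - c)) \<in> bipoly l"
    using bipoly_affine[OF q(1), of 1 "-c"] by simp
  have "euler m c (\<lambda>x. q (x - c)) x = p x" for x
  proof -
    have "((\<lambda>x. q (x - c)) has_derivative (\<lambda>h. dir_deriv h q (x - c))) (at x)"
      by (rule has_derivative_compose[where f = "\<lambda>x. x - c" and g = q])
       (auto intro!: derivative_eq_intros bipoly_has_derivative[OF q(1)])
    then have "euler m c (\<lambda>x. q (x - c)) x = euler m 0 q (x - c)"
      unfolding euler_def by (simp add: dir_deriv_eq)
    then show ?thesis using q(2) by simp
  qed
  then show ?thesis using q' by blast
qed

text \<open>Along the ray from \<open>c\<close> to \<open>x\<close>, \<open>s\<^sup>m q\<close> has derivative \<open>s\<^sup>m\<^sup>-\<^sup>1\<close> times the operator applied to \<open>q\<close>.\<close>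

lemma euler_inj:
  assumes q: "q \<in> bipoly l" and m: "m \<ge> 1" and zero: "euler (real m) c q = 0"
  shows "q = 0"
proof
  fix x
  define \<phi> where "\<phi> s = s ^ m * q (linepath c x s)" for s :: real
  have "(\<phi> has_real_derivative 0) (at s)" for s
  proof -
    have d: "((\<lambda>s. q (linepath c x s)) has_real_derivative dir_deriv (x - c) q (linepath c x s)) (at s)"
      using vpoly_linepath_derivative[of q l c x s UNIV] q
      by (simp add: vpoly_real has_real_derivative_iff_has_vector_derivative)
    have "linepath c x s - c = s *\<^sub>R (x - c)"
      by (simp add: linepath_def algebra_simps)
    moreover have "dir_deriv (s *\<^sub>R (x - c)) q y = s * dir_deriv (x - c) q y" for y
      using linear_scale[OF has_derivative_linear[OF bipoly_has_derivative[OF q]]] by simp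
    ultimately have "real m * q (linepath c x s) + s * dir_deriv (x - c) q (linepath c x s) = 0"
      using fun_cong[OF zero, of "linepath c x s"] by (simp add: euler_def)
    moreover have "s ^ m = s * s ^ (m - 1)"
      using m by (cases m) auto
    then have "real m * s ^ (m - 1) * q (linepath c x s) + dir_deriv (x - c) q (linepath c x s) * s ^ m
        = s ^ (m - 1) * (real m * q (linepath c x s) + s * dir_deriv (x - c) q (linepath c x s))"
      by (simp only: ring_distribs mult_ac)
    ultimately have "real m * s ^ (m - 1) * q (linepath c x s) + dir_deriv (x - c) q (linepath c x s) * s ^ m = 0"
      by simp
    then show ?thesis
      unfolding \<phi>_def[abs_def] by (auto intro!: derivative_eq_intros d)
  qed
  then have "\<phi> 1 = \<phi> 0"
    using DERIV_isconst_all by blast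
  then show "q x = 0 x"
    using m by (simp add: \<phi>_def linepath_def)
qed

lemma euler_bij: "m \<ge> 1 \<Longrightarrow> bij_betw (euler (real m) c) (bipoly l) (bipoly l)"
  unfolding bij_betw_def
proof
  assume m: "m \<ge> 1"
  show "inj_on (euler (real m) c) (bipoly l)"
  proof (rule inj_onI)
    fix p q assume pq: "p \<in> bipoly l" "q \<in> bipoly l" "euler (real m) c p = euler (real m) c q"
    have "euler (real m) c (p + (-1) *\<^sub>R q) = 0"
      unfolding euler_add[OF pq(1) subspace_scale[OF subspace_bipoly pq(2), of "-1"]] euler_scale[OF pq(2)]
      using pq(3) by simp
    then have "p + (-1) *\<^sub>R q = 0"
      using euler_inj[OF _ m] pq by (meson subspace_add subspace_bipoly subspace_scale)
    then show "p = q" by simp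
  qed
  show "euler (real m) c ` bipoly l = bipoly l"
    using euler_bipoly euler_surj[of "real m"] m by (auto simp: image_iff) (metis)
qed

text \<open>Passage to univariate polynomials, whose roots and degrees are under control. For
  negative l the truncation in \<open>nat l\<close> does no harm, since p is then zero.\<close>

lemma bipoly_line:
  assumes "p \<in> bipoly l"
  shows "\<exists>q. degree q \<le> nat l \<and> (\<forall>s. p (a + s *\<^sub>R v) = poly q s)"
  using assms
proof (induction rule: bipoly_induct)
  case (monomial i j)
  let ?q = "[:a $ 1, v $ 1:] ^ i * [:a $ 2, v $ 2:] ^ j"
  have "degree ?q \<le> degree ([:a $ 1, v $ 1:] ^ i) + degree ([:a $ 2, v $ 2:] ^ j)"
    by (rule degree_mult_le)
  also have "\<dots> \<le> 1 * i + 1 * j"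
    by (intro add_mono order_trans[OF degree_power_le] mult_right_mono) (auto simp: degree_pCons_eq_if)
  finally have "degree ?q \<le> nat l"
    using monomial by simp
  moreover have "\<forall>s. monomial2 i j (a + s *\<^sub>R v) = poly ?q s"
    by (simp add: monomial2_def algebra_simps)
  ultimately show ?case by blast
next
  case zero
  then show ?case by (intro exI[of _ 0]) simp
next
  case (add p q)
  then obtain p' q' where "degree p' \<le> nat l" "degree q' \<le> nat l"
    "\<And>s. p (a + s *\<^sub>R v) = poly p' s" "\<And>s. q (a + s *\<^sub>R v) = poly q' s"
    by blast
  then show ?case
    by (intro exI[of _ "p' + q'"]) (simp add: degree_add_le)
next
  case (scale c p)
  then obtain p' where "degree p' \<le> nat l" "\<And>s. p (a + s *\<^sub>R v) = poly p' s"
    by blast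
  then show ?case
    by (intro exI[of _ "smult c p'"]) simp
qed

text \<open>On the line from a to x the polynomial has infinitely many zeros near a.\<close>

lemma bipoly_identity:
  assumes p: "p \<in> bipoly l" and "open A" "a \<in> A" and zero: "\<And>x. x \<in> A \<Longrightarrow> p x = 0"
  shows "p x = 0"
proof -
  obtain q where q: "\<And>s. p (a + s *\<^sub>R (x - a)) = poly q s"
    using bipoly_line[OF p] by blast
  have "((\<lambda>s. a + s *\<^sub>R (x - a)) \<longlongrightarrow> a + 0 *\<^sub>R (x - a)) (nhds (0::real))"
    by (intro tendsto_intros filterlim_ident)
  then have "\<forall>\<^sub>F s in nhds 0. a + s *\<^sub>R (x - a) \<in> A"
    using assms by (intro topological_tendstoD) auto
  then obtain e where e: "e > 0" "\<And>s. dist s 0 < e \<Longrightarrow> a + s *\<^sub>R (x - a) \<in> A"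
    unfolding eventually_nhds_metric by blast
  have "poly q s = 0" if "s \<in> {0<..<e}" for s
    using e(2)[of s] zero q[of s] that by auto
  then have "{0<..<e} \<subseteq> {s. poly q s = 0}"
    by blast
  then have "infinite {s. poly q s = 0}"
    using e(1) infinite_Ioo finite_subset by blast
  then have "q = 0"
    using poly_roots_finite by blast
  then show ?thesis
    using q[of 1] by simp
qed

section \<open>Integrals over elements and edges\<close>

lemma continuous_nonneg_integral_zero:
  fixes f :: "'a::euclidean_space \<Rightarrow> real"
  assumes f: "continuous_on (cbox a b) f" "\<And>x. x \<in> cbox a b \<Longrightarrow> 0 \<le> f x"
    and "integral (cbox a b) f = 0" "box a b \<noteq> {}" "x \<in> cbox a b"
  shows "f x = 0"
proof (rule has_integral_0_cbox_imp_0[OF f(1) _ _ assms(4,5)])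
  show "(f has_integral 0) (cbox a b)"
    using integrable_integral[OF integrable_continuous[OF f(1)]] assms(3) by simp
qed (use f(2) box_subset_cbox[of a b] in blast)

lemma integrable_on_bounded_open:
  fixes f :: "real^2 \<Rightarrow> 'b::euclidean_space"
  assumes T: "open T" "bounded T" and f: "continuous_on (closure T) f"
  shows "f absolutely_integrable_on T" "f integrable_on T"
proof -
  have "set_integrable lborel (closure T) f"
    unfolding set_integrable_def
    by (rule borel_integrable_compact) (use T f in \<open>auto simp: compact_closure\<close>)
  then have "set_integrable lborel T f"
    by (rule set_integrable_subset) (use T closure_subset in auto)
  then show "f absolutely_integrable_on T"
    unfolding set_integrable_def by (rule integrable_completion[THEN iffD2, rotated])
      (use \<open>set_integrable lborel T f\<close> in \<open>auto simp: set_integrable_def\<close>)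
  then show "f integrable_on T"
    by (rule set_lebesgue_integral_eq_integral)
qed

lemma l2_functional_element:
  assumes T: "open T" "bounded T"
  shows "l2_functional T (integral T)"
proof
  note int = integrable_on_bounded_open(2)[OF T]
  fix f g :: "real^2 \<Rightarrow> real" and c :: real
  show "integral T f = integral T g" if "\<And>x. x \<in> T \<Longrightarrow> f x = g x"
    using that by (rule integral_cong)
  assume f: "continuous_on (closure T) f"
  show "integral T (\<lambda>x. c * f x) = c * integral T f"
    by simp
  show "integral T (\<lambda>x. f x + g x) = integral T f + integral T g" if "continuous_on (closure T) g"
    using int f that by (intro integral_add)
  assume nn: "\<And>x. x \<in> T \<Longrightarrow> 0 \<le> f x"
  show "0 \<le> integral T f"
    using int[OF f] nn by (intro integral_nonneg) auto
  fix x assume zero: "integral T f = 0" and x: "x \<in> T"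
  \<comment> \<open>Definiteness is local: the nonnegative integrand also has zero integral over a
    box around x inside T.\<close>
  obtain a b where ab: "cbox a b \<subseteq> T" "x \<in> box a b"
    using open_contains_cbox[OF T(1) x] by metis
  have cf: "continuous_on (cbox a b) f"
    using f ab closure_subset by (meson continuous_on_subset order_trans)
  have "integral (cbox a b) f \<le> integral T f"
    using ab int[OF f] nn integrable_continuous[OF cf] by (intro integral_subset_le) auto
  moreover have "0 \<le> integral (cbox a b) f"
    using ab nn integrable_continuous[OF cf] by (intro integral_nonneg) auto
  ultimately have "integral (cbox a b) f = 0"
    using zero by simp
  moreover have "x \<in> cbox a b"
    using ab box_subset_cbox by blast
  ultimately show "f x = 0"
    using continuous_nonneg_integral_zero[OF cf] nn ab by blast
qed

lemma edge_length_pos: "fst E \<noteq> snd E \<Longrightarrow> 0 < edge_length E"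
  by (simp add: edge_length_def)

lemma closure_seg: "fst E \<noteq> snd E \<Longrightarrow> closure (seg E) = closed_segment (fst E) (snd E)"
  by (simp add: seg_def closure_open_segment)

lemma linepath_in_seg: 
  assumes "fst E \<noteq> snd E"
  shows "s \<in> {0<..<1} \<Longrightarrow> linepath (fst E) (snd E) s \<in> seg E"
    and "s \<in> {0..1} \<Longrightarrow> linepath (fst E) (snd E) s \<in> closure (seg E)"
    and "x \<in> seg E \<Longrightarrow> \<exists>s\<in>{0<..<1}. x = linepath (fst E) (snd E) s"
  using assms by (auto simp: closure_seg closed_segment_def linepath_def) (auto simp: seg_def in_segment)

lemma continuous_on_edge:
  assumes "fst E \<noteq> snd E" "continuous_on (closure (seg E)) f"
  shows "continuous_on {0..1} (\<lambda>s. f (linepath (fst E) (snd E) s))"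
  by (rule continuous_on_compose2[OF assms(2)]) (auto intro: continuous_intros linepath_in_seg(2)[OF assms(1)])

lemma integral_cong_Ioo:
  fixes f g :: "real \<Rightarrow> real"
  assumes "\<And>s. s \<in> {0<..<1} \<Longrightarrow> f s = g s"
  shows "integral {0..1} f = integral {0..1} g"
  by (rule integral_spike[of "{0, 1}"]) (use assms in \<open>auto simp: less_le\<close>)

lemma l2_functional_edge:
  assumes E: "fst E \<noteq> snd E"
  shows "l2_functional (seg E) (edge_integral E)"
proof
  note pos = edge_length_pos[OF E]
  note cont = continuous_on_edge[OF E]
  note int = integrable_continuous_interval[OF cont]
  fix f g :: "real^2 \<Rightarrow> real" and c :: real
  show "edge_integral E f = edge_integral E g" if "\<And>x. x \<in> seg E \<Longrightarrow> f x = g x"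
    unfolding edge_integral_def using that linepath_in_seg(1)[OF E]
    by (intro arg_cong[where f = "(*) (edge_length E)"] integral_cong_Ioo) blast
  assume f: "continuous_on (closure (seg E)) f"
  show "edge_integral E (\<lambda>x. c * f x) = c * edge_integral E f"
    by (simp add: edge_integral_def)
  show "edge_integral E (\<lambda>x. f x + g x) = edge_integral E f + edge_integral E g" if "continuous_on (closure (seg E)) g"
    using int[OF f] int[OF that] by (simp add: edge_integral_def integral_add distrib_left)
  assume nn: "\<And>x. x \<in> seg E \<Longrightarrow> 0 \<le> f x"
  have nn': "0 \<le> f (linepath (fst E) (snd E) s)" if "s \<in> {0..1}" for s
    by (rule continuous_ge_on_closure[OF f linepath_in_seg(2)[OF E that] nn])
  show "0 \<le> edge_integral E f"
    unfolding edge_integral_def using pos nn' int[OF f]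
    by (intro mult_nonneg_nonneg integral_nonneg) auto
  fix x assume zero: "edge_integral E f = 0" and x: "x \<in> seg E"
  obtain s where s: "s \<in> {0<..<1}" "x = linepath (fst E) (snd E) s"
    using linepath_in_seg(3)[OF E x] by blast
  show "f x = 0"
    unfolding s(2) using continuous_nonneg_integral_zero[of 0 1 "\<lambda>s. f (linepath (fst E) (snd E) s)" s]
      cont[OF f] nn' zero pos s by (simp add: edge_integral_def)
qed

section \<open>Spaces of restrictions of polynomials\<close>

lemma linear_restr: "linear (restr Y :: (real^2 \<Rightarrow> 'b::real_vector) \<Rightarrow> _)"
  by (intro linearI) (auto simp: restr_def fun_eq_iff)

lemma restr_span: "restr Y ` span B = span (restr Y ` B)"
  using span_linear_image[OF linear_restr] by metis

lemma polys_eq: "polys l Y = restr Y ` vpoly l"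
  by (simp add: polys_def vpoly_real)

lemma by_rows_restr: "by_rows (restr Y ` S) = restr Y ` by_rows S"
proof
  show "restr Y ` by_rows S \<subseteq> by_rows (restr Y ` S)"
  proof
    fix f assume "f \<in> restr Y ` by_rows S"
    then obtain g where g: "f = restr Y g" "\<And>i. (\<lambda>x. g x $ i) \<in> S"
      by (auto simp: by_rows_def)
    have "(\<lambda>x. f x $ i) = restr Y (\<lambda>x. g x $ i)" for i
      by (auto simp: g(1) restr_def)
    then show "f \<in> by_rows (restr Y ` S)"
      using g(2) by (auto simp: by_rows_def)
  qed
  show "by_rows (restr Y ` S) \<subseteq> restr Y ` by_rows S"
  proof
    fix f assume "f \<in> by_rows (restr Y ` S)"
    then have "\<forall>i. \<exists>g. g \<in> S \<and> (\<lambda>x. f x $ i) = restr Y g"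
      by (auto simp: by_rows_def)
    then obtain g where g: "\<And>i. g i \<in> S" "\<And>i. (\<lambda>x. f x $ i) = restr Y (g i)"
      by metis
    have "f = restr Y (\<lambda>x. \<chi> i. g i x)"
      using g(2) by (auto simp: fun_eq_iff vec_eq_iff restr_def)
    moreover have "(\<lambda>x. \<chi> i. g i x) \<in> by_rows S"
      using g(1) by (simp add: by_rows_def)
    ultimately show "f \<in> restr Y ` by_rows S" by blast
  qed
qed

lemma by_rows_polys: "by_rows (polys l Y) = restr Y ` vpoly l"
  by (simp add: polys_eq by_rows_restr by_rows_vpoly)

lemma by_rows_by_rows_polys: "by_rows (by_rows (polys l Y)) = restr Y ` vpoly l"
  by (simp add: by_rows_polys by_rows_restr by_rows_vpoly)

lemma restr_vpoly_span: "restr Y ` vpoly l = span (restr Y ` vmonomials l)"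
  by (simp add: vpoly_eq_span restr_span)

lemma (in l2_functional) restr_cfun:
  assumes "continuous_on (closure Y) f"
  shows "restr Y f \<in> cfun"
  unfolding cfun_def
proof (intro CollectI conjI allI impI)
  show "continuous_on (closure Y) (restr Y f)"
    using assms by (rule continuous_on_eq) (simp add: restr_def)
qed (simp add: restr_def)

lemma (in l2_functional) restr_vmonomials: "restr Y ` vmonomials l \<subseteq> cfun"
proof -
  have "f \<in> vpoly l" if "f \<in> vmonomials l" for f :: "real^2 \<Rightarrow> 'c::euclidean_space"
    using that by (auto simp: vpoly_eq_span intro: span_base)
  then show ?thesis
    by (auto intro!: restr_cfun vpoly_continuous)
qed

lemmas (in l2_functional) Riesz_vpoly =
  Riesz[OF finite_imageI[OF finite_vmonomials] restr_vmonomials, folded restr_vpoly_span]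
lemmas (in l2_functional) Riesz_precomp_vpoly =
  Riesz_precomp[OF finite_imageI[OF finite_vmonomials] restr_vmonomials, folded restr_vpoly_span]
lemmas (in l2_functional) Riesz_unique_vpoly =
  Riesz_unique[OF restr_vmonomials, folded restr_vpoly_span]
lemmas (in l2_functional) l2_proj_unique_vpoly =
  l2_proj_unique[OF restr_vmonomials, folded restr_vpoly_span]
lemmas (in l2_functional) l2_proj_exists_vpoly =
  l2_proj_exists[OF finite_imageI[OF finite_vmonomials] restr_vmonomials, folded restr_vpoly_span]

section \<open>Discrete inverse and trace inequalities\<close>

text \<open>Norm equivalence on a fixed interval, so the constant depends on the degree bound only.
  The inner product is definite because a polynomial that vanishes on an interval is zero.\<close>

lemma poly_inverse_inequality:
  "\<exists>C\<ge>0. \<forall>q::real poly. degree q \<le> N \<longrightarrow>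
    (\<forall>s\<in>{0..1}. (poly (pderiv q) s)\<^sup>2 \<le> C * integral {0..1} (\<lambda>s. (poly q s)\<^sup>2))"
proof -
  define V where "V = range (poly :: real poly \<Rightarrow> real \<Rightarrow> real)"
  define S :: "(real \<Rightarrow> real) set" where "S = (\<lambda>i s. s ^ i) ` {..N}"
  have "finite S" by (simp add: S_def)
  have "S \<subseteq> V"
  proof -
    have "(\<lambda>s::real. s ^ i) = poly (monom 1 i)" for i :: nat
      by (auto simp: fun_eq_iff poly_monom)
    then show ?thesis unfolding S_def V_def by auto
  qed
  have cont: "continuous_on A f" if "f \<in> V" for f A
    using that by (auto simp: V_def intro!: continuous_intros)
  interpret inner_product_on V "\<lambda>u w. integral {0..1} (\<lambda>s. u s * w s)"
  proof
    show "subspace V"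
    proof (rule subspaceI)
      have "0 = poly (0::real poly)" by auto
      then show "0 \<in> V" unfolding V_def by blast
      have "poly p + poly q = poly (p + q)" for p q :: "real poly" by auto
      then show "x + y \<in> V" if "x \<in> V" "y \<in> V" for x y using that unfolding V_def by auto
      have "c *\<^sub>R poly p = poly (smult c p)" for p :: "real poly" and c by auto
      then show "c *\<^sub>R x \<in> V" if "x \<in> V" for x c using that unfolding V_def by auto
    qed
    fix x y z :: "real \<Rightarrow> real" and r :: real
    assume x: "x \<in> V"
    show "0 \<le> integral {0..1} (\<lambda>s. x s * x s)"
      by (intro integral_nonneg integrable_continuous_interval continuous_intros cont x) auto
    show "integral {0..1} (\<lambda>s. (r *\<^sub>R x) s * z s) = r * integral {0..1} (\<lambda>s. x s * z s)"
      by (simp add: mult.assoc)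
    show "integral {0..1} (\<lambda>s. x s * z s) = integral {0..1} (\<lambda>s. z s * x s)"
      by (simp add: mult.commute)
    show "x = 0" if "integral {0..1} (\<lambda>s. x s * x s) = 0"
    proof -
      obtain q where q: "x = poly q" using x by (auto simp: V_def)
      have c: "continuous_on {0..1} (\<lambda>s. poly q s * poly q s)"
        by (intro continuous_intros)
      have "poly q s = 0" if "s \<in> {0..1}" for s
        using c continuous_nonneg_integral_zero[of 0 1 "\<lambda>s. x s * x s" s] that q
          \<open>integral {0..1} (\<lambda>s. x s * x s) = 0\<close>
        by auto
      then have "{0..1} \<subseteq> {s. poly q s = 0}" by blast
      then have "infinite {s. poly q s = 0}"
        using infinite_Icc[of 0 "1::real"] finite_subset zero_less_one by blast
      then have "q = 0" using poly_roots_finite by blast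
      then show ?thesis using q by (simp add: fun_eq_iff)
    qed
    assume "y \<in> V" "z \<in> V"
    then show "integral {0..1} (\<lambda>s. (x + y) s * z s) = integral {0..1} (\<lambda>s. x s * z s) + integral {0..1} (\<lambda>s. y s * z s)"
      using x unfolding plus_fun_apply distrib_right
      by (intro integral_add integrable_continuous_interval continuous_intros cont)
  qed
  have dS: "(f has_real_derivative deriv f s) (at s)" if "f \<in> S" for f s
    using that unfolding S_def by (auto intro!: derivative_eq_intros simp: DERIV_imp_deriv[OF DERIV_power[OF DERIV_ident]])
  have "\<exists>C\<ge>0. \<forall>p\<in>span S. \<forall>s\<in>{0..1}. (deriv p s)\<^sup>2 \<le> C * integral {0..1} (\<lambda>s. p s * p s)"
  proof (rule evaluation_bound[OF \<open>finite S\<close> \<open>S \<subseteq> V\<close>])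
    show "deriv (\<Sum>f\<in>S. c f *\<^sub>R f) s = (\<Sum>f\<in>S. c f * deriv f s)" for s and c :: "_ \<Rightarrow> real"
    proof (rule DERIV_imp_deriv)
      have "((\<lambda>s. \<Sum>f\<in>S. c f * f s) has_real_derivative (\<Sum>f\<in>S. c f * deriv f s)) (at s)"
        by (intro DERIV_sum DERIV_cmult dS)
      then show "((\<Sum>f\<in>S. c f *\<^sub>R f) has_real_derivative (\<Sum>f\<in>S. c f * deriv f s)) (at s)"
        by (simp add: sum_fun_apply[abs_def])
    qed
    show "\<exists>M. \<forall>s\<in>{0..1}. \<bar>deriv f s\<bar> \<le> M" if f: "f \<in> S" for f
    proof -
      obtain i where i: "f = (\<lambda>s. s ^ i)" using f by (auto simp: S_def)
      have "deriv f s = real i * s ^ (i - 1)" for s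
        unfolding i by (rule DERIV_imp_deriv) (auto intro!: derivative_eq_intros)
      then show ?thesis
        by (intro exI[of _ "real i"]) (auto simp: abs_mult power_le_one intro!: mult_left_le)
    qed
  qed
  then obtain C where C: "C \<ge> 0" "\<And>p s. p \<in> span S \<Longrightarrow> s \<in> {0..1} \<Longrightarrow> (deriv p s)\<^sup>2 \<le> C * integral {0..1} (\<lambda>s. p s * p s)"
    by blast
  have "poly q \<in> span S" if "degree q \<le> N" for q
  proof -
    have "poly q = (\<Sum>i\<le>degree q. coeff q i *\<^sub>R (\<lambda>s. s ^ i))"
      by (auto simp: fun_eq_iff poly_altdef sum_fun_apply)
    also have "\<dots> \<in> span S"
      using that by (intro span_sum span_scale span_base) (auto simp: S_def)
    finally show ?thesis .
  qed
  moreover have "deriv (poly q) s = poly (pderiv q) s" for q :: "real poly" and s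
    by (rule DERIV_imp_deriv[OF poly_DERIV])
  ultimately show ?thesis
    using C by (metis (no_types, lifting) power2_eq_square integral_cong)
qed

lemma dir_deriv_scale:
  assumes "f \<in> vpoly l"
  shows "dir_deriv (r *\<^sub>R t) f x = r *\<^sub>R dir_deriv t f x"
  using linear_scale[OF has_derivative_linear[OF vpoly_has_derivative[OF assms]]] by simp

lemma edge_length_tangent: "fst E \<noteq> snd E \<Longrightarrow> snd E - fst E = edge_length E *\<^sub>R tangent E"
  by (simp add: tangent_def edge_length_def)

text \<open>The affine parameter on the unit interval reduces every edge to the univariate bound.
  The derivative in this parameter is \<open>edge_length E\<close> times the tangential one, which
  gives the power -2.\<close>

lemma edge_inverse_inequality:
  "\<exists>C\<ge>0. \<forall>v::real^2 \<Rightarrow> real^2. v \<in> vpoly l \<longrightarrow> (\<forall>E. fst E \<noteq> snd E \<longrightarrow>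
    edge_integral E (\<lambda>x. (norm (dir_deriv (tangent E) v x))\<^sup>2)
      \<le> C / (edge_length E)\<^sup>2 * edge_integral E (\<lambda>x. (norm (v x))\<^sup>2))"
proof -
  obtain C where C: "C \<ge> 0" "\<And>q::real poly. \<And>s. degree q \<le> nat l \<Longrightarrow> s \<in> {0..1} \<Longrightarrow>
      (poly (pderiv q) s)\<^sup>2 \<le> C * integral {0..1} (\<lambda>s. (poly q s)\<^sup>2)"
    using poly_inverse_inequality[of "nat l"] by blast
  have "edge_integral E (\<lambda>x. (norm (dir_deriv (tangent E) v x))\<^sup>2)
      \<le> C / (edge_length E)\<^sup>2 * edge_integral E (\<lambda>x. (norm (v x))\<^sup>2)"
    if v: "v \<in> vpoly l" and E: "fst E \<noteq> snd E" for v :: "real^2 \<Rightarrow> real^2" and E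
  proof -
    note pos = edge_length_pos[OF E]
    let ?L = "linepath (fst E) (snd E)"
    let ?d = "snd E - fst E"
    have norm2: "(norm x)\<^sup>2 = (\<Sum>i\<in>UNIV. (x $ i)\<^sup>2)" for x :: "real^2"
      unfolding power2_norm_eq_inner by (simp add: inner_vec_def power2_eq_square)
    have cv: "continuous_on {0..1} (\<lambda>s. v (?L s))"
      by (intro continuous_on_compose2[OF vpoly_continuous[OF v, of UNIV]] continuous_intros) auto
    have cd: "continuous_on {0..1} (\<lambda>s. dir_deriv t v (?L s))" for t
      by (intro continuous_on_compose2[OF vpoly_continuous[OF vpoly_dir_deriv[OF v], of UNIV]] continuous_intros) auto
    have comp: "(dir_deriv ?d v (?L s) $ i)\<^sup>2 \<le> C * integral {0..1} (\<lambda>s. (v (?L s) $ i)\<^sup>2)" if s: "s \<in> {0..1}" for s i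
    proof -
      have vi: "(\<lambda>x. v x $ i) \<in> vpoly l"
        by (rule vpoly_component[OF v])
      obtain q where q: "degree q \<le> nat l" "\<And>s. v (fst E + s *\<^sub>R ?d) $ i = poly q s"
        using bipoly_line[of "\<lambda>x. v x $ i" l "fst E" ?d] vi unfolding vpoly_real by blast
      have L: "?L s = fst E + s *\<^sub>R ?d" for s
        by (simp add: linepath_def algebra_simps)
      have "((\<lambda>s. v (?L s) $ i) has_vector_derivative dir_deriv ?d v (?L s) $ i) (at s)"
        using vpoly_linepath_derivative[OF vi, of "fst E" "snd E" s UNIV] by (simp add: dir_deriv_component[OF v])
      then have "(poly q has_real_derivative dir_deriv ?d v (?L s) $ i) (at s)"
        unfolding L q(2) by (simp add: has_real_derivative_iff_has_vector_derivative)
      then have "dir_deriv ?d v (?L s) $ i = poly (pderiv q) s"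
        using poly_DERIV DERIV_unique by blast
      then show ?thesis
        using C(2)[OF q(1) s] unfolding L q(2) by simp
    qed
    have "(norm (dir_deriv ?d v (?L s)))\<^sup>2 \<le> C * integral {0..1} (\<lambda>s. (norm (v (?L s)))\<^sup>2)" if s: "s \<in> {0..1}" for s
    proof -
      have "(norm (dir_deriv ?d v (?L s)))\<^sup>2 \<le> (\<Sum>i\<in>UNIV. C * integral {0..1} (\<lambda>s. (v (?L s) $ i)\<^sup>2))"
        unfolding norm2 by (rule sum_mono) (rule comp[OF s])
      also have "\<dots> = C * integral {0..1} (\<lambda>s. (norm (v (?L s)))\<^sup>2)"
        unfolding norm2 sum_distrib_left[symmetric]
        by (subst integral_sum) (auto intro!: integrable_continuous_interval continuous_intros cv)
      finally show ?thesis .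
    qed
    \<comment> \<open>The pointwise bound does not depend on s, so integrating it over the unit
      interval costs nothing.\<close>
    then have "integral {0..1} (\<lambda>s. (norm (dir_deriv ?d v (?L s)))\<^sup>2)
        \<le> integral {0..1::real} (\<lambda>_. C * integral {0..1} (\<lambda>s. (norm (v (?L s)))\<^sup>2))"
      by (intro integral_le integrable_continuous_interval continuous_intros cd) auto
    also have "(\<lambda>s. (norm (dir_deriv ?d v (?L s)))\<^sup>2)
        = (\<lambda>s. (edge_length E)\<^sup>2 * (norm (dir_deriv (tangent E) v (?L s)))\<^sup>2)"
      unfolding edge_length_tangent[OF E] dir_deriv_scale[OF v] by (simp add: power_mult_distrib)
    finally show ?thesis
      using pos by (simp add: edge_integral_def field_simps)
  qed
  then show ?thesis using C(1) by blast
qed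

text \<open>A polynomial is controlled on the disk of radius h by a small square inside the disk of
  radius \<open>\<rho> * h\<close>: norm equivalence on reference sets of unit size, then the
  scaling \<open>x = h y + z\<close>. The large disk is the one that will contain the
  element.\<close>

lemma element_sup_bound_scalar:
  fixes \<rho> :: real
  assumes \<rho>: "\<rho> > 0"
  shows "\<exists>C\<ge>0. \<forall>v\<in>bipoly l. \<forall>z h T. 0 < h \<longrightarrow> open T \<longrightarrow> bounded T \<longrightarrow> ball z (\<rho> * h) \<subseteq> T \<longrightarrow>
    (\<forall>x\<in>cball z h. (v x)\<^sup>2 \<le> C / h\<^sup>2 * integral T (\<lambda>x. (v x)\<^sup>2))"
proof -
  \<comment> \<open>Half side \<open>\<rho> / 3\<close>: the points of the square have norm at most
    \<open>2 * \<rho> / 3\<close> and lie in the open disk of radius \<rho>.\<close>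
  define u :: "real^2" where "u = vec (\<rho> / 3)"
  let ?Q = "cbox (-u) u"
  have box0: "0 \<in> box (-u) u"
    using \<rho> by (simp add: mem_box_cart u_def)
  interpret inner_product_on "bipoly l" "\<lambda>p q. integral ?Q (\<lambda>x. p x * q x)"
  proof
    fix x y z :: "real^2 \<Rightarrow> real" and r :: real
    assume x: "x \<in> bipoly l"
    note cont = bipoly_continuous
    show "0 \<le> integral ?Q (\<lambda>s. x s * x s)"
      by (intro integral_nonneg integrable_continuous continuous_intros cont[OF x]) auto
    show "integral ?Q (\<lambda>s. (r *\<^sub>R x) s * z s) = r * integral ?Q (\<lambda>s. x s * z s)"
      by (simp add: mult.assoc)
    show "integral ?Q (\<lambda>s. x s * z s) = integral ?Q (\<lambda>s. z s * x s)"
      by (simp add: mult.commute)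
    show "x = 0" if zero: "integral ?Q (\<lambda>s. x s * x s) = 0"
    proof -
      have "x s * x s = 0" if "s \<in> box (-u) u" for s
        by (rule continuous_nonneg_integral_zero[OF _ _ zero])
          (use that box0 box_subset_cbox[of "-u" u] in \<open>auto intro!: continuous_intros cont[OF x]\<close>)
      then show ?thesis
        using bipoly_identity[OF x open_box box0] by auto
    qed
    assume "y \<in> bipoly l" "z \<in> bipoly l"
    then show "integral ?Q (\<lambda>s. (x + y) s * z s) = integral ?Q (\<lambda>s. x s * z s) + integral ?Q (\<lambda>s. y s * z s)"
      using x cont unfolding plus_fun_apply distrib_right
      by (intro integral_add integrable_continuous continuous_intros) blast+
  qed (rule subspace_bipoly)
  have mono_bipoly: "f \<in> bipoly l" if "f \<in> monomials2 l" for f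
    using that by (auto simp: bipoly_eq_span intro: span_base)
  have "\<exists>C\<ge>0. \<forall>p\<in>span (monomials2 l). \<forall>x\<in>cball 0 1. (p x)\<^sup>2 \<le> C * integral ?Q (\<lambda>s. p s * p s)"
  proof (rule evaluation_bound[OF finite_monomials2])
    show "monomials2 l \<subseteq> bipoly l" using mono_bipoly by blast
    show "(\<Sum>f\<in>monomials2 l. c f *\<^sub>R f) x = (\<Sum>f\<in>monomials2 l. c f * f x)" for x and c :: "_ \<Rightarrow> real"
      by (simp add: sum_fun_apply)
    show "\<exists>M. \<forall>x\<in>cball 0 1. \<bar>f x\<bar> \<le> M" if "f \<in> monomials2 l" for f
    proof -
      have "compact (f ` cball 0 1)"
        by (intro compact_continuous_image bipoly_continuous[OF mono_bipoly[OF that]] compact_cball)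
      then show ?thesis
        using bounded_real compact_imp_bounded by (metis imageI)
    qed
  qed
  then obtain C where C: "C \<ge> 0" "\<And>p x. p \<in> bipoly l \<Longrightarrow> x \<in> cball 0 1 \<Longrightarrow> (p x)\<^sup>2 \<le> C * integral ?Q (\<lambda>s. p s * p s)"
    unfolding bipoly_eq_span by blast
  have "(v x)\<^sup>2 \<le> C / h\<^sup>2 * integral T (\<lambda>x. (v x)\<^sup>2)"
    if v: "v \<in> bipoly l" and h: "0 < h" and T: "open T" "bounded T" "ball z (\<rho> * h) \<subseteq> T" and x: "x \<in> cball z h" for v z h T x
  proof -
    let ?v2 = "\<lambda>x. (v x)\<^sup>2"
    have cv: "continuous_on A ?v2" for A
      by (intro continuous_intros bipoly_continuous[OF v])
    let ?B = "cbox (z - h *\<^sub>R u) (z + h *\<^sub>R u)"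
    have sub: "?B \<subseteq> T"
    proof
      fix y assume y: "y \<in> ?B"
      have *: "\<bar>(y - z) $ i\<bar> \<le> h * \<rho> / 3" for i
      proof -
        have "(z - h *\<^sub>R u) $ i \<le> y $ i" "y $ i \<le> (z + h *\<^sub>R u) $ i"
          using y unfolding mem_box_cart by blast+
        then have "z $ i - h * \<rho> / 3 \<le> y $ i" "y $ i \<le> z $ i + h * \<rho> / 3"
          by (simp_all add: u_def)
        then show ?thesis unfolding vector_minus_component by linarith
      qed
      have "norm (y - z) \<le> \<bar>(y - z) $ 1\<bar> + \<bar>(y - z) $ 2\<bar>"
        using norm_le_l1_cart[of "y - z"] by (simp add: sum_2)
      also have "\<dots> \<le> h * \<rho> / 3 + h * \<rho> / 3"
        by (intro add_mono *)
      also have "\<dots> < \<rho> * h"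
        using \<rho> h by simp
      finally show "y \<in> T"
        using T(3) by (auto simp: dist_norm norm_minus_commute)
    qed
    have "(?v2 has_integral integral ?B ?v2) ?B"
      using cv by (intro integrable_integral integrable_continuous)
    \<comment> \<open>The scaling has Jacobian \<open>h\<^sup>2\<close>, the source of the
      denominator in the bound.\<close>
    from has_integral_affinity'[OF this h, of z]
    have "((\<lambda>y. ?v2 (h *\<^sub>R y + z)) has_integral (integral ?B ?v2 /\<^sub>R h\<^sup>2)) ?Q"
      using h by (simp add: algebra_simps power2_eq_square)
    then have "integral ?Q (\<lambda>y. ?v2 (h *\<^sub>R y + z)) = integral ?B ?v2 / h\<^sup>2"
      by (simp add: integral_unique divide_inverse mult.commute)
    moreover have "integral ?B ?v2 \<le> integral T ?v2"
      by (rule integral_subset_le[OF sub integrable_continuous[OF cv] integrable_on_bounded_open(2)[OF T(1,2) cv]]) simp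
    moreover have "(v (h *\<^sub>R ((x - z) /\<^sub>R h) + z))\<^sup>2 \<le> C * integral ?Q (\<lambda>y. ?v2 (h *\<^sub>R y + z))"
    proof -
      have "(x - z) /\<^sub>R h \<in> cball 0 1"
        unfolding mem_cball dist_0_norm norm_scaleR
        using x h by (simp add: dist_norm norm_minus_commute field_simps)
      then show ?thesis
        using C(2)[OF bipoly_affine[OF v, of h z]] by (simp only: power2_eq_square)
    qed
    moreover have "h *\<^sub>R ((x - z) /\<^sub>R h) + z = x"
      using h by simp
    ultimately have "(v x)\<^sup>2 \<le> C * (integral ?B ?v2 / h\<^sup>2)" "integral ?B ?v2 \<le> integral T ?v2"
      by simp_all
    moreover have "C * (integral ?B ?v2 / h\<^sup>2) \<le> C * (integral T ?v2 / h\<^sup>2)"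
      using calculation(2) C(1) by (intro mult_left_mono divide_right_mono) auto
    ultimately show ?thesis by simp
  qed
  then show ?thesis using C(1) by blast
qed

lemma norm_sq_Basis: "(norm x)\<^sup>2 = (\<Sum>b\<in>Basis. (x \<bullet> b)\<^sup>2)" for x :: "'a::euclidean_space"
  unfolding power2_norm_eq_inner by (subst euclidean_inner) (simp add: power2_eq_square)

text \<open>Both sides are sums over an orthonormal basis, so the scalar constant survives.\<close>

lemma element_sup_bound:
  fixes \<rho> :: real
  assumes \<rho>: "\<rho> > 0"
  shows "\<exists>C\<ge>0. \<forall>v :: real^2 \<Rightarrow> 'b::euclidean_space. v \<in> vpoly l \<longrightarrow>
    (\<forall>z h T. 0 < h \<longrightarrow> open T \<longrightarrow> bounded T \<longrightarrow> ball z (\<rho> * h) \<subseteq> T \<longrightarrow>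
    (\<forall>x\<in>cball z h. (norm (v x))\<^sup>2 \<le> C / h\<^sup>2 * integral T (\<lambda>x. (norm (v x))\<^sup>2)))"
proof -
  obtain C where C: "C \<ge> 0" "\<And>v z h T x. v \<in> bipoly l \<Longrightarrow> 0 < h \<Longrightarrow> open T \<Longrightarrow> bounded T \<Longrightarrow>
      ball z (\<rho> * h) \<subseteq> T \<Longrightarrow> x \<in> cball z h \<Longrightarrow> (v x)\<^sup>2 \<le> C / h\<^sup>2 * integral T (\<lambda>x. (v x)\<^sup>2)"
    using element_sup_bound_scalar[OF \<rho>, of l] by metis
  have "(norm (v x))\<^sup>2 \<le> C / h\<^sup>2 * integral T (\<lambda>x. (norm (v x))\<^sup>2)"
    if v: "v \<in> vpoly l" and h: "0 < h" and T: "open T" "bounded T" "ball z (\<rho> * h) \<subseteq> T" and x: "x \<in> cball z h"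
    for v :: "real^2 \<Rightarrow> 'b" and z h T x
  proof -
    have vb: "(\<lambda>x. v x \<bullet> b) \<in> bipoly l" for b
      by (rule vpoly_inner[OF v])
    have "(norm (v x))\<^sup>2 \<le> (\<Sum>b\<in>Basis. C / h\<^sup>2 * integral T (\<lambda>x. (v x \<bullet> b)\<^sup>2))"
      unfolding norm_sq_Basis by (rule sum_mono) (rule C(2)[OF vb h T x])
    also have "\<dots> = C / h\<^sup>2 * integral T (\<lambda>x. (norm (v x))\<^sup>2)"
      unfolding norm_sq_Basis sum_distrib_left[symmetric]
      by (subst integral_sum)
        (auto intro!: integrable_on_bounded_open(2) T continuous_intros vpoly_continuous[OF v])
    finally show ?thesis .
  qed
  then show ?thesis using C(1) by blast
qed

section \<open>Star-shaped polygons\<close>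

definition cross2 :: "real^2 \<Rightarrow> real^2 \<Rightarrow> real" where
  "cross2 u v = u $ 1 * v $ 2 - u $ 2 * v $ 1"

lemma cross2_simps:
  "cross2 (u + u') v = cross2 u v + cross2 u' v" "cross2 u (v + v') = cross2 u v + cross2 u v'"
  "cross2 (u - u') v = cross2 u v - cross2 u' v" "cross2 u (v - v') = cross2 u v - cross2 u v'"
  "cross2 (c *\<^sub>R u) v = c * cross2 u v" "cross2 u (c *\<^sub>R v) = c * cross2 u v" "cross2 u u = 0"
  by (auto simp: cross2_def algebra_simps)

lemma cross2_commute: "cross2 v u = - cross2 u v"
  by (simp add: cross2_def)

lemma cross2_zeroD:
  assumes "cross2 u v = 0" "u \<noteq> 0"
  obtains c where "v = c *\<^sub>R u"
proof
  have pos: "u $ 1 * u $ 1 + u $ 2 * u $ 2 \<noteq> 0"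
    using assms(2) by (auto simp: vec_eq_iff forall_2 add_nonneg_eq_0_iff)
  show "v = ((u \<bullet> v) / (u \<bullet> u)) *\<^sub>R u"
    using pos assms(1) by (simp add: vec_eq_iff forall_2 inner_vec_def sum_2 cross2_def field_simps)
qed

lemma normal_inner:
  assumes "fst E \<noteq> snd E"
  shows "cross2 w (snd E - fst E) = - edge_length E * (w \<bullet> normal E)"
  using edge_length_pos[OF assms]
  by (simp add: cross2_def normal_def tangent_def inner_vec_def sum_2 field_simps)

lemma norm_tangent: "fst E \<noteq> snd E \<Longrightarrow> norm (tangent E) = 1"
  by (simp add: tangent_def edge_length_def dist_norm norm_minus_commute)

lemma normal_normal: "fst E \<noteq> snd E \<Longrightarrow> normal E \<bullet> normal E = 1"
  using norm_tangent[of E] by (simp add: normal_def inner_vec_def sum_2 norm_eq_1)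

text \<open>Near u both segments run on the same side of the line through 0 and u, so a ray from 0
  close to u meets both. In coordinates,
  \<open>w1 - u = k *\<^sub>R u + \<rho> *\<^sub>R (w2 - u)\<close> with \<rho> positive.\<close>

lemma crossing_segments:
  assumes pos: "cross2 u w1 * cross2 u w2 > 0"
  obtains s t c where "0 < s" "s < 1" "0 < t" "t < 1" "0 < c"
    "u + s *\<^sub>R (w2 - u) = c *\<^sub>R (u + t *\<^sub>R (w1 - u))"
proof -
  define \<rho> where "\<rho> = cross2 u w1 / cross2 u w2"
  have \<rho>: "\<rho> > 0" and d2: "cross2 u w2 \<noteq> 0"
    using pos by (auto simp: \<rho>_def zero_less_mult_iff zero_less_divide_iff)
  have "u \<noteq> 0" using d2 by (auto simp: cross2_def)
  have "cross2 u ((w1 - u) - \<rho> *\<^sub>R (w2 - u)) = 0"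
    using d2 by (simp add: cross2_simps \<rho>_def)
  then obtain k where k: "(w1 - u) - \<rho> *\<^sub>R (w2 - u) = k *\<^sub>R u"
    using cross2_zeroD \<open>u \<noteq> 0\<close> by blast
  \<comment> \<open>Small enough, for either sign of k, that \<open>1 + t * k\<close> is at least
    1/2 and the parameter on the second segment stays below 1.\<close>
  define t where "t = 1 / (2 * (1 + \<bar>k\<bar> + \<rho>))"
  have t: "0 < t" "t < 1" "t * \<bar>k\<bar> \<le> 1 / 2" "2 * (t * \<rho>) < 1"
    using \<rho> by (auto simp: t_def field_simps)
  have tk: "1 + t * k \<ge> 1 / 2"
  proof -
    have "t * (- k) \<le> t * \<bar>k\<bar>"
      using t(1) by (intro mult_left_mono) auto
    then show ?thesis using t(3) by simp
  qed
  show thesis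
  proof (rule that[of "t * \<rho> / (1 + t * k)" t "1 / (1 + t * k)"])
    show "0 < t * \<rho> / (1 + t * k)" "t * \<rho> / (1 + t * k) < 1" "0 < 1 / (1 + t * k)"
      using tk t \<rho> by (auto simp: field_simps)
    have "w1 - u = k *\<^sub>R u + \<rho> *\<^sub>R (w2 - u)"
      using k by (metis diff_add_cancel)
    then have "u + t *\<^sub>R (w1 - u) = u + t *\<^sub>R (k *\<^sub>R u + \<rho> *\<^sub>R (w2 - u))"
      by (simp only:)
    also have "\<dots> = (1 + t * k) *\<^sub>R u + (t * \<rho>) *\<^sub>R (w2 - u)"
      by (simp add: algebra_simps)
    finally show "u + (t * \<rho> / (1 + t * k)) *\<^sub>R (w2 - u) = (1 / (1 + t * k)) *\<^sub>R (u + t *\<^sub>R (w1 - u))"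
      using tk by (simp add: scaleR_add_right)
  qed (use t in auto)
qed

text \<open>\<open>ES\<close> is just a finite disjoint family of segments whose closures make up
  the frontier. How they meet is derived from the star shape: seen from z, each direction meets the
  frontier once.\<close>

locale star_polygon =
  fixes T :: "(real^2) set" and z :: "real^2" and r :: real and ES :: "edge set"
  assumes open_T: "open T" and bounded_T: "bounded T" and nonempty_T: "T \<noteq> {}" and r_pos: "0 < r"
    and star: "\<And>y x. y \<in> ball z r \<Longrightarrow> x \<in> T \<Longrightarrow> closed_segment y x \<subseteq> T"
    and finite_ES: "finite ES"
    and ends: "\<And>E. E \<in> ES \<Longrightarrow> fst E \<noteq> snd E"
    and disjoint: "pairwise (\<lambda>E E'. disjnt (seg E) (seg E')) ES"
    and frontier_T: "frontier T = (\<Union>E\<in>ES. closure (seg E))"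
begin

section \<open>The boundary as seen from the centre of the ball\<close>

lemma ball_subset: "ball z r \<subseteq> T"
  using nonempty_T star by blast

lemma frontier_disj: "p \<in> frontier T \<Longrightarrow> p \<notin> T" "p \<in> frontier T \<Longrightarrow> p \<in> closure T"
  by (simp_all add: frontier_def interior_open[OF open_T])

lemma seg_frontier:
  assumes "E \<in> ES"
  shows "closed_segment (fst E) (snd E) \<subseteq> frontier T" and "seg E \<subseteq> frontier T"
proof -
  have "closure (seg E) \<subseteq> frontier T"
    unfolding frontier_T using assms by blast
  then show "closed_segment (fst E) (snd E) \<subseteq> frontier T" "seg E \<subseteq> frontier T"
    using closure_seg[OF ends[OF assms]] closure_subset[of "seg E"] by auto
qed

text \<open>Approximate p by some x in T and shift y to compensate, keeping the combination the
  same; the ball leaves room for the shift.\<close>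

lemma star_closure:
  assumes y: "y \<in> ball z r" and p: "p \<in> closure T" and s: "0 \<le> s" "s < 1"
  shows "y + s *\<^sub>R (p - y) \<in> T"
proof -
  \<comment> \<open>Makes the shift \<open>s / (1 - s) * dist x p\<close> smaller than the distance
    from y to the boundary of the ball.\<close>
  define e where "e = (r - dist z y) * (1 - s)"
  have e: "e > 0" using y s by (simp add: e_def)
  obtain x where x: "x \<in> T" "dist x p < e"
    using p e closure_approachable by blast
  define y' where "y' = y + (s / (1 - s)) *\<^sub>R (p - x)"
  have "dist y y' = s / (1 - s) * dist x p"
    using s by (simp add: y'_def dist_norm norm_minus_commute)
  also have "\<dots> \<le> 1 / (1 - s) * dist x p"
    using s by (intro mult_right_mono divide_right_mono) auto
  also have "\<dots> < r - dist z y"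
    using x(2) s by (simp add: e_def field_simps)
  finally have "y' \<in> ball z r"
    using dist_triangle[of z y' y] by simp
  then have "closed_segment y' x \<subseteq> T"
    using star x by blast
  moreover have "y + s *\<^sub>R (p - y) = (1 - s) *\<^sub>R y' + s *\<^sub>R x"
  proof -
    have "(1 - s) *\<^sub>R y' = (1 - s) *\<^sub>R y + s *\<^sub>R (p - x)"
      using s by (simp add: y'_def scaleR_add_right)
    then show ?thesis by (simp add: algebra_simps)
  qed
  moreover have "(1 - s) *\<^sub>R y' + s *\<^sub>R x \<in> closed_segment y' x"
    unfolding closed_segment_def using s by (intro CollectI exI[of _ s]) simp
  ultimately show ?thesis by auto
qed

text \<open>All points before a frontier point on its ray lie in T, so neither of two frontier
  points can precede the other.\<close>

lemma frontier_ray_unique: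
  assumes y: "y \<in> ball z r" and p: "p \<in> frontier T" "p' \<in> frontier T" and c: "p' - y = c *\<^sub>R (p - y)" "c > 0"
  shows "p' = p"
proof -
  have "\<not> c < 1"
  proof
    assume "c < 1"
    then have "y + c *\<^sub>R (p - y) \<in> T"
      using star_closure[OF y frontier_disj(2)[OF p(1)]] c by simp
    then show False using frontier_disj(1)[OF p(2)] c(1) by (metis add.commute diff_add_cancel)
  qed
  moreover have "\<not> c > 1"
  proof
    assume "c > 1"
    then have "y + (1 / c) *\<^sub>R (p' - y) \<in> T"
      using star_closure[OF y frontier_disj(2)[OF p(2)], of "1 / c"] by simp
    then show False using frontier_disj(1)[OF p(1)] c by simp
  qed
  ultimately have "c = 1" by simp
  then show ?thesis using c by simp
qed

text \<open>Otherwise both ends lie on one ray from y, against \<open>frontier_ray_unique\<close>,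
  or y lies on the edge and hence on the frontier.\<close>

lemma not_collinear:
  assumes y: "y \<in> ball z r" and E: "E \<in> ES"
  shows "cross2 (fst E - y) (snd E - y) \<noteq> 0"
proof
  assume zero: "cross2 (fst E - y) (snd E - y) = 0"
  have yT: "y \<in> T" using ball_subset y by blast
  have fr: "fst E \<in> frontier T" "snd E \<in> frontier T"
    using seg_frontier(1)[OF E] by auto
  have "fst E - y \<noteq> 0"
    using yT fr frontier_disj by auto
  then obtain c where c: "snd E - y = c *\<^sub>R (fst E - y)"
    using zero cross2_zeroD by blast
  show False
  proof (cases "c > 0")
    case True
    then show ?thesis using frontier_ray_unique[OF y fr c] ends[OF E] by simp
  next
    case False
    have "y = (1 - 1 / (1 - c)) *\<^sub>R fst E + (1 / (1 - c)) *\<^sub>R snd E"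
    proof -
      have "(1 - c) *\<^sub>R ((1 - 1 / (1 - c)) *\<^sub>R fst E + (1 / (1 - c)) *\<^sub>R snd E) = - c *\<^sub>R fst E + snd E"
        using False by (simp add: scaleR_add_right right_diff_distrib)
      also have "\<dots> = (1 - c) *\<^sub>R y"
        using c by (simp add: algebra_simps)
      finally show ?thesis
        using False by simp
    qed
    moreover have "0 \<le> 1 / (1 - c)" "1 / (1 - c) \<le> 1"
      using False by auto
    ultimately have "y \<in> closed_segment (fst E) (snd E)"
      unfolding closed_segment_def by blast
    then show ?thesis
      using seg_frontier(1)[OF E] yT frontier_disj by blast
  qed
qed

lemma z_ball: "z \<in> ball z r"
  using r_pos by simp

lemmas not_collinear_z = not_collinear[OF z_ball]

text \<open>Some ray from z meets both pieces, so they share a frontier point and disjointness of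
  the edges applies. The pieces are only included in the edges, so that V may also be an inner point
  of an edge.\<close>

lemma edge_unique:
  assumes E: "E1 \<in> ES" "E2 \<in> ES" and sub: "open_segment V W1 \<subseteq> seg E1" "open_segment V W2 \<subseteq> seg E2"
    and pos: "cross2 (V - z) (W1 - z) * cross2 (V - z) (W2 - z) > 0"
  shows "E1 = E2"
proof -
  obtain s t c where st: "0 < s" "s < 1" "0 < t" "t < 1" "0 < c"
    "(V - z) + s *\<^sub>R ((W2 - z) - (V - z)) = c *\<^sub>R ((V - z) + t *\<^sub>R ((W1 - z) - (V - z)))"
    using crossing_segments[OF pos] by blast
  have "W1 \<noteq> V" "W2 \<noteq> V"
    using pos cross2_simps(7) by auto
  have in_seg: "V + s *\<^sub>R (W - V) \<in> open_segment V W" if "0 < s" "s < 1" "W \<noteq> V" for s W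
    using that by (auto simp: in_segment algebra_simps intro!: exI[of _ s])
  have p1: "V + t *\<^sub>R (W1 - V) \<in> seg E1" and p2: "V + s *\<^sub>R (W2 - V) \<in> seg E2"
    using sub in_seg st \<open>W1 \<noteq> V\<close> \<open>W2 \<noteq> V\<close> by blast+
  have "(V + s *\<^sub>R (W2 - V)) - z = c *\<^sub>R ((V + t *\<^sub>R (W1 - V)) - z)"
    using st(6) by (simp add: algebra_simps)
  then have "V + s *\<^sub>R (W2 - V) = V + t *\<^sub>R (W1 - V)"
    using frontier_ray_unique[OF z_ball] p1 p2 seg_frontier(2) E st(5) by blast
  then have "\<not> disjnt (seg E1) (seg E2)"
    using p1 p2 by (auto simp: disjnt_def)
  then show ?thesis
    using disjoint E by (auto simp: pairwise_def)
qed

text \<open>Otherwise \<open>E\<close> leaves V to both sides of the line through z and V, and on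
  one of them it competes with \<open>E0\<close>.\<close>

lemma vertex_not_in_seg:
  assumes E: "E0 \<in> ES" "E \<in> ES" and V: "V = fst E0 \<or> V = snd E0"
  shows "V \<notin> seg E"
proof
  assume VE: "V \<in> seg E"
  obtain W0 where W0: "{V, W0} = {fst E0, snd E0}" "open_segment V W0 = seg E0"
    using V by (auto simp: seg_def open_segment_commute)
  have "cross2 (V - z) (W0 - z) \<noteq> 0"
    using not_collinear_z[OF E(1)] W0(1) by (auto simp: doubleton_eq_iff cross2_commute[of "fst E0 - z"])
  obtain t where t: "0 < t" "t < 1" "V = (1 - t) *\<^sub>R fst E + t *\<^sub>R snd E"
    using VE by (auto simp: seg_def in_segment)
  let ?c = "cross2 (fst E - z) (snd E - z)"
  have Vz: "V - z = (1 - t) *\<^sub>R (fst E - z) + t *\<^sub>R (snd E - z)"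
    by (simp add: t algebra_simps)
  have c1: "cross2 (V - z) (fst E - z) = - t * ?c" and c2: "cross2 (V - z) (snd E - z) = (1 - t) * ?c"
    unfolding Vz cross2_simps(1,5,7) by (simp_all add: cross2_commute[of "snd E - z" "fst E - z"])
  have "?c \<noteq> 0" by (rule not_collinear_z[OF E(2)])
  then have "cross2 (V - z) (fst E - z) * cross2 (V - z) (W0 - z) > 0 \<or>
      cross2 (V - z) (snd E - z) * cross2 (V - z) (W0 - z) > 0"
    unfolding c1 c2 using t(1,2) \<open>cross2 (V - z) (W0 - z) \<noteq> 0\<close>
    by (auto simp: zero_less_mult_iff mult_less_0_iff neq_iff)
  moreover have "open_segment V (fst E) \<subseteq> seg E" "open_segment V (snd E) \<subseteq> seg E"
    using open_closed_segment[OF VE[unfolded seg_def]] unfolding seg_def by (simp_all add: subset_open_segment)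
  ultimately have "E = E0"
    using edge_unique[OF E(2) E(1)] W0(2) by blast
  then show False
    using VE V by (auto simp: seg_def open_segment_def)
qed

text \<open>Turn the ray through V slightly to the side \<sigma> and let the angle tend to 0. The
  frontier points that are hit have V as a limit, so one of them lies on an edge ending in V, and
  that edge leaves to the chosen side.\<close>

lemma edge_exists:
  assumes E0: "E0 \<in> ES" "V = fst E0 \<or> V = snd E0" and \<sigma>: "\<sigma> = 1 \<or> \<sigma> = -1"
  shows "\<exists>E\<in>ES. \<exists>W. (V = fst E \<and> W = snd E \<or> V = snd E \<and> W = fst E) \<and> \<sigma> * cross2 (V - z) (W - z) > 0"
proof -
  have V: "V \<in> frontier T"
    using seg_frontier(1)[OF E0(1)] E0(2) by auto
  define u where "u = V - z"
  have "u \<noteq> 0"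
    using V ball_subset z_ball frontier_disj unfolding u_def by force
  define e :: "real^2" where "e = \<sigma> *\<^sub>R vector [- u $ 2, u $ 1]"
  have ue: "u \<bullet> e = 0" "\<sigma> * cross2 u e = u \<bullet> u"
    using \<sigma> by (auto simp: e_def inner_vec_def sum_2 cross2_def)
  define v where "v n = u + inverse (real (Suc n)) *\<^sub>R e" for n
  have v0: "v n \<noteq> 0" for n
  proof
    assume "v n = 0"
    then have "u \<bullet> v n = 0" by simp
    then show False using ue \<open>u \<noteq> 0\<close> by (simp add: v_def inner_add_right)
  qed
  have "z \<in> interior T"
    using z_ball ball_subset open_T by (auto simp: interior_open)
  then have "\<exists>d>0. z + d *\<^sub>R v n \<in> frontier T" for n
    using ray_to_frontier[OF bounded_T _ v0[of n]] by metis
  then obtain d where d: "\<And>n. d n > 0" "\<And>n. z + d n *\<^sub>R v n \<in> frontier T"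
    by metis
  define p where "p n = z + d n *\<^sub>R v n" for n
  have "compact (frontier T)"
    using bounded_T by (rule compact_frontier_bounded)
  then have "seq_compact (frontier T)"
    by (rule compact_imp_seq_compact)
  moreover have "\<forall>n. p n \<in> frontier T"
    using d(2) by (simp add: p_def)
  ultimately obtain l k where l: "l \<in> frontier T" "strict_mono k" "(p \<circ> k) \<longlonglongrightarrow> l"
    by (rule seq_compactE)
  \<comment> \<open>As e is orthogonal to u, the radial factor is a continuous function of the point
    that is hit and converges along with it.\<close>
  have "d n = (u \<bullet> (p n - z)) / (u \<bullet> u)" for n
    using \<open>u \<noteq> 0\<close> ue by (simp add: p_def v_def inner_add_right)
  then have "(\<lambda>n. d (k n)) \<longlonglongrightarrow> (u \<bullet> (l - z)) / (u \<bullet> u)"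
    using l(3) \<open>u \<noteq> 0\<close> unfolding o_def by (simp only:) (intro tendsto_intros; simp)
  then obtain c where c: "(\<lambda>n. d (k n)) \<longlonglongrightarrow> c" by blast
  have "(\<lambda>n. inverse (real (Suc (k n)))) \<longlonglongrightarrow> 0"
    using LIMSEQ_subseq_LIMSEQ[OF LIMSEQ_inverse_real_of_nat l(2)] by (simp add: o_def)
  then have "(\<lambda>n. z + d (k n) *\<^sub>R (u + inverse (real (Suc (k n))) *\<^sub>R e)) \<longlonglongrightarrow> z + c *\<^sub>R (u + 0 *\<^sub>R e)"
    by (intro tendsto_intros c)
  then have "(p \<circ> k) \<longlonglongrightarrow> z + c *\<^sub>R u"
    by (simp add: p_def v_def o_def)
  then have lz: "l = z + c *\<^sub>R u"
    using l(3) LIMSEQ_unique by blast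
  have "c \<ge> 0"
    using d(1) by (intro LIMSEQ_le_const[OF c]) (auto intro: less_imp_le)
  moreover have "c \<noteq> 0"
    using lz frontier_disj(1)[OF l(1)] subsetD[OF ball_subset z_ball] by auto
  ultimately have "l = V"
    using frontier_ray_unique[OF z_ball V l(1), of c] lz by (simp add: u_def)
  \<comment> \<open>Finitely many closed edges miss V, so their union stays away from a
    neighbourhood of V.\<close>
  define K where "K = (\<Union>E\<in>{E \<in> ES. V \<notin> closure (seg E)}. closure (seg E))"
  have "closed K" "V \<notin> K"
    unfolding K_def using finite_ES by auto
  then have "open (- K)" "l \<in> - K"
    using \<open>l = V\<close> by auto
  then have "\<forall>\<^sub>F n in sequentially. (p \<circ> k) n \<in> - K"
    using l(3) topological_tendstoD by blast
  then obtain n where n: "p (k n) \<notin> K"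
    by (auto simp: eventually_sequentially)
  have "p (k n) \<in> frontier T" using d(2) by (simp add: p_def)
  then obtain E where E: "E \<in> ES" "p (k n) \<in> closure (seg E)" "V \<in> closure (seg E)"
    using n frontier_T by (auto simp: K_def)
  note cs = closure_seg[OF ends[OF E(1)]]
  have "V = fst E \<or> V = snd E"
    using vertex_not_in_seg[OF E0(1) E(1) E0(2)] E(3) cs by (auto simp: seg_def open_segment_def)
  then obtain W where W: "V = fst E \<and> W = snd E \<or> V = snd E \<and> W = fst E"
    by blast
  then have "p (k n) \<in> closed_segment V W"
    using E(2) cs by (auto simp: closed_segment_commute)
  then obtain t where t: "0 \<le> t" "p (k n) = (1 - t) *\<^sub>R V + t *\<^sub>R W"
    by (auto simp: closed_segment_def)
  have "\<sigma> * cross2 u (p (k n) - z) = t * (\<sigma> * cross2 u (W - z))"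
  proof -
    have "p (k n) - z = (1 - t) *\<^sub>R u + t *\<^sub>R (W - z)"
      by (simp add: t u_def algebra_simps)
    then show ?thesis by (simp add: cross2_simps)
  qed
  moreover have "\<sigma> * cross2 u (p (k n) - z) = d (k n) * inverse (real (Suc (k n))) * (u \<bullet> u)"
    unfolding ue(2)[symmetric] by (simp add: p_def v_def cross2_simps)
  moreover have "d (k n) * inverse (real (Suc (k n))) * (u \<bullet> u) > 0"
    using d(1) \<open>u \<noteq> 0\<close> by simp
  ultimately have "0 < t * (\<sigma> * cross2 u (W - z))"
    by simp
  then have "\<sigma> * cross2 (V - z) (W - z) > 0"
    using t(1) unfolding zero_less_mult_iff[of t] u_def by linarith
  then show ?thesis
    using W E(1) by blast
qed

text \<open>For \<sigma> = 1 the end at which \<open>E\<close> starts when the boundary is run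
  counterclockwise about z, for \<sigma> = -1 the end at which it stops.\<close>

definition ccw_end :: "real \<Rightarrow> edge \<Rightarrow> real^2" where
  "ccw_end \<sigma> E = (if \<sigma> * cross2 (fst E - z) (snd E - z) > 0 then fst E else snd E)"

text \<open>Injectivity is \<open>edge_unique\<close>, surjectivity is \<open>edge_exists\<close>:
  each vertex has exactly one edge on each side.\<close>

lemma bij_ccw_end:
  assumes \<sigma>: "\<sigma> = 1 \<or> \<sigma> = -1"
  shows "bij_betw (ccw_end \<sigma>) ES (\<Union>E\<in>ES. {fst E, snd E})"
proof -
  have other: "\<exists>W. open_segment (ccw_end \<sigma> E) W = seg E \<and> \<sigma> * cross2 (ccw_end \<sigma> E - z) (W - z) > 0"
    if "E \<in> ES" for E
    using not_collinear_z[OF that] \<sigma>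
    by (auto simp: ccw_end_def seg_def open_segment_commute cross2_commute[of "fst E - z"] neq_iff
        intro: exI[of _ "fst E"] exI[of _ "snd E"])
  have "inj_on (ccw_end \<sigma>) ES"
  proof (rule inj_onI)
    fix E1 E2 assume E: "E1 \<in> ES" "E2 \<in> ES" "ccw_end \<sigma> E1 = ccw_end \<sigma> E2"
    obtain W1 W2 where W: "open_segment (ccw_end \<sigma> E1) W1 = seg E1" "\<sigma> * cross2 (ccw_end \<sigma> E1 - z) (W1 - z) > 0"
      "open_segment (ccw_end \<sigma> E2) W2 = seg E2" "\<sigma> * cross2 (ccw_end \<sigma> E2 - z) (W2 - z) > 0"
      using other[OF E(1)] other[OF E(2)] by blast
    have "(\<sigma> * cross2 (ccw_end \<sigma> E1 - z) (W1 - z)) * (\<sigma> * cross2 (ccw_end \<sigma> E1 - z) (W2 - z)) > 0"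
      by (rule mult_pos_pos[OF W(2) W(4)[folded E(3)]])
    then have "cross2 (ccw_end \<sigma> E1 - z) (W1 - z) * cross2 (ccw_end \<sigma> E1 - z) (W2 - z) > 0"
      using \<sigma> by auto
    then show "E1 = E2"
      using edge_unique[OF E(1,2)] W(1,3) E(3) by (metis order_refl)
  qed
  moreover have "ccw_end \<sigma> ` ES = (\<Union>E\<in>ES. {fst E, snd E})"
  proof
    show "ccw_end \<sigma> ` ES \<subseteq> (\<Union>E\<in>ES. {fst E, snd E})"
      by (auto simp: ccw_end_def)
    show "(\<Union>E\<in>ES. {fst E, snd E}) \<subseteq> ccw_end \<sigma> ` ES"
    proof
      fix V assume "V \<in> (\<Union>E\<in>ES. {fst E, snd E})"
      then obtain E0 where E0: "E0 \<in> ES" "V = fst E0 \<or> V = snd E0" by blast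
      obtain E W where E: "E \<in> ES" "V = fst E \<and> W = snd E \<or> V = snd E \<and> W = fst E"
        "\<sigma> * cross2 (V - z) (W - z) > 0"
        using edge_exists[OF E0 \<sigma>] by blast
      have "ccw_end \<sigma> E = V"
        using E(2,3) by (auto simp: ccw_end_def cross2_commute[of "fst E - z"])
      then show "V \<in> ccw_end \<sigma> ` ES"
        using E(1) by blast
    qed
  qed
  ultimately show ?thesis by (simp add: bij_betw_def)
qed

text \<open>Every vertex is the first end of exactly one edge and the second end of exactly one edge,
  in the counterclockwise order.\<close>

lemma boundary_cycle:
  fixes q :: "real^2 \<Rightarrow> real"
  shows "(\<Sum>E\<in>ES. sgn (cross2 (fst E - z) (snd E - z)) * (q (snd E) - q (fst E))) = 0"
proof -
  have "(\<Sum>E\<in>ES. sgn (cross2 (fst E - z) (snd E - z)) * (q (snd E) - q (fst E)))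
      = (\<Sum>E\<in>ES. q (ccw_end (-1) E) - q (ccw_end 1 E))"
  proof (rule sum.cong[OF refl])
    fix E assume "E \<in> ES"
    from not_collinear_z[OF this]
    show "sgn (cross2 (fst E - z) (snd E - z)) * (q (snd E) - q (fst E)) = q (ccw_end (-1) E) - q (ccw_end 1 E)"
      by (auto simp: ccw_end_def sgn_if)
  qed
  also have "\<dots> = (\<Sum>E\<in>ES. q (ccw_end (-1) E)) - (\<Sum>E\<in>ES. q (ccw_end 1 E))"
    by (rule sum_subtractf)
  also have "\<dots> = 0"
    using sum.reindex_bij_betw[OF bij_ccw_end[of "-1"], of q] sum.reindex_bij_betw[OF bij_ccw_end[of 1], of q]
    by simp
  finally show ?thesis .
qed

lemma cross_normal:
  assumes "E \<in> ES"
  shows "cross2 (fst E - y) (snd E - y) = - edge_length E * ((fst E - y) \<bullet> normal E)"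
proof -
  have "cross2 (fst E - y) (snd E - y) = cross2 (fst E - y) (snd E - fst E)"
    by (simp add: cross2_def algebra_simps)
  then show ?thesis
    using normal_inner[OF ends[OF assms]] by simp
qed

text \<open>If the line of the edge came closer to z than r, the foot of the perpendicular from z
  would lie both in the ball and on that line, against \<open>not_collinear\<close>.\<close>

lemma normal_distance:
  assumes E: "E \<in> ES"
  shows "r \<le> \<bar>(fst E - z) \<bullet> normal E\<bar>"
proof (rule ccontr)
  let ?m = "(fst E - z) \<bullet> normal E"
  assume "\<not> r \<le> \<bar>?m\<bar>"
  moreover have nn: "normal E \<bullet> normal E = 1" using normal_normal ends E by simp
  ultimately have "z + ?m *\<^sub>R normal E \<in> ball z r"
    by (simp add: dist_norm norm_eq_sqrt_inner)
  moreover have "(fst E - (z + ?m *\<^sub>R normal E)) \<bullet> normal E = 0"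
    using nn by (simp add: inner_diff_left inner_add_left)
  ultimately show False
    using not_collinear E cross_normal[OF E, of "z + ?m *\<^sub>R normal E"] by simp
qed

text \<open>Central projection from z writes the shifted point as
  \<open>z + \<mu> s *\<^sub>R (c s - z)\<close> with \<open>c s\<close> on the line of the edge.
  For small s the point \<open>c s\<close> stays on the edge, hence on the frontier, and comparing
  \<open>\<mu> s\<close> with 1 decides between inside and outside.\<close>

lemma side_of_edge:
  assumes E: "E \<in> ES" and x: "x \<in> seg E"
  shows "\<forall>\<^sub>F s in nhds 0. (s * ((fst E - z) \<bullet> normal E) < 0 \<longrightarrow> x + s *\<^sub>R normal E \<in> T) \<and>
    (s * ((fst E - z) \<bullet> normal E) > 0 \<longrightarrow> x + s *\<^sub>R normal E \<notin> T)"
proof -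
  define m where "m = (fst E - z) \<bullet> normal E"
  define d where "d = snd E - fst E"
  have m0: "m \<noteq> 0" using normal_distance[OF E] r_pos by (auto simp: m_def)
  have d0: "d \<noteq> 0" using ends[OF E] by (simp add: d_def)
  \<comment> \<open>Ratio of the signed distances \<open>m + s\<close> and m from z to the parallel
    lines through the shifted point and through the edge.\<close>
  define \<mu> where "\<mu> s = 1 + s / m" for s
  define c where "c s = z + (1 / \<mu> s) *\<^sub>R (x + s *\<^sub>R normal E - z)" for s
  \<comment> \<open>Coordinate of \<open>c s\<close> along the edge; it is continuous at s = 0,
    where it lies strictly between 0 and 1.\<close>
  define \<tau> where "\<tau> s = ((c s - fst E) \<bullet> d) / (d \<bullet> d)" for s
  obtain t where t: "0 < t" "t < 1" "x = (1 - t) *\<^sub>R fst E + t *\<^sub>R snd E"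
    using x by (auto simp: seg_def in_segment)
  have xd: "x = fst E + t *\<^sub>R d" by (simp add: t d_def algebra_simps)
  have nn: "normal E \<bullet> normal E = 1" using normal_normal ends E by simp
  have dn: "d \<bullet> normal E = 0"
    using normal_inner[OF ends[OF E], of d] edge_length_pos[OF ends[OF E]] by (simp add: d_def[symmetric] cross2_simps)
  have "(\<tau> \<longlongrightarrow> \<tau> 0) (nhds 0)"
    unfolding \<tau>_def c_def \<mu>_def by (intro tendsto_intros filterlim_ident) (use d0 m0 in auto)
  moreover have "\<tau> 0 = t"
    using d0 by (simp add: \<tau>_def c_def \<mu>_def xd)
  ultimately have \<tau>: "\<forall>\<^sub>F s in nhds 0. \<tau> s \<in> {0<..<1}"
    using t by (intro topological_tendstoD) auto
  have "(\<mu> \<longlongrightarrow> \<mu> 0) (nhds 0)"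
    unfolding \<mu>_def by (intro tendsto_intros filterlim_ident) (use m0 in auto)
  then have "\<forall>\<^sub>F s in nhds 0. \<mu> s \<in> {0<..}"
    using order_tendstoD(1)[of \<mu> "\<mu> 0" "nhds 0" 0] by (simp add: \<mu>_def[of 0])
  then show ?thesis
    using \<tau>
  proof eventually_elim
    fix s assume \<mu>: "\<mu> s \<in> {0<..}" and \<tau>: "\<tau> s \<in> {0<..<1}"
    have "(c s - fst E) \<bullet> normal E = 0"
    proof -
      have "(x + s *\<^sub>R normal E - z) \<bullet> normal E = m + s"
        using nn dn by (simp add: xd m_def inner_simps)
      also have "\<dots> = m * \<mu> s"
        using m0 by (simp add: \<mu>_def field_simps)
      finally have "(c s - z) \<bullet> normal E = m"
        using \<mu> by (simp add: c_def)
      then show ?thesis by (simp add: m_def inner_diff_left)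
    qed
    then have "cross2 d (c s - fst E) = 0"
      using normal_inner[OF ends[OF E], of "c s - fst E"] by (simp add: d_def cross2_commute[of "snd E - fst E"])
    then obtain k where k: "c s - fst E = k *\<^sub>R d"
      using d0 cross2_zeroD by blast
    then have "k = \<tau> s" using d0 by (simp add: \<tau>_def)
    then have "c s \<in> seg E"
      using k \<tau> ends[OF E] by (auto simp: seg_def in_segment d_def algebra_simps intro!: exI[of _ "\<tau> s"])
    then have cf: "c s \<in> frontier T" using seg_frontier E by blast
    have \<mu>c: "x + s *\<^sub>R normal E = z + \<mu> s *\<^sub>R (c s - z)"
      using \<mu> by (simp add: c_def)
    have "s * m < 0 \<Longrightarrow> x + s *\<^sub>R normal E \<in> T"
      unfolding \<mu>c using \<mu> by (intro star_closure z_ball frontier_disj(2) cf)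
        (auto simp: \<mu>_def divide_less_0_iff mult_less_0_iff)
    moreover have "x + s *\<^sub>R normal E \<notin> T" if "s * m > 0"
    proof
      assume "x + s *\<^sub>R normal E \<in> T"
      then have "z + (1 / \<mu> s) *\<^sub>R (x + s *\<^sub>R normal E - z) \<in> T"
        using \<mu> that closure_subset by (intro star_closure z_ball)
          (auto simp: \<mu>_def zero_less_divide_iff zero_less_mult_iff)
      then show False using cf frontier_disj by (simp add: c_def)
    qed
    ultimately show "(s * ((fst E - z) \<bullet> normal E) < 0 \<longrightarrow> x + s *\<^sub>R normal E \<in> T) \<and>
      (s * ((fst E - z) \<bullet> normal E) > 0 \<longrightarrow> x + s *\<^sub>R normal E \<notin> T)"
      by (simp add: m_def)
  qed
qed

lemma side_at_right:
  assumes E: "E \<in> ES" and x: "x \<in> seg E" and \<sigma>: "\<sigma> = 1 \<or> \<sigma> = -1"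
  shows "\<sigma> * ((fst E - z) \<bullet> normal E) < 0 \<Longrightarrow> \<forall>\<^sub>F s in at_right 0. x + (\<sigma> * s) *\<^sub>R normal E \<in> T"
    and "\<sigma> * ((fst E - z) \<bullet> normal E) > 0 \<Longrightarrow> \<forall>\<^sub>F s in at_right 0. x + (\<sigma> * s) *\<^sub>R normal E \<notin> T"
proof -
  have "((\<lambda>s. \<sigma> * s) \<longlongrightarrow> \<sigma> * 0) (at_right 0)"
    by (intro tendsto_intros)
  then have "filterlim (\<lambda>s. \<sigma> * s) (nhds 0) (at_right 0)"
    by simp
  from eventually_compose_filterlim[OF side_of_edge[OF E x] this]
  have ev: "\<forall>\<^sub>F s in at_right 0. (\<sigma> * s * ((fst E - z) \<bullet> normal E) < 0 \<longrightarrow> x + (\<sigma> * s) *\<^sub>R normal E \<in> T) \<and>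
    (\<sigma> * s * ((fst E - z) \<bullet> normal E) > 0 \<longrightarrow> x + (\<sigma> * s) *\<^sub>R normal E \<notin> T)" .
  have pos: "\<forall>\<^sub>F s in at_right (0::real). s > 0"
    by (rule eventually_at_right_less)
  show "\<sigma> * ((fst E - z) \<bullet> normal E) < 0 \<Longrightarrow> \<forall>\<^sub>F s in at_right 0. x + (\<sigma> * s) *\<^sub>R normal E \<in> T"
    using ev pos by eventually_elim (use \<sigma> in \<open>auto simp: mult_less_0_iff zero_less_mult_iff\<close>)
  show "\<sigma> * ((fst E - z) \<bullet> normal E) > 0 \<Longrightarrow> \<forall>\<^sub>F s in at_right 0. x + (\<sigma> * s) *\<^sub>R normal E \<notin> T"
    using ev pos by eventually_elim (use \<sigma> in \<open>auto simp: mult_less_0_iff zero_less_mult_iff\<close>)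
qed

text \<open>The side condition in \<open>sign_TE\<close> holds for all points of the edge or for
  none, and the signed distance from z to the edge line tells which.\<close>

lemma sign_TE_eq:
  assumes E: "E \<in> ES"
  shows "sign_TE T E = sgn ((fst E - z) \<bullet> normal E)"
proof -
  let ?m = "(fst E - z) \<bullet> normal E"
  have m0: "?m \<noteq> 0" using normal_distance[OF E] r_pos by auto
  have "midpoint (fst E) (snd E) \<in> seg E"
    using ends[OF E] by (simp add: seg_def)
  then obtain x where x: "x \<in> seg E" by blast
  show ?thesis
  proof (cases "?m > 0")
    case True
    then have "\<forall>x\<in>seg E. \<forall>\<^sub>F s in at_right 0. x + s *\<^sub>R normal E \<notin> T"
      using side_at_right(2)[OF E, of _ 1] by simp
    then show ?thesis using True by (simp add: sign_TE_def)
  next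
    case False
    then have m: "?m < 0" using m0 by simp
    then have "\<forall>\<^sub>F s in at_right 0. x + s *\<^sub>R normal E \<in> T"
      using side_at_right(1)[OF E x, of 1] by simp
    then have "\<not> (\<forall>\<^sub>F s in at_right 0. x + s *\<^sub>R normal E \<notin> T)"
      using eventually_happens'[OF trivial_limit_at_right_real] eventually_conj by fastforce
    then show ?thesis using m x by (auto simp: sign_TE_def)
  qed
qed

lemma sign_TE_cross:
  assumes E: "E \<in> ES"
  shows "sign_TE T E = - sgn (cross2 (fst E - z) (snd E - z))"
  unfolding sign_TE_eq[OF E] cross_normal[OF E]
  using edge_length_pos[OF ends[OF E]] by (simp add: sgn_mult)

text \<open>Discrete form of the fact that an exact tangential derivative integrates to zero around
  the boundary. It disposes of the end-point terms whenever one integrates by parts along the edges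
  of an element.\<close>

lemma sign_TE_sum:
  fixes q :: "real^2 \<Rightarrow> real"
  shows "(\<Sum>E\<in>ES. sign_TE T E * (q (snd E) - q (fst E))) = 0"
  using boundary_cycle[of q] by (simp add: sign_TE_cross sum_negf)

end

section \<open>The divergence theorem\<close>

text \<open>Transfer to pairs by the volume-preserving coordinate map, where Fubini for continuous
  functions applies.\<close>

lemma integral_unit_square:
  fixes h :: "real^2 \<Rightarrow> real"
  assumes h: "continuous_on UNIV h"
  shows "integral (cbox 0 (vec 1)) h = integral {0..1} (\<lambda>s. integral {0..1} (\<lambda>t. h (vector [s, t])))"
proof -
  define g :: "real \<times> real \<Rightarrow> real^2" where "g p = vector [fst p, snd p]" for p
  define h' :: "real^2 \<Rightarrow> real \<times> real" where "h' x = (x $ 1, x $ 2)" for x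
  have img: "g ` cbox (a, c) (b, d) = cbox (vector [a, c]) (vector [b, d])" for a b c d
  proof
    show "cbox (vector [a, c]) (vector [b, d]) \<subseteq> g ` cbox (a, c) (b, d)"
    proof
      fix x :: "real^2" assume "x \<in> cbox (vector [a, c]) (vector [b, d])"
      then have "x = g (x $ 1, x $ 2)" "(x $ 1, x $ 2) \<in> cbox (a, c) (b, d)"
        by (auto simp: g_def vec_eq_iff forall_2 mem_box_cart)
      then show "x \<in> g ` cbox (a, c) (b, d)" by blast
    qed
  qed (auto simp: g_def mem_box_cart forall_2)
  have img': "h' ` cbox u v = cbox (u $ 1, u $ 2) (v $ 1, v $ 2)" for u v
  proof
    show "cbox (u $ 1, u $ 2) (v $ 1, v $ 2) \<subseteq> h' ` cbox u v"
    proof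
      fix p assume "p \<in> cbox (u $ 1, u $ 2) (v $ 1, v $ 2)"
      moreover obtain a b where "p = (a, b)" by (cases p)
      ultimately have "p = h' (vector [fst p, snd p])" "vector [fst p, snd p] \<in> cbox u v"
        by (auto simp: h'_def mem_box_cart forall_2)
      then show "p \<in> h' ` cbox u v" by blast
    qed
  qed (auto simp: h'_def mem_box_cart forall_2)
  have cg: "continuous_on UNIV g"
  proof -
    have "g p = fst p *\<^sub>R axis 1 1 + snd p *\<^sub>R axis 2 1" for p
      by (simp add: g_def vec_eq_iff forall_2 axis_def)
    then show ?thesis by (simp add: continuous_intros)
  qed
  have "((\<lambda>p. h (g p)) has_integral (1 / 1) *\<^sub>R integral (cbox 0 (vec 1)) h) (h' ` cbox 0 (vec 1))"
  proof (rule has_integral_twiddle)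
    show "h' (g x) = x" "g (h' y) = y" for x y
      by (auto simp: g_def h'_def vec_eq_iff forall_2)
    show "continuous (at x) g" for x
      using cg continuous_on_eq_continuous_at by blast
    show "\<exists>w z. g ` cbox u v = cbox w z" for u v
      using img by (metis surj_pair)
    show "\<exists>w z. h' ` cbox u v = cbox w z" for u v
      using img' by blast
    show "measure lborel (g ` cbox u v) = 1 * measure lborel (cbox u v)" for u v
    proof -
      obtain a c b d where uv: "u = (a, c)" "v = (b, d)" by (metis surj_pair)
      have ex_2: "(\<exists>i::2. P i) \<longleftrightarrow> P 1 \<or> P 2" for P
        by (metis exhaust_2)
      show ?thesis
        unfolding uv img
        by (cases "a \<le> b \<and> c \<le> d")
          (auto simp: content_Pair content_cbox_if_cart interval_eq_empty_cart ex_2 UNIV_2)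
    qed
    show "(h has_integral integral (cbox 0 (vec 1)) h) (cbox 0 (vec 1))"
      using h by (intro integrable_integral integrable_continuous continuous_on_subset[OF h]) auto
  qed simp
  then have "integral (cbox 0 (vec 1)) h = integral (cbox (0, 0) (1, 1)) (\<lambda>p. h (g p))"
    unfolding img' by (simp add: integral_unique)
  also have "\<dots> = integral {0..1} (\<lambda>s. integral {0..1} (\<lambda>t. h (g (s, t))))"
    by (subst integral_prod_continuous) (auto intro!: continuous_on_compose2[OF h] continuous_on_subset[OF cg])
  finally show ?thesis by (simp add: g_def)
qed

text \<open>Collapsed coordinates: the first component runs along rays from the apex z, the second
  along the opposite side. On the square, Fubini and the fundamental theorem apply in each
  variable.\<close>

definition triangle_map :: "real^2 \<Rightarrow> real^2 \<Rightarrow> real^2 \<Rightarrow> real^2 \<Rightarrow> real^2" where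
  "triangle_map z u v w = z + w $ 1 *\<^sub>R ((1 - w $ 2) *\<^sub>R u + w $ 2 *\<^sub>R v)"

text \<open>The Jacobian is \<open>w $ 1\<close> times \<open>cross2 u v\<close>. On the open box
  the map is injective because the coefficients of u and v determine w as long as
  \<open>w $ 1\<close> is positive.\<close>

lemma triangle_integral:
  fixes f :: "real^2 \<Rightarrow> real"
  assumes f: "continuous_on UNIV f" and d: "cross2 u v \<noteq> 0"
  shows "(f has_integral (\<bar>cross2 u v\<bar> * integral (cbox 0 (vec 1)) (\<lambda>w. w $ 1 * f (triangle_map z u v w))))
    (triangle_map z u v ` box 0 (vec 1))"
proof -
  let ?g = "triangle_map z u v" and ?S = "box 0 (vec 1) :: (real^2) set"
  define g' where "g' w h = h $ 1 *\<^sub>R ((1 - w $ 2) *\<^sub>R u + w $ 2 *\<^sub>R v) + w $ 1 *\<^sub>R (h $ 2 *\<^sub>R (v - u))" for w h :: "real^2"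
  have der: "(?g has_derivative g' w) (at w within ?S)" for w
    unfolding triangle_map_def[abs_def] g'_def[abs_def]
    by (rule derivative_eq_intros bounded_linear.has_derivative[OF bounded_linear_vec_nth] refl)+
      (auto simp: fun_eq_iff algebra_simps)
  have det: "det (matrix (g' w)) = w $ 1 * cross2 u v" for w
    by (simp add: det_2 matrix_def g'_def cross2_def axis_def) (simp add: algebra_simps)
  have cg: "continuous_on A ?g" for A
    unfolding triangle_map_def by (intro continuous_intros)
  have inj: "inj_on ?g ?S"
  proof (rule inj_onI)
    fix w w' assume w: "w \<in> ?S" "w' \<in> ?S" "?g w = ?g w'"
    have 1: "cross2 (?g w - z) v = w $ 1 * (1 - w $ 2) * cross2 u v"
      and 2: "cross2 u (?g w - z) = w $ 1 * w $ 2 * cross2 u v" for w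
      by (simp_all add: triangle_map_def cross2_simps)
    have *: "w $ 1 * (1 - w $ 2) = w' $ 1 * (1 - w' $ 2)" "w $ 1 * w $ 2 = w' $ 1 * w' $ 2"
      using 1[of w] 1[of w'] 2[of w] 2[of w'] w(3) d by auto
    then have "w $ 1 = w' $ 1" by (simp add: algebra_simps)
    moreover have "w $ 1 > 0" using w(1) by (simp add: mem_box_cart)
    ultimately show "w = w'" using *(2) by (simp add: vec_eq_iff forall_2)
  qed
  \<comment> \<open>The change of variables is stated for functions with values in a Cartesian
    space, hence the detour through one-component vectors.\<close>
  define F :: "real^2 \<Rightarrow> real^1" where "F x = f x *\<^sub>R vec 1" for x
  have cF: "continuous_on A F" for A
    unfolding F_def by (intro continuous_intros continuous_on_subset[OF f]) auto
  let ?b = "integral ?S (\<lambda>w. \<bar>det (matrix (g' w))\<bar> *\<^sub>R F (?g w))"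
  have cont: "continuous_on A (\<lambda>w. \<bar>det (matrix (g' w))\<bar> *\<^sub>R F (?g w))" for A
    unfolding det by (intro continuous_intros continuous_on_compose2[OF cF[of UNIV] cg]) auto
  have ai: "(\<lambda>w. \<bar>det (matrix (g' w))\<bar> *\<^sub>R F (?g w)) absolutely_integrable_on ?S"
    by (rule integrable_on_bounded_open(1)[OF open_box bounded_box cont])
  then have "F absolutely_integrable_on (?g ` ?S) \<and> integral (?g ` ?S) F = ?b"
    using has_absolute_integral_change_of_variables[of ?S ?g g' F ?b, OF _ der inj] by auto
  then have "(F has_integral ?b) (?g ` ?S)"
    by (metis has_integral_integral set_lebesgue_integral_eq_integral(1))
  from has_integral_linear[OF this bounded_linear_vec_nth[of 1]]
  have "((\<lambda>x. F x $ 1) has_integral ?b $ 1) (?g ` ?S)"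
    by (simp only: o_def)
  moreover have "?b $ 1 = integral ?S (\<lambda>w. (\<bar>det (matrix (g' w))\<bar> *\<^sub>R F (?g w)) $ 1)"
    using integral_linear[OF integrable_on_bounded_open(2)[OF open_box bounded_box cont, of 0 "vec 1"] bounded_linear_vec_nth[of 1]]
    by (simp only: o_def)
  moreover have "\<dots> = integral (cbox 0 (vec 1)) (\<lambda>w. (\<bar>det (matrix (g' w))\<bar> *\<^sub>R F (?g w)) $ 1)"
    by (rule integral_open_interval)
  moreover have "\<dots> = integral (cbox 0 (vec 1)) (\<lambda>w. \<bar>cross2 u v\<bar> * (w $ 1 * f (?g w)))"
    by (rule integral_cong) (auto simp: det F_def abs_mult mem_box_cart)
  ultimately show ?thesis by (simp add: F_def)
qed

lemma linear_cross2: "linear (\<lambda>p. cross2 p w)"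
  by (intro linearI) (simp_all add: cross2_simps)

lemma divergence_vpoly: "F \<in> vpoly l \<Longrightarrow> divergence F x = dir_deriv (axis 1 1) F x $ 1 + dir_deriv (axis 2 1) F x $ 2"
  by (simp add: divergence_def sum_2 dir_deriv_component)

lemma divergence_bipoly: "F \<in> vpoly l \<Longrightarrow> divergence F \<in> bipoly (l - 1)"
proof -
  assume F: "F \<in> vpoly l"
  have "divergence F = (\<lambda>x. dir_deriv (axis 1 1) F x $ 1 + dir_deriv (axis 2 1) F x $ 2)"
    using divergence_vpoly[OF F] by auto
  then show ?thesis
    unfolding vpoly_real[symmetric] by (simp add: vpoly_add vpoly_component vpoly_dir_deriv[OF F])
qed

text \<open>With \<open>y = u + t w\<close> and \<open>x = z + s y\<close>, \<open>w = v - u\<close>, the Piola identity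
  \<open>s (u \<times> v) div F(x) = \<partial>\<^sub>s (s F(x) \<times> w) - \<partial>\<^sub>t (F(x) \<times> y)\<close> reduces the claim to the fundamental theorem.\<close>

lemma triangle_divergence:
  assumes F: "F \<in> vpoly l"
  shows "cross2 u v * integral (cbox 0 (vec 1)) (\<lambda>w. w $ 1 * divergence F (triangle_map z u v w))
    = integral {0..1} (\<lambda>t. cross2 (F (linepath (z + u) (z + v) t)) (v - u))
      - (integral {0..1} (\<lambda>s. cross2 (F (z + s *\<^sub>R v)) v) - integral {0..1} (\<lambda>s. cross2 (F (z + s *\<^sub>R u)) u))"
proof -
  define w where "w = v - u"
  define y where "y t = u + t *\<^sub>R w" for t
  define X where "X s t = z + s *\<^sub>R y t" for s t
  define F1 where "F1 = dir_deriv (axis 1 1) F"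
  define F2 where "F2 = dir_deriv (axis 2 1) F"
  have F12: "F1 \<in> vpoly (l - 1)" "F2 \<in> vpoly (l - 1)"
    unfolding F1_def F2_def using vpoly_dir_deriv[OF F] by auto
  have D: "dir_deriv h F x = h $ 1 *\<^sub>R F1 x + h $ 2 *\<^sub>R F2 x" for h x
    unfolding F1_def F2_def by (rule dir_deriv_linear[OF F])
  define As where "As s t = cross2 (F (X s t)) w + s * cross2 (dir_deriv (y t) F (X s t)) w" for s t
  define Bt where "Bt s t = cross2 (F (X s t)) w + cross2 (dir_deriv (s *\<^sub>R w) F (X s t)) (y t)" for s t
  have cX: "continuous_on A (\<lambda>p. X (fst p) (snd p))" for A
    unfolding X_def y_def by (intro continuous_intros)
  have cGX: "continuous_on A (\<lambda>p. G (X (fst p) (snd p)))" if "G \<in> vpoly m" for G :: "real^2 \<Rightarrow> real^2" and m A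
    by (rule continuous_on_compose2[OF vpoly_continuous[OF that, of UNIV] cX]) auto
  have cy: "continuous_on A (\<lambda>p. y (snd p))" for A :: "(real \<times> real) set"
    unfolding y_def by (intro continuous_intros)
  have cAs: "continuous_on A (\<lambda>p. As (fst p) (snd p))" for A
    unfolding As_def D cross2_def by (intro continuous_intros cGX[OF F] cGX[OF F12(1)] cGX[OF F12(2)] cy)
  have cBt: "continuous_on A (\<lambda>p. Bt (fst p) (snd p))" for A
    unfolding Bt_def D cross2_def by (intro continuous_intros cGX[OF F] cGX[OF F12(1)] cGX[OF F12(2)] cy)
  have key: "cross2 u v * (s * divergence F (X s t)) = As s t - Bt s t" for s t
    unfolding divergence_vpoly[OF F] F1_def[symmetric] F2_def[symmetric] As_def Bt_def D w_def y_def cross2_def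
    by (simp add: algebra_simps)
  have intA: "integral {0..1} (\<lambda>s. As s t) = cross2 (F (linepath (z + u) (z + v) t)) w" for t
  proof -
    have "((\<lambda>s. s * cross2 (F (X s t)) w) has_vector_derivative As s t) (at s within {0..1})" for s
    proof -
      have "linepath z (z + y t) s = X s t" for s
        by (simp add: linepath_def X_def algebra_simps)
      then have "((\<lambda>s. F (X s t)) has_vector_derivative dir_deriv (y t) F (X s t)) (at s within {0..1})"
        using vpoly_linepath_derivative[OF F, of z "z + y t" s "{0..1}"] by simp
      from bounded_linear.has_vector_derivative[OF linear_cross2[unfolded linear_conv_bounded_linear] this, of w]
      have "((\<lambda>s. cross2 (F (X s t)) w) has_real_derivative cross2 (dir_deriv (y t) F (X s t)) w) (at s within {0..1})"
        by (simp add: has_real_derivative_iff_has_vector_derivative)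
      from DERIV_mult[OF DERIV_ident this] show ?thesis
        by (simp add: has_real_derivative_iff_has_vector_derivative[symmetric] As_def algebra_simps)
    qed
    then have "((\<lambda>s. As s t) has_integral (1 * cross2 (F (X 1 t)) w - 0 * cross2 (F (X 0 t)) w)) {0..1}"
      by (intro fundamental_theorem_of_calculus) auto
    moreover have "X 1 t = linepath (z + u) (z + v) t"
      by (simp add: X_def y_def w_def linepath_def algebra_simps)
    ultimately show ?thesis by (simp add: integral_unique)
  qed
  have intB: "integral {0..1} (\<lambda>t. Bt s t) = cross2 (F (z + s *\<^sub>R v)) v - cross2 (F (z + s *\<^sub>R u)) u" for s
  proof -
    have "((\<lambda>t. cross2 (F (X s t)) (y t)) has_vector_derivative Bt s t) (at t within {0..1})" for t
    proof -
      have L: "linepath (z + s *\<^sub>R u) (z + s *\<^sub>R v) t = X s t" for t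
        by (simp add: linepath_def X_def y_def w_def algebra_simps)
      moreover have "z + s *\<^sub>R v - (z + s *\<^sub>R u) = s *\<^sub>R w" by (simp add: w_def algebra_simps)
      ultimately have d: "((\<lambda>t. F (X s t)) has_vector_derivative dir_deriv (s *\<^sub>R w) F (X s t)) (at t within {0..1})"
        using vpoly_linepath_derivative[OF F, of "z + s *\<^sub>R u" "z + s *\<^sub>R v" t "{0..1}"] by simp
      have dF: "((\<lambda>t. F (X s t) $ i) has_real_derivative dir_deriv (s *\<^sub>R w) F (X s t) $ i) (at t within {0..1})" for i
        using bounded_linear.has_vector_derivative[OF bounded_linear_vec_nth d]
        by (simp add: has_real_derivative_iff_has_vector_derivative)
      have dy: "((\<lambda>t. y t $ i) has_real_derivative w $ i) (at t within {0..1})" for i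
        unfolding y_def by (auto intro!: derivative_eq_intros)
      show ?thesis
        unfolding has_real_derivative_iff_has_vector_derivative[symmetric] cross2_def Bt_def
        by (rule derivative_eq_intros dF dy refl)+ (simp add: algebra_simps)
    qed
    then have "((\<lambda>t. Bt s t) has_integral (cross2 (F (X s 1)) (y 1) - cross2 (F (X s 0)) (y 0))) {0..1}"
      by (intro fundamental_theorem_of_calculus) auto
    then show ?thesis by (simp add: integral_unique X_def y_def w_def)
  qed
  have "cross2 u v * integral (cbox 0 (vec 1)) (\<lambda>w. w $ 1 * divergence F (triangle_map z u v w))
     = integral (cbox 0 (vec 1)) (\<lambda>w. cross2 u v * (w $ 1 * divergence F (triangle_map z u v w)))"
    by simp
  also have "\<dots> = integral {0..1} (\<lambda>s. integral {0..1} (\<lambda>t. cross2 u v * (s * divergence F (X s t))))"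
  proof (subst integral_unit_square)
    show "continuous_on UNIV (\<lambda>w. cross2 u v * (w $ 1 * divergence F (triangle_map z u v w)))"
      unfolding triangle_map_def
      by (intro continuous_intros continuous_on_compose2[OF bipoly_continuous[OF divergence_bipoly[OF F], of UNIV]]) auto
    have "triangle_map z u v (vector [s, t]) = X s t" for s t
      by (simp add: triangle_map_def X_def y_def w_def algebra_simps)
    then show "integral {0..1} (\<lambda>s. integral {0..1} (\<lambda>t. cross2 u v * (vector [s, t] $ 1 * divergence F (triangle_map z u v (vector [s, t])))))
      = integral {0..1} (\<lambda>s. integral {0..1} (\<lambda>t. cross2 u v * (s * divergence F (X s t))))"
      by simp
  qed
  also have "\<dots> = integral (cbox (0, 0) (1, 1)) (\<lambda>p. As (fst p) (snd p) - Bt (fst p) (snd p))"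
    unfolding key by (subst integral_prod_continuous) (auto intro!: continuous_on_diff cAs cBt)
  also have "\<dots> = integral (cbox (0, 0) (1, 1)) (\<lambda>p. As (fst p) (snd p)) - integral (cbox (0, 0) (1, 1)) (\<lambda>p. Bt (fst p) (snd p))"
    by (intro integral_diff integrable_continuous cAs cBt)
  also have "integral (cbox (0, 0) (1, 1)) (\<lambda>p. Bt (fst p) (snd p)) = integral {0..1} (\<lambda>s. integral {0..1} (\<lambda>t. Bt s t))"
    by (subst integral_prod_continuous) (auto intro!: cBt)
  also have "\<dots> = integral {0..1} (\<lambda>s. cross2 (F (z + s *\<^sub>R v)) v) - integral {0..1} (\<lambda>s. cross2 (F (z + s *\<^sub>R u)) u)"
  proof -
    have c: "continuous_on {0..1} (\<lambda>s. cross2 (F (z + s *\<^sub>R a)) b)" for a b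
      unfolding cross2_def by (intro continuous_intros continuous_on_compose2[OF vpoly_continuous[OF F, of UNIV]]) auto
    show ?thesis
      unfolding intB by (intro integral_diff integrable_continuous_interval c)
  qed
  also have "integral (cbox (0, 0) (1, 1)) (\<lambda>p. As (fst p) (snd p)) = integral {0..1} (\<lambda>s. integral {0..1} (\<lambda>t. As s t))"
    by (subst integral_prod_continuous) (auto intro!: cAs)
  also have "\<dots> = integral {0..1} (\<lambda>t. integral {0..1} (\<lambda>s. As s t))"
    using integral_swap_continuous[of 0 0 1 1 As] cAs by (simp add: case_prod_beta)
  finally show ?thesis
    unfolding intA w_def .
qed

section \<open>Decomposition of a star-shaped polygon into cones\<close>

context star_polygon
begin

definition cone :: "edge \<Rightarrow> (real^2) set" where
  "cone E = triangle_map z (fst E - z) (snd E - z) ` box 0 (vec 1)"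

lemma cone_point:
  assumes "E \<in> ES" "x \<in> cone E"
  obtains p s where "p \<in> seg E" "0 < s" "s < 1" "x = z + s *\<^sub>R (p - z)"
proof -
  obtain w where w: "w \<in> box 0 (vec 1)" "x = triangle_map z (fst E - z) (snd E - z) w"
    using assms by (auto simp: cone_def)
  have w': "0 < w $ i" "w $ i < 1" for i
    using w(1) by (auto simp: mem_box_cart)
  show thesis
  proof (rule that)
    show "linepath (fst E) (snd E) (w $ 2) \<in> seg E"
      using linepath_in_seg(1)[OF ends[OF assms(1)]] w' by simp
    show "x = z + w $ 1 *\<^sub>R (linepath (fst E) (snd E) (w $ 2) - z)"
      by (simp add: w(2) triangle_map_def linepath_def algebra_simps)
  qed (use w' in auto)
qed

lemma cone_pointI:
  assumes "E \<in> ES" "p \<in> seg E" "0 < s" "s < 1"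
  shows "z + s *\<^sub>R (p - z) \<in> cone E"
proof -
  obtain t where t: "t \<in> {0<..<1}" "p = linepath (fst E) (snd E) t"
    using linepath_in_seg(3)[OF ends[OF assms(1)] assms(2)] by blast
  have "z + s *\<^sub>R (p - z) = triangle_map z (fst E - z) (snd E - z) (vector [s, t])"
    by (simp add: t(2) triangle_map_def linepath_def algebra_simps)
  moreover have "vector [s, t] \<in> (box 0 (vec 1) :: (real^2) set)"
    using t assms by (simp add: mem_box_cart forall_2)
  ultimately show ?thesis
    unfolding cone_def by blast
qed

lemma cone_subset:
  assumes E: "E \<in> ES"
  shows "cone E \<subseteq> T"
proof
  fix x assume "x \<in> cone E"
  then obtain p s where p: "p \<in> seg E" "0 < s" "s < 1" "x = z + s *\<^sub>R (p - z)"
    by (rule cone_point[OF E])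
  then have "p \<in> frontier T"
    using seg_frontier(2)[OF E] by blast
  then show "x \<in> T"
    unfolding p(4) using p by (intro star_closure z_ball frontier_disj) auto
qed

lemma cone_disjoint:
  assumes "E \<in> ES" "E' \<in> ES" "E \<noteq> E'"
  shows "cone E \<inter> cone E' = {}"
proof (rule ccontr)
  assume "cone E \<inter> cone E' \<noteq> {}"
  then obtain x where x: "x \<in> cone E" "x \<in> cone E'" by blast
  obtain p s where p: "p \<in> seg E" "0 < s" "x = z + s *\<^sub>R (p - z)"
    using cone_point[OF assms(1) x(1)] by blast
  obtain p' s' where p': "p' \<in> seg E'" "0 < s'" "x = z + s' *\<^sub>R (p' - z)"
    using cone_point[OF assms(2) x(2)] by blast
  have "p' - z = (1 / s') *\<^sub>R (s' *\<^sub>R (p' - z))"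
    using p'(2) by simp
  also have "s' *\<^sub>R (p' - z) = s *\<^sub>R (p - z)"
    using p(3) p'(3) by simp
  finally have "p' - z = (s / s') *\<^sub>R (p - z)" by simp
  then have "p' = p"
    using frontier_ray_unique[OF z_ball subsetD[OF seg_frontier(2)[OF assms(1)] p(1)]
        subsetD[OF seg_frontier(2)[OF assms(2)] p'(1)], of "s / s'"] p(2) p'(2) by simp
  then show False
    using disjoint assms p p' by (auto simp: pairwise_def disjnt_def)
qed

text \<open>Push x outwards to the frontier point p of its ray. If p is not an inner point of an
  edge, it is a vertex, and x lies on one of finitely many lines, which together form a null
  set.\<close>

lemma cone_cover:
  assumes "x \<in> T"
  shows "(\<exists>E\<in>ES. x \<in> cone E) \<or> (\<exists>V\<in>(\<Union>E\<in>ES. {fst E, snd E}). cross2 (V - z) (x - z) = 0)"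
proof (cases "x = z \<or> ES = {}")
  case True
  \<comment> \<open>For x = z every vertex line will do, and a vertex exists because a bounded
    nonempty set has nonempty frontier.\<close>
  have "frontier T \<noteq> {}"
    using bounded_T nonempty_T frontier_eq_empty[of T] not_bounded_UNIV[where 'a = "real^2"] by metis
  then obtain E where "E \<in> ES" using frontier_T by blast
  moreover have "cross2 (fst E - z) (x - z) = 0"
    using True \<open>E \<in> ES\<close> by (auto simp: cross2_def)
  ultimately show ?thesis by blast
next
  case False
  have "z \<in> interior T"
    using z_ball ball_subset open_T by (auto simp: interior_open)
  then obtain d where d: "0 < d" "z + d *\<^sub>R (x - z) \<in> frontier T"
    using ray_to_frontier[OF bounded_T, of z "x - z"] False by auto
  define p where "p = z + d *\<^sub>R (x - z)"
  have "\<not> d \<le> 1"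
  proof
    assume "d \<le> 1"
    then have "p \<in> closed_segment z x"
      using d(1) unfolding p_def closed_segment_def by (intro CollectI exI[of _ d]) (auto simp: algebra_simps)
    then show False
      using star[OF z_ball assms] frontier_disj(1) d(2) p_def by blast
  qed
  then have xp: "x = z + (1 / d) *\<^sub>R (p - z)" "0 < 1 / d" "1 / d < 1"
    using d(1) by (auto simp: p_def)
  obtain E where E: "E \<in> ES" "p \<in> closure (seg E)"
    using d(2) frontier_T p_def by auto
  show ?thesis
  proof (cases "p \<in> seg E")
    case True
    then show ?thesis using cone_pointI[OF E(1)] xp E(1) by metis
  next
    case False
    then have "p = fst E \<or> p = snd E"
      using E(2) closure_seg[OF ends[OF E(1)]] by (auto simp: seg_def open_segment_def)
    moreover have "cross2 (p - z) (x - z) = 0"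
      using cross2_simps(5)[of d "x - z" "x - z"] cross2_simps(7)[of "x - z"] by (simp add: p_def)
    ultimately show ?thesis using E(1) by blast
  qed
qed

lemma integral_cones:
  assumes f: "continuous_on UNIV f"
  shows "integral T f = (\<Sum>E\<in>ES. \<bar>cross2 (fst E - z) (snd E - z)\<bar> *
    integral (cbox 0 (vec 1)) (\<lambda>w. w $ 1 * f (triangle_map z (fst E - z) (snd E - z) w)))" (is "_ = sum ?i ES")
proof -
  have "(f has_integral ?i E) (cone E)" if "E \<in> ES" for E
    unfolding cone_def by (rule triangle_integral[OF f not_collinear_z[OF that]])
  then have "(f has_integral sum ?i ES) (\<Union>E\<in>ES. cone E)"
    using finite_ES by (intro has_integral_UN) (auto simp: pairwise_def cone_disjoint)
  moreover have "(f has_integral sum ?i ES) (\<Union>E\<in>ES. cone E) \<longleftrightarrow> (f has_integral sum ?i ES) T"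
  proof (rule has_integral_spike_set_eq)
    have "(\<Union>E\<in>ES. cone E) - T = {}"
      using cone_subset by blast
    then show "negligible {x \<in> (\<Union>E\<in>ES. cone E) - T. f x \<noteq> 0}"
      by (metis (no_types, lifting) Collect_empty_eq empty_iff negligible_empty)
    have line: "negligible {x. cross2 (V - z) (x - z) = 0}" if V: "V \<in> (\<Union>E\<in>ES. {fst E, snd E})" for V
    proof -
      have "V \<in> frontier T"
        using V seg_frontier(1) by fastforce
      then have "V \<noteq> z"
        using frontier_disj(1) ball_subset z_ball by blast
      define a :: "real^2" where "a = vector [- (V - z) $ 2, (V - z) $ 1]"
      have "a \<noteq> 0"
        using \<open>V \<noteq> z\<close> by (auto simp: a_def vec_eq_iff forall_2)
      have "{x. cross2 (V - z) (x - z) = 0} = {x. a \<bullet> x = a \<bullet> z}"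
        by (auto simp: a_def cross2_def inner_vec_def sum_2 algebra_simps)
      then show ?thesis
        using negligible_hyperplane \<open>a \<noteq> 0\<close> by auto
    qed
    have "negligible (\<Union>V\<in>(\<Union>E\<in>ES. {fst E, snd E}). {x. cross2 (V - z) (x - z) = 0})"
      using finite_ES line by (intro negligible_Union) auto
    then show "negligible {x \<in> T - (\<Union>E\<in>ES. cone E). f x \<noteq> 0}"
      by (rule negligible_subset) (use cone_cover in blast)
  qed
  ultimately show ?thesis by (simp add: integral_unique)
qed

text \<open>Every cone contributes the flux through its edge and the difference of the radial terms
  \<Phi> at the two ends; the latter cancel around the boundary by
  \<open>sign_TE_sum\<close>.\<close>

theorem divergence_theorem:
  assumes F: "F \<in> vpoly l"
  shows "integral T (divergence F) = (\<Sum>E\<in>ES. sign_TE T E * edge_integral E (\<lambda>x. F x \<bullet> normal E))"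
proof -
  define \<Phi> where "\<Phi> V = integral {0..1} (\<lambda>s. cross2 (F (z + s *\<^sub>R (V - z))) (V - z))" for V
  define d where "d E = cross2 (fst E - z) (snd E - z)" for E :: edge
  have "integral T (divergence F) = (\<Sum>E\<in>ES. \<bar>d E\<bar> *
    integral (cbox 0 (vec 1)) (\<lambda>w. w $ 1 * divergence F (triangle_map z (fst E - z) (snd E - z) w)))"
    unfolding d_def by (rule integral_cones[OF bipoly_continuous[OF divergence_bipoly[OF F]]])
  also have "\<dots> = (\<Sum>E\<in>ES. sign_TE T E * edge_integral E (\<lambda>x. F x \<bullet> normal E) + sign_TE T E * (\<Phi> (snd E) - \<Phi> (fst E)))"
  proof (rule sum.cong[OF refl])
    fix E assume E: "E \<in> ES"
    let ?I = "integral (cbox 0 (vec 1)) (\<lambda>w. w $ 1 * divergence F (triangle_map z (fst E - z) (snd E - z) w))"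
    have "\<bar>d E\<bar> * ?I = sgn (d E) * (d E * ?I)"
      by (simp add: abs_sgn)
    also have "d E * ?I = integral {0..1} (\<lambda>t. cross2 (F (linepath (fst E) (snd E) t)) (snd E - fst E)) - (\<Phi> (snd E) - \<Phi> (fst E))"
      unfolding d_def \<Phi>_def using triangle_divergence[OF F, of "fst E - z" "snd E - z" z] by simp
    also have "integral {0..1} (\<lambda>t. cross2 (F (linepath (fst E) (snd E) t)) (snd E - fst E)) = - edge_integral E (\<lambda>x. F x \<bullet> normal E)"
      unfolding normal_inner[OF ends[OF E]] edge_integral_def by simp
    finally show "\<bar>d E\<bar> * ?I = sign_TE T E * edge_integral E (\<lambda>x. F x \<bullet> normal E) + sign_TE T E * (\<Phi> (snd E) - \<Phi> (fst E))"
      unfolding sign_TE_cross[OF E] d_def[symmetric] by (simp add: algebra_simps)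
  qed
  also have "\<dots> = (\<Sum>E\<in>ES. sign_TE T E * edge_integral E (\<lambda>x. F x \<bullet> normal E))"
    by (simp add: sum.distrib sign_TE_sum)
  finally show ?thesis .
qed

end

text \<open>Apply the divergence theorem to \<open>x - z\<close>: its divergence is 2, and its
  outward flux through an edge is at least r times the length. T lies in a square of side
  \<open>2 * h\<close>, whence the 8.\<close>

lemma (in star_polygon) perimeter_bound:
  assumes h: "0 < h" "T \<subseteq> cball z h"
  shows "r * (\<Sum>E\<in>ES. edge_length E) \<le> 8 * h\<^sup>2"
proof -
  define F where "F x = x - z" for x :: "real^2"
  have "F \<in> vpoly 1"
    unfolding F_def by (intro vpoly_rowsI)
      (auto simp: vpoly_real intro!: bipoly_diff bipoly_coord bipoly_const)
  note div = divergence_theorem[OF this]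
  have "divergence F x = 2" for x
  proof -
    have "dir_deriv (axis j 1) F x = axis j 1" for j
      by (rule dir_deriv_eq) (auto simp: F_def[abs_def] intro!: derivative_eq_intros)
    then show ?thesis
      by (simp add: divergence_vpoly[OF \<open>F \<in> vpoly 1\<close>] axis_def)
  qed
  then have "integral T (\<lambda>x. 2 :: real) = (\<Sum>E\<in>ES. sign_TE T E * edge_integral E (\<lambda>x. F x \<bullet> normal E))"
    using div by (metis (no_types, lifting) integral_cong)
  also have "\<dots> \<ge> (\<Sum>E\<in>ES. r * edge_length E)"
  proof (rule sum_mono)
    fix E assume E: "E \<in> ES"
    have n0: "(snd E - fst E) \<bullet> normal E = 0"
      using normal_inner[OF ends[OF E], of "snd E - fst E"] edge_length_pos[OF ends[OF E]] by (simp add: cross2_simps(7))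
    have "F (linepath (fst E) (snd E) s) \<bullet> normal E = (fst E - z) \<bullet> normal E" for s
    proof -
      have "F (linepath (fst E) (snd E) s) = (fst E - z) + s *\<^sub>R (snd E - fst E)"
        by (simp add: F_def linepath_def algebra_simps)
      then show ?thesis using n0 by (simp add: inner_add_left)
    qed
    then have "edge_integral E (\<lambda>x. F x \<bullet> normal E) = edge_length E * ((fst E - z) \<bullet> normal E)"
      by (simp add: edge_integral_def)
    moreover have "sgn m * (edge_length E * m) = \<bar>m\<bar> * edge_length E" for m :: real
      by (simp add: sgn_if)
    ultimately show "r * edge_length E \<le> sign_TE T E * edge_integral E (\<lambda>x. F x \<bullet> normal E)"
      unfolding sign_TE_eq[OF E] using normal_distance[OF E] edge_length_pos[OF ends[OF E]]
      by (simp add: mult_right_mono)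
  qed
  finally have "r * (\<Sum>E\<in>ES. edge_length E) \<le> integral T (\<lambda>x. 2)"
    by (simp add: sum_distrib_left)
  also have "\<dots> \<le> integral (cbox (z - vec h) (z + vec h)) (\<lambda>x. 2)"
  proof (rule integral_subset_le)
    show "T \<subseteq> cbox (z - vec h) (z + vec h)"
    proof
      fix x assume "x \<in> T"
      then have "norm (x - z) \<le> h"
        using h(2) by (auto simp: dist_norm norm_minus_commute)
      then have "\<bar>(x - z) $ i\<bar> \<le> h" for i
        using component_le_norm_cart order_trans by blast
      then have "-h \<le> x $ i - z $ i \<and> x $ i - z $ i \<le> h" for i
        by (simp add: abs_le_iff) (metis minus_le_iff minus_diff_eq)
      then show "x \<in> cbox (z - vec h) (z + vec h)"
        by (simp add: mem_box_cart algebra_simps)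
    qed
    show "(\<lambda>x. 2 :: real) integrable_on T"
      by (rule integrable_on_bounded_open(2)[OF open_T bounded_T]) simp
  qed auto
  also have "\<dots> = 8 * h\<^sup>2"
    using h(1) by (simp add: content_cbox_if_cart interval_eq_empty_cart UNIV_2 power2_eq_square)
  finally show ?thesis .
qed

section \<open>Traces on edges\<close>

lemma bipoly_inner:
  assumes f: "f \<in> vpoly l" and g: "g \<in> vpoly m"
  shows "(\<lambda>x. f x \<bullet> g x) \<in> bipoly (l + m)"
proof -
  have "(\<lambda>x. f x \<bullet> g x) = (\<Sum>b\<in>Basis. (\<lambda>x. (f x \<bullet> b) * (g x \<bullet> b)))"
  proof
    show "f x \<bullet> g x = (\<Sum>b\<in>Basis. (\<lambda>x. (f x \<bullet> b) * (g x \<bullet> b))) x" for x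
      by (subst euclidean_inner) (simp add: sum_fun_apply)
  qed
  also have "\<dots> \<in> bipoly (l + m)"
    by (intro subspace_sum subspace_bipoly bipoly_mult) (use f g in \<open>auto simp: vpoly_def\<close>)
  finally show ?thesis .
qed

lemma dir_deriv_inner:
  assumes f: "f \<in> vpoly l" and g: "g \<in> vpoly m"
  shows "dir_deriv t (\<lambda>x. f x \<bullet> g x) x = dir_deriv t f x \<bullet> g x + f x \<bullet> dir_deriv t g x"
  using dir_deriv_eq[OF has_derivative_inner[OF vpoly_has_derivative[OF f] vpoly_has_derivative[OF g]], of t x]
  by (simp add: add.commute)

lemma edge_integral_tangential:
  assumes E: "fst E \<noteq> snd E" and p: "p \<in> bipoly l"
  shows "edge_integral E (dir_deriv (tangent E) p) = p (snd E) - p (fst E)"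
proof -
  have p': "p \<in> vpoly l" using p by (simp add: vpoly_real)
  have "((\<lambda>s. dir_deriv (snd E - fst E) p (linepath (fst E) (snd E) s)) has_integral
      (p (linepath (fst E) (snd E) 1) - p (linepath (fst E) (snd E) 0))) {0..1}"
    using vpoly_linepath_derivative[OF p'] by (intro fundamental_theorem_of_calculus) auto
  then have "integral {0..1} (\<lambda>s. dir_deriv (snd E - fst E) p (linepath (fst E) (snd E) s)) = p (snd E) - p (fst E)"
    by (simp add: integral_unique linepath_0' linepath_1')
  then show ?thesis
    unfolding edge_length_tangent[OF E] dir_deriv_scale[OF p'] by (simp add: edge_integral_def)
qed

lemma edge_integration_by_parts:
  assumes E: "fst E \<noteq> snd E" and f: "f \<in> vpoly l" and g: "g \<in> vpoly m"
  shows "edge_integral E (\<lambda>x. dir_deriv (tangent E) f x \<bullet> g x) + edge_integral E (\<lambda>x. f x \<bullet> dir_deriv (tangent E) g x)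
    = f (snd E) \<bullet> g (snd E) - f (fst E) \<bullet> g (fst E)"
proof -
  interpret l2_functional "seg E" "edge_integral E" by (rule l2_functional_edge[OF E])
  have "edge_integral E (\<lambda>x. dir_deriv (tangent E) f x \<bullet> g x) + edge_integral E (\<lambda>x. f x \<bullet> dir_deriv (tangent E) g x)
    = edge_integral E (\<lambda>x. dir_deriv (tangent E) f x \<bullet> g x + f x \<bullet> dir_deriv (tangent E) g x)"
    by (intro I_add[symmetric] continuous_on_inner vpoly_continuous[OF f] vpoly_continuous[OF g]
        vpoly_continuous[OF vpoly_dir_deriv[OF f]] vpoly_continuous[OF vpoly_dir_deriv[OF g]])
  also have "\<dots> = edge_integral E (dir_deriv (tangent E) (\<lambda>x. f x \<bullet> g x))"
    using dir_deriv_inner[OF f g] by (intro arg_cong[where f = "edge_integral E"] ext) simp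
  also have "\<dots> = f (snd E) \<bullet> g (snd E) - f (fst E) \<bullet> g (fst E)"
    by (rule edge_integral_tangential[OF E bipoly_inner[OF f g]])
  finally show ?thesis .
qed

lemma dir_deriv_restr_seg:
  assumes E: "fst E \<noteq> snd E" and x: "x \<in> seg E"
  shows "dir_deriv (tangent E) (restr (seg E) f) x = dir_deriv (tangent E) f x"
proof (rule dir_deriv_cong)
  obtain t where t: "t \<in> {0<..<1}" "x = linepath (fst E) (snd E) t"
    using linepath_in_seg(3)[OF E x] by blast
  have "((\<lambda>s. t + s / edge_length E) \<longlongrightarrow> t + 0 / edge_length E) (nhds 0)"
    using edge_length_pos[OF E] by (intro tendsto_intros filterlim_ident) auto
  then have "\<forall>\<^sub>F s in nhds 0. t + s / edge_length E \<in> {0<..<1}"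
    using t(1) by (intro topological_tendstoD) auto
  then show "\<forall>\<^sub>F s in nhds 0. restr (seg E) f (x + s *\<^sub>R tangent E) = f (x + s *\<^sub>R tangent E)"
  proof eventually_elim
    fix s assume s: "t + s / edge_length E \<in> {0<..<1}"
    have "x + s *\<^sub>R tangent E = linepath (fst E) (snd E) (t + s / edge_length E)"
      by (simp add: t(2) linepath_def tangent_def divide_inverse algebra_simps)
    then have "x + s *\<^sub>R tangent E \<in> closure (seg E)"
      using linepath_in_seg(1)[OF E s] closure_subset by auto
    then show "restr (seg E) f (x + s *\<^sub>R tangent E) = f (x + s *\<^sub>R tangent E)"
      by (simp add: restr_def)
  qed
qed

section \<open>Existence and uniqueness of the trace on one edge\<close>

definition edge_coord :: "edge \<Rightarrow> real^2 \<Rightarrow> real" where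
  "edge_coord E x = (x - fst E) \<bullet> tangent E / edge_length E"

lemma edge_coord_bipoly: "edge_coord E \<in> bipoly 1"
proof -
  have "(\<lambda>x :: real^2. x - fst E) \<in> vpoly 1"
    by (intro vpoly_rowsI) (auto simp: vpoly_real intro!: bipoly_diff bipoly_coord bipoly_const)
  from bipoly_scale[OF vpoly_inner[OF this, of "tangent E"], of "1 / edge_length E"]
  show ?thesis by (simp add: edge_coord_def[abs_def])
qed

lemma edge_coord_linepath: 
  assumes E: "fst E \<noteq> snd E"
  shows "edge_coord E (linepath (fst E) (snd E) s) = s"
proof -
  have "linepath (fst E) (snd E) s - fst E = (s * edge_length E) *\<^sub>R tangent E"
    using edge_length_tangent[OF E] by (simp add: linepath_def algebra_simps)
  then show ?thesis
    using norm_tangent[OF E] edge_length_pos[OF E] by (simp add: edge_coord_def norm_eq_1)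
qed

lemma edge_coord_ends:
  assumes E: "fst E \<noteq> snd E"
  shows "edge_coord E (fst E) = 0" "edge_coord E (snd E) = 1"
  using edge_coord_linepath[OF E, of 0] edge_coord_linepath[OF E, of 1] by (simp_all add: linepath_0' linepath_1')

definition bubble :: "edge \<Rightarrow> real^2 \<Rightarrow> real" where
  "bubble E x = edge_coord E x * (1 - edge_coord E x)"

lemma bubble_bipoly: "bubble E \<in> bipoly 2"
  using bipoly_mult[OF edge_coord_bipoly bipoly_diff[OF bipoly_const[of 1 1] edge_coord_bipoly], of E E]
  by (simp add: bubble_def[abs_def])

lemma bubble_pos: "fst E \<noteq> snd E \<Longrightarrow> x \<in> seg E \<Longrightarrow> 0 < bubble E x"
  using linepath_in_seg(3)[of E x] by (auto simp: bubble_def edge_coord_linepath)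

text \<open>The bubble is positive on the open edge, so the weighted integral is still definite.
  Existence and uniqueness of the trace both come from this weighted inner product.\<close>

lemma l2_functional_bubble:
  assumes E: "fst E \<noteq> snd E"
  shows "l2_functional (seg E) (\<lambda>f. edge_integral E (\<lambda>x. bubble E x * f x))"
proof -
  interpret l2_functional "seg E" "edge_integral E" by (rule l2_functional_edge[OF E])
  have c: "continuous_on (closure (seg E)) (\<lambda>x. bubble E x * f x)" if "continuous_on (closure (seg E)) f" for f
    by (intro continuous_on_mult bipoly_continuous[OF bubble_bipoly] that)
  show ?thesis
  proof
    fix f g :: "real^2 \<Rightarrow> real" and r x
    show "edge_integral E (\<lambda>x. bubble E x * f x) = edge_integral E (\<lambda>x. bubble E x * g x)"
      if "\<And>x. x \<in> seg E \<Longrightarrow> f x = g x"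
      using that by (intro I_cong) simp
    assume f: "continuous_on (closure (seg E)) f"
    show "edge_integral E (\<lambda>x. bubble E x * (f x + g x)) = edge_integral E (\<lambda>x. bubble E x * f x) + edge_integral E (\<lambda>x. bubble E x * g x)"
      if "continuous_on (closure (seg E)) g"
      unfolding distrib_left by (rule I_add[OF c[OF f] c[OF that]])
    show "edge_integral E (\<lambda>x. bubble E x * (r * f x)) = r * edge_integral E (\<lambda>x. bubble E x * f x)"
      using I_scale[OF c[OF f], of r] by (simp add: mult_ac)
    assume nn: "\<And>x. x \<in> seg E \<Longrightarrow> 0 \<le> f x"
    have nn': "0 \<le> bubble E x * f x" if "x \<in> seg E" for x
      using nn[OF that] bubble_pos[OF E that] by simp
    show "0 \<le> edge_integral E (\<lambda>x. bubble E x * f x)"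
      by (rule I_nonneg[OF c[OF f] nn'])
    show "f x = 0" if "edge_integral E (\<lambda>x. bubble E x * f x) = 0" "x \<in> seg E"
      using I_definite[OF c[OF f] nn' that] bubble_pos[OF E that(2)] by simp
  qed
qed

lemma poly_edge_coord: "(\<lambda>x. poly q (edge_coord E x)) \<in> bipoly (int (degree q))"
proof -
  have pow: "(\<lambda>x. edge_coord E x ^ n) \<in> bipoly (int n)" for n
  proof (induction n)
    case (Suc n)
    then show ?case using bipoly_mult[OF edge_coord_bipoly Suc] by simp
  qed (simp add: bipoly_const)
  have "(\<lambda>x. poly q (edge_coord E x)) = (\<Sum>i\<le>degree q. coeff q i *\<^sub>R (\<lambda>x. edge_coord E x ^ i))"
    by (auto simp: fun_eq_iff poly_altdef sum_fun_apply)
  also have "\<dots> \<in> bipoly (int (degree q))"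
    by (intro subspace_sum subspace_scale subspace_bipoly) (use bipoly_mono[OF _ pow] in auto)
  finally show ?thesis .
qed

text \<open>On the edge d is a univariate polynomial divisible by \<open>s * (s - 1)\<close>. The
  quotient is extended to the plane as a polynomial in \<open>edge_coord\<close>.\<close>

lemma bubble_factor:
  assumes E: "fst E \<noteq> snd E" and d: "d \<in> bipoly (int k + 2)" and zero: "d (fst E) = 0" "d (snd E) = 0"
  shows "\<exists>e\<in>bipoly (int k). \<forall>x\<in>closure (seg E). d x = bubble E x * e x"
proof -
  obtain q where q: "degree q \<le> nat (int k + 2)" "\<And>s. d (fst E + s *\<^sub>R (snd E - fst E)) = poly q s"
    using bipoly_line[OF d] by blast
  have L: "linepath (fst E) (snd E) s = fst E + s *\<^sub>R (snd E - fst E)" for s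
    by (simp add: linepath_def algebra_simps)
  have "poly q 0 = 0" "poly q 1 = 0"
    using q(2)[of 0] q(2)[of 1] zero by simp_all
  then obtain q1 where q1: "q = [:0, 1:] * q1"
    using poly_eq_0_iff_dvd[of q 0] by (auto elim: dvdE)
  have "poly q1 1 = 0"
    using \<open>poly q 1 = 0\<close> by (simp add: q1)
  then obtain q2 where q2: "q1 = [:-1, 1:] * q2"
    using poly_eq_0_iff_dvd[of q1 1] by (auto elim: dvdE)
  have deg: "degree q2 \<le> k"
  proof (cases "q2 = 0")
    case False
    have "degree q1 = 1 + degree q2"
      unfolding q2 by (subst degree_mult_eq) (use False in auto)
    moreover have "q1 \<noteq> 0"
      using calculation by auto
    then have "degree q = 1 + degree q1"
      unfolding q1 by (subst degree_mult_eq) auto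
    ultimately have "degree q = 2 + degree q2" by simp
    then show ?thesis using q(1) by simp
  qed simp
  \<comment> \<open>The minus sign turns \<open>s * (s - 1)\<close> into the bubble
    \<open>s * (1 - s)\<close>.\<close>
  define e where "e x = - poly q2 (edge_coord E x)" for x
  have "e \<in> bipoly (int k)"
    unfolding e_def using bipoly_uminus[OF bipoly_mono[OF _ poly_edge_coord]] deg by simp
  moreover have "d x = bubble E x * e x" if "x \<in> closure (seg E)" for x
  proof -
    have "x \<in> closed_segment (fst E) (snd E)"
      using that closure_seg[OF E] by simp
    then obtain s where s: "x = linepath (fst E) (snd E) s"
      unfolding closed_segment_def linepath_def by blast
    have "d x = poly q s" unfolding s L q(2) ..
    then show ?thesis
      unfolding e_def bubble_def s edge_coord_linepath[OF E] by (simp add: q1 q2 algebra_simps)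
  qed
  ultimately show ?thesis by blast
qed

definition is_edge_trace :: "nat \<Rightarrow> edge \<Rightarrow> h1_vec \<Rightarrow> (real^2 \<Rightarrow> real^2) \<Rightarrow> bool" where
  "is_edge_trace k E v g \<longleftrightarrow> g \<in> vpoly (int k + 2) \<and> g (fst E) = h1_vert v (fst E) \<and> g (snd E) = h1_vert v (snd E) \<and>
    (\<forall>q\<in>vpoly (int k). edge_integral E (\<lambda>x. g x \<bullet> q x) = edge_integral E (\<lambda>x. h1_edge v E x \<bullet> q x))"

text \<open>Only the values on the edge are determined; a plane polynomial is chosen so that it can
  be differentiated freely. It depends on the edge and not on an element, which makes the trace
  single-valued.\<close>

definition edge_trace :: "nat \<Rightarrow> edge \<Rightarrow> h1_vec \<Rightarrow> real^2 \<Rightarrow> real^2" where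
  "edge_trace k E v = (SOME g. is_edge_trace k E v g)"

lemma continuous_on_polys:
  assumes "fst E \<noteq> snd E" "f \<in> restr (seg E) ` vpoly l"
  shows "continuous_on (closure (seg E)) f"
proof -
  interpret l2_functional "seg E" "edge_integral E" by (rule l2_functional_edge[OF assms(1)])
  obtain g where g: "f = restr (seg E) g" "g \<in> vpoly l" using assms(2) by blast
  show ?thesis
    unfolding g(1) by (rule cfun_D[OF restr_cfun[OF vpoly_continuous[OF g(2)]]])
qed

text \<open>Ansatz: linear interpolant of the vertex unknowns plus bubble times u. The bubble leaves
  the end values alone, and the moment conditions become a weighted Riesz problem for u of degree
  k.\<close>

lemma edge_trace:
  assumes E: "fst E \<noteq> snd E" and v: "h1_edge v E \<in> by_rows (polys (int k) (seg E))"
  shows "is_edge_trace k E v (edge_trace k E v)"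
proof -
  interpret l2_functional "seg E" "edge_integral E" by (rule l2_functional_edge[OF E])
  interpret B: l2_functional "seg E" "\<lambda>f. edge_integral E (\<lambda>x. bubble E x * f x)"
    by (rule l2_functional_bubble[OF E])
  define \<alpha> where "\<alpha> = h1_vert v (fst E)"
  define \<beta> where "\<beta> = h1_vert v (snd E)"
  define g0 where "g0 x = \<alpha> + edge_coord E x *\<^sub>R (\<beta> - \<alpha>)" for x
  have g0: "g0 \<in> vpoly (int k + 2)"
    unfolding g0_def by (intro vpoly_add vpoly_const vpoly_scaleR_const bipoly_mono[OF _ edge_coord_bipoly]) auto
  define m where "m x = h1_edge v E x - g0 x" for x
  have cv: "continuous_on (closure (seg E)) (h1_edge v E)"
    using continuous_on_polys[OF E] v by (simp add: by_rows_polys)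
  have cm: "continuous_on (closure (seg E)) m"
    unfolding m_def by (intro continuous_on_diff cv vpoly_continuous[OF g0])
  define l where "l q = edge_integral E (\<lambda>x. m x \<bullet> q x)" for q :: "real^2 \<Rightarrow> real^2"
  note cq = continuous_on_polys[OF E]
  have "\<exists>u\<in>restr (seg E) ` vpoly (int k). \<forall>q\<in>restr (seg E) ` vpoly (int k).
      edge_integral E (\<lambda>x. bubble E x * (u x \<bullet> q x)) = l q"
  proof (rule B.Riesz_vpoly)
    fix x y :: "real^2 \<Rightarrow> real^2" and r
    assume x: "x \<in> restr (seg E) ` vpoly (int k)"
    show "l (r *\<^sub>R x) = r * l x"
      using I_scale[OF continuous_on_inner[OF cm cq[OF x]], of r] by (simp add: l_def)
    assume y: "y \<in> restr (seg E) ` vpoly (int k)"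
    show "l (x + y) = l x + l y"
      using I_add[OF continuous_on_inner[OF cm cq[OF x]] continuous_on_inner[OF cm cq[OF y]]]
      by (simp add: l_def inner_add_right)
  qed
  then obtain u where u: "u \<in> vpoly (int k)"
    "\<And>q. q \<in> vpoly (int k) \<Longrightarrow> edge_integral E (\<lambda>x. bubble E x * (restr (seg E) u x \<bullet> restr (seg E) q x)) = l (restr (seg E) q)"
    by blast
  define g where "g x = g0 x + bubble E x *\<^sub>R u x" for x
  have "(\<lambda>x. bubble E x *\<^sub>R u x) \<in> vpoly (int k + 2)"
    using vpoly_scaleR[OF bubble_bipoly u(1)] by (simp add: add.commute)
  then have "g \<in> vpoly (int k + 2)"
    unfolding g_def using g0 by (intro vpoly_add)
  moreover have "g (fst E) = h1_vert v (fst E)" "g (snd E) = h1_vert v (snd E)"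
    using edge_coord_ends[OF E] by (simp_all add: g_def g0_def bubble_def \<alpha>_def \<beta>_def)
  moreover have "edge_integral E (\<lambda>x. g x \<bullet> q x) = edge_integral E (\<lambda>x. h1_edge v E x \<bullet> q x)"
    if q: "q \<in> vpoly (int k)" for q
  proof -
    have r: "restr (seg E) f x = f x" if "x \<in> seg E" for f :: "real^2 \<Rightarrow> real^2" and x
      using that closure_subset[of "seg E"] by (auto simp: restr_def)
    have c: "continuous_on (closure (seg E)) (\<lambda>x. g0 x \<bullet> q x)" "continuous_on (closure (seg E)) (\<lambda>x. bubble E x * (u x \<bullet> q x))"
      "continuous_on (closure (seg E)) (\<lambda>x. m x \<bullet> q x)"
      by (intro continuous_on_inner continuous_on_mult vpoly_continuous[OF g0] vpoly_continuous[OF q] vpoly_continuous[OF u(1)]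
          bipoly_continuous[OF bubble_bipoly] cm)+
    have "edge_integral E (\<lambda>x. g x \<bullet> q x) = edge_integral E (\<lambda>x. g0 x \<bullet> q x + bubble E x * (u x \<bullet> q x))"
      by (simp add: g_def inner_add_left)
    also have "\<dots> = edge_integral E (\<lambda>x. g0 x \<bullet> q x) + edge_integral E (\<lambda>x. bubble E x * (u x \<bullet> q x))"
      by (rule I_add[OF c(1,2)])
    also have "edge_integral E (\<lambda>x. bubble E x * (u x \<bullet> q x)) = l (restr (seg E) q)"
      unfolding u(2)[OF q, symmetric] by (intro I_cong) (simp add: r)
    also have "\<dots> = edge_integral E (\<lambda>x. m x \<bullet> q x)"
      unfolding l_def by (intro I_cong) (simp add: r)
    also have "edge_integral E (\<lambda>x. g0 x \<bullet> q x) + edge_integral E (\<lambda>x. m x \<bullet> q x)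
        = edge_integral E (\<lambda>x. g0 x \<bullet> q x + m x \<bullet> q x)"
      by (rule I_add[OF c(1,3), symmetric])
    also have "\<dots> = edge_integral E (\<lambda>x. h1_edge v E x \<bullet> q x)"
      by (simp add: m_def inner_diff_left)
    finally show ?thesis .
  qed
  ultimately have "is_edge_trace k E v g" by (simp add: is_edge_trace_def)
  then show ?thesis
    unfolding edge_trace_def by (rule someI[of "is_edge_trace k E v"])
qed

text \<open>Write d as bubble times e and use e, of degree k, as test function.\<close>

lemma edge_trace_unique_scalar:
  assumes E: "fst E \<noteq> snd E" and d: "d \<in> bipoly (int k + 2)" "d (fst E) = 0" "d (snd E) = 0"
    and moments: "\<And>q. q \<in> bipoly (int k) \<Longrightarrow> edge_integral E (\<lambda>x. d x * q x) = 0"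
    and x: "x \<in> closure (seg E)"
  shows "d x = 0"
proof -
  interpret l2_functional "seg E" "edge_integral E" by (rule l2_functional_edge[OF E])
  interpret B: l2_functional "seg E" "\<lambda>f. edge_integral E (\<lambda>x. bubble E x * f x)"
    by (rule l2_functional_bubble[OF E])
  obtain e where e: "e \<in> bipoly (int k)" "\<And>x. x \<in> closure (seg E) \<Longrightarrow> d x = bubble E x * e x"
    using bubble_factor[OF E d] by blast
  have "edge_integral E (\<lambda>x. bubble E x * (e x \<bullet> e x)) = edge_integral E (\<lambda>x. d x * e x)"
    using e(2) closure_subset[of "seg E"] by (intro I_cong) (auto simp: mult_ac)
  also have "\<dots> = 0" by (rule moments[OF e(1)])
  finally have "e x = 0"
    using B.zero_on_closure[OF bipoly_continuous[OF e(1)] _ x] by blast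
  then show ?thesis using e(2)[OF x] by simp
qed

text \<open>For w of degree k + 1 the tangential derivative has degree k, where edge unknown and
  trace have the same moments. The definition is then an exact integration by parts of the
  trace.\<close>

lemma grad_edge_eq:
  assumes E: "fst E \<noteq> snd E" and v: "h1_edge v E \<in> by_rows (polys (int k) (seg E))"
  shows "grad_edge k E v = restr (seg E) (dir_deriv (tangent E) (edge_trace k E v))"
proof -
  interpret l2_functional "seg E" "edge_integral E" by (rule l2_functional_edge[OF E])
  let ?g = "edge_trace k E v" and ?t = "tangent E"
  have g: "?g \<in> vpoly (int k + 2)" "?g (fst E) = h1_vert v (fst E)" "?g (snd E) = h1_vert v (snd E)"
    "\<And>q. q \<in> vpoly (int k) \<Longrightarrow> edge_integral E (\<lambda>x. ?g x \<bullet> q x) = edge_integral E (\<lambda>x. h1_edge v E x \<bullet> q x)"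
    using edge_trace[OF E v] by (auto simp: is_edge_trace_def)
  have dg: "dir_deriv ?t ?g \<in> vpoly (int k + 1)"
    using vpoly_dir_deriv[OF g(1), of ?t] by (simp add: add.commute)
  have r: "restr (seg E) f x = f x" if "x \<in> seg E" for f :: "real^2 \<Rightarrow> real^2" and x
    using that closure_subset[of "seg E"] by (auto simp: restr_def)
  have rhs: "- edge_integral E (\<lambda>x. h1_edge v E x \<bullet> dir_deriv ?t (restr (seg E) w) x)
      + (\<Sum>V\<in>verts_of_edge E. sign_EV E V * (h1_vert v V \<bullet> restr (seg E) w V))
    = edge_integral E (\<lambda>x. restr (seg E) (dir_deriv ?t ?g) x \<bullet> restr (seg E) w x)"
    if w: "w \<in> vpoly (int k + 1)" for w
  proof -
    have dw: "dir_deriv ?t w \<in> vpoly (int k)"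
      using vpoly_dir_deriv[OF w] by simp
    have "edge_integral E (\<lambda>x. h1_edge v E x \<bullet> dir_deriv ?t (restr (seg E) w) x)
        = edge_integral E (\<lambda>x. h1_edge v E x \<bullet> dir_deriv ?t w x)"
      by (intro I_cong) (simp add: dir_deriv_restr_seg[OF E])
    also have "\<dots> = edge_integral E (\<lambda>x. ?g x \<bullet> dir_deriv ?t w x)"
      using g(4)[OF dw] by simp
    finally have 1: "edge_integral E (\<lambda>x. h1_edge v E x \<bullet> dir_deriv ?t (restr (seg E) w) x)
        = edge_integral E (\<lambda>x. ?g x \<bullet> dir_deriv ?t w x)" .
    have "fst E \<in> closure (seg E)" "snd E \<in> closure (seg E)"
      by (simp_all add: closure_seg[OF E])
    then have 2: "(\<Sum>V\<in>verts_of_edge E. sign_EV E V * (h1_vert v V \<bullet> restr (seg E) w V))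
      = ?g (snd E) \<bullet> w (snd E) - ?g (fst E) \<bullet> w (fst E)"
      using E g(2,3) by (simp add: verts_of_edge_def sign_EV_def restr_def)
    have 3: "edge_integral E (\<lambda>x. restr (seg E) (dir_deriv ?t ?g) x \<bullet> restr (seg E) w x)
      = edge_integral E (\<lambda>x. dir_deriv ?t ?g x \<bullet> w x)"
      by (intro I_cong) (simp add: r)
    show ?thesis
      unfolding 1 2 3 using edge_integration_by_parts[OF E g(1) w] by simp
  qed
  show ?thesis
    unfolding grad_edge_def by_rows_polys
  proof (rule the_equality)
    show "restr (seg E) (dir_deriv ?t ?g) \<in> restr (seg E) ` vpoly (int k + 1) \<and>
      (\<forall>w\<in>restr (seg E) ` vpoly (int k + 1). edge_integral E (\<lambda>x. restr (seg E) (dir_deriv ?t ?g) x \<bullet> w x) =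
        - edge_integral E (\<lambda>x. h1_edge v E x \<bullet> dir_deriv ?t w x) + (\<Sum>V\<in>verts_of_edge E. sign_EV E V * (h1_vert v V \<bullet> w V)))"
      using dg rhs by auto
    fix G assume G: "G \<in> restr (seg E) ` vpoly (int k + 1) \<and>
      (\<forall>w\<in>restr (seg E) ` vpoly (int k + 1). edge_integral E (\<lambda>x. G x \<bullet> w x) =
        - edge_integral E (\<lambda>x. h1_edge v E x \<bullet> dir_deriv ?t w x) + (\<Sum>V\<in>verts_of_edge E. sign_EV E V * (h1_vert v V \<bullet> w V)))"
    show "G = restr (seg E) (dir_deriv ?t ?g)"
      by (rule Riesz_unique_vpoly[of G "int k + 1"]) (use G rhs dg in auto)
  qed
qed

section \<open>Reconstruction operators on an element\<close>

lemma dir_deriv_add: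
  assumes f: "f \<in> vpoly l" and g: "g \<in> vpoly m"
  shows "dir_deriv t (\<lambda>y. f y + g y) x = dir_deriv t f x + dir_deriv t g x"
  by (rule dir_deriv_eq[OF has_derivative_add[OF vpoly_has_derivative[OF f] vpoly_has_derivative[OF g]]])

lemma dir_deriv_scaleR:
  assumes f: "f \<in> vpoly l"
  shows "dir_deriv t (\<lambda>y. r *\<^sub>R f y) x = r *\<^sub>R dir_deriv t f x"
  by (rule dir_deriv_eq[OF has_derivative_scaleR_right[OF vpoly_has_derivative[OF f]]])

lemma rowwise_divergence:
  assumes Z: "Z \<in> vpoly l"
  shows "rowwise divergence Z = (\<lambda>x. \<chi> i. dir_deriv (axis 1 1) Z x $ i $ 1 + dir_deriv (axis 2 1) Z x $ i $ 2)"
  by (auto simp: rowwise_def fun_eq_iff vec_eq_iff divergence_vpoly[OF vpoly_component[OF Z]] dir_deriv_component[OF Z])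

lemma rowwise_divergence_vpoly:
  assumes Z: "Z \<in> vpoly l"
  shows "rowwise divergence Z \<in> vpoly (l - 1)"
proof (rule vpoly_rowsI)
  show "(\<lambda>x. rowwise divergence Z x $ i) \<in> vpoly (l - 1)" for i
    unfolding rowwise_divergence[OF Z] using vpoly_dir_deriv[OF Z]
    by (simp add: vpoly_add vpoly_component)
qed

lemma rowwise_divergence_add:
  assumes "Z \<in> vpoly l" "W \<in> vpoly l"
  shows "rowwise divergence (\<lambda>x. Z x + W x) x = rowwise divergence Z x + rowwise divergence W x"
  unfolding rowwise_divergence[OF vpoly_add[OF assms]] rowwise_divergence[OF assms(1)] rowwise_divergence[OF assms(2)]
  by (simp add: dir_deriv_add[OF assms] vec_eq_iff)

lemma rowwise_divergence_scale:
  assumes "Z \<in> vpoly l"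
  shows "rowwise divergence (\<lambda>x. r *\<^sub>R Z x) x = r *\<^sub>R rowwise divergence Z x"
  unfolding rowwise_divergence[OF vpoly_scale[OF assms]] rowwise_divergence[OF assms(1)]
  by (simp add: dir_deriv_scaleR[OF assms] vec_eq_iff distrib_left)

section \<open>Curls, radial fields and the Koszul decomposition\<close>

lemma curl_eq: "q \<in> bipoly l \<Longrightarrow> curl q x \<bullet> normal E = - dir_deriv (tangent E) q x"
  using dir_deriv_linear[of q l "tangent E" x] by (simp add: vpoly_real curl_def normal_def inner_vec_def sum_2)

lemma curl_vpoly:
  assumes q: "q \<in> bipoly l"
  shows "curl q \<in> vpoly (l - 1)"
proof (rule vpoly_rowsI)
  show "(\<lambda>x. curl q x $ i) \<in> vpoly (l - 1)" for i
    using exhaust_2[of i] bipoly_dir_deriv[OF q] bipoly_uminus[OF bipoly_dir_deriv[OF q]]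
    by (auto simp: curl_def vpoly_real)
qed

lemma curl_add: "p \<in> bipoly l \<Longrightarrow> q \<in> bipoly l \<Longrightarrow> curl (\<lambda>x. p x + q x) x = curl p x + curl q x"
  using dir_deriv_add[of p l q l] by (simp add: curl_def vpoly_real vec_eq_iff forall_2)

lemma curl_scale: "p \<in> bipoly l \<Longrightarrow> curl (\<lambda>x. r * p x) x = r *\<^sub>R curl p x"
  using dir_deriv_scaleR[of p l] by (simp add: curl_def vpoly_real vec_eq_iff forall_2)

lemma monomial2_partials_commute:
  "dir_deriv (axis 1 1) (dir_deriv (axis 2 1) (monomial2 i j)) x = dir_deriv (axis 2 1) (dir_deriv (axis 1 1) (monomial2 i j)) x"
proof -
  have 1: "dir_deriv (axis 1 1) (monomial2 i j) = (\<lambda>x. real i *\<^sub>R monomial2 (i - 1) j x)" for i j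
    by (rule ext, subst dir_deriv_eq[OF monomial2_has_derivative]) (simp add: axis_def)
  have 2: "dir_deriv (axis 2 1) (monomial2 i j) = (\<lambda>x. real j *\<^sub>R monomial2 i (j - 1) x)" for i j
    by (rule ext, subst dir_deriv_eq[OF monomial2_has_derivative]) (simp add: axis_def)
  have m: "monomial2 i j \<in> vpoly (int i + int j)" for i j
    by (simp add: vpoly_real monomial2_in_bipoly)
  show ?thesis
    unfolding 1 2 dir_deriv_scaleR[OF m] by simp
qed

lemma partials_commute:
  assumes "p \<in> bipoly l"
  shows "dir_deriv (axis 1 1) (dir_deriv (axis 2 1) p) x = dir_deriv (axis 2 1) (dir_deriv (axis 1 1) p) x"
proof -
  have "p \<in> bipoly l \<and> dir_deriv (axis 1 1) (dir_deriv (axis 2 1) p) = dir_deriv (axis 2 1) (dir_deriv (axis 1 1) p)"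
    using assms
  proof (induction rule: bipoly_induct)
    case (monomial i j)
    then show ?case using monomial2_partials_commute monomial2_in_bipoly by auto
  next
    case zero
    have "dir_deriv t (\<lambda>x. 0 :: real) = (\<lambda>x. 0)" for t
      by (rule ext, rule dir_deriv_eq[OF has_derivative_const])
    then show ?case by (simp add: bipoly_zero)
  next
    case (add p q)
    then have pq: "p \<in> vpoly l" "q \<in> vpoly l" by (simp_all add: vpoly_real)
    have "dir_deriv s (dir_deriv t (\<lambda>x. p x + q x)) = (\<lambda>x. dir_deriv s (dir_deriv t p) x + dir_deriv s (dir_deriv t q) x)" for s t
      unfolding dir_deriv_add[OF pq, abs_def] dir_deriv_add[OF vpoly_dir_deriv[OF pq(1)] vpoly_dir_deriv[OF pq(2)], abs_def] ..
    then show ?case using add bipoly_add by auto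
  next
    case (scale c p)
    then have p: "p \<in> vpoly l" by (simp add: vpoly_real)
    have "dir_deriv s (dir_deriv t (\<lambda>x. c *\<^sub>R p x)) = (\<lambda>x. c *\<^sub>R dir_deriv s (dir_deriv t p) x)" for s t
      unfolding dir_deriv_scaleR[OF p, abs_def] dir_deriv_scaleR[OF vpoly_dir_deriv[OF p], abs_def] ..
    then show ?case using scale bipoly_scale by auto
  qed
  then show ?thesis by simp
qed

lemma divergence_curl:
  assumes q: "q \<in> bipoly l"
  shows "divergence (curl q) x = 0"
proof -
  have "(\<lambda>y. curl q y $ 1) = dir_deriv (axis 2 1) q" "(\<lambda>y. curl q y $ 2) = (\<lambda>y. (- 1) *\<^sub>R dir_deriv (axis 1 1) q y)"
    by (auto simp: curl_def)
  then show ?thesis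
    using partials_commute[OF q, of x] dir_deriv_scaleR[of "dir_deriv (axis 1 1) q" "l - 1" "axis 2 1" "-1" x]
      bipoly_dir_deriv[OF q]
    by (simp add: divergence_def sum_2 vpoly_real)
qed

text \<open>With \<open>\<xi> = x - c\<close>, the identity \<open>\<xi> div F - curl (\<xi> \<times> F) = F + (\<xi> \<cdot> \<nabla>) F\<close> gives the
  decomposition, its right-hand side being surjective in \<open>F\<close>.\<close>

lemma Koszul_decomposition:
  fixes F :: "real^2 \<Rightarrow> real^2"
  assumes F: "F \<in> vpoly l"
  shows "\<exists>q\<in>bipoly (l + 1). \<exists>p\<in>bipoly (l - 1). F = (\<lambda>x. curl q x + p x *\<^sub>R (x - c))"
proof -
  have Fi: "(\<lambda>x. F x $ i) \<in> bipoly l" for i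
    using vpoly_component[OF F] by (simp add: vpoly_real)
  obtain f1 f2 where f: "f1 \<in> bipoly l" "f2 \<in> bipoly l" "euler 1 c f1 = (\<lambda>x. F x $ 1)" "euler 1 c f2 = (\<lambda>x. F x $ 2)"
    using euler_surj[of 1 _ l c] Fi by (metis order_refl)
  define q where "q x = (x - c) $ 2 * f1 x - (x - c) $ 1 * f2 x" for x
  define p where "p x = dir_deriv (axis 1 1) f1 x + dir_deriv (axis 2 1) f2 x" for x
  have co: "(\<lambda>x. (x - c) $ i) \<in> bipoly 1" for i
    using bipoly_diff[OF bipoly_coord[of 1 i] bipoly_const[of 1 "c $ i"]] by simp
  have q: "q \<in> bipoly (l + 1)"
    unfolding q_def using bipoly_diff[OF bipoly_mult[OF co[of 2] f(1)] bipoly_mult[OF co[of 1] f(2)]]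
    by (simp add: add.commute)
  have p: "p \<in> bipoly (l - 1)"
    unfolding p_def by (intro bipoly_add bipoly_dir_deriv f)
  have dq: "dir_deriv t q x = (t $ 2 * f1 x + (x - c) $ 2 * dir_deriv t f1 x) - (t $ 1 * f2 x + (x - c) $ 1 * dir_deriv t f2 x)" for t x
    unfolding q_def[abs_def]
    by (rule dir_deriv_eq) (rule derivative_eq_intros bounded_linear.has_derivative[OF bounded_linear_vec_nth]
      bipoly_has_derivative[OF f(1)] bipoly_has_derivative[OF f(2)] refl | simp add: fun_eq_iff)+
  have "F x = curl q x + p x *\<^sub>R (x - c)" for x
    using fun_cong[OF f(3), of x] fun_cong[OF f(4), of x]
    unfolding euler_expand[OF f(1)] euler_expand[OF f(2)] curl_def dq p_def
    by (simp add: vec_eq_iff forall_2 axis_def algebra_simps)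
  then show ?thesis using q p by blast
qed

lemma subspace_eq_span:
  fixes W :: "'a::real_vector set"
  assumes "finite B" "subspace W" "W \<subseteq> span B"
  shows "\<exists>B'. finite B' \<and> W = span B'"
proof -
  obtain B' where B': "B' \<subseteq> W" "independent B'" "W \<subseteq> span B'"
    using maximal_independent_subset[of W] by metis
  have "finite B'"
    using independent_span_bound[OF assms(1) B'(2)] B'(1) assms(3) by auto
  moreover have "W = span B'"
    using B' assms(2) by (simp add: span_minimal subset_antisym)
  ultimately show ?thesis by blast
qed

lemma (in l2_functional) l2_proj_subspace:
  fixes W :: "(real^2 \<Rightarrow> 'b::euclidean_space) set"
  assumes W: "subspace W" "W \<subseteq> restr Y ` vpoly l" and f: "continuous_on (closure Y) f"
  shows "l2_proj I W f \<in> W" and "\<And>q. q \<in> W \<Longrightarrow> I (\<lambda>x. l2_proj I W f x \<bullet> q x) = I (\<lambda>x. f x \<bullet> q x)"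
proof -
  obtain B where B: "finite B" "W = span B"
    using subspace_eq_span[OF finite_imageI[OF finite_vmonomials, of "restr Y" l] W(1)] W(2)
    unfolding restr_vpoly_span by blast
  have "W \<subseteq> cfun"
    using W(2) by (auto intro: restr_cfun vpoly_continuous)
  then have "B \<subseteq> cfun"
    using B(2) span_superset by blast
  from l2_proj_exists[OF B(1) this f] show "l2_proj I W f \<in> W"
    "\<And>q. q \<in> W \<Longrightarrow> I (\<lambda>x. l2_proj I W f x \<bullet> q x) = I (\<lambda>x. f x \<bullet> q x)"
    unfolding B(2) by auto
qed

text \<open>A projection is invisible when tested against its own space, and tensors inherit this
  row by row.\<close>

lemma (in l2_functional) rowwise_l2_proj:
  fixes W :: "(real^2 \<Rightarrow> 'b::euclidean_space) set" and f :: "real^2 \<Rightarrow> 'b^2"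
  assumes W: "subspace W" "W \<subseteq> restr Y ` vpoly l" and f: "continuous_on (closure Y) f" and q: "q \<in> by_rows W"
  shows "I (\<lambda>x. rowwise (l2_proj I W) f x \<bullet> q x) = I (\<lambda>x. f x \<bullet> q x)"
proof -
  have fi: "continuous_on (closure Y) (\<lambda>x. f x $ i)" for i
    by (intro continuous_intros f)
  have qi: "(\<lambda>x. q x $ i) \<in> W" for i
    using q by (simp add: by_rows_def)
  have cW: "continuous_on (closure Y) g" if "g \<in> W" for g
    using that W(2) by (auto intro: cfun_D restr_cfun vpoly_continuous)
  note proj = l2_proj_subspace[OF W fi]
  have "I (\<lambda>x. rowwise (l2_proj I W) f x \<bullet> q x) = I (\<lambda>x. \<Sum>i\<in>UNIV. l2_proj I W (\<lambda>y. f y $ i) x \<bullet> q x $ i)"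
    by (simp add: rowwise_def inner_vec_def)
  also have "\<dots> = (\<Sum>i\<in>UNIV. I (\<lambda>x. l2_proj I W (\<lambda>y. f y $ i) x \<bullet> q x $ i))"
    by (rule I_sum) (auto intro!: continuous_on_inner cW proj(1) qi)
  also have "\<dots> = (\<Sum>i\<in>UNIV. I (\<lambda>x. f x $ i \<bullet> q x $ i))"
    using proj(2)[OF qi] by simp
  also have "\<dots> = I (\<lambda>x. \<Sum>i\<in>UNIV. f x $ i \<bullet> q x $ i)"
    by (rule I_sum[symmetric]) (auto intro!: continuous_on_inner cW fi qi)
  also have "\<dots> = I (\<lambda>x. f x \<bullet> q x)"
    by (simp add: inner_vec_def)
  finally show ?thesis .
qed

text \<open>The tensor product of p and \<open>x - c\<close>; for polynomial p these fields are,
  before restriction to T, the members of \<open>Rc_space\<close> taken row-wise.\<close>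

definition outer :: "real^2 \<Rightarrow> (real^2 \<Rightarrow> real^2) \<Rightarrow> real^2 \<Rightarrow> real^2^2" where
  "outer c p x = (\<chi> i. p x $ i *\<^sub>R (x - c))"

lemma outer_vpoly:
  assumes p: "p \<in> vpoly l"
  shows "outer c p \<in> vpoly (l + 1)"
proof (rule vpoly_rowsI)
  have "(\<lambda>x. x - c) \<in> vpoly 1"
    by (intro vpoly_rowsI) (auto simp: vpoly_real intro!: bipoly_diff bipoly_coord bipoly_const)
  then show "(\<lambda>x. outer c p x $ i) \<in> vpoly (l + 1)" for i
    using vpoly_scaleR[of "\<lambda>x. p x $ i" l "\<lambda>x. x - c" 1] vpoly_component[OF p, of i]
    by (simp add: outer_def vpoly_real)
qed

text \<open>The 2 is the dimension, the divergence of \<open>x - c\<close>. Taking the divergence of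
  radial fields is thus a bijection of polynomials of given degree, which makes the potential
  well-defined.\<close>

lemma divergence_radial:
  assumes p: "p \<in> bipoly l"
  shows "divergence (\<lambda>x. p x *\<^sub>R (x - c)) x = euler 2 c p x"
proof -
  have d: "dir_deriv t (\<lambda>x. p x * (x - c) $ i) x = p x * t $ i + dir_deriv t p x * (x - c) $ i" for t i
    by (rule dir_deriv_eq) (rule derivative_eq_intros bounded_linear.has_derivative[OF bounded_linear_vec_nth]
      bipoly_has_derivative[OF p] refl | simp add: fun_eq_iff)+
  have "divergence (\<lambda>x. p x *\<^sub>R (x - c)) x = (\<Sum>j\<in>UNIV. dir_deriv (axis j 1) (\<lambda>x. p x * (x - c) $ j) x)"
    by (simp add: divergence_def)
  also have "\<dots> = euler 2 c p x"
    unfolding d euler_expand[OF p] by (simp add: sum_2 axis_def algebra_simps)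
  finally show ?thesis .
qed

lemma rowwise_divergence_outer:
  assumes p: "p \<in> vpoly l"
  shows "rowwise divergence (outer c p) = rowwise (euler 2 c) p"
proof
  fix x
  have "(\<lambda>x. p x $ i) \<in> bipoly l" for i
    using vpoly_component[OF p] by (simp add: vpoly_real)
  from divergence_radial[OF this] show "rowwise divergence (outer c p) x = rowwise (euler 2 c) p x"
    by (simp add: rowwise_def outer_def vec_eq_iff)
qed

lemma bij_betw_rowwise:
  assumes "bij_betw A S S"
  shows "bij_betw (rowwise A) (by_rows S) (by_rows S)"
proof (rule bij_betwI')
  fix f g :: "real^2 \<Rightarrow> 'a^2"
  assume f: "f \<in> by_rows S"
  then have fi: "(\<lambda>x. f x $ i) \<in> S" for i by (simp add: by_rows_def)
  show "rowwise A f \<in> by_rows S"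
    using fi bij_betwE[OF assms] by (simp add: by_rows_def rowwise_def)
  assume "g \<in> by_rows S"
  then have gi: "(\<lambda>x. g x $ i) \<in> S" for i by (simp add: by_rows_def)
  have "f = g" if "rowwise A f = rowwise A g"
  proof -
    have "A (\<lambda>x. f x $ i) = A (\<lambda>x. g x $ i)" for i
      using that by (simp add: rowwise_def fun_eq_iff vec_eq_iff)
    then have "(\<lambda>x. f x $ i) = (\<lambda>x. g x $ i)" for i
      using bij_betw_imp_inj_on[OF assms] fi gi by (auto dest: inj_onD)
    then show ?thesis by (simp add: fun_eq_iff vec_eq_iff)
  qed
  then show "rowwise A f = rowwise A g \<longleftrightarrow> f = g" by blast
next
  fix g :: "real^2 \<Rightarrow> 'a^2"
  assume "g \<in> by_rows S"
  then have "(\<lambda>x. g x $ i) \<in> A ` S" for i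
    unfolding bij_betw_imp_surj_on[OF assms] by (simp add: by_rows_def)
  then have "\<forall>i. \<exists>h. h \<in> S \<and> A h = (\<lambda>x. g x $ i)"
    unfolding image_iff by metis
  then obtain h where h: "\<And>i. h i \<in> S" "\<And>i. A (h i) = (\<lambda>x. g x $ i)" by metis
  show "\<exists>f\<in>by_rows S. g = rowwise A f"
    by (rule bexI[of _ "\<lambda>x. \<chi> i. h i x"]) (use h in \<open>auto simp: by_rows_def rowwise_def fun_eq_iff vec_eq_iff\<close>)
qed

lemma euler_rowwise_bij: "bij_betw (rowwise (euler 2 c)) (vpoly l :: (real^2 \<Rightarrow> real^2) set) (vpoly l)"
  using bij_betw_rowwise[OF euler_bij[of 2 c l]] by (simp add: by_rows_bipoly)

lemma rowwise_euler_add: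
  assumes "p \<in> vpoly l" "q \<in> vpoly l"
  shows "rowwise (euler 2 c) (p + q) = rowwise (euler 2 c) p + rowwise (euler 2 c) q"
proof -
  have c: "(\<lambda>x. p x $ i) \<in> bipoly l" "(\<lambda>x. q x $ i) \<in> bipoly l" for i
    using vpoly_component[OF assms(1)] vpoly_component[OF assms(2)] by (simp_all add: vpoly_real)
  show ?thesis
    using euler_add[OF c] by (auto simp: rowwise_def fun_eq_iff vec_eq_iff plus_fun_def)
qed

lemma rowwise_euler_scale:
  assumes "p \<in> vpoly l"
  shows "rowwise (euler 2 c) (r *\<^sub>R p) = r *\<^sub>R rowwise (euler 2 c) p"
proof -
  have c: "(\<lambda>x. p x $ i) \<in> bipoly l" for i
    using vpoly_component[OF assms] by (simp add: vpoly_real)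
  show ?thesis
    using euler_scale[OF c] by (auto simp: rowwise_def fun_eq_iff vec_eq_iff scaleR_fun_def)
qed

lemma inj_on_restr:
  assumes "open Y" "Y \<noteq> {}"
  shows "inj_on (restr Y) (vpoly l :: (real^2 \<Rightarrow> 'b::euclidean_space) set)"
proof (rule inj_onI)
  fix f g :: "real^2 \<Rightarrow> 'b"
  assume fg: "f \<in> vpoly l" "g \<in> vpoly l" "restr Y f = restr Y g"
  obtain a where a: "a \<in> Y" using assms by blast
  show "f = g"
  proof
    fix x
    have "f x \<bullet> b = g x \<bullet> b" for b
    proof -
      have "(\<lambda>x. (f x - g x) \<bullet> b) \<in> bipoly l"
        using vpoly_inner[OF vpoly_diff[OF fg(1,2)]] .
      moreover have "(f y - g y) \<bullet> b = 0" if "y \<in> Y" for y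
        using fun_cong[OF fg(3), of y] that closure_subset[of Y] by (auto simp: restr_def)
      ultimately have "(f x - g x) \<bullet> b = 0"
        using bipoly_identity[OF _ assms(1) a] by blast
      then show ?thesis by (simp add: inner_diff_left)
    qed
    then show "f x = g x" using vector_eq_rdot by blast
  qed
qed

locale mesh_element = star_polygon T z r "edges_of M T" for M :: mesh and T z r +
  fixes k :: nat and v :: h1_vec
  assumes v_elem: "h1_elem v T \<in> by_rows (polys (int k) T)"
    and v_edge: "\<And>E. E \<in> edges_of M T \<Longrightarrow> h1_edge v E \<in> by_rows (polys (int k) (seg E))"
begin

sublocale l2: l2_functional T "integral T"
  by (rule l2_functional_element[OF open_T bounded_T])

abbreviation "c \<equiv> centre M T"
abbreviation "ES \<equiv> edges_of M T"
abbreviation "\<gamma> E \<equiv> edge_trace k E v"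

lemma edge_l2: "E \<in> ES \<Longrightarrow> l2_functional (seg E) (edge_integral E)"
  by (rule l2_functional_edge[OF ends])

lemma trace:
  assumes "E \<in> ES"
  shows "\<gamma> E \<in> vpoly (int k + 2)" "\<gamma> E (fst E) = h1_vert v (fst E)" "\<gamma> E (snd E) = h1_vert v (snd E)"
    "\<And>q. q \<in> vpoly (int k) \<Longrightarrow> edge_integral E (\<lambda>x. \<gamma> E x \<bullet> q x) = edge_integral E (\<lambda>x. h1_edge v E x \<bullet> q x)"
  using edge_trace[OF ends[OF assms] v_edge[OF assms]] by (auto simp: is_edge_trace_def)

text \<open>Two different edges can meet only in an end point of both, where both traces equal the
  vertex unknown.\<close>

lemma trace_compatible:
  assumes E: "E \<in> ES" "E' \<in> ES" and x: "x \<in> closure (seg E)" "x \<in> closure (seg E')"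
  shows "\<gamma> E x = \<gamma> E' x"
proof (cases "E = E'")
  case False
  note cs = closure_seg[OF ends[OF E(1)]] closure_seg[OF ends[OF E(2)]]
  have disj: "seg E \<inter> seg E' = {}"
    using disjoint E False by (auto simp: pairwise_def disjnt_def)
  have ends': "(x \<in> seg E \<or> x = fst E \<or> x = snd E) \<and> (x \<in> seg E' \<or> x = fst E' \<or> x = snd E')"
    using x cs by (auto simp: seg_def open_segment_def)
  then have "x \<notin> seg E" "x \<notin> seg E'"
    using disj vertex_not_in_seg[OF E(2,1)] vertex_not_in_seg[OF E] by blast+
  then show ?thesis
    using ends' trace(2,3)[OF E(1)] trace(2,3)[OF E(2)] by auto
qed simp

lemma restr_eq: "x \<in> T \<Longrightarrow> restr T f x = f x" "E \<in> ES \<Longrightarrow> x \<in> seg E \<Longrightarrow> restr T f x = f x"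
  using closure_subset[of T] frontier_disj(2) seg_frontier(2) by (auto simp: restr_def subset_iff)

lemma cont_closed_seg:
  assumes E: "E \<in> ES" and g: "\<And>x. x \<in> closure (seg E) \<Longrightarrow> g x = f x" and f: "f \<in> vpoly l"
  shows "continuous_on (closure (seg E)) g"
  using vpoly_continuous[OF f] by (rule continuous_on_eq) (simp add: g)

text \<open>The glued edge traces satisfy the defining conditions, and any other solution agrees
  with them edge by edge through \<open>edge_trace_unique_scalar\<close>.\<close>

lemma bd_trace_eq:
  "E \<in> ES \<Longrightarrow> x \<in> closure (seg E) \<Longrightarrow> bd_trace k M T v x = \<gamma> E x"
proof -
  let ?P = "\<lambda>g. g \<in> by_rows (cont_polys (int k + 2) M T) \<and>
     (\<forall>E\<in>ES. rowwise (l2_proj (edge_integral E) (polys (int k) (seg E))) g = h1_edge v E) \<and>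
     (\<forall>V\<in>verts_of_elem M T. g V = h1_vert v V)"
  \<comment> \<open>A vertex lies on two edges; by \<open>trace_compatible\<close> the choice
    between them is immaterial.\<close>
  define g where "g x = (if x \<in> frontier T then \<gamma> (SOME E. E \<in> ES \<and> x \<in> closure (seg E)) x else 0)" for x
  have g: "g x = \<gamma> E x" if "E \<in> ES" "x \<in> closure (seg E)" for E x
  proof -
    have "x \<in> frontier T" using frontier_T that by blast
    moreover define E0 where "E0 = (SOME E. E \<in> ES \<and> x \<in> closure (seg E))"
    have "E0 \<in> ES \<and> x \<in> closure (seg E0)"
      unfolding E0_def by (rule someI[of _ E]) (use that in blast)
    then have "\<gamma> E0 x = \<gamma> E x"
      using trace_compatible that by blast
    ultimately show ?thesis
      by (simp add: g_def E0_def)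
  qed
  have gi: "(\<lambda>x. \<gamma> E x $ i) \<in> bipoly (int k + 2)" if "E \<in> ES" for E i
    using vpoly_component[OF trace(1)[OF that]] by (simp add: vpoly_real)
  have Pg: "?P g"
  proof (intro conjI ballI)
    have cg: "continuous_on (frontier T) g"
      unfolding frontier_T
      by (rule continuous_on_closed_Union[OF finite_ES]) (auto intro: cont_closed_seg[OF _ g trace(1)])
    have "restr (seg E) (\<lambda>x. g x $ i) = restr (seg E) (\<lambda>x. \<gamma> E x $ i)" if "E \<in> ES" for E i
      using g[OF that] by (auto simp: restr_def)
    then show "g \<in> by_rows (cont_polys (int k + 2) M T)"
      using cg gi by (auto simp: by_rows_def cont_polys_def polys_def g_def intro!: continuous_intros)
    show "g V = h1_vert v V" if "V \<in> verts_of_elem M T" for V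
    proof -
      have "V \<in> (\<Union>E\<in>ES. {fst E, snd E})"
        using that unfolding verts_of_elem_def verts_of_edge_def .
      then obtain E where E: "E \<in> ES" "V = fst E \<or> V = snd E" by blast
      then have "V \<in> closure (seg E)"
        using closure_seg[OF ends[OF E(1)]] by auto
      then show ?thesis
        using g[OF E(1)] trace(2,3)[OF E(1)] E(2) by auto
    qed
    fix E assume E: "E \<in> ES"
    interpret e: l2_functional "seg E" "edge_integral E" by (rule edge_l2[OF E])
    have "l2_proj (edge_integral E) (restr (seg E) ` vpoly (int k)) (\<lambda>x. g x $ i) = (\<lambda>x. h1_edge v E x $ i)" for i
    proof (rule e.l2_proj_unique_vpoly)
      show "continuous_on (closure (seg E)) (\<lambda>x. g x $ i)"
        by (intro continuous_intros cont_closed_seg[OF E g[OF E] trace(1)[OF E]])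
      show p: "(\<lambda>x. h1_edge v E x $ i) \<in> restr (seg E) ` vpoly (int k)"
        using v_edge[OF E] by (simp add: by_rows_def polys_eq)
      fix q :: "real^2 \<Rightarrow> real" assume "q \<in> restr (seg E) ` vpoly (int k)"
      then obtain q' where q': "q = restr (seg E) q'" "q' \<in> vpoly (int k)" by blast
      \<comment> \<open>The moments of the edge trace are vectorial; a test field along one axis
        isolates a component.\<close>
      have "(\<lambda>x. q' x *\<^sub>R axis i (1::real)) \<in> vpoly (int k)"
        using q'(2) by (intro vpoly_scaleR_const) (simp add: vpoly_real)
      from trace(4)[OF E this] have "edge_integral E (\<lambda>x. \<gamma> E x $ i * q' x) = edge_integral E (\<lambda>x. h1_edge v E x $ i * q' x)"
        by (simp add: inner_axis mult.commute)
      moreover have "edge_integral E (\<lambda>x. (g x $ i - h1_edge v E x $ i) \<bullet> q x)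
        = edge_integral E (\<lambda>x. \<gamma> E x $ i * q' x - h1_edge v E x $ i * q' x)"
        using g[OF E] closure_subset[of "seg E"] by (intro e.I_cong) (auto simp: q'(1) restr_def left_diff_distrib)
      moreover have "\<dots> = edge_integral E (\<lambda>x. \<gamma> E x $ i * q' x) - edge_integral E (\<lambda>x. h1_edge v E x $ i * q' x)"
        using q'(2) by (intro e.I_diff continuous_on_mult continuous_on_polys[OF ends[OF E] p] bipoly_continuous[OF gi[OF E]])
          (auto intro: vpoly_continuous)
      ultimately show "edge_integral E (\<lambda>x. (g x $ i - h1_edge v E x $ i) \<bullet> q x) = 0"
        by simp
    qed
    then show "rowwise (l2_proj (edge_integral E) (polys (int k) (seg E))) g = h1_edge v E"
      by (simp add: rowwise_def polys_eq fun_eq_iff vec_eq_iff)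
  qed
  have uniq: "g' = g" if P: "?P g'" for g'
  proof
    fix x
    show "g' x = g x"
    proof (cases "x \<in> frontier T")
      case False
      then have "g' x $ i = 0" for i
        using P by (auto simp: by_rows_def cont_polys_def)
      then show ?thesis using False by (simp add: g_def vec_eq_iff)
    next
      case True
      then obtain E where E: "E \<in> ES" "x \<in> closure (seg E)" using frontier_T by blast
      interpret e: l2_functional "seg E" "edge_integral E" by (rule edge_l2[OF E(1)])
      have "g' x $ i = \<gamma> E x $ i" for i
      proof -
        have cp: "(\<lambda>x. g' x $ i) \<in> cont_polys (int k + 2) M T"
          using P by (simp add: by_rows_def)
        then obtain p where p: "p \<in> bipoly (int k + 2)" "restr (seg E) (\<lambda>x. g' x $ i) = restr (seg E) p"
          using E(1) by (auto simp: cont_polys_def polys_def)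
        have gp: "g' y $ i = p y" if "y \<in> closure (seg E)" for y
          using fun_cong[OF p(2), of y] that by (simp add: restr_def)
        have cp: "continuous_on (closure (seg E)) (\<lambda>x. g' x $ i)"
          using bipoly_continuous[OF p(1)] by (rule continuous_on_eq) (simp add: gp)
        have V: "g' V = h1_vert v V" if "V \<in> {fst E, snd E}" for V
          using P E(1) that by (auto simp: verts_of_elem_def verts_of_edge_def)
        have proj: "l2_proj (edge_integral E) (restr (seg E) ` vpoly (int k)) (\<lambda>x. g' x $ i) = (\<lambda>x. h1_edge v E x $ i)"
          using P E(1) by (auto simp: rowwise_def polys_eq fun_eq_iff vec_eq_iff)
        define d where "d y = p y - \<gamma> E y $ i" for y
        have "d x = 0"
        proof (rule edge_trace_unique_scalar[OF ends[OF E(1)] _ _ _ _ E(2)])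
          show "d \<in> bipoly (int k + 2)"
            unfolding d_def by (intro bipoly_diff p gi E)
          show "d (fst E) = 0" "d (snd E) = 0"
            using V gp[of "fst E"] gp[of "snd E"] trace(2,3)[OF E(1)] closure_seg[OF ends[OF E(1)]]
            by (simp_all add: d_def)
          fix q assume q: "q \<in> bipoly (int k)"
          have q': "restr (seg E) q \<in> restr (seg E) ` vpoly (int k)"
            using q by (simp add: vpoly_real)
          have "(\<lambda>x. q x *\<^sub>R axis i (1::real)) \<in> vpoly (int k)"
            using q by (rule vpoly_scaleR_const)
          from trace(4)[OF E(1) this] have "edge_integral E (\<lambda>x. \<gamma> E x $ i * q x) = edge_integral E (\<lambda>x. h1_edge v E x $ i * q x)"
            by (simp add: inner_axis mult.commute)
          moreover have "edge_integral E (\<lambda>x. h1_edge v E x $ i * q x) = edge_integral E (\<lambda>x. p x * q x)"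
          proof -
            have "edge_integral E (\<lambda>x. h1_edge v E x $ i * q x) = edge_integral E (\<lambda>x. h1_edge v E x $ i \<bullet> restr (seg E) q x)"
              using closure_subset[of "seg E"] by (intro e.I_cong) (auto simp: restr_def)
            also have "\<dots> = edge_integral E (\<lambda>x. g' x $ i \<bullet> restr (seg E) q x)"
              using e.l2_proj_exists_vpoly(2)[OF cp q'] unfolding proj .
            also have "\<dots> = edge_integral E (\<lambda>x. p x * q x)"
              using closure_subset[of "seg E"] gp by (intro e.I_cong) (auto simp: restr_def)
            finally show ?thesis .
          qed
          moreover have "edge_integral E (\<lambda>x. d x * q x) = edge_integral E (\<lambda>x. p x * q x) - edge_integral E (\<lambda>x. \<gamma> E x $ i * q x)"
            unfolding d_def left_diff_distrib
            by (intro e.I_diff continuous_on_mult bipoly_continuous[OF p(1)] bipoly_continuous[OF q] bipoly_continuous[OF gi[OF E(1)]])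
          ultimately show "edge_integral E (\<lambda>x. d x * q x) = 0" by simp
        qed
        then show ?thesis using gp[OF E(2)] by (simp add: d_def)
      qed
      then show ?thesis using g[OF E] by (simp add: vec_eq_iff)
    qed
  qed
  have "bd_trace k M T v = g"
    unfolding bd_trace_def by (rule the_equality) (use Pg uniq in blast)+
  then show "E \<in> ES \<Longrightarrow> x \<in> closure (seg E) \<Longrightarrow> bd_trace k M T v x = \<gamma> E x"
    using g by simp
qed

end

section \<open>Row-wise test spaces and integration by parts\<close>

lemma vpoly_mult_vec: "Z \<in> vpoly l \<Longrightarrow> (\<lambda>x. Z x *v n) \<in> vpoly l" for Z :: "real^2 \<Rightarrow> real^2^2"
  by (intro vpoly_rowsI) (simp add: matrix_vector_mul_component vpoly_real vpoly_inner vpoly_component)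

lemma Rc_space_eq: "Rc_space l M T = restr T ` (\<lambda>p x. p x *\<^sub>R (x - centre M T)) ` bipoly (l - 1)"
proof -
  have "(\<lambda>x. restr T p x *\<^sub>R (x - centre M T)) = restr T (\<lambda>x. p x *\<^sub>R (x - centre M T))" for p
    by (auto simp: restr_def)
  then show ?thesis
    by (simp add: Rc_space_def polys_def image_image)
qed

lemma R_space_eq: "R_space l T = restr T ` curl ` bipoly (l + 1)"
  by (simp add: R_space_def image_image)

lemma by_rows_outer: "by_rows ((\<lambda>p x. p x *\<^sub>R (x - c)) ` bipoly l) = outer c ` vpoly l"
proof
  show "outer c ` vpoly l \<subseteq> by_rows ((\<lambda>p x. p x *\<^sub>R (x - c)) ` bipoly l)"
  proof
    fix X assume "X \<in> outer c ` vpoly l"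
    then obtain p where p: "X = outer c p" "p \<in> vpoly l" by blast
    then have "(\<lambda>x. p x $ i) \<in> bipoly l" for i
      using vpoly_component[OF p(2)] by (simp add: vpoly_real)
    then show "X \<in> by_rows ((\<lambda>p x. p x *\<^sub>R (x - c)) ` bipoly l)"
      by (auto simp: by_rows_def p(1) outer_def)
  qed
  show "by_rows ((\<lambda>p x. p x *\<^sub>R (x - c)) ` bipoly l) \<subseteq> outer c ` vpoly l"
  proof
    fix X :: "real^2 \<Rightarrow> real^2^2" assume "X \<in> by_rows ((\<lambda>p x. p x *\<^sub>R (x - c)) ` bipoly l)"
    then have "\<forall>i. \<exists>p. p \<in> bipoly l \<and> (\<lambda>x. X x $ i) = (\<lambda>x. p x *\<^sub>R (x - c))"
      unfolding by_rows_def by blast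
    then obtain p where p: "\<And>i. p i \<in> bipoly l" "\<And>i. (\<lambda>x. X x $ i) = (\<lambda>x. p i x *\<^sub>R (x - c))"
      by metis
    have "X = outer c (\<lambda>x. \<chi> i. p i x)"
      using p(2) by (auto simp: outer_def fun_eq_iff vec_eq_iff)
    moreover have "(\<lambda>x. \<chi> i. p i x) \<in> vpoly l"
      using p(1) by (intro vpoly_rowsI) (simp add: vpoly_real)
    ultimately show "X \<in> outer c ` vpoly l" by blast
  qed
qed

lemma by_rows_Rc_space: "by_rows (Rc_space l M T) = restr T ` outer (centre M T) ` vpoly (l - 1)"
  by (simp add: Rc_space_eq by_rows_restr by_rows_outer)

lemma subspace_Rc_space: "subspace (Rc_space l M T)"
proof -
  have "linear (\<lambda>p x. p x *\<^sub>R (x - centre M T))"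
    by (intro linearI) (auto simp: fun_eq_iff algebra_simps)
  then show ?thesis
    unfolding Rc_space_eq by (intro linear_subspace_image linear_restr subspace_bipoly)
qed

lemma Rc_space_subset: "Rc_space l M T \<subseteq> restr T ` vpoly l"
proof -
  have r: "(\<lambda>x. x - centre M T) \<in> vpoly 1"
    by (intro vpoly_rowsI) (auto simp: vpoly_real intro!: bipoly_diff bipoly_coord bipoly_const)
  show ?thesis
    unfolding Rc_space_eq using vpoly_scaleR[OF _ r, of _ "l - 1"] by auto
qed

lemma subspace_R_space: "subspace (R_space l T)"
proof -
  have "subspace (curl ` bipoly (l + 1))"
  proof (rule subspaceI)
    have "curl (\<lambda>x. 0) = 0"
      using curl_scale[OF bipoly_zero[of l], of 0] by (auto simp: fun_eq_iff)
    then show "0 \<in> curl ` bipoly (l + 1)"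
      using bipoly_zero by (metis imageI)
    show "f + g \<in> curl ` bipoly (l + 1)" if f: "f \<in> curl ` bipoly (l + 1)" and g: "g \<in> curl ` bipoly (l + 1)" for f g
    proof -
      obtain p where p: "f = curl p" "p \<in> bipoly (l + 1)"
        using f by (rule imageE)
      obtain q where q: "g = curl q" "q \<in> bipoly (l + 1)"
        using g by (rule imageE)
      have "f + g = curl (\<lambda>x. p x + q x)"
        using curl_add[OF p(2) q(2)] by (auto simp: p(1) q(1) fun_eq_iff)
      then show ?thesis using bipoly_add[OF p(2) q(2)] by blast
    qed
    show "r *\<^sub>R f \<in> curl ` bipoly (l + 1)" if f: "f \<in> curl ` bipoly (l + 1)" for r f
    proof -
      obtain p where p: "f = curl p" "p \<in> bipoly (l + 1)"
        using f by (rule imageE)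
      have "r *\<^sub>R f = curl (\<lambda>x. r * p x)"
        using curl_scale[OF p(2)] by (auto simp: p(1) fun_eq_iff)
      then show ?thesis using bipoly_scale[OF p(2)] by blast
    qed
  qed
  then show ?thesis
    unfolding R_space_eq by (rule linear_subspace_image[OF linear_restr])
qed

lemma R_space_subset: "R_space l T \<subseteq> restr T ` vpoly l"
  unfolding R_space_eq using curl_vpoly[of _ "l + 1"] by auto

lemma rowwise_curl_vpoly:
  assumes r: "r \<in> vpoly l"
  shows "rowwise curl r \<in> vpoly (l - 1)"
proof (rule vpoly_rowsI)
  show "(\<lambda>x. rowwise curl r x $ i) \<in> vpoly (l - 1)" for i
    using curl_vpoly[of "\<lambda>x. r x $ i" l] vpoly_component[OF r, of i] by (simp add: rowwise_def vpoly_real)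
qed

lemma rowwise_divergence_curl:
  assumes r: "r \<in> vpoly l"
  shows "rowwise divergence (rowwise curl r) x = 0"
proof -
  have "(\<lambda>x. r x $ i) \<in> bipoly l" for i
    using vpoly_component[OF r] by (simp add: vpoly_real)
  from divergence_curl[OF this] show ?thesis
    by (simp add: rowwise_def vec_eq_iff)
qed

lemma rowwise_curl_normal:
  assumes r: "r \<in> vpoly l"
  shows "rowwise curl r x *v normal E = - dir_deriv (tangent E) r x"
proof -
  have "(\<lambda>x. r x $ i) \<in> bipoly l" for i
    using vpoly_component[OF r] by (simp add: vpoly_real)
  from curl_eq[OF this] show ?thesis
    by (simp add: rowwise_def vec_eq_iff matrix_vector_mul_component dir_deriv_component[OF r])
qed

definition gradient :: "(real^2 \<Rightarrow> real^2) \<Rightarrow> real^2 \<Rightarrow> real^2^2" where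
  "gradient P x = (\<chi> i j. dir_deriv (axis j 1) P x $ i)"

lemma gradient_vpoly:
  assumes P: "P \<in> vpoly l"
  shows "gradient P \<in> vpoly (l - 1)"
proof (intro vpoly_rowsI)
  show "(\<lambda>x. gradient P x $ i $ j) \<in> vpoly (l - 1)" for i j
    using vpoly_component[OF vpoly_dir_deriv[OF P]] by (simp add: gradient_def)
qed

lemma gradient_mult: "P \<in> vpoly l \<Longrightarrow> gradient P x *v t = dir_deriv t P x"
  using dir_deriv_linear[of P l t x]
  by (simp add: vec_eq_iff matrix_vector_mult_def gradient_def sum_2 mult.commute)

text \<open>The divergence theorem for the vector field obtained by applying the transpose of Z to
  P.\<close>

lemma (in star_polygon) integration_by_parts:
  assumes P: "P \<in> vpoly l" and Z: "Z \<in> vpoly m"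
  shows "integral T (\<lambda>x. gradient P x \<bullet> Z x) + integral T (\<lambda>x. P x \<bullet> rowwise divergence Z x)
    = (\<Sum>E\<in>ES. sign_TE T E * edge_integral E (\<lambda>x. P x \<bullet> (Z x *v normal E)))"
proof -
  interpret l2: l2_functional T "integral T"
    by (rule l2_functional_element[OF open_T bounded_T])
  define col where "col j x = (\<chi> i. Z x $ i $ j)" for j x
  define F :: "real^2 \<Rightarrow> real^2" where "F x = (\<chi> j. P x \<bullet> col j x)" for x
  have col: "col j \<in> vpoly m" for j
    unfolding col_def by (rule vpoly_rowsI) (simp add: vpoly_component[OF vpoly_component[OF Z]])
  have F: "F \<in> vpoly (l + m)"
    unfolding F_def by (rule vpoly_rowsI) (simp add: vpoly_real bipoly_inner[OF P col])
  have "divergence F x = gradient P x \<bullet> Z x + P x \<bullet> rowwise divergence Z x" for x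
  proof -
    have "dir_deriv (axis j 1) (col j) x $ i = dir_deriv (axis j 1) Z x $ i $ j" for i j
      by (simp add: dir_deriv_component[OF col] col_def dir_deriv_component[OF Z] dir_deriv_component[OF vpoly_component[OF Z]])
    moreover have "divergence F x = (\<Sum>j\<in>UNIV. dir_deriv (axis j 1) P x \<bullet> col j x + P x \<bullet> dir_deriv (axis j 1) (col j) x)"
      by (simp add: divergence_def F_def dir_deriv_inner[OF P col])
    ultimately show ?thesis
      unfolding rowwise_divergence[OF Z]
      by (simp add: sum_2 inner_vec_def gradient_def col_def algebra_simps)
  qed
  then have "divergence F = (\<lambda>x. gradient P x \<bullet> Z x + P x \<bullet> rowwise divergence Z x)"
    by blast
  then have "integral T (\<lambda>x. gradient P x \<bullet> Z x) + integral T (\<lambda>x. P x \<bullet> rowwise divergence Z x) = integral T (divergence F)"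
    using l2.I_add[OF continuous_on_inner[OF vpoly_continuous[OF gradient_vpoly[OF P]] vpoly_continuous[OF Z]]
        continuous_on_inner[OF vpoly_continuous[OF P] vpoly_continuous[OF rowwise_divergence_vpoly[OF Z]]]] by simp
  moreover have "F x \<bullet> n = P x \<bullet> (Z x *v n)" for x n
    by (simp add: F_def col_def inner_vec_def matrix_vector_mult_def sum_2 algebra_simps)
  ultimately show ?thesis
    using divergence_theorem[OF F] by simp
qed

section \<open>Gradient, potential and rotor of an element as plane polynomials\<close>

context mesh_element
begin

lemma cont_restr: "f \<in> vpoly l \<Longrightarrow> continuous_on (closure T) (restr T f)"
  using l2.restr_cfun[OF vpoly_continuous] l2.cfun_D by blast

definition flux :: "(real^2 \<Rightarrow> real^2^2) \<Rightarrow> real" where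
  "flux Z = (\<Sum>E\<in>ES. sign_TE T E * edge_integral E (\<lambda>x. \<gamma> E x \<bullet> (Z x *v normal E)))"

lemma cont_flux:
  assumes "E \<in> ES" "Z \<in> vpoly l"
  shows "continuous_on A (\<lambda>x. \<gamma> E x \<bullet> (Z x *v normal E))"
  by (intro continuous_on_inner vpoly_continuous[OF trace(1)[OF assms(1)]] vpoly_continuous[OF vpoly_mult_vec[OF assms(2)]])

lemma flux_add:
  assumes Z: "Z \<in> vpoly l" "W \<in> vpoly l"
  shows "flux (\<lambda>x. Z x + W x) = flux Z + flux W"
proof -
  have "edge_integral E (\<lambda>x. \<gamma> E x \<bullet> ((Z x + W x) *v normal E))
      = edge_integral E (\<lambda>x. \<gamma> E x \<bullet> (Z x *v normal E)) + edge_integral E (\<lambda>x. \<gamma> E x \<bullet> (W x *v normal E))" if "E \<in> ES" for E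
    unfolding matrix_vector_mult_add_rdistrib inner_add_right
    by (rule l2_functional.I_add[OF edge_l2[OF that] cont_flux[OF that Z(1)] cont_flux[OF that Z(2)]])
  then show ?thesis
    by (simp add: flux_def sum.distrib[symmetric] distrib_left)
qed

lemma flux_scale:
  assumes Z: "Z \<in> vpoly l"
  shows "flux (\<lambda>x. a *\<^sub>R Z x) = a * flux Z"
proof -
  have "edge_integral E (\<lambda>x. \<gamma> E x \<bullet> ((a *\<^sub>R Z x) *v normal E)) = a * edge_integral E (\<lambda>x. \<gamma> E x \<bullet> (Z x *v normal E))" if "E \<in> ES" for E
    unfolding scaleR_matrix_vector_assoc[symmetric] inner_scaleR_right
    by (rule l2_functional.I_scale[OF edge_l2[OF that] cont_flux[OF that Z]])
  then show ?thesis
    by (simp add: flux_def sum_distrib_left mult_ac)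
qed

lemma flux_bd_trace:
  "(\<Sum>E\<in>ES. sign_TE T E * edge_integral E (\<lambda>x. bd_trace k M T v x \<bullet> (restr T Z x *v normal E))) = flux Z"
proof -
  have "edge_integral E (\<lambda>x. bd_trace k M T v x \<bullet> (restr T Z x *v normal E)) = edge_integral E (\<lambda>x. \<gamma> E x \<bullet> (Z x *v normal E))"
    if "E \<in> ES" for E
    using that closure_subset[of "seg E"]
    by (intro l2_functional.I_cong[OF edge_l2[OF that]]) (simp add: bd_trace_eq restr_eq(2) subset_iff)
  then show ?thesis by (simp add: flux_def)
qed

lemma rowwise_divergence_restr:
  assumes x: "x \<in> T"
  shows "rowwise divergence (restr T Z) x = rowwise divergence Z x"
  unfolding rowwise_def divergence_def
  by (auto simp: vec_eq_iff restr_eq(1) intro!: sum.cong dir_deriv_cong_open[OF open_T x])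

lemma rowwise_curl_restr:
  assumes x: "x \<in> T"
  shows "rowwise curl (restr T u) x = rowwise curl u x"
proof -
  have "dir_deriv t (\<lambda>y. restr T u y $ i) x = dir_deriv t (\<lambda>y. u y $ i) x" for t i
    by (rule dir_deriv_cong_open[OF open_T x]) (simp add: restr_eq(1))
  then show ?thesis by (simp add: rowwise_def curl_def)
qed

abbreviation "vT \<equiv> h1_elem v T"

lemma cont_vT: "continuous_on (closure T) vT"
  using v_elem cont_restr by (auto simp: by_rows_polys)

definition grad_functional :: "(real^2 \<Rightarrow> real^2^2) \<Rightarrow> real" where
  "grad_functional Z = - integral T (\<lambda>x. vT x \<bullet> rowwise divergence Z x) + flux Z"

lemma grad_functional_add:
  assumes Z: "Z \<in> vpoly l" "W \<in> vpoly l"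
  shows "grad_functional (\<lambda>x. Z x + W x) = grad_functional Z + grad_functional W"
proof -
  note c = continuous_on_inner[OF cont_vT vpoly_continuous[OF rowwise_divergence_vpoly]]
  show ?thesis
    unfolding grad_functional_def flux_add[OF Z] rowwise_divergence_add[OF Z] inner_add_right l2.I_add[OF c[OF Z(1)] c[OF Z(2)]]
    by simp
qed

lemma grad_functional_scale:
  assumes Z: "Z \<in> vpoly l"
  shows "grad_functional (\<lambda>x. a *\<^sub>R Z x) = a * grad_functional Z"
proof -
  note c = continuous_on_inner[OF cont_vT vpoly_continuous[OF rowwise_divergence_vpoly]]
  show ?thesis
    unfolding grad_functional_def flux_scale[OF Z] rowwise_divergence_scale[OF Z] inner_scaleR_right l2.I_scale[OF c[OF Z]]
    by (simp add: algebra_simps)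
qed

lemma restr_inner: "integral T (\<lambda>x. restr T f x \<bullet> restr T g x) = integral T (\<lambda>x. f x \<bullet> g x)"
  by (rule l2.I_cong) (simp add: restr_eq(1))

text \<open>Riesz gives a solution and definiteness its uniqueness. On restrictions of plane
  polynomials the defining functional becomes \<open>grad_functional\<close>, whose linearity is
  visible.\<close>

lemma grad_elem_ex:
  "\<exists>G\<in>vpoly (int k + 1). grad_elem k M T v = restr T G \<and>
    (\<forall>Z\<in>vpoly (int k + 1). integral T (\<lambda>x. G x \<bullet> Z x) = grad_functional Z)"
proof -
  define l where "l Z = - integral T (\<lambda>x. vT x \<bullet> rowwise divergence Z x)
    + (\<Sum>E\<in>ES. sign_TE T E * edge_integral E (\<lambda>x. bd_trace k M T v x \<bullet> (Z x *v normal E)))" for Z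
  have l: "l (restr T Z) = grad_functional Z" for Z
  proof -
    have "integral T (\<lambda>x. vT x \<bullet> rowwise divergence (restr T Z) x) = integral T (\<lambda>x. vT x \<bullet> rowwise divergence Z x)"
      by (rule l2.I_cong) (simp add: rowwise_divergence_restr)
    then show ?thesis by (simp add: l_def flux_bd_trace grad_functional_def)
  qed
  have "\<exists>G\<in>restr T ` vpoly (int k + 1). \<forall>Z\<in>restr T ` vpoly (int k + 1). integral T (\<lambda>x. G x \<bullet> Z x) = l Z"
  proof (rule l2.Riesz_vpoly)
    fix X Y :: "real^2 \<Rightarrow> real^2^2" and r
    assume "X \<in> restr T ` vpoly (int k + 1)"
    then obtain X' where X': "X = restr T X'" "X' \<in> vpoly (int k + 1)" by blast
    have "r *\<^sub>R X = restr T (\<lambda>x. r *\<^sub>R X' x)"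
      by (auto simp: X'(1) restr_def fun_eq_iff)
    then show "l (r *\<^sub>R X) = r * l X"
      using grad_functional_scale[OF X'(2)] by (simp add: l X'(1))
    assume "Y \<in> restr T ` vpoly (int k + 1)"
    then obtain Y' where Y': "Y = restr T Y'" "Y' \<in> vpoly (int k + 1)" by blast
    have "X + Y = restr T (\<lambda>x. X' x + Y' x)"
      by (auto simp: X'(1) Y'(1) restr_def fun_eq_iff)
    then show "l (X + Y) = l X + l Y"
      using grad_functional_add[OF X'(2) Y'(2)] by (simp add: l X'(1) Y'(1))
  qed
  then obtain G where G: "G \<in> vpoly (int k + 1)"
    "\<And>Z. Z \<in> restr T ` vpoly (int k + 1) \<Longrightarrow> integral T (\<lambda>x. restr T G x \<bullet> Z x) = l Z"
    by blast
  have "grad_elem k M T v = restr T G"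
    unfolding grad_elem_def by_rows_by_rows_polys l_def[symmetric]
  proof (rule the_equality)
    show "restr T G \<in> restr T ` vpoly (int k + 1) \<and>
      (\<forall>Z\<in>restr T ` vpoly (int k + 1). integral T (\<lambda>x. restr T G x \<bullet> Z x) = l Z)"
      using G by blast
    fix G' assume "G' \<in> restr T ` vpoly (int k + 1) \<and>
      (\<forall>Z\<in>restr T ` vpoly (int k + 1). integral T (\<lambda>x. G' x \<bullet> Z x) = l Z)"
    then show "G' = restr T G"
      using G by (intro l2.Riesz_unique_vpoly[of G' "int k + 1"]) auto
  qed
  moreover have "integral T (\<lambda>x. G x \<bullet> Z x) = grad_functional Z" if "Z \<in> vpoly (int k + 1)" for Z
    using G(2)[OF imageI[OF that]] by (simp add: restr_inner l)
  ultimately show ?thesis using G(1) by blast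
qed

text \<open>A plane polynomial that restricts to the element gradient, so that estimates on T and on
  its edges can do without \<open>restr\<close>.\<close>

definition G :: "real^2 \<Rightarrow> real^2^2" where
  "G = (SOME G. G \<in> vpoly (int k + 1) \<and> grad_elem k M T v = restr T G \<and>
    (\<forall>Z\<in>vpoly (int k + 1). integral T (\<lambda>x. G x \<bullet> Z x) = grad_functional Z))"

lemma
  shows G_vpoly: "G \<in> vpoly (int k + 1)"
    and grad_elem_eq: "grad_elem k M T v = restr T G"
    and G_eq: "Z \<in> vpoly (int k + 1) \<Longrightarrow> integral T (\<lambda>x. G x \<bullet> Z x) = grad_functional Z"
  using someI_ex[OF grad_elem_ex[unfolded Bex_def]] unfolding G_def by auto

definition pot_functional :: "(real^2 \<Rightarrow> real^2) \<Rightarrow> real" where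
  "pot_functional p = - integral T (\<lambda>x. G x \<bullet> outer c p x) + flux (outer c p)"

lemma cont_G: "continuous_on A G"
  by (rule vpoly_continuous[OF G_vpoly])

lemma outer_add: "outer c (p + q) = (\<lambda>x. outer c p x + outer c q x)"
  and outer_scale: "outer c (a *\<^sub>R p) = (\<lambda>x. a *\<^sub>R outer c p x)"
  by (auto simp: outer_def fun_eq_iff vec_eq_iff algebra_simps)

text \<open>The test tensors are radial with coefficient p of degree k + 2, and their divergence
  \<open>rowwise (euler 2 c) p\<close> runs through all fields of degree k + 2. Existence and
  uniqueness are therefore Riesz after a bijective change of test function.\<close>

lemma pot_grad_ex:
  "\<exists>P\<in>vpoly (int k + 2). pot_grad k M T v = restr T P \<and>
    (\<forall>p\<in>vpoly (int k + 2). integral T (\<lambda>x. P x \<bullet> rowwise (euler 2 c) p x) = pot_functional p)"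
proof -
  let ?A = "\<lambda>p. restr T (rowwise (euler 2 c) p)"
  have cG: "continuous_on A (\<lambda>x. G x \<bullet> outer c p x)" if "p \<in> vpoly l" for p l A
    by (intro continuous_on_inner cont_G vpoly_continuous[OF outer_vpoly[OF that]])
  have "\<exists>P\<in>restr T ` vpoly (int k + 2). \<forall>p\<in>vpoly (int k + 2). integral T (\<lambda>x. P x \<bullet> ?A p x) = pot_functional p"
  proof (rule l2.Riesz_precomp_vpoly)
    fix x y :: "real^2 \<Rightarrow> real^2" and r
    assume x: "x \<in> vpoly (int k + 2)"
    show "?A (r *\<^sub>R x) = r *\<^sub>R ?A x"
      unfolding rowwise_euler_scale[OF x] by (auto simp: restr_def fun_eq_iff)
    show "pot_functional (r *\<^sub>R x) = r * pot_functional x"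
      unfolding pot_functional_def outer_scale flux_scale[OF outer_vpoly[OF x]] inner_scaleR_right l2.I_scale[OF cG[OF x]]
      by (simp add: algebra_simps)
    assume y: "y \<in> vpoly (int k + 2)"
    show "?A (x + y) = ?A x + ?A y"
      unfolding rowwise_euler_add[OF x y] by (auto simp: restr_def fun_eq_iff)
    show "pot_functional (x + y) = pot_functional x + pot_functional y"
      unfolding pot_functional_def outer_add flux_add[OF outer_vpoly[OF x] outer_vpoly[OF y]] inner_add_right
        l2.I_add[OF cG[OF x] cG[OF y]] by simp
  next
    show "subspace (vpoly (int k + 2))" by (rule subspace_vpoly)
    have "bij_betw (restr T) (vpoly (int k + 2)) (restr T ` vpoly (int k + 2) :: (real^2 \<Rightarrow> real^2) set)"
      using inj_on_restr[OF open_T nonempty_T] by (rule inj_on_imp_bij_betw)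
    from bij_betw_trans[OF euler_rowwise_bij this]
    show "bij_betw ?A (vpoly (int k + 2)) (restr T ` vpoly (int k + 2))"
      by (simp add: o_def)
  qed
  then obtain P where P: "P \<in> vpoly (int k + 2)"
    "\<And>p. p \<in> vpoly (int k + 2) \<Longrightarrow> integral T (\<lambda>x. restr T P x \<bullet> ?A p x) = pot_functional p"
    by blast
  have lhs: "integral T (\<lambda>x. f x \<bullet> rowwise divergence (restr T (outer c p)) x) = integral T (\<lambda>x. f x \<bullet> ?A p x)"
    if "p \<in> vpoly l" for p l f
    by (rule l2.I_cong) (simp add: rowwise_divergence_restr rowwise_divergence_outer[OF that] restr_eq(1))
  have rhs: "- integral T (\<lambda>x. grad_elem k M T v x \<bullet> restr T (outer c p) x)
        + (\<Sum>E\<in>ES. sign_TE T E * edge_integral E (\<lambda>x. bd_trace k M T v x \<bullet> (restr T (outer c p) x *v normal E)))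
      = pot_functional p" for p
    unfolding flux_bd_trace grad_elem_eq restr_inner pot_functional_def ..
  have X: "by_rows (Rc_space (int k + 3) M T) = restr T ` outer c ` vpoly (int k + 2)"
    by (simp add: by_rows_Rc_space add.commute)
  have "pot_grad k M T v = restr T P"
    unfolding pot_grad_def by_rows_polys X ball_simps(9)
  proof (rule the_equality)
    show "restr T P \<in> restr T ` vpoly (int k + 2) \<and>
     (\<forall>p\<in>vpoly (int k + 2). integral T (\<lambda>x. restr T P x \<bullet> rowwise divergence (restr T (outer c p)) x) =
        - integral T (\<lambda>x. grad_elem k M T v x \<bullet> restr T (outer c p) x)
        + (\<Sum>E\<in>ES. sign_TE T E * edge_integral E (\<lambda>x. bd_trace k M T v x \<bullet> (restr T (outer c p) x *v normal E))))"
      unfolding rhs using P by (auto simp: lhs)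
    fix P' assume P': "P' \<in> restr T ` vpoly (int k + 2) \<and>
     (\<forall>p\<in>vpoly (int k + 2). integral T (\<lambda>x. P' x \<bullet> rowwise divergence (restr T (outer c p)) x) =
        - integral T (\<lambda>x. grad_elem k M T v x \<bullet> restr T (outer c p) x)
        + (\<Sum>E\<in>ES. sign_TE T E * edge_integral E (\<lambda>x. bd_trace k M T v x \<bullet> (restr T (outer c p) x *v normal E))))"
    show "P' = restr T P"
    proof (rule l2.Riesz_unique_vpoly[of P' "int k + 2"])
      fix q :: "real^2 \<Rightarrow> real^2" assume "q \<in> restr T ` vpoly (int k + 2)"
      then obtain q' where q': "q = restr T q'" "q' \<in> vpoly (int k + 2)" by blast
      from q'(2) have "q' \<in> rowwise (euler 2 c) ` vpoly (int k + 2)"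
        unfolding bij_betw_imp_surj_on[OF euler_rowwise_bij] .
      then obtain p where p: "p \<in> vpoly (int k + 2)" "q = ?A p"
        using q'(1) by blast
      have "integral T (\<lambda>x. P' x \<bullet> ?A p x) = pot_functional p"
        using conjunct2[OF P', rule_format, OF p(1)] unfolding rhs lhs[OF p(1)] .
      then show "integral T (\<lambda>x. P' x \<bullet> q x) = integral T (\<lambda>x. restr T P x \<bullet> q x)"
        unfolding p(2) P(2)[OF p(1)] .
    next
      show "P' \<in> restr T ` vpoly (int k + 2)" using P' by blast
    qed (rule imageI[OF P(1)])
  qed
  moreover have "integral T (\<lambda>x. P x \<bullet> rowwise (euler 2 c) p x) = pot_functional p" if "p \<in> vpoly (int k + 2)" for p
    using P(2)[OF that] by (simp add: restr_inner)
  ultimately show ?thesis using P(1) by blast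
qed

definition P :: "real^2 \<Rightarrow> real^2" where
  "P = (SOME P. P \<in> vpoly (int k + 2) \<and> pot_grad k M T v = restr T P \<and>
    (\<forall>p\<in>vpoly (int k + 2). integral T (\<lambda>x. P x \<bullet> rowwise (euler 2 c) p x) = pot_functional p))"

lemma
  shows P_vpoly: "P \<in> vpoly (int k + 2)"
    and pot_grad_eq: "pot_grad k M T v = restr T P"
    and P_eq: "p \<in> vpoly (int k + 2) \<Longrightarrow> integral T (\<lambda>x. P x \<bullet> rowwise (euler 2 c) p x) = pot_functional p"
  using someI_ex[OF pot_grad_ex[unfolded Bex_def]] unfolding P_def by auto

text \<open>For q = \<open>rowwise (euler 2 c) p\<close> of degree k, the radial tensor of p has
  degree k + 1 and is admissible in the definition of the element gradient as well. Combining both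
  definitions cancels the flux.\<close>

lemma P_moments:
  assumes q: "q \<in> vpoly (int k)"
  shows "integral T (\<lambda>x. P x \<bullet> q x) = integral T (\<lambda>x. vT x \<bullet> q x)"
proof -
  have "q \<in> rowwise (euler 2 c) ` vpoly (int k)"
    unfolding bij_betw_imp_surj_on[OF euler_rowwise_bij] by (rule q)
  then obtain p where p: "p \<in> vpoly (int k)" "q = rowwise (euler 2 c) p"
    by blast
  have "integral T (\<lambda>x. P x \<bullet> q x) = pot_functional p"
    unfolding p(2) using vpoly_mono[OF _ p(1), of "int k + 2"] by (intro P_eq) simp
  also have "\<dots> = integral T (\<lambda>x. vT x \<bullet> q x)"
    unfolding pot_functional_def G_eq[OF outer_vpoly[OF p(1)]] grad_functional_def rowwise_divergence_outer[OF p(1)] p(2)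
    by simp
  finally show ?thesis .
qed


text \<open>The divergence of Z has degree k, so the potential may replace the element unknown;
  subtracting the exact integration by parts for the potential leaves the boundary
  difference.\<close>

lemma gradient_error:
  assumes Z: "Z \<in> vpoly (int k + 1)"
  shows "integral T (\<lambda>x. (G x - gradient P x) \<bullet> Z x)
    = - (\<Sum>E\<in>ES. sign_TE T E * edge_integral E (\<lambda>x. (P x - \<gamma> E x) \<bullet> (Z x *v normal E)))"
proof -
  have cJ: "continuous_on A (gradient P)" for A
    by (rule vpoly_continuous[OF gradient_vpoly[OF P_vpoly]])
  have "integral T (\<lambda>x. (G x - gradient P x) \<bullet> Z x) = grad_functional Z - integral T (\<lambda>x. gradient P x \<bullet> Z x)"
    using l2.I_inner_diff[OF cont_G cJ vpoly_continuous[OF Z]] by (simp add: G_eq[OF Z])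
  also have "grad_functional Z = - integral T (\<lambda>x. P x \<bullet> rowwise divergence Z x) + flux Z"
    unfolding grad_functional_def using P_moments[of "rowwise divergence Z"] rowwise_divergence_vpoly[OF Z] by simp
  also have "- integral T (\<lambda>x. P x \<bullet> rowwise divergence Z x) + flux Z - integral T (\<lambda>x. gradient P x \<bullet> Z x)
     = flux Z - (\<Sum>E\<in>ES. sign_TE T E * edge_integral E (\<lambda>x. P x \<bullet> (Z x *v normal E)))"
    using integration_by_parts[OF P_vpoly Z] by simp
  also have "\<dots> = - (\<Sum>E\<in>ES. sign_TE T E * edge_integral E (\<lambda>x. (P x - \<gamma> E x) \<bullet> (Z x *v normal E)))"
  proof -
    have "edge_integral E (\<lambda>x. (P x - \<gamma> E x) \<bullet> (Z x *v normal E))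
      = edge_integral E (\<lambda>x. P x \<bullet> (Z x *v normal E)) - edge_integral E (\<lambda>x. \<gamma> E x \<bullet> (Z x *v normal E))" if "E \<in> ES" for E
      by (intro l2_functional.I_inner_diff[OF edge_l2[OF that]] vpoly_continuous[OF P_vpoly]
          vpoly_continuous[OF trace(1)[OF that]] vpoly_continuous[OF vpoly_mult_vec[OF Z]])
    then show ?thesis
      by (simp add: flux_def sum_subtractf right_diff_distrib)
  qed
  finally show ?thesis .
qed

text \<open>A curl has no divergence, so the element unknown drops out. Its normal component is a
  tangential derivative, and the vertex terms left by integrating along the edges cancel.\<close>

lemma G_curl:
  assumes u: "u \<in> vpoly (int k + 2)"
  shows "integral T (\<lambda>x. G x \<bullet> rowwise curl u x)
    = (\<Sum>E\<in>ES. sign_TE T E * edge_integral E (\<lambda>x. dir_deriv (tangent E) (\<gamma> E) x \<bullet> u x))"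
proof -
  have "rowwise curl u \<in> vpoly (int k + 1)"
    using rowwise_curl_vpoly[OF u] by (simp add: add.commute)
  then have "integral T (\<lambda>x. G x \<bullet> rowwise curl u x) = flux (rowwise curl u)"
    by (simp add: G_eq grad_functional_def rowwise_divergence_curl[OF u])
  also have "\<dots> = (\<Sum>E\<in>ES. sign_TE T E * edge_integral E (\<lambda>x. dir_deriv (tangent E) (\<gamma> E) x \<bullet> u x)
      - sign_TE T E * (h1_vert v (snd E) \<bullet> u (snd E) - h1_vert v (fst E) \<bullet> u (fst E)))"
    unfolding flux_def
  proof (rule sum.cong[OF refl])
    fix E assume E: "E \<in> ES"
    have "edge_integral E (\<lambda>x. \<gamma> E x \<bullet> (rowwise curl u x *v normal E))
      = edge_integral E (\<lambda>x. (- 1) * (\<gamma> E x \<bullet> dir_deriv (tangent E) u x))"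
      by (simp add: rowwise_curl_normal[OF u])
    also have "\<dots> = - edge_integral E (\<lambda>x. \<gamma> E x \<bullet> dir_deriv (tangent E) u x)"
      by (subst l2_functional.I_scale[OF edge_l2[OF E]])
        (auto intro!: continuous_on_inner vpoly_continuous[OF trace(1)[OF E]] vpoly_continuous[OF vpoly_dir_deriv[OF u]])
    also have "\<dots> = edge_integral E (\<lambda>x. dir_deriv (tangent E) (\<gamma> E) x \<bullet> u x)
      - (h1_vert v (snd E) \<bullet> u (snd E) - h1_vert v (fst E) \<bullet> u (fst E))"
      using edge_integration_by_parts[OF ends[OF E] trace(1)[OF E] u] trace(2,3)[OF E] by simp
    finally show "sign_TE T E * edge_integral E (\<lambda>x. \<gamma> E x \<bullet> (rowwise curl u x *v normal E)) =
      sign_TE T E * edge_integral E (\<lambda>x. dir_deriv (tangent E) (\<gamma> E) x \<bullet> u x)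
      - sign_TE T E * (h1_vert v (snd E) \<bullet> u (snd E) - h1_vert v (fst E) \<bullet> u (fst E))"
      by (simp add: right_diff_distrib)
  qed
  also have "\<dots> = (\<Sum>E\<in>ES. sign_TE T E * edge_integral E (\<lambda>x. dir_deriv (tangent E) (\<gamma> E) x \<bullet> u x))"
    unfolding sum_subtractf using sign_TE_sum[of "\<lambda>V. h1_vert v V \<bullet> u V"] by simp
  finally show ?thesis .
qed

abbreviation "\<tau> \<equiv> discrete_grad k M v"

lemma grad_edge_integral:
  "(\<Sum>E\<in>ES. sign_TE T E * edge_integral E (\<lambda>x. rot_edge \<tau> E x \<bullet> restr T u x))
    = (\<Sum>E\<in>ES. sign_TE T E * edge_integral E (\<lambda>x. dir_deriv (tangent E) (\<gamma> E) x \<bullet> u x))"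
proof -
  have "edge_integral E (\<lambda>x. rot_edge \<tau> E x \<bullet> restr T u x) = edge_integral E (\<lambda>x. dir_deriv (tangent E) (\<gamma> E) x \<bullet> u x)"
    if E: "E \<in> ES" for E
    using closure_subset[of "seg E"]
    by (intro l2_functional.I_cong[OF edge_l2[OF E]])
      (auto simp: discrete_grad_def grad_edge_eq[OF ends[OF E] v_edge[OF E]] restr_def[of "seg E"] restr_eq(2)[OF E])
  then show ?thesis by simp
qed

text \<open>Rows of the curl of a field of degree k + 1 lie in the projection space
  \<open>R_space (int k) T\<close>, so the projected gradient may be replaced by G, and
  \<open>G_curl\<close> balances the edge terms.\<close>

lemma rotor_zero: "rotor k M T \<tau> = (\<lambda>x. 0)"
proof -
  have rhs: "integral T (\<lambda>x. rot_R \<tau> T x \<bullet> rowwise curl (restr T r) x)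
      - (\<Sum>E\<in>ES. sign_TE T E * edge_integral E (\<lambda>x. rot_edge \<tau> E x \<bullet> restr T r x)) = 0"
    if r: "r \<in> vpoly (int k + 1)" for r
  proof -
    have "integral T (\<lambda>x. rot_R \<tau> T x \<bullet> rowwise curl (restr T r) x) = integral T (\<lambda>x. rot_R \<tau> T x \<bullet> restr T (rowwise curl r) x)"
      by (rule l2.I_cong) (simp add: rowwise_curl_restr restr_eq(1))
    also have "\<dots> = integral T (\<lambda>x. restr T G x \<bullet> restr T (rowwise curl r) x)"
      unfolding discrete_grad_def grad_elem_eq hrot_vec.simps
    proof (rule l2.rowwise_l2_proj[OF subspace_R_space R_space_subset cont_restr[OF G_vpoly]])
      have "(\<lambda>x. r x $ i) \<in> bipoly (int k + 1)" for i
        using vpoly_component[OF r] by (simp add: vpoly_real)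
      then have "rowwise curl r \<in> by_rows (curl ` bipoly (int k + 1))"
        by (auto simp: by_rows_def rowwise_def)
      then show "restr T (rowwise curl r) \<in> by_rows (R_space (int k) T)"
        by (simp add: R_space_eq by_rows_restr)
    qed
    also have "\<dots> = integral T (\<lambda>x. G x \<bullet> rowwise curl r x)"
      by (rule restr_inner)
    also have "\<dots> = (\<Sum>E\<in>ES. sign_TE T E * edge_integral E (\<lambda>x. dir_deriv (tangent E) (\<gamma> E) x \<bullet> r x))"
      by (rule G_curl) (use vpoly_mono[OF _ r] in simp)
    finally show ?thesis by (simp add: grad_edge_integral)
  qed
  have z: "(\<lambda>x. 0) = restr T (\<lambda>x. 0 :: real^2)"
    by (auto simp: restr_def)
  have z': "(\<lambda>x. 0 :: real^2) \<in> vpoly (int k + 1)"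
    using subspace_0[OF subspace_vpoly] by (simp add: zero_fun_def)
  have z'': "(\<lambda>x. 0) \<in> restr T ` (vpoly (int k + 1) :: (real^2 \<Rightarrow> real^2) set)"
    using imageI[OF z', of "restr T"] z by simp
  show ?thesis
    unfolding rotor_def by_rows_polys
  proof (rule the_equality)
    show "(\<lambda>x. 0 :: real^2) \<in> restr T ` vpoly (int k + 1) \<and>
     (\<forall>r\<in>restr T ` vpoly (int k + 1). integral T (\<lambda>x. 0 \<bullet> r x) = integral T (\<lambda>x. rot_R \<tau> T x \<bullet> rowwise curl r x)
        - (\<Sum>E\<in>ES. sign_TE T E * edge_integral E (\<lambda>x. rot_edge \<tau> E x \<bullet> r x)))"
      using rhs by (intro conjI z'') auto
    fix R assume R: "R \<in> restr T ` vpoly (int k + 1) \<and>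
     (\<forall>r\<in>restr T ` vpoly (int k + 1). integral T (\<lambda>x. R x \<bullet> r x) = integral T (\<lambda>x. rot_R \<tau> T x \<bullet> rowwise curl r x)
        - (\<Sum>E\<in>ES. sign_TE T E * edge_integral E (\<lambda>x. rot_edge \<tau> E x \<bullet> r x)))"
    show "R = (\<lambda>x. 0)"
    proof (rule l2.Riesz_unique_vpoly[of R "int k + 1"])
      show "R \<in> restr T ` vpoly (int k + 1)" using R by blast
      fix q assume "q \<in> restr T ` (vpoly (int k + 1) :: (real^2 \<Rightarrow> real^2) set)"
      then show "integral T (\<lambda>x. R x \<bullet> q x) = integral T (\<lambda>x. 0 \<bullet> q x)"
        using R rhs by auto
    qed (rule z'')
  qed
qed

text \<open>With zero rotor, G satisfies the defining equations by \<open>G_curl\<close>, now for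
  test fields of degree k + 2. Curls and radial tensors together exhaust degree k + 1, which gives
  uniqueness.\<close>

lemma pot_rot_eq: "pot_rot k M T \<tau> = restr T G"
proof -
  have Rc: "by_rows (Rc_space (int k + 1) M T) = restr T ` outer c ` vpoly (int k)"
    by (simp add: by_rows_Rc_space)
  have oc: "outer c p \<in> vpoly (int k + 1)" if "p \<in> vpoly (int k)" for p
    by (rule outer_vpoly[OF that])
  have rc: "rowwise curl r \<in> vpoly (int k + 1)" if "r \<in> vpoly (int k + 2)" for r
    using rowwise_curl_vpoly[OF that] by (simp add: add.commute)
  define R where "R r Z = integral T (\<lambda>x. rotor k M T \<tau> x \<bullet> r x)
        + (\<Sum>E\<in>ES. sign_TE T E * edge_integral E (\<lambda>x. rot_edge \<tau> E x \<bullet> r x))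
        + integral T (\<lambda>x. rot_Rc \<tau> T x \<bullet> Z x)" for r Z
  have lhs: "integral T (\<lambda>x. f x \<bullet> (rowwise curl (restr T r) x + restr T Z x)) = integral T (\<lambda>x. f x \<bullet> (rowwise curl r x + Z x))" for f r Z
    by (rule l2.I_cong) (simp add: rowwise_curl_restr restr_eq(1))
  have eq: "integral T (\<lambda>x. restr T G x \<bullet> (rowwise curl r x + outer c p x)) = R (restr T r) (restr T (outer c p))"
    if r: "r \<in> vpoly (int k + 2)" and p: "p \<in> vpoly (int k)" for r p
  proof -
    have "integral T (\<lambda>x. rot_Rc \<tau> T x \<bullet> restr T (outer c p) x) = integral T (\<lambda>x. restr T G x \<bullet> restr T (outer c p) x)"
      unfolding discrete_grad_def grad_elem_eq hrot_vec.simps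
      by (rule l2.rowwise_l2_proj[OF subspace_Rc_space Rc_space_subset cont_restr[OF G_vpoly]]) (use p Rc in blast)
    then have "R (restr T r) (restr T (outer c p)) = integral T (\<lambda>x. G x \<bullet> rowwise curl r x) + integral T (\<lambda>x. G x \<bullet> outer c p x)"
      unfolding R_def rotor_zero grad_edge_integral G_curl[OF r] restr_inner by simp
    also have "\<dots> = integral T (\<lambda>x. G x \<bullet> rowwise curl r x + G x \<bullet> outer c p x)"
      by (rule l2.I_add[symmetric]) (intro continuous_on_inner cont_G vpoly_continuous[OF oc[OF p]] vpoly_continuous[OF rc[OF r]])+
    also have "\<dots> = integral T (\<lambda>x. restr T G x \<bullet> (rowwise curl r x + outer c p x))"
      by (rule l2.I_cong) (simp add: restr_eq(1) inner_add_right)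
    finally show ?thesis by simp
  qed
  have Koszul: "\<exists>r\<in>vpoly (int k + 2). \<exists>p\<in>vpoly (int k). Y = (\<lambda>x. rowwise curl r x + outer c p x)"
    if Y: "Y \<in> vpoly (int k + 1)" for Y :: "real^2 \<Rightarrow> real^2^2"
  proof -
    have "\<forall>i. \<exists>q p. q \<in> bipoly (int k + 2) \<and> p \<in> bipoly (int k) \<and> (\<lambda>x. Y x $ i) = (\<lambda>x. curl q x + p x *\<^sub>R (x - c))"
    proof
      fix i
      have "int k + 1 + 1 = int k + 2" "int k + 1 - 1 = int k" by simp_all
      then show "\<exists>q p. q \<in> bipoly (int k + 2) \<and> p \<in> bipoly (int k) \<and> (\<lambda>x. Y x $ i) = (\<lambda>x. curl q x + p x *\<^sub>R (x - c))"
        using Koszul_decomposition[OF vpoly_component[OF Y, of i], of c] by metis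
    qed
    from choice[OF this] obtain q where
      "\<forall>i. \<exists>p. q i \<in> bipoly (int k + 2) \<and> p \<in> bipoly (int k) \<and> (\<lambda>x. Y x $ i) = (\<lambda>x. curl (q i) x + p x *\<^sub>R (x - c))" ..
    from choice[OF this] obtain p where
      "\<forall>i. q i \<in> bipoly (int k + 2) \<and> p i \<in> bipoly (int k) \<and> (\<lambda>x. Y x $ i) = (\<lambda>x. curl (q i) x + p i x *\<^sub>R (x - c))" ..
    then have qp: "\<And>i. q i \<in> bipoly (int k + 2)" "\<And>i. p i \<in> bipoly (int k)"
      "\<And>i. (\<lambda>x. Y x $ i) = (\<lambda>x. curl (q i) x + p i x *\<^sub>R (x - c))"
      by blast+
    have "(\<lambda>x. \<chi> i. q i x) \<in> vpoly (int k + 2)" "(\<lambda>x. \<chi> i. p i x) \<in> vpoly (int k)"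
      by (auto intro!: vpoly_rowsI simp: vpoly_real qp)
    moreover have "Y = (\<lambda>x. rowwise curl (\<lambda>x. \<chi> i. q i x) x + outer c (\<lambda>x. \<chi> i. p i x) x)"
      using qp(3) by (simp add: fun_eq_iff vec_eq_iff rowwise_def outer_def)
    ultimately show ?thesis by blast
  qed
  show ?thesis
    unfolding pot_rot_def by_rows_by_rows_polys unfolding by_rows_polys Rc R_def[symmetric]
  proof (rule the_equality)
    show "restr T G \<in> restr T ` vpoly (int k + 1) \<and>
     (\<forall>r\<in>restr T ` vpoly (int k + 2). \<forall>Z\<in>restr T ` outer c ` vpoly (int k).
        integral T (\<lambda>x. restr T G x \<bullet> (rowwise curl r x + Z x)) = R r Z)"
      using G_vpoly by (auto simp: lhs eq)
    fix P' assume P': "P' \<in> restr T ` vpoly (int k + 1) \<and>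
     (\<forall>r\<in>restr T ` vpoly (int k + 2). \<forall>Z\<in>restr T ` outer c ` vpoly (int k).
        integral T (\<lambda>x. P' x \<bullet> (rowwise curl r x + Z x)) = R r Z)"
    show "P' = restr T G"
    proof (rule l2.Riesz_unique_vpoly[of P' "int k + 1"])
      fix Y :: "real^2 \<Rightarrow> real^2^2" assume "Y \<in> restr T ` vpoly (int k + 1)"
      then obtain r p where rp: "r \<in> vpoly (int k + 2)" "p \<in> vpoly (int k)"
        "Y = restr T (\<lambda>x. rowwise curl r x + outer c p x)"
        using Koszul by blast
      have Y: "integral T (\<lambda>x. f x \<bullet> Y x) = integral T (\<lambda>x. f x \<bullet> (rowwise curl r x + outer c p x))" for f
        by (rule l2.I_cong) (simp add: rp(3) restr_eq(1))
      have "integral T (\<lambda>x. P' x \<bullet> (rowwise curl (restr T r) x + restr T (outer c p) x)) = R (restr T r) (restr T (outer c p))"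
        using P' rp(1,2) by blast
      then show "integral T (\<lambda>x. P' x \<bullet> Y x) = integral T (\<lambda>x. restr T G x \<bullet> Y x)"
        unfolding Y lhs eq[OF rp(1,2)] .
    qed (use P' G_vpoly in auto)
  qed
qed

end

section \<open>The local estimate\<close>

lemma (in l2_functional) I_abs_le:
  assumes c: "continuous_on (closure Y) f" "continuous_on (closure Y) a" "continuous_on (closure Y) b"
    and le: "\<And>x. x \<in> Y \<Longrightarrow> \<bar>f x\<bar> \<le> p * a x + q * b x"
  shows "\<bar>I f\<bar> \<le> p * I a + q * I b"
proof -
  have ca: "continuous_on (closure Y) (\<lambda>x. p * a x)" "continuous_on (closure Y) (\<lambda>x. q * b x)"
    by (intro continuous_intros c)+
  have "\<bar>I f\<bar> \<le> I (\<lambda>x. \<bar>f x\<bar>)"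
    by (rule I_abs[OF c(1)])
  also have "\<dots> \<le> I (\<lambda>x. p * a x + q * b x)"
    by (intro I_mono continuous_intros c le)
  also have "\<dots> = p * I a + q * I b"
    unfolding I_add[OF ca] I_scale[OF c(2)] I_scale[OF c(3)] ..
  finally show ?thesis .
qed

lemma norm_real2: "(norm x)\<^sup>2 = (x $ 1)\<^sup>2 + (x $ 2)\<^sup>2" for x :: "real^2"
  unfolding power2_norm_eq_inner by (simp add: inner_vec_def sum_2 power2_eq_square)

lemma norm_real22: "(norm A)\<^sup>2 = (A $ 1 $ 1)\<^sup>2 + (A $ 1 $ 2)\<^sup>2 + (A $ 2 $ 1)\<^sup>2 + (A $ 2 $ 2)\<^sup>2" for A :: "real^2^2"
  unfolding power2_norm_eq_inner by (simp add: inner_vec_def sum_2 power2_eq_square)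

lemma norm_mult_unit:
  fixes A :: "real^2^2"
  assumes "norm t = 1"
  shows "(norm (A *v t))\<^sup>2 \<le> (norm A)\<^sup>2"
proof -
  have t: "(t $ 1)\<^sup>2 + (t $ 2)\<^sup>2 = 1"
    using norm_real2[of t] assms by simp
  have cs: "(a * t $ 1 + b * t $ 2)\<^sup>2 \<le> a\<^sup>2 + b\<^sup>2" for a b
  proof -
    have "a\<^sup>2 + b\<^sup>2 - (a * t $ 1 + b * t $ 2)\<^sup>2 = (a\<^sup>2 + b\<^sup>2) * ((t $ 1)\<^sup>2 + (t $ 2)\<^sup>2) - (a * t $ 1 + b * t $ 2)\<^sup>2"
      using t by simp
    also have "\<dots> = (a * t $ 2 - b * t $ 1)\<^sup>2"
      by (simp add: power2_eq_square algebra_simps)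
    finally show ?thesis by (metis diff_ge_0_iff_ge zero_le_power2)
  qed
  show ?thesis
    unfolding norm_real22 norm_real2 using cs[of "A $ 1 $ 1" "A $ 1 $ 2"] cs[of "A $ 2 $ 1" "A $ 2 $ 2"]
    by (simp add: matrix_vector_mult_def sum_2)
qed

lemma Young:
  fixes a b :: "'a::real_inner" and \<alpha> :: real
  assumes "\<alpha> > 0"
  shows "\<bar>a \<bullet> b\<bar> \<le> \<alpha> * (norm a)\<^sup>2 + 1 / (4 * \<alpha>) * (norm b)\<^sup>2"
proof -
  have "0 \<le> (2 * \<alpha> * norm a - norm b)\<^sup>2 / (4 * \<alpha>)"
    using assms by simp
  also have "\<dots> = \<alpha> * (norm a)\<^sup>2 + 1 / (4 * \<alpha>) * (norm b)\<^sup>2 - norm a * norm b"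
    using assms by (simp add: power2_eq_square field_simps)
  finally show ?thesis
    using Cauchy_Schwarz_ineq2[of a b] by linarith
qed

lemma norm_add_sq: "(norm (a + b))\<^sup>2 \<le> 2 * (norm a)\<^sup>2 + 2 * (norm b)\<^sup>2" for a b :: "'a::real_inner"
proof -
  have "2 * (norm a)\<^sup>2 + 2 * (norm b)\<^sup>2 - (norm (a + b))\<^sup>2 = (norm (a - b))\<^sup>2"
    unfolding power2_norm_eq_inner by (simp add: inner_add inner_diff inner_commute)
  then show ?thesis by (smt (verit) zero_le_power2)
qed

definition sym_part :: "real^2^2 \<Rightarrow> real^2^2" where
  "sym_part A = (A + transpose A) /\<^sub>R 2"

text \<open>The identity \<open>|A|\<^sup>2 = 2 |sym A|\<^sup>2 + 2 det A - (tr A)\<^sup>2\<close> is what makes Korn's inequality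
  elementary in the plane: \<open>\<integral> det \<nabla>v\<close> is a boundary term.\<close>

lemma norm_sym_part_det:
  "(norm A)\<^sup>2 \<le> 4 * (norm (sym_part B))\<^sup>2 + 4 * (norm (B - A))\<^sup>2 + 2 * det A"
proof -
  have "(norm A)\<^sup>2 \<le> 2 * (norm (sym_part A))\<^sup>2 + 2 * det A"
  proof -
    have "2 * (norm (sym_part A))\<^sup>2 + 2 * det A - (norm A)\<^sup>2 = (A $ 1 $ 1 + A $ 2 $ 2)\<^sup>2"
      unfolding norm_real22 by (simp add: sym_part_def transpose_def det_2 power2_eq_square field_simps)
    then show ?thesis by (smt (verit) zero_le_power2)
  qed
  moreover have "(norm (sym_part A))\<^sup>2 \<le> 2 * (norm (sym_part B))\<^sup>2 + 2 * (norm (sym_part (A - B)))\<^sup>2"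
  proof -
    have "sym_part A = sym_part B + sym_part (A - B)"
      by (simp add: sym_part_def transpose_def vec_eq_iff field_simps)
    then show ?thesis using norm_add_sq by metis
  qed
  moreover have "(norm (sym_part C))\<^sup>2 \<le> (norm C)\<^sup>2" for C
  proof -
    have "(norm C)\<^sup>2 - (norm (sym_part C))\<^sup>2 = (C $ 1 $ 2 - C $ 2 $ 1)\<^sup>2 / 2"
      unfolding norm_real22 by (simp add: sym_part_def transpose_def power2_eq_square field_simps)
    then show ?thesis by (smt (verit) zero_le_power2 divide_nonneg_nonneg)
  qed
  ultimately show ?thesis
    by (smt (verit) norm_minus_commute)
qed

text \<open>The determinant of the gradient is the gradient contracted with the row-wise curl of the
  field with components \<open>P x $ 2\<close> and 0, and a curl is free of divergence.\<close>

lemma (in star_polygon) integral_det_gradient: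
  assumes P: "P \<in> vpoly l"
  shows "integral T (\<lambda>x. det (gradient P x))
    = - (\<Sum>E\<in>ES. sign_TE T E * edge_integral E (\<lambda>x. P x $ 1 * dir_deriv (tangent E) P x $ 2))"
proof -
  define w :: "real^2 \<Rightarrow> real^2" where "w x = vector [P x $ 2, 0]" for x
  have w: "w \<in> vpoly l"
    unfolding w_def
  proof (rule vpoly_rowsI)
    show "(\<lambda>x. (vector [P x $ 2, 0] :: real^2) $ i) \<in> vpoly l" for i
      using exhaust_2[of i] vpoly_component[OF P, of 2] by (auto simp: vpoly_real bipoly_zero)
  qed
  have w12: "(\<lambda>x. w x $ 1) = (\<lambda>x. P x $ 2)" "(\<lambda>x. w x $ 2) = (\<lambda>x. 0)"
    by (simp_all add: w_def)
  have d0: "dir_deriv t (\<lambda>x. 0 :: real) x = 0" for t x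
    by (rule dir_deriv_eq[OF has_derivative_const])
  have dw: "dir_deriv t w x $ 1 = dir_deriv t P x $ 2" "dir_deriv t w x $ 2 = 0" for t x
    unfolding dir_deriv_component[OF w] w12 dir_deriv_component[OF P] by (simp_all add: d0)
  have "gradient P x \<bullet> rowwise curl w x = det (gradient P x)" for x
  proof -
    have "rowwise curl w x $ i = vector [dir_deriv (axis 2 1) w x $ i, - dir_deriv (axis 1 1) w x $ i]" for i
      by (simp add: rowwise_def curl_def dir_deriv_component[OF w])
    then show ?thesis
      by (simp add: inner_vec_def sum_2 det_2 gradient_def dw)
  qed
  moreover have "P x \<bullet> rowwise divergence (rowwise curl w) x = 0" for x
    by (simp add: rowwise_divergence_curl[OF w])
  moreover have "P x \<bullet> (rowwise curl w x *v normal E) = - (P x $ 1 * dir_deriv (tangent E) P x $ 2)" for x E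
    by (simp add: rowwise_curl_normal[OF w] inner_vec_def sum_2 dw)
  moreover have "edge_integral E (\<lambda>x. - f x) = - edge_integral E f" for E f
    by (simp add: edge_integral_def)
  ultimately show ?thesis
    using integration_by_parts[OF P rowwise_curl_vpoly[OF w]] by (simp add: sum_negf)
qed

text \<open>Collects all that the estimate knows about the geometry. The constants stay parameters,
  so that their independence of the mesh shows when the locale is instantiated.\<close>

locale regular_element = mesh_element M T z r k v for M T z r k v +
  fixes h \<rho> Ctr Cinv :: real
  assumes h: "0 < h" "T \<subseteq> cball z h" and \<rho>: "0 < \<rho>"
    and edge_length_ge: "\<And>E. E \<in> edges_of M T \<Longrightarrow> \<rho>\<^sup>2 * h \<le> edge_length E"
    and Ctr: "0 \<le> Ctr" and trace_inequality: "\<And>Z :: real^2 \<Rightarrow> real^2^2. Z \<in> vpoly (int k + 1) \<Longrightarrow>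
      (\<Sum>E\<in>edges_of M T. edge_integral E (\<lambda>x. (norm (Z x))\<^sup>2)) \<le> Ctr / h * integral T (\<lambda>x. (norm (Z x))\<^sup>2)"
    and Cinv: "0 \<le> Cinv" and inverse_inequality: "\<And>E (w :: real^2 \<Rightarrow> real^2). E \<in> edges_of M T \<Longrightarrow> w \<in> vpoly (int k + 2) \<Longrightarrow>
      edge_integral E (\<lambda>x. (norm (dir_deriv (tangent E) w x))\<^sup>2) \<le> Cinv / (edge_length E)\<^sup>2 * edge_integral E (\<lambda>x. (norm (w x))\<^sup>2)"
begin

abbreviation "Q \<equiv> gradient P"
abbreviation "W \<equiv> \<lambda>x. G x - gradient P x"
abbreviation "\<delta> E \<equiv> \<lambda>x. P x - \<gamma> E x"
abbreviation "nT f \<equiv> integral T (\<lambda>x. (norm (f x))\<^sup>2)"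
abbreviation "nE E f \<equiv> edge_integral E (\<lambda>x. (norm (f x))\<^sup>2)"
text \<open>The squared mismatch between potential and trace on the boundary. Up to constants,
  \<open>S / h\<close> is the size of every error term, and the scaled stabilisation controls
  it.\<close>

definition S where "S = (\<Sum>E\<in>ES. nE E (\<delta> E))"

lemma Q_vpoly: "Q \<in> vpoly (int k + 1)"
  using gradient_vpoly[OF P_vpoly] by (simp add: add.commute)

lemma W_vpoly: "W \<in> vpoly (int k + 1)"
  by (intro vpoly_diff G_vpoly Q_vpoly)

lemma \<delta>_vpoly: "E \<in> ES \<Longrightarrow> \<delta> E \<in> vpoly (int k + 2)"
  by (intro vpoly_diff P_vpoly trace(1))

lemma cont_norm: "f \<in> vpoly l \<Longrightarrow> continuous_on A (\<lambda>x. (norm (f x))\<^sup>2)"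
  by (intro continuous_intros vpoly_continuous)

lemma nT_nonneg: "f \<in> vpoly l \<Longrightarrow> 0 \<le> nT f"
  by (intro l2.I_nonneg cont_norm) auto

lemma nE_nonneg: "E \<in> ES \<Longrightarrow> f \<in> vpoly l \<Longrightarrow> 0 \<le> nE E f"
  by (rule l2_functional.I_nonneg[OF edge_l2 cont_norm]) auto

lemma S_nonneg: "0 \<le> S"
  unfolding S_def
proof (rule sum_nonneg)
  show "0 \<le> nE E (\<delta> E)" if "E \<in> ES" for E
    by (rule nE_nonneg[OF that \<delta>_vpoly[OF that]])
qed

lemma sign_sum_le:
  assumes "\<And>E. E \<in> ES \<Longrightarrow> \<bar>f E\<bar> \<le> g E"
  shows "\<bar>\<Sum>E\<in>ES. sign_TE T E * f E\<bar> \<le> (\<Sum>E\<in>ES. g E)"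
proof -
  have "\<bar>\<Sum>E\<in>ES. sign_TE T E * f E\<bar> \<le> (\<Sum>E\<in>ES. \<bar>sign_TE T E * f E\<bar>)"
    by (rule sum_abs)
  also have "\<dots> \<le> (\<Sum>E\<in>ES. g E)"
    using assms by (intro sum_mono) (simp add: abs_mult sign_TE_def)
  finally show ?thesis .
qed

lemma W_bound: "nT W \<le> (Ctr + 1) / h * S"
proof -
  \<comment> \<open>Weight in Young's inequality: after the trace inequality the term in W has the
    factor \<open>Ctr / (2 * (Ctr + 1))\<close>, below one half, and is absorbed. The added 1 keeps
    \<alpha> positive when \<open>Ctr\<close> is 0.\<close>
  define \<alpha> where "\<alpha> = (Ctr + 1) / (2 * h)"
  have \<alpha>: "\<alpha> > 0" using Ctr h by (simp add: \<alpha>_def)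
  have edge: "\<bar>edge_integral E (\<lambda>x. \<delta> E x \<bullet> (W x *v normal E))\<bar> \<le> \<alpha> * nE E (\<delta> E) + 1 / (4 * \<alpha>) * nE E W" if E: "E \<in> ES" for E
  proof (rule l2_functional.I_abs_le[OF edge_l2[OF E]])
    show "continuous_on (closure (seg E)) (\<lambda>x. \<delta> E x \<bullet> (W x *v normal E))"
      by (intro continuous_on_inner vpoly_continuous[OF \<delta>_vpoly[OF E]] vpoly_continuous[OF vpoly_mult_vec[OF W_vpoly]])
    show "continuous_on (closure (seg E)) (\<lambda>x. (norm (\<delta> E x))\<^sup>2)" "continuous_on (closure (seg E)) (\<lambda>x. (norm (W x))\<^sup>2)"
      by (rule cont_norm[OF \<delta>_vpoly[OF E]] cont_norm[OF W_vpoly])+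
    fix x
    have "norm (normal E) = 1"
      using normal_normal[OF ends[OF E]] by (simp add: norm_eq_1)
    then have "1 / (4 * \<alpha>) * (norm (W x *v normal E))\<^sup>2 \<le> 1 / (4 * \<alpha>) * (norm (W x))\<^sup>2"
      using \<alpha> norm_mult_unit by (intro mult_left_mono) auto
    then show "\<bar>\<delta> E x \<bullet> (W x *v normal E)\<bar> \<le> \<alpha> * (norm (\<delta> E x))\<^sup>2 + 1 / (4 * \<alpha>) * (norm (W x))\<^sup>2"
      using Young[OF \<alpha>, of "\<delta> E x" "W x *v normal E"] by linarith
  qed
  have "\<bar>\<Sum>E\<in>ES. sign_TE T E * edge_integral E (\<lambda>x. \<delta> E x \<bullet> (W x *v normal E))\<bar>
      \<le> (\<Sum>E\<in>ES. \<alpha> * nE E (\<delta> E) + 1 / (4 * \<alpha>) * nE E W)"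
    by (rule sign_sum_le) (rule edge)
  moreover have "nT W = - (\<Sum>E\<in>ES. sign_TE T E * edge_integral E (\<lambda>x. \<delta> E x \<bullet> (W x *v normal E)))"
    unfolding power2_norm_eq_inner by (rule gradient_error[OF W_vpoly])
  ultimately have "nT W \<le> (\<Sum>E\<in>ES. \<alpha> * nE E (\<delta> E) + 1 / (4 * \<alpha>) * nE E W)"
    by linarith
  also have "\<dots> = \<alpha> * S + 1 / (4 * \<alpha>) * (\<Sum>E\<in>ES. nE E W)"
    by (simp add: S_def sum.distrib sum_distrib_left)
  also have "\<dots> \<le> \<alpha> * S + 1 / (4 * \<alpha>) * (Ctr / h * nT W)"
    using \<alpha> trace_inequality[OF W_vpoly] by (intro add_left_mono mult_left_mono) auto
  also have "1 / (4 * \<alpha>) * (Ctr / h * nT W) = Ctr / (2 * (Ctr + 1)) * nT W"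
  proof -
    have "1 / (4 * (d / (2 * h))) * (a / h * x) = a / (2 * d) * x" if "d > 0" for d a x
      using h that by (simp add: field_simps)
    from this[of "Ctr + 1"] show ?thesis
      using Ctr by (simp add: \<alpha>_def)
  qed
  also have "\<alpha> * S + Ctr / (2 * (Ctr + 1)) * nT W \<le> \<alpha> * S + 1 / 2 * nT W"
    using Ctr nT_nonneg[OF W_vpoly] by (intro add_left_mono mult_right_mono) (auto simp: field_simps)
  finally have "nT W \<le> 2 * \<alpha> * S" by simp
  also have "2 * \<alpha> = (Ctr + 1) / h"
    using h by (simp add: \<alpha>_def field_simps)
  finally show ?thesis .
qed

text \<open>The circulation of the trace. For a rigid rotation the symmetric gradient and the
  mismatch vanish while this term does not, so it cannot be estimated on one element.\<close>

definition J where "J = (\<Sum>E\<in>ES. sign_TE T E * edge_integral E (\<lambda>x. \<gamma> E x $ 1 * dir_deriv (tangent E) (\<gamma> E) x $ 2))"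

text \<open>Expand \<gamma> = P - \<delta>. The one term with P undifferentiated,
  \<open>P x $ 1\<close> times the tangential derivative of the second component of \<delta>, is
  integrated by parts; then every product has an undifferentiated factor \<delta>.\<close>

lemma boundary_defect:
  "integral T (\<lambda>x. det (Q x)) + J = (\<Sum>E\<in>ES. sign_TE T E * edge_integral E (\<lambda>x.
     \<delta> E x $ 2 * dir_deriv (tangent E) P x $ 1 - \<delta> E x $ 1 * dir_deriv (tangent E) P x $ 2
     + \<delta> E x $ 1 * dir_deriv (tangent E) (\<delta> E) x $ 2))"
proof -
  \<comment> \<open>The end-point term uses the vertex unknown in place of the trace, so it is a
    function of the vertex alone, as \<open>sign_TE_sum\<close> requires.\<close>
  define q where "q V = P V $ 1 * (P V - h1_vert v V) $ 2" for V
  have "sign_TE T E * edge_integral E (\<lambda>x. \<delta> E x $ 2 * dir_deriv (tangent E) P x $ 1 - \<delta> E x $ 1 * dir_deriv (tangent E) P x $ 2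
     + \<delta> E x $ 1 * dir_deriv (tangent E) (\<delta> E) x $ 2)
    = sign_TE T E * edge_integral E (\<lambda>x. \<gamma> E x $ 1 * dir_deriv (tangent E) (\<gamma> E) x $ 2)
      - sign_TE T E * edge_integral E (\<lambda>x. P x $ 1 * dir_deriv (tangent E) P x $ 2)
      + sign_TE T E * (q (snd E) - q (fst E))" if E: "E \<in> ES" for E
  proof -
    interpret e: l2_functional "seg E" "edge_integral E" by (rule edge_l2[OF E])
    let ?d = "dir_deriv (tangent E)"
    have Pi: "(\<lambda>x. P x $ i) \<in> vpoly (int k + 2)" and \<delta>i: "(\<lambda>x. \<delta> E x $ i) \<in> vpoly (int k + 2)" for i
      by (rule vpoly_component[OF P_vpoly] vpoly_component[OF \<delta>_vpoly[OF E]])+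
    have c: "continuous_on A (\<lambda>x. f x $ i * ?d g x $ j)" if "f \<in> vpoly l" "g \<in> vpoly m"
      for f g :: "real^2 \<Rightarrow> real^2" and i j l m A
      by (intro continuous_on_mult vpoly_continuous[OF vpoly_component[OF that(1)]]
          vpoly_continuous[OF vpoly_component[OF vpoly_dir_deriv[OF that(2)]]])
    have ibp: "edge_integral E (\<lambda>x. \<delta> E x $ 2 * ?d P x $ 1) + edge_integral E (\<lambda>x. P x $ 1 * ?d (\<delta> E) x $ 2) = q (snd E) - q (fst E)"
      using edge_integration_by_parts[OF ends[OF E] Pi[of 1] \<delta>i[of 2]] trace(2,3)[OF E]
      by (simp add: dir_deriv_component[OF P_vpoly] dir_deriv_component[OF \<delta>_vpoly[OF E]] q_def mult.commute del: vector_minus_component)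
    have d\<gamma>: "?d (\<gamma> E) x = ?d P x - ?d (\<delta> E) x" for x
      using dir_deriv_diff[OF P_vpoly trace(1)[OF E], of "tangent E" x] by simp
    have "(\<lambda>x. (\<delta> E x $ 2 * ?d P x $ 1 - \<delta> E x $ 1 * ?d P x $ 2 + \<delta> E x $ 1 * ?d (\<delta> E) x $ 2) + P x $ 1 * ?d P x $ 2)
      = (\<lambda>x. (\<gamma> E x $ 1 * ?d (\<gamma> E) x $ 2 + \<delta> E x $ 2 * ?d P x $ 1) + P x $ 1 * ?d (\<delta> E) x $ 2)"
      unfolding d\<gamma> by (auto simp: algebra_simps)
    from arg_cong[OF this, of "edge_integral E"]
    have "edge_integral E (\<lambda>x. (\<delta> E x $ 2 * ?d P x $ 1 - \<delta> E x $ 1 * ?d P x $ 2 + \<delta> E x $ 1 * ?d (\<delta> E) x $ 2) + P x $ 1 * ?d P x $ 2)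
      = edge_integral E (\<lambda>x. (\<gamma> E x $ 1 * ?d (\<gamma> E) x $ 2 + \<delta> E x $ 2 * ?d P x $ 1) + P x $ 1 * ?d (\<delta> E) x $ 2)" .
    moreover have "edge_integral E (\<lambda>x. (\<delta> E x $ 2 * ?d P x $ 1 - \<delta> E x $ 1 * ?d P x $ 2 + \<delta> E x $ 1 * ?d (\<delta> E) x $ 2) + P x $ 1 * ?d P x $ 2)
      = edge_integral E (\<lambda>x. \<delta> E x $ 2 * ?d P x $ 1 - \<delta> E x $ 1 * ?d P x $ 2 + \<delta> E x $ 1 * ?d (\<delta> E) x $ 2)
        + edge_integral E (\<lambda>x. P x $ 1 * ?d P x $ 2)"
      by (intro e.I_add continuous_on_add continuous_on_diff c[OF P_vpoly P_vpoly] c[OF \<delta>_vpoly[OF E] P_vpoly] c[OF \<delta>_vpoly[OF E] \<delta>_vpoly[OF E]])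
    moreover have "edge_integral E (\<lambda>x. (\<gamma> E x $ 1 * ?d (\<gamma> E) x $ 2 + \<delta> E x $ 2 * ?d P x $ 1) + P x $ 1 * ?d (\<delta> E) x $ 2)
      = edge_integral E (\<lambda>x. \<gamma> E x $ 1 * ?d (\<gamma> E) x $ 2 + \<delta> E x $ 2 * ?d P x $ 1) + edge_integral E (\<lambda>x. P x $ 1 * ?d (\<delta> E) x $ 2)"
      by (intro e.I_add continuous_on_add c[OF trace(1)[OF E] trace(1)[OF E]] c[OF \<delta>_vpoly[OF E] P_vpoly] c[OF P_vpoly \<delta>_vpoly[OF E]])
    moreover have "edge_integral E (\<lambda>x. \<gamma> E x $ 1 * ?d (\<gamma> E) x $ 2 + \<delta> E x $ 2 * ?d P x $ 1)
      = edge_integral E (\<lambda>x. \<gamma> E x $ 1 * ?d (\<gamma> E) x $ 2) + edge_integral E (\<lambda>x. \<delta> E x $ 2 * ?d P x $ 1)"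
      by (intro e.I_add c[OF trace(1)[OF E] trace(1)[OF E]] c[OF \<delta>_vpoly[OF E] P_vpoly])
    ultimately have *: "edge_integral E (\<lambda>x. \<delta> E x $ 2 * ?d P x $ 1 - \<delta> E x $ 1 * ?d P x $ 2 + \<delta> E x $ 1 * ?d (\<delta> E) x $ 2)
      = edge_integral E (\<lambda>x. \<gamma> E x $ 1 * ?d (\<gamma> E) x $ 2) - edge_integral E (\<lambda>x. P x $ 1 * ?d P x $ 2) + (q (snd E) - q (fst E))"
      using ibp by linarith
    show ?thesis unfolding * by (simp only: distrib_left right_diff_distrib)
  qed
  then show ?thesis
    using sign_TE_sum[of q] integral_det_gradient[OF P_vpoly]
    by (simp add: J_def sum.distrib sum_subtractf)
qed

lemma edge_term_bound:
  assumes E: "E \<in> ES"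
  shows "1 / edge_length E * nE E (\<delta> E) \<le> 1 / (\<rho>\<^sup>2 * h) * nE E (\<delta> E)"
  using edge_length_ge[OF E] \<rho> h nE_nonneg[OF E \<delta>_vpoly[OF E]]
  by (intro mult_right_mono divide_left_mono mult_pos_pos edge_length_pos[OF ends[OF E]]) auto

lemma det_bound:
  "integral T (\<lambda>x. det (Q x)) + J \<le> 1 / 4 * nT Q + ((Ctr + 1) + (1 + Cinv) / \<rho>\<^sup>2) / h * S"
proof -
  \<comment> \<open>Chosen so that \<open>nT Q\<close> returns with a factor of at most 1/4. The
    determinant enters the bound for Q with the factor 2, which leaves one half to be absorbed
    there.\<close>
  define \<beta> where "\<beta> = (Ctr + 1) / h"
  have \<beta>: "\<beta> > 0" using Ctr h by (simp add: \<beta>_def)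
  have edge: "\<bar>edge_integral E (\<lambda>x.
     \<delta> E x $ 2 * dir_deriv (tangent E) P x $ 1 - \<delta> E x $ 1 * dir_deriv (tangent E) P x $ 2
     + \<delta> E x $ 1 * dir_deriv (tangent E) (\<delta> E) x $ 2)\<bar>
     \<le> (\<beta> + (1 + Cinv) / (\<rho>\<^sup>2 * h)) * nE E (\<delta> E) + 1 / (4 * \<beta>) * nE E Q" if E: "E \<in> ES" for E
  proof -
    interpret e: l2_functional "seg E" "edge_integral E" by (rule edge_l2[OF E])
    let ?d = "dir_deriv (tangent E)"
    \<comment> \<open>With this weight both Young terms scale alike under the inverse inequality, as
      \<open>nE E (\<delta> E)\<close> over the edge length.\<close>
    define \<mu> where "\<mu> = 1 / edge_length E"
    have \<mu>: "\<mu> > 0" using edge_length_pos[OF ends[OF E]] by (simp add: \<mu>_def)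
    note \<delta> = \<delta>_vpoly[OF E]
    have c: "continuous_on A (\<lambda>x. f x $ i * ?d g x $ j)" if "f \<in> vpoly l" "g \<in> vpoly m"
      for f g :: "real^2 \<Rightarrow> real^2" and i j l m A
      by (intro continuous_on_mult vpoly_continuous[OF vpoly_component[OF that(1)]]
          vpoly_continuous[OF vpoly_component[OF vpoly_dir_deriv[OF that(2)]]])
    have c1: "continuous_on A (\<lambda>x. \<delta> E x $ 2 * ?d P x $ 1 - \<delta> E x $ 1 * ?d P x $ 2)" for A
      by (intro continuous_on_diff c[OF \<delta> P_vpoly])
    have c2: "continuous_on A (\<lambda>x. \<delta> E x $ 1 * ?d (\<delta> E) x $ 2)" for A
      by (rule c[OF \<delta> \<delta>])
    have 1: "\<bar>edge_integral E (\<lambda>x. \<delta> E x $ 2 * ?d P x $ 1 - \<delta> E x $ 1 * ?d P x $ 2)\<bar> \<le> \<beta> * nE E (\<delta> E) + 1 / (4 * \<beta>) * nE E Q"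
    proof (rule e.I_abs_le[OF c1 cont_norm[OF \<delta>] cont_norm[OF Q_vpoly]])
      fix x
      \<comment> \<open>\<delta> turned by a right angle: the two products become a single inner
        product with a vector of the same norm.\<close>
      define \<delta>' :: "real^2" where "\<delta>' = vector [\<delta> E x $ 2, - \<delta> E x $ 1]"
      have a: "(norm \<delta>')\<^sup>2 = (norm (\<delta> E x))\<^sup>2"
        unfolding norm_real2 by (simp add: \<delta>'_def power2_eq_square algebra_simps)
      have b: "\<delta>' \<bullet> ?d P x = \<delta> E x $ 2 * ?d P x $ 1 - \<delta> E x $ 1 * ?d P x $ 2"
        by (simp add: \<delta>'_def inner_vec_def sum_2 algebra_simps)
      have c: "1 / (4 * \<beta>) * (norm (?d P x))\<^sup>2 \<le> 1 / (4 * \<beta>) * (norm (Q x))\<^sup>2"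
        unfolding gradient_mult[OF P_vpoly, symmetric]
        using \<beta> norm_mult_unit[OF norm_tangent[OF ends[OF E]]] by (intro mult_left_mono) auto
      show "\<bar>\<delta> E x $ 2 * ?d P x $ 1 - \<delta> E x $ 1 * ?d P x $ 2\<bar> \<le> \<beta> * (norm (\<delta> E x))\<^sup>2 + 1 / (4 * \<beta>) * (norm (Q x))\<^sup>2"
        unfolding b[symmetric] using Young[OF \<beta>, of \<delta>' "?d P x", unfolded a] c by linarith
    qed
    have 2: "\<bar>edge_integral E (\<lambda>x. \<delta> E x $ 1 * ?d (\<delta> E) x $ 2)\<bar> \<le> \<mu> * nE E (\<delta> E) + 1 / (4 * \<mu>) * nE E (?d (\<delta> E))"
    proof (rule e.I_abs_le[OF c2 cont_norm[OF \<delta>] cont_norm[OF vpoly_dir_deriv[OF \<delta>]]])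
      fix x
      have n: "(y $ i)\<^sup>2 \<le> (norm y)\<^sup>2" for y :: "real^2" and i
        unfolding norm_real2 using exhaust_2[of i] by auto
      have "\<bar>\<delta> E x $ 1 \<bullet> ?d (\<delta> E) x $ 2\<bar> \<le> \<mu> * (norm (\<delta> E x $ 1))\<^sup>2 + 1 / (4 * \<mu>) * (norm (?d (\<delta> E) x $ 2))\<^sup>2"
        by (rule Young[OF \<mu>])
      also have "\<dots> \<le> \<mu> * (norm (\<delta> E x))\<^sup>2 + 1 / (4 * \<mu>) * (norm (?d (\<delta> E) x))\<^sup>2"
        using \<mu> n[of "\<delta> E x" 1] n[of "?d (\<delta> E) x" 2] by (intro add_mono mult_left_mono) auto
      finally show "\<bar>\<delta> E x $ 1 * ?d (\<delta> E) x $ 2\<bar> \<le> \<mu> * (norm (\<delta> E x))\<^sup>2 + 1 / (4 * \<mu>) * (norm (?d (\<delta> E) x))\<^sup>2"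
        by simp
    qed
    have "1 / (4 * \<mu>) * nE E (?d (\<delta> E)) \<le> 1 / (4 * \<mu>) * (Cinv / (edge_length E)\<^sup>2 * nE E (\<delta> E))"
      using \<mu> by (intro mult_left_mono inverse_inequality[OF E \<delta>]) auto
    also have "\<dots> = Cinv / 4 * (\<mu> * nE E (\<delta> E))"
      using edge_length_pos[OF ends[OF E]] by (simp add: \<mu>_def power2_eq_square field_simps)
    also have "\<dots> \<le> Cinv * (\<mu> * nE E (\<delta> E))"
      using Cinv \<mu> nE_nonneg[OF E \<delta>] by (intro mult_right_mono) auto
    finally have "\<mu> * nE E (\<delta> E) + 1 / (4 * \<mu>) * nE E (?d (\<delta> E)) \<le> (1 + Cinv) * (\<mu> * nE E (\<delta> E))"
      by (simp add: algebra_simps)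
    also have "\<dots> \<le> (1 + Cinv) * (1 / (\<rho>\<^sup>2 * h) * nE E (\<delta> E))"
      using Cinv edge_term_bound[OF E] unfolding \<mu>_def by (intro mult_left_mono) auto
    finally have "\<bar>edge_integral E (\<lambda>x. \<delta> E x $ 1 * ?d (\<delta> E) x $ 2)\<bar> \<le> (1 + Cinv) / (\<rho>\<^sup>2 * h) * nE E (\<delta> E)"
      using 2 by simp
    moreover have "edge_integral E (\<lambda>x. \<delta> E x $ 2 * ?d P x $ 1 - \<delta> E x $ 1 * ?d P x $ 2 + \<delta> E x $ 1 * ?d (\<delta> E) x $ 2)
      = edge_integral E (\<lambda>x. \<delta> E x $ 2 * ?d P x $ 1 - \<delta> E x $ 1 * ?d P x $ 2) + edge_integral E (\<lambda>x. \<delta> E x $ 1 * ?d (\<delta> E) x $ 2)"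
      by (rule e.I_add[OF c1 c2])
    ultimately show ?thesis
      using 1 by (simp only: distrib_right)
  qed
  have "integral T (\<lambda>x. det (Q x)) + J \<le> (\<Sum>E\<in>ES. (\<beta> + (1 + Cinv) / (\<rho>\<^sup>2 * h)) * nE E (\<delta> E) + 1 / (4 * \<beta>) * nE E Q)"
    unfolding boundary_defect by (rule order_trans[OF abs_ge_self]) (rule sign_sum_le, rule edge)
  also have "\<dots> = (\<beta> + (1 + Cinv) / (\<rho>\<^sup>2 * h)) * S + 1 / (4 * \<beta>) * (\<Sum>E\<in>ES. nE E Q)"
    by (simp add: S_def sum.distrib sum_distrib_left)
  also have "\<dots> \<le> (\<beta> + (1 + Cinv) / (\<rho>\<^sup>2 * h)) * S + 1 / (4 * \<beta>) * (Ctr / h * nT Q)"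
    using \<beta> trace_inequality[OF Q_vpoly] by (intro add_left_mono mult_left_mono) auto
  also have "1 / (4 * \<beta>) * (Ctr / h * nT Q) = Ctr / (4 * (Ctr + 1)) * nT Q"
  proof -
    have "1 / (4 * (d / h)) * (a / h * x) = a / (4 * d) * x" if "d > 0" for d a x
      using h that by (simp add: field_simps)
    from this[of "Ctr + 1"] show ?thesis
      using Ctr by (simp add: \<beta>_def)
  qed
  also have "(\<beta> + (1 + Cinv) / (\<rho>\<^sup>2 * h)) * S + Ctr / (4 * (Ctr + 1)) * nT Q \<le> (\<beta> + (1 + Cinv) / (\<rho>\<^sup>2 * h)) * S + 1 / 4 * nT Q"
    using Ctr nT_nonneg[OF Q_vpoly] by (intro add_left_mono mult_right_mono) (auto simp: field_simps)
  also have "\<beta> + (1 + Cinv) / (\<rho>\<^sup>2 * h) = ((Ctr + 1) + (1 + Cinv) / \<rho>\<^sup>2) / h"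
    using h \<rho> by (simp add: \<beta>_def field_simps)
  finally show ?thesis by simp
qed


lemma sym_part_vpoly: "(\<lambda>x. sym_part (G x)) \<in> vpoly (int k + 1)"
proof (intro vpoly_rowsI)
  fix i j
  have "(\<lambda>x. G x $ i $ j) \<in> bipoly (int k + 1)" for i j
    using vpoly_component[OF vpoly_component[OF G_vpoly]] by (simp add: vpoly_real)
  from bipoly_scale[OF bipoly_add[OF this[of i j] this[of j i]], of "1 / 2"]
  show "(\<lambda>x. sym_part (G x) $ i $ j) \<in> vpoly (int k + 1)"
    by (simp add: sym_part_def transpose_def vpoly_real)
qed

definition K\<^sub>1 where "K\<^sub>1 = (Ctr + 1) + (1 + Cinv) / \<rho>\<^sup>2"

text \<open>The determinant inequality combined with \<open>det_bound\<close>: half of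
  \<open>nT Q\<close> is absorbed on the left, which doubles the other factors. \<open>J\<close>
  keeps its sign, for it must cancel exactly later.\<close>

lemma Q_bound: "nT Q \<le> 8 * nT (\<lambda>x. sym_part (G x)) + 8 * nT W + 4 * (K\<^sub>1 / h * S) - 4 * J"
proof -
  note c = cont_norm[OF sym_part_vpoly] cont_norm[OF W_vpoly] cont_norm[OF Q_vpoly]
  have cdet: "continuous_on A (\<lambda>x. det (Q x))" for A
  proof -
    have "continuous_on A (\<lambda>x. Q x $ i $ j)" for i j
      by (rule vpoly_continuous[OF vpoly_component[OF vpoly_component[OF Q_vpoly]]])
    then show ?thesis
      unfolding det_2 by (intro continuous_on_diff continuous_on_mult)
  qed
  have "nT Q \<le> integral T (\<lambda>x. (4 * (norm (sym_part (G x)))\<^sup>2 + 4 * (norm (W x))\<^sup>2) + 2 * det (Q x))"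
    by (intro l2.I_mono continuous_on_add continuous_on_mult_left c cdet) (rule norm_sym_part_det)
  also have "\<dots> = integral T (\<lambda>x. 4 * (norm (sym_part (G x)))\<^sup>2 + 4 * (norm (W x))\<^sup>2) + integral T (\<lambda>x. 2 * det (Q x))"
    by (intro l2.I_add continuous_on_add continuous_on_mult_left c cdet)
  also have "integral T (\<lambda>x. 4 * (norm (sym_part (G x)))\<^sup>2 + 4 * (norm (W x))\<^sup>2)
      = integral T (\<lambda>x. 4 * (norm (sym_part (G x)))\<^sup>2) + integral T (\<lambda>x. 4 * (norm (W x))\<^sup>2)"
    by (intro l2.I_add continuous_on_mult_left c)
  finally have "nT Q \<le> 4 * nT (\<lambda>x. sym_part (G x)) + 4 * nT W + 2 * integral T (\<lambda>x. det (Q x))"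
    by simp
  then show ?thesis
    using det_bound unfolding K\<^sub>1_def by linarith
qed

lemma G_bound: "nT G \<le> 2 * nT Q + 2 * nT W"
proof -
  note c = cont_norm[OF W_vpoly] cont_norm[OF Q_vpoly] cont_norm[OF G_vpoly]
  have "(norm (G x))\<^sup>2 \<le> 2 * (norm (Q x))\<^sup>2 + 2 * (norm (W x))\<^sup>2" for x
    using norm_add_sq[of "Q x" "W x"] by simp
  then have "nT G \<le> integral T (\<lambda>x. 2 * (norm (Q x))\<^sup>2 + 2 * (norm (W x))\<^sup>2)"
    by (intro l2.I_mono continuous_on_add continuous_on_mult_left c)
  also have "\<dots> = integral T (\<lambda>x. 2 * (norm (Q x))\<^sup>2) + integral T (\<lambda>x. 2 * (norm (W x))\<^sup>2)"
    by (intro l2.I_add continuous_on_mult_left c)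
  finally show ?thesis by simp
qed

lemma edge_length_le:
  assumes E: "E \<in> ES"
  shows "edge_length E \<le> 2 * h"
proof -
  have "closure T \<subseteq> cball z h"
    using h(2) by (simp add: closure_minimal)
  moreover have "fst E \<in> closure T" "snd E \<in> closure T"
    using seg_frontier(1)[OF E] frontier_disj(2) by auto
  ultimately have "fst E \<in> cball z h" "snd E \<in> cball z h" by blast+
  then show ?thesis
    unfolding edge_length_def using dist_triangle2[of "fst E" "snd E" z] by (simp add: dist_commute)
qed

text \<open>On an edge, potential minus edge component is G t minus the tangential derivative of
  \<gamma>, that is, W t plus the tangential derivative of \<delta>. The weight
  \<open>edge_length E\<close> offsets the \<open>1 / h\<close> of the trace inequality and one of
  the two negative powers in the inverse inequality.\<close>

lemma stab_rot_bound:
  "0 \<le> stab_rot k M T \<tau> \<tau>" "stab_rot k M T \<tau> \<tau> \<le> 4 * Ctr * nT W + 2 * Cinv / \<rho>\<^sup>2 / h * S"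
proof -
  let ?d = "\<lambda>E. dir_deriv (tangent E)"
  have eq: "edge_integral E (\<lambda>x. (pot_rot k M T \<tau> x *v tangent E - rot_edge \<tau> E x) \<bullet> (pot_rot k M T \<tau> x *v tangent E - rot_edge \<tau> E x))
    = nE E (\<lambda>x. W x *v tangent E + ?d E (\<delta> E) x)" if E: "E \<in> ES" for E
  proof (rule l2_functional.I_cong[OF edge_l2[OF E]])
    fix x assume x: "x \<in> seg E"
    have "pot_rot k M T \<tau> x *v tangent E - rot_edge \<tau> E x = G x *v tangent E - ?d E (\<gamma> E) x"
    proof -
      have "rot_edge \<tau> E = restr (seg E) (?d E (\<gamma> E))"
        by (simp add: discrete_grad_def grad_edge_eq[OF ends[OF E] v_edge[OF E]])
      then have "rot_edge \<tau> E x = ?d E (\<gamma> E) x"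
        using x closure_subset[of "seg E"] by (auto simp: restr_def)
      then show ?thesis by (simp add: pot_rot_eq restr_eq(2)[OF E x])
    qed
    also have "\<dots> = W x *v tangent E + ?d E (\<delta> E) x"
      unfolding dir_deriv_diff[OF P_vpoly trace(1)[OF E]] matrix_vector_mult_diff_rdistrib gradient_mult[OF P_vpoly] by simp
    finally show "(pot_rot k M T \<tau> x *v tangent E - rot_edge \<tau> E x) \<bullet> (pot_rot k M T \<tau> x *v tangent E - rot_edge \<tau> E x)
      = (norm (W x *v tangent E + ?d E (\<delta> E) x))\<^sup>2"
      by (simp only: power2_norm_eq_inner)
  qed
  have v: "(\<lambda>x. W x *v tangent E + ?d E (\<delta> E) x) \<in> vpoly (int k + 1)" if "E \<in> ES" for E
    using vpoly_dir_deriv[OF \<delta>_vpoly[OF that], of "tangent E"]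
    by (intro vpoly_add vpoly_mult_vec W_vpoly) (simp add: add.commute)
  have stab: "stab_rot k M T \<tau> \<tau> = (\<Sum>E\<in>ES. edge_length E * nE E (\<lambda>x. W x *v tangent E + ?d E (\<delta> E) x))"
    unfolding stab_rot_def by (intro sum.cong) (simp_all add: eq)
  show "0 \<le> stab_rot k M T \<tau> \<tau>"
    unfolding stab by (intro sum_nonneg mult_nonneg_nonneg nE_nonneg[OF _ v] less_imp_le[OF edge_length_pos[OF ends]])
  have "edge_length E * nE E (\<lambda>x. W x *v tangent E + ?d E (\<delta> E) x)
      \<le> 4 * h * nE E W + 2 * Cinv / \<rho>\<^sup>2 / h * nE E (\<delta> E)" if E: "E \<in> ES" for E
  proof -
    interpret e: l2_functional "seg E" "edge_integral E" by (rule edge_l2[OF E])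
    note pos = edge_length_pos[OF ends[OF E]]
    note d\<delta> = vpoly_dir_deriv[OF \<delta>_vpoly[OF E], of "tangent E"]
    have "nE E (\<lambda>x. W x *v tangent E + ?d E (\<delta> E) x) \<le> edge_integral E (\<lambda>x. 2 * (norm (W x))\<^sup>2 + 2 * (norm (?d E (\<delta> E) x))\<^sup>2)"
    proof (intro e.I_mono continuous_on_add continuous_on_mult_left cont_norm[OF v[OF E]] cont_norm[OF W_vpoly] cont_norm[OF d\<delta>])
      show "(norm (W x *v tangent E + ?d E (\<delta> E) x))\<^sup>2 \<le> 2 * (norm (W x))\<^sup>2 + 2 * (norm (?d E (\<delta> E) x))\<^sup>2" for x
        using norm_add_sq[of "W x *v tangent E" "?d E (\<delta> E) x"] norm_mult_unit[OF norm_tangent[OF ends[OF E]], of "W x"] by linarith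
    qed
    also have "\<dots> = edge_integral E (\<lambda>x. 2 * (norm (W x))\<^sup>2) + edge_integral E (\<lambda>x. 2 * (norm (?d E (\<delta> E) x))\<^sup>2)"
      by (intro e.I_add continuous_on_mult_left cont_norm[OF W_vpoly] cont_norm[OF d\<delta>])
    also have "\<dots> = 2 * nE E W + 2 * nE E (?d E (\<delta> E))"
      by (simp only: e.I_scale[OF cont_norm[OF W_vpoly]] e.I_scale[OF cont_norm[OF d\<delta>]])
    also have "\<dots> \<le> 2 * nE E W + 2 * (Cinv / (edge_length E)\<^sup>2 * nE E (\<delta> E))"
      using inverse_inequality[OF E \<delta>_vpoly[OF E]] by linarith
    finally have "edge_length E * nE E (\<lambda>x. W x *v tangent E + ?d E (\<delta> E) x)
      \<le> edge_length E * (2 * nE E W + 2 * (Cinv / (edge_length E)\<^sup>2 * nE E (\<delta> E)))"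
      using pos by (intro mult_left_mono) auto
    also have "\<dots> = 2 * edge_length E * nE E W + 2 * Cinv * (1 / edge_length E * nE E (\<delta> E))"
      using pos by (simp add: field_simps power2_eq_square)
    also have "\<dots> \<le> 2 * (2 * h) * nE E W + 2 * Cinv * (1 / (\<rho>\<^sup>2 * h) * nE E (\<delta> E))"
    proof (rule add_mono)
      show "2 * edge_length E * nE E W \<le> 2 * (2 * h) * nE E W"
        using edge_length_le[OF E] nE_nonneg[OF E W_vpoly] by (intro mult_right_mono) auto
      show "2 * Cinv * (1 / edge_length E * nE E (\<delta> E)) \<le> 2 * Cinv * (1 / (\<rho>\<^sup>2 * h) * nE E (\<delta> E))"
        by (rule mult_left_mono[OF edge_term_bound[OF E]]) (use Cinv in simp)
    qed
    finally show ?thesis by (simp add: field_simps)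
  qed
  then have "stab_rot k M T \<tau> \<tau> \<le> (\<Sum>E\<in>ES. 4 * h * nE E W + 2 * Cinv / \<rho>\<^sup>2 / h * nE E (\<delta> E))"
    unfolding stab by (rule sum_mono)
  also have "\<dots> = 4 * h * (\<Sum>E\<in>ES. nE E W) + 2 * Cinv / \<rho>\<^sup>2 / h * S"
    by (simp add: S_def sum.distrib sum_distrib_left)
  also have "\<dots> \<le> 4 * h * (Ctr / h * nT W) + 2 * Cinv / \<rho>\<^sup>2 / h * S"
    using h trace_inequality[OF W_vpoly] by (intro add_right_mono mult_left_mono) auto
  finally show "stab_rot k M T \<tau> \<tau> \<le> 4 * Ctr * nT W + 2 * Cinv / \<rho>\<^sup>2 / h * S"
    using h by simp
qed

lemma stab1_bound: "\<rho>\<^sup>2 * (S / h) \<le> stab1 k M T v v / h\<^sup>2"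
proof -
  have eq: "edge_integral E (\<lambda>x. (pot_grad k M T v x - bd_trace k M T v x) \<bullet> (pot_grad k M T v x - bd_trace k M T v x)) = nE E (\<delta> E)"
    if E: "E \<in> ES" for E
    unfolding power2_norm_eq_inner
    by (rule l2_functional.I_cong[OF edge_l2[OF E]])
      (use closure_subset[of "seg E"] in \<open>auto simp: pot_grad_eq restr_eq(2)[OF E] bd_trace_eq[OF E]\<close>)
  have "\<rho>\<^sup>2 * h * S = (\<Sum>E\<in>ES. \<rho>\<^sup>2 * h * nE E (\<delta> E))"
    by (simp add: S_def sum_distrib_left)
  also have "\<dots> \<le> (\<Sum>E\<in>ES. edge_length E * nE E (\<delta> E))"
    by (intro sum_mono mult_right_mono edge_length_ge nE_nonneg[OF _ \<delta>_vpoly])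
  also have "\<dots> = stab1 k M T v v"
    unfolding stab1_def by (intro sum.cong) (simp_all add: eq)
  finally have "\<rho>\<^sup>2 * h * S / h\<^sup>2 \<le> stab1 k M T v v / h\<^sup>2"
    using h by (intro divide_right_mono) auto
  then show ?thesis
    using h by (simp add: power2_eq_square)
qed

text \<open>Sum of \<open>G_bound\<close>, \<open>Q_bound\<close> and \<open>stab_rot_bound\<close>:
  16 = 2 * 8, 18 = 2 * 8 + 2, and the factors of \<open>K\<^sub>1\<close> and \<open>J\<close>
  double from 4 to 8. The last division by \<open>\<rho>\<^sup>2\<close> passes from
  \<open>S / h\<close> to the stabilisation.\<close>

theorem element_estimate:
  "(rot_norm_elem k M T \<tau>)\<^sup>2 \<le> 16 * integral T (\<lambda>x. (norm (sym_grad_elem k M T v x))\<^sup>2)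
    + ((18 + 4 * Ctr) * (Ctr + 1) + 8 * K\<^sub>1 + 2 * Cinv / \<rho>\<^sup>2) / \<rho>\<^sup>2 * (stab1 k M T v v / h\<^sup>2) - 8 * J"
proof -
  have l2: "(l2norm T (pot_rot k M T \<tau>))\<^sup>2 = nT G"
  proof -
    have "integral T (\<lambda>x. (norm (pot_rot k M T \<tau> x))\<^sup>2) = nT G"
      unfolding pot_rot_eq by (rule l2.I_cong) (simp add: restr_eq(1))
    then show ?thesis
      using nT_nonneg[OF G_vpoly] by (simp add: l2norm_def)
  qed
  have sym: "integral T (\<lambda>x. (norm (sym_grad_elem k M T v x))\<^sup>2) = nT (\<lambda>x. sym_part (G x))"
    by (rule l2.I_cong) (simp add: sym_grad_elem_def grad_elem_eq restr_eq(1) sym_part_def)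
  have "(rot_norm_elem k M T \<tau>)\<^sup>2 = nT G + stab_rot k M T \<tau> \<tau>"
    unfolding rot_norm_elem_def l2 using nT_nonneg[OF G_vpoly] stab_rot_bound(1) by simp
  also have "\<dots> \<le> 16 * nT (\<lambda>x. sym_part (G x)) + (18 + 4 * Ctr) * nT W + 8 * (K\<^sub>1 / h * S) + 2 * Cinv / \<rho>\<^sup>2 / h * S - 8 * J"
    using G_bound Q_bound stab_rot_bound(2) unfolding distrib_right[of 18] by linarith
  also have "\<dots> \<le> 16 * nT (\<lambda>x. sym_part (G x)) + (18 + 4 * Ctr) * ((Ctr + 1) / h * S) + 8 * (K\<^sub>1 / h * S) + 2 * Cinv / \<rho>\<^sup>2 / h * S - 8 * J"
    using W_bound Ctr by (intro diff_right_mono add_right_mono add_left_mono mult_left_mono) auto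
  also have "\<dots> = 16 * nT (\<lambda>x. sym_part (G x)) + ((18 + 4 * Ctr) * (Ctr + 1) + 8 * K\<^sub>1 + 2 * Cinv / \<rho>\<^sup>2) / \<rho>\<^sup>2 * (\<rho>\<^sup>2 * (S / h)) - 8 * J"
  proof -
    have cancel: "a / \<rho>\<^sup>2 * (\<rho>\<^sup>2 * y) = a * y" for a y
      using \<rho> by simp
    show ?thesis unfolding cancel by (simp add: algebra_simps add_divide_distrib)
  qed
  also have "\<dots> \<le> 16 * nT (\<lambda>x. sym_part (G x)) + ((18 + 4 * Ctr) * (Ctr + 1) + 8 * K\<^sub>1 + 2 * Cinv / \<rho>\<^sup>2) / \<rho>\<^sup>2 * (stab1 k M T v v / h\<^sup>2) - 8 * J"
    using stab1_bound Ctr Cinv \<rho>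
    by (intro diff_right_mono add_left_mono mult_left_mono) (auto simp: K\<^sub>1_def)
  finally show ?thesis
    unfolding sym .
qed

end

section \<open>Regular meshes\<close>

text \<open>Parallel to the side p q the triangle is nowhere wider than that side: between two
  points in this direction the barycentric weight of w is the same, and that of q changes by at most
  1.\<close>

lemma cball_in_triangle:
  fixes p q w :: "real^2"
  assumes sub: "cball x s \<subseteq> convex hull {p, q, w}" and pq: "p \<noteq> q" and s: "0 \<le> s"
  shows "2 * s \<le> dist p q"
proof -
  define d where "d = q - p"
  have d0: "norm d > 0" using pq by (simp add: d_def)
  have bary: "\<exists>b c. 0 \<le> b \<and> b \<le> 1 \<and> y - p = b *\<^sub>R d + c *\<^sub>R (w - p)" if y: "y \<in> convex hull {p, q, w}" for y
  proof -
    obtain a b c where abc: "0 \<le> a" "0 \<le> b" "0 \<le> c" "a + b + c = 1" "y = a *\<^sub>R p + b *\<^sub>R q + c *\<^sub>R w"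
      using y unfolding convex_hull_3 by blast
    have a: "a = 1 - b - c" using abc(4) by simp
    have "y - p = b *\<^sub>R d + c *\<^sub>R (w - p)"
      unfolding abc(5) d_def a by (simp add: algebra_simps)
    moreover have "b \<le> 1" using abc by linarith
    ultimately show ?thesis using abc(2) by blast
  qed
  define u where "u = d /\<^sub>R norm d"
  have nu: "norm u = 1" using d0 by (simp add: u_def)
  have in_T: "x + t *\<^sub>R n \<in> convex hull {p, q, w}" if "norm n = 1" "\<bar>t\<bar> \<le> s" for t n
    using that by (intro subsetD[OF sub]) (simp add: dist_norm)
  show ?thesis
  proof (cases "cross2 d (w - p) = 0")
    \<comment> \<open>A degenerate triangle lies on a line, so a disk inside it has radius
      0.\<close>
    case True
    have zero: "cross2 d (y - p) = 0" if y: "y \<in> convex hull {p, q, w}" for y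
    proof -
      obtain b c where "y - p = b *\<^sub>R d + c *\<^sub>R (w - p)"
        using bary[OF y] by blast
      then have "cross2 d (y - p) = b * cross2 d d + c * cross2 d (w - p)"
        by (simp only: cross2_simps(2,6))
      then show ?thesis using True cross2_simps(7)[of d] by simp
    qed
    define n :: "real^2" where "n = vector [- u $ 2, u $ 1]"
    have "(norm n)\<^sup>2 = (norm u)\<^sup>2"
      unfolding norm_real2 by (simp add: n_def)
    then have "norm n = 1" using nu power2_eq_iff_nonneg[of "norm n" "norm u"] by simp
    have "cross2 d (x + s *\<^sub>R n - p) - cross2 d (x + 0 *\<^sub>R n - p) = s * cross2 d n"
      by (simp add: cross2_def algebra_simps)
    moreover have "cross2 d n = norm d"
    proof -
      have "cross2 d n = d \<bullet> u" by (simp add: cross2_def n_def inner_vec_def sum_2)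
      also have "\<dots> = norm d" using d0 by (simp add: u_def dot_square_norm power2_eq_square)
      finally show ?thesis .
    qed
    ultimately have "s * norm d = 0"
      using zero[OF in_T[OF \<open>norm n = 1\<close>, of s]] zero[OF in_T[OF \<open>norm n = 1\<close>, of 0]] s by simp
    then show ?thesis using d0 by simp
  next
    case False
    obtain b c where b: "0 \<le> b" "b \<le> 1" "x + s *\<^sub>R u - p = b *\<^sub>R d + c *\<^sub>R (w - p)"
      using bary[OF in_T[OF nu, of s]] s by auto
    obtain b' c' where b': "0 \<le> b'" "b' \<le> 1" "x + (- s) *\<^sub>R u - p = b' *\<^sub>R d + c' *\<^sub>R (w - p)"
      using bary[OF in_T[OF nu, of "-s"]] s by auto
    have diff: "(2 * s) *\<^sub>R u = (b - b') *\<^sub>R d + (c - c') *\<^sub>R (w - p)"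
    proof -
      have "(2 * s) *\<^sub>R u = (x + s *\<^sub>R u - p) - (x + (- s) *\<^sub>R u - p)"
        by (simp add: algebra_simps flip: scaleR_2)
      then show ?thesis unfolding b b' by (simp add: algebra_simps)
    qed
    have "cross2 d ((2 * s) *\<^sub>R u) = 0"
      by (simp add: u_def cross2_simps)
    then have "(c - c') * cross2 d (w - p) = 0"
      unfolding diff cross2_simps(2,6,7) by simp
    then have "(2 * s) *\<^sub>R u = (b - b') *\<^sub>R d"
      using diff False by simp
    then have "norm ((2 * s) *\<^sub>R u) = norm ((b - b') *\<^sub>R d)"
      by simp
    then have "2 * s = \<bar>b - b'\<bar> * norm d"
      using nu s by simp
    also have "\<dots> \<le> 1 * norm d"
      using b b' d0 by (intro mult_right_mono) auto
    finally show ?thesis by (simp add: d_def dist_norm norm_minus_commute)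
  qed
qed

text \<open>Choose a submesh edge inside \<open>E\<close> and a submesh triangle of T having it as a
  side. The inradius is at most half that side, and each of the two regularity conditions costs one
  factor \<rho>.\<close>

lemma submesh_edge_length:
  assumes S: "matching_submesh \<Omega> M S"
    and reg: "\<And>\<tau> T. \<tau> \<in> S \<Longrightarrow> 2 simplex \<tau> \<Longrightarrow> \<rho> * diameter \<tau> \<le> inradius \<tau>"
      "\<And>\<tau> T. \<tau> \<in> S \<Longrightarrow> 2 simplex \<tau> \<Longrightarrow> T \<in> elems M \<Longrightarrow> \<tau> \<subseteq> closure T \<Longrightarrow> \<rho> * diameter T \<le> diameter \<tau>"
    and \<rho>: "0 < \<rho>" and T: "T \<in> elems M" and E: "E \<in> edges_of M T" "fst E \<noteq> snd E"
  shows "\<rho>\<^sup>2 * diameter T \<le> edge_length E"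
proof -
  have cs: "closure (seg E) = closed_segment (fst E) (snd E)"
    by (rule closure_seg[OF E(2)])
  have EM: "E \<in> edges M" and fr: "seg E \<subseteq> frontier T"
    using E(1) by (auto simp: edges_of_def)
  have "fst E \<in> closure (seg E)" using cs by simp
  then obtain e where e: "e \<in> S" "1 simplex e" "e \<subseteq> closure (seg E)"
    using S EM unfolding matching_submesh_def by blast
  then obtain C where C: "card C = 2" "e = convex hull C"
    unfolding simplex_def by force
  then obtain p q where pq: "C = {p, q}" "p \<noteq> q"
    by (meson card_2_iff)
  have e_seg: "e = closed_segment p q"
    by (simp add: C(2) pq(1) segment_convex_hull)
  have "dist p q \<le> edge_length E"
  proof -
    have "p \<in> closed_segment (fst E) (snd E)" "q \<in> closed_segment (fst E) (snd E)"
      using e(3) cs e_seg by auto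
    then obtain s t where st: "0 \<le> s" "s \<le> 1" "p = (1 - s) *\<^sub>R fst E + s *\<^sub>R snd E"
      "0 \<le> t" "t \<le> 1" "q = (1 - t) *\<^sub>R fst E + t *\<^sub>R snd E"
      unfolding closed_segment_def by blast
    have "p - q = (t - s) *\<^sub>R (fst E - snd E)"
      unfolding st by (simp add: algebra_simps)
    then have "dist p q = \<bar>t - s\<bar> * dist (fst E) (snd E)"
      by (simp add: dist_norm)
    also have "\<dots> \<le> 1 * dist (fst E) (snd E)"
      using st by (intro mult_right_mono) auto
    finally show ?thesis by (simp add: edge_length_def)
  qed
  have "closure (seg E) \<subseteq> frontier T"
    using fr frontier_closed closure_minimal by blast
  \<comment> \<open>The midpoint selects a triangle that meets the relative interior of e. As the
    two meet in a face of e, all of e lies in the triangle, and its ends are extreme points, hence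
    vertices, of it.\<close>
  moreover have m: "midpoint p q \<in> e"
    by (simp add: e_seg)
  ultimately have "midpoint p q \<in> closure T"
    using e(3) by (auto simp: frontier_def)
  then obtain \<tau> where \<tau>: "\<tau> \<in> S" "2 simplex \<tau>" "\<tau> \<subseteq> closure T" "midpoint p q \<in> \<tau>"
    using S T unfolding matching_submesh_def by blast
  have "(A \<inter> B) face_of A" if "A \<in> S" "B \<in> S" for A B
    using S that unfolding matching_submesh_def simplicial_complex_def by simp
  then have face: "(e \<inter> \<tau>) face_of e" "(\<tau> \<inter> e) face_of \<tau>"
    using e(1) \<tau>(1) by simp_all
  have "midpoint p q \<in> open_segment p q"
    using pq(2) by simp
  moreover have "p \<in> e" "q \<in> e" "midpoint p q \<in> e \<inter> \<tau>"
    using m \<tau>(4) by (simp_all add: e_seg)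
  ultimately have "p \<in> e \<inter> \<tau>" "q \<in> e \<inter> \<tau>"
    using face(1)[unfolded face_of_def] by blast+
  then have "e \<subseteq> \<tau>"
    unfolding e_seg using convex_simplex[OF \<tau>(2)] by (simp add: closed_segment_subset)
  then have e_face: "e face_of \<tau>"
    using face(2) by (simp add: Int_absorb1)
  obtain D where D: "card D = 3" "\<tau> = convex hull D"
    using \<tau>(2) unfolding simplex_def by force
  have "{p} face_of e" "{q} face_of e"
    unfolding e_seg face_of_singleton by (simp_all add: extreme_point_of_segment)
  then have "{p} face_of \<tau>" "{q} face_of \<tau>"
    using face_of_trans e_face by blast+
  then have "p extreme_point_of \<tau>" "q extreme_point_of \<tau>"
    unfolding face_of_singleton .
  then have "p \<in> D" "q \<in> D"
    unfolding D(2) using extreme_point_of_convex_hull by blast+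
  then have "card (D - {p, q}) = 1"
    using D(1) pq(2) by (subst card_Diff_subset) (auto intro: card_ge_0_finite)
  then obtain w where "D - {p, q} = {w}"
    by (meson card_1_singletonE)
  then have Dw: "D = {p, q, w}"
    using \<open>p \<in> D\<close> \<open>q \<in> D\<close> by blast
  have "inradius \<tau> \<le> dist p q / 2"
    unfolding inradius_def
  proof (rule cSup_least)
    have "0 \<in> {r. 0 \<le> r \<and> (\<exists>x. cball x r \<subseteq> \<tau>)}"
      using \<tau>(4) by (auto intro: exI[of _ "midpoint p q"])
    then show "{r. 0 \<le> r \<and> (\<exists>x. cball x r \<subseteq> \<tau>)} \<noteq> {}" by blast
    fix s assume "s \<in> {r. 0 \<le> r \<and> (\<exists>x. cball x r \<subseteq> \<tau>)}"
    then obtain x where x: "0 \<le> s" "cball x s \<subseteq> convex hull {p, q, w}"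
      unfolding D(2) Dw by blast
    show "s \<le> dist p q / 2"
      using cball_in_triangle[OF x(2) pq(2) x(1)] by simp
  qed
  have "\<rho>\<^sup>2 * diameter T = \<rho> * (\<rho> * diameter T)"
    by (simp add: power2_eq_square)
  also have "\<dots> \<le> \<rho> * diameter \<tau>"
    using reg(2)[OF \<tau>(1,2) T \<tau>(3)] \<rho> by (intro mult_left_mono) auto
  also have "\<dots> \<le> dist p q / 2"
    using reg(1)[OF \<tau>(1,2)] \<open>inradius \<tau> \<le> dist p q / 2\<close> by linarith
  also have "\<dots> \<le> edge_length E"
    using \<open>dist p q \<le> edge_length E\<close> zero_le_dist[of p q] by linarith
  finally show ?thesis .
qed

lemma open_polygonD:
  assumes "open_polygon A"
  shows "open A" "bounded A" "A \<noteq> {}"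
proof -
  obtain F where F: "finite F" "\<And>\<tau>. \<tau> \<in> F \<Longrightarrow> 2 simplex \<tau>" "A = interior (\<Union>F)"
    using assms unfolding open_polygon_def by blast
  show "open A" "A \<noteq> {}"
    using assms F(3) by (auto simp: open_polygon_def)
  have "bounded (\<Union>F)"
    using F(1,2) compact_simplex compact_imp_bounded by (intro bounded_Union) blast+
  then show "bounded A"
    unfolding F(3) using bounded_subset interior_subset by blast
qed

lemma diameter_open_pos:
  fixes T :: "(real^2) set"
  assumes "open T" "bounded T" "T \<noteq> {}"
  shows "0 < diameter T"
proof -
  obtain x e where x: "x \<in> T" "0 < e" "ball x e \<subseteq> T"
    using assms by (metis ex_in_conv open_contains_ball)
  define y where "y = x + (e / 2) *\<^sub>R axis 1 (1::real)"
  have xy: "dist x y = e / 2"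
    using x(2) by (simp add: y_def dist_norm norm_axis_1)
  then have "y \<in> T"
    using x by auto
  then show ?thesis
    using diameter_bounded_bound[OF assms(2) x(1)] xy x(2) by fastforce
qed

lemma polygonal_meshD:
  assumes "polygonal_mesh \<Omega> M"
  shows "finite (elems M)" and "finite (edges M)" and "pairwise disjnt (elems M)"
    and "pairwise (\<lambda>E E'. disjnt (seg E) (seg E')) (edges M)"
    and "\<forall>T\<in>elems M. open_polygon T" and "\<forall>E\<in>edges M. fst E \<noteq> snd E"
    and "\<forall>T\<in>elems M. frontier T = (\<Union>E\<in>edges_of M T. closure (seg E))"
    and "closure \<Omega> = (\<Union>T\<in>elems M. closure T)" and "verts M = (\<Union>E\<in>edges M. verts_of_edge E)"
    and "\<forall>E\<in>edges M. seg E \<subseteq> frontier \<Omega> \<or> card {T \<in> elems M. seg E \<subseteq> frontier T} = 2"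
  using assms unfolding polygonal_mesh_def by simp_all

lemma star_polygon_element:
  assumes M: "polygonal_mesh \<Omega> M" and reg: "regular_mesh \<Omega> \<rho> M" and \<rho>: "0 < \<rho>" and T: "T \<in> elems M"
  shows "\<exists>z. star_polygon T z (\<rho> * diameter T) (edges_of M T) \<and> T \<subseteq> cball z (diameter T)"
proof -
  have pT: "open_polygon T" and fE: "finite (edges M)" and ne: "\<And>E. E \<in> edges M \<Longrightarrow> fst E \<noteq> snd E"
    and dj: "pairwise (\<lambda>E E'. disjnt (seg E) (seg E')) (edges M)"
    and fr: "frontier T = (\<Union>E\<in>edges_of M T. closure (seg E))"
    using polygonal_meshD[OF M] T by blast+
  have sub: "edges_of M T \<subseteq> edges M"
    by (auto simp: edges_of_def)
  note T' = open_polygonD[OF pT]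
  from conjunct2[OF reg[unfolded regular_mesh_def], THEN bspec, OF T]
  obtain z where z: "\<forall>y\<in>ball z (\<rho> * diameter T). \<forall>x\<in>T. closed_segment y x \<subseteq> T" ..
  have h: "0 < diameter T" by (rule diameter_open_pos[OF T'])
  have star: "star_polygon T z (\<rho> * diameter T) (edges_of M T)"
  proof
    show "open T" "bounded T" "T \<noteq> {}" by (rule T')+
    show "0 < \<rho> * diameter T" using \<rho> h by simp
    show "closed_segment y x \<subseteq> T" if "y \<in> ball z (\<rho> * diameter T)" "x \<in> T" for y x
      by (rule z[rule_format, OF that])
    show "finite (edges_of M T)" using fE sub finite_subset by blast
    show "fst E \<noteq> snd E" if "E \<in> edges_of M T" for E using ne sub that by blast
    show "pairwise (\<lambda>E E'. disjnt (seg E) (seg E')) (edges_of M T)"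
      using dj sub by (rule pairwise_subset)
    show "frontier T = (\<Union>E\<in>edges_of M T. closure (seg E))" by (rule fr)
  qed
  have "z \<in> T"
    using star_polygon.ball_subset[OF star] star_polygon.z_ball[OF star] by blast
  then have "T \<subseteq> cball z (diameter T)"
    using diameter_bounded_bound[OF T'(2)] by auto
  then show ?thesis using star by blast
qed

text \<open>The trace inequality is perimeter times pointwise bound:
  \<open>8 * diameter T / \<rho>\<close> from \<open>perimeter_bound\<close> with radius
  \<open>\<rho> * diameter T\<close>, times \<open>Csup / (diameter T)\<^sup>2\<close>. This is the
  origin of the constant \<open>8 * Csup / \<rho>\<close>.\<close>

lemma regular_element_mesh:
  assumes M: "polygonal_mesh \<Omega> M" and reg: "regular_mesh \<Omega> \<rho> M" and \<rho>: "0 < \<rho>" and T: "T \<in> elems M"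
    and v: "v \<in> H1 k M"
    and Csup: "0 \<le> Csup" "\<And>(Z :: real^2 \<Rightarrow> real^2^2) z h T x. Z \<in> vpoly (int k + 1) \<Longrightarrow> 0 < h \<Longrightarrow> open T \<Longrightarrow> bounded T \<Longrightarrow>
      ball z (\<rho> * h) \<subseteq> T \<Longrightarrow> x \<in> cball z h \<Longrightarrow> (norm (Z x))\<^sup>2 \<le> Csup / h\<^sup>2 * integral T (\<lambda>x. (norm (Z x))\<^sup>2)"
    and Cinv: "0 \<le> Cinv" "\<And>(w :: real^2 \<Rightarrow> real^2) E. w \<in> vpoly (int k + 2) \<Longrightarrow> fst E \<noteq> snd E \<Longrightarrow>
      edge_integral E (\<lambda>x. (norm (dir_deriv (tangent E) w x))\<^sup>2) \<le> Cinv / (edge_length E)\<^sup>2 * edge_integral E (\<lambda>x. (norm (w x))\<^sup>2)"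
  shows "\<exists>z. regular_element M T z (\<rho> * diameter T) k v (diameter T) \<rho> (8 * Csup / \<rho>) Cinv"
proof -
  obtain z where sp: "star_polygon T z (\<rho> * diameter T) (edges_of M T)" and sub: "T \<subseteq> cball z (diameter T)"
    using star_polygon_element[OF M reg \<rho> T] by blast
  interpret star_polygon T z "\<rho> * diameter T" "edges_of M T" by (rule sp)
  have h: "0 < diameter T" by (rule diameter_open_pos[OF open_T bounded_T nonempty_T])
  have EM: "E \<in> edges M" if "E \<in> edges_of M T" for E
    using that by (simp add: edges_of_def)
  have mesh: "mesh_element M T z (\<rho> * diameter T) k v"
    using v T EM by (intro mesh_element.intro[OF sp] mesh_element_axioms.intro) (auto simp: H1_def)
  from conjunct1[OF reg[unfolded regular_mesh_def]]
  obtain S where "matching_submesh \<Omega> M S \<and>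
    (\<forall>\<tau>\<in>S. 2 simplex \<tau> \<longrightarrow> \<rho> * diameter \<tau> \<le> inradius \<tau> \<and>
      (\<forall>T\<in>elems M. \<tau> \<subseteq> closure T \<longrightarrow> \<rho> * diameter T \<le> diameter \<tau>))" ..
  then have S: "matching_submesh \<Omega> M S"
    "\<And>\<tau>. \<tau> \<in> S \<Longrightarrow> 2 simplex \<tau> \<Longrightarrow> \<rho> * diameter \<tau> \<le> inradius \<tau>"
    "\<And>\<tau> T. \<tau> \<in> S \<Longrightarrow> 2 simplex \<tau> \<Longrightarrow> T \<in> elems M \<Longrightarrow> \<tau> \<subseteq> closure T \<Longrightarrow> \<rho> * diameter T \<le> diameter \<tau>"
    by simp_all
  have "regular_element_axioms M T z k (diameter T) \<rho> (8 * Csup / \<rho>) Cinv"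
  proof
    show "0 < diameter T" "T \<subseteq> cball z (diameter T)" "0 < \<rho>" "0 \<le> Cinv"
      by (fact h sub \<rho> Cinv(1))+
    show "0 \<le> 8 * Csup / \<rho>" using Csup(1) \<rho> by simp
    show "\<rho>\<^sup>2 * diameter T \<le> edge_length E" if "E \<in> edges_of M T" for E
      by (rule submesh_edge_length[OF S(1) S(2) S(3) \<rho> T that ends[OF that]])
    show "edge_integral E (\<lambda>x. (norm (dir_deriv (tangent E) w x))\<^sup>2) \<le> Cinv / (edge_length E)\<^sup>2 * edge_integral E (\<lambda>x. (norm (w x))\<^sup>2)"
      if "E \<in> edges_of M T" "w \<in> vpoly (int k + 2)" for E and w :: "real^2 \<Rightarrow> real^2"
      by (rule Cinv(2)[OF that(2) ends[OF that(1)]])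
    fix Z :: "real^2 \<Rightarrow> real^2^2" assume Z: "Z \<in> vpoly (int k + 1)"
    define b where "b = Csup / (diameter T)\<^sup>2 * integral T (\<lambda>x. (norm (Z x))\<^sup>2)"
    have b: "(norm (Z x))\<^sup>2 \<le> b" if "x \<in> cball z (diameter T)" for x
      unfolding b_def by (rule Csup(2)[OF Z h open_T bounded_T ball_subset that])
    have "0 \<le> b"
      using b[of z] h by (meson centre_in_cball less_imp_le order_trans zero_le_power2)
    have "edge_integral E (\<lambda>x. (norm (Z x))\<^sup>2) \<le> edge_length E * b" if E: "E \<in> edges_of M T" for E
    proof -
      have "seg E \<subseteq> cball z (diameter T)"
        using seg_frontier(2)[OF E] frontier_disj(2) closure_minimal[OF sub closed_cball] by blast
      then have "edge_integral E (\<lambda>x. (norm (Z x))\<^sup>2) \<le> edge_integral E (\<lambda>x. b)"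
        by (intro l2_functional.I_mono[OF l2_functional_edge[OF ends[OF E]]] continuous_intros vpoly_continuous[OF Z] b) auto
      then show ?thesis by (simp add: edge_integral_def)
    qed
    then have "(\<Sum>E\<in>edges_of M T. edge_integral E (\<lambda>x. (norm (Z x))\<^sup>2)) \<le> (\<Sum>E\<in>edges_of M T. edge_length E * b)"
      by (rule sum_mono)
    also have "\<dots> = (\<Sum>E\<in>edges_of M T. edge_length E) * b"
      by (simp add: sum_distrib_right)
    also have "\<dots> \<le> (8 * diameter T / \<rho>) * b"
      using perimeter_bound[OF h sub] \<rho> h \<open>0 \<le> b\<close> by (intro mult_right_mono) (auto simp: field_simps power2_eq_square)
    also have "\<dots> = 8 * Csup / \<rho> / diameter T * integral T (\<lambda>x. (norm (Z x))\<^sup>2)"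
      using h by (simp add: b_def power2_eq_square)
    finally show "(\<Sum>E\<in>edges_of M T. edge_integral E (\<lambda>x. (norm (Z x))\<^sup>2)) \<le> 8 * Csup / \<rho> / diameter T * integral T (\<lambda>x. (norm (Z x))\<^sup>2)" .
  qed
  then show ?thesis
    using mesh regular_element.intro by blast
qed

text \<open>With equal signs both elements would contain the points close to an inner point of the
  edge on one and the same side.\<close>

lemma opposite_signs:
  assumes S1: "star_polygon T1 z1 r1 ES1" and S2: "star_polygon T2 z2 r2 ES2"
    and E: "E \<in> ES1" "E \<in> ES2" and disj: "T1 \<inter> T2 = {}"
  shows "sign_TE T1 E + sign_TE T2 E = 0"
proof (rule ccontr)
  interpret S1: star_polygon T1 z1 r1 ES1 by (rule S1)
  interpret S2: star_polygon T2 z2 r2 ES2 by (rule S2)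
  let ?m1 = "(fst E - z1) \<bullet> normal E" and ?m2 = "(fst E - z2) \<bullet> normal E"
  have "?m1 \<noteq> 0" "?m2 \<noteq> 0"
    using S1.normal_distance[OF E(1)] S1.r_pos S2.normal_distance[OF E(2)] S2.r_pos by auto
  moreover assume "sign_TE T1 E + sign_TE T2 E \<noteq> 0"
  ultimately obtain \<sigma> :: real where \<sigma>: "\<sigma> = 1 \<or> \<sigma> = -1" "\<sigma> * ?m1 < 0" "\<sigma> * ?m2 < 0"
    unfolding S1.sign_TE_eq[OF E(1)] S2.sign_TE_eq[OF E(2)]
    by (cases "?m1 > 0"; cases "?m2 > 0") (auto simp: sgn_if intro: that[of 1] that[of "-1"])
  have "midpoint (fst E) (snd E) \<in> seg E"
    using S1.ends[OF E(1)] by (simp add: seg_def)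
  then obtain x where x: "x \<in> seg E" by blast
  have "\<forall>\<^sub>F s in at_right 0. x + (\<sigma> * s) *\<^sub>R normal E \<in> T1 \<and> x + (\<sigma> * s) *\<^sub>R normal E \<in> T2"
    using S1.side_at_right(1)[OF E(1) x \<sigma>(1,2)] S2.side_at_right(1)[OF E(2) x \<sigma>(1,3)] by (rule eventually_conj)
  then show False
    using disj eventually_happens'[OF trivial_limit_at_right_real] by blast
qed

text \<open>After exchanging the sums, an inner edge occurs once for each of its two elements, with
  opposite signs. It is essential that c depends on the edge alone.\<close>

lemma sum_over_interfaces:
  assumes M: "polygonal_mesh \<Omega> M"
    and star: "\<And>T. T \<in> elems M \<Longrightarrow> \<exists>z r. star_polygon T z r (edges_of M T)"
    and boundary: "\<And>E. E \<in> edges M \<Longrightarrow> seg E \<subseteq> frontier \<Omega> \<Longrightarrow> c E = 0"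
  shows "(\<Sum>T\<in>elems M. \<Sum>E\<in>edges_of M T. sign_TE T E * c E) = 0"
proof -
  have fin: "finite (elems M)" "finite (edges M)" and disj: "pairwise disjnt (elems M)"
    and two: "\<And>E. E \<in> edges M \<Longrightarrow> seg E \<subseteq> frontier \<Omega> \<or> card {T \<in> elems M. seg E \<subseteq> frontier T} = 2"
    using polygonal_meshD[OF M] by blast+
  have "(\<Sum>T\<in>elems M. \<Sum>E\<in>edges_of M T. sign_TE T E * c E)
    = (\<Sum>E\<in>edges M. \<Sum>T\<in>{T \<in> elems M. seg E \<subseteq> frontier T}. sign_TE T E * c E)"
    unfolding edges_of_def by (rule sum.swap_restrict[OF fin])
  also have "\<dots> = 0"
  proof (rule sum.neutral, rule ballI)
    fix E assume E: "E \<in> edges M"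
    show "(\<Sum>T\<in>{T \<in> elems M. seg E \<subseteq> frontier T}. sign_TE T E * c E) = 0"
    proof (cases "seg E \<subseteq> frontier \<Omega>")
      case True
      then show ?thesis using boundary[OF E] by simp
    next
      case False
      then have "card {T \<in> elems M. seg E \<subseteq> frontier T} = 2"
        using two[OF E] by blast
      then obtain T1 T2 where T: "{T \<in> elems M. seg E \<subseteq> frontier T} = {T1, T2}" "T1 \<noteq> T2"
        by (meson card_2_iff)
      then have mem: "T1 \<in> elems M" "T2 \<in> elems M" "E \<in> edges_of M T1" "E \<in> edges_of M T2"
        using E by (auto simp: edges_of_def)
      obtain z1 r1 z2 r2 where "star_polygon T1 z1 r1 (edges_of M T1)" "star_polygon T2 z2 r2 (edges_of M T2)"
        using star mem(1,2) by blast
      moreover have "T1 \<inter> T2 = {}"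
        using disj mem(1,2) T(2) by (auto simp: pairwise_def disjnt_def)
      ultimately have "sign_TE T1 E + sign_TE T2 E = 0"
        using opposite_signs mem(3,4) by blast
      then show ?thesis
        unfolding T(1) using T(2) by (simp add: distrib_right[symmetric])
    qed
  qed
  finally show ?thesis .
qed

text \<open>Zero end values and zero moments leave only the zero trace.\<close>

lemma edge_trace_boundary:
  assumes M: "polygonal_mesh \<Omega> M" and v: "v \<in> H1_0 \<Omega> k M" and E: "E \<in> edges M" "seg E \<subseteq> frontier \<Omega>"
    and x: "x \<in> closure (seg E)"
  shows "edge_trace k E v x $ i = 0"
proof -
  have ne: "fst E \<noteq> snd E" and verts: "fst E \<in> verts M" "snd E \<in> verts M"
    using polygonal_meshD(6,9)[OF M] E(1) by (auto simp: verts_of_edge_def)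
  have "closure (seg E) \<subseteq> frontier \<Omega>"
    using E(2) frontier_closed closure_minimal by blast
  then have fr: "fst E \<in> frontier \<Omega>" "snd E \<in> frontier \<Omega>"
    using closure_seg[OF ne] by auto
  have vE: "h1_edge v E \<in> by_rows (polys (int k) (seg E))" "h1_edge v E = (\<lambda>x. 0)"
    "h1_vert v (fst E) = 0" "h1_vert v (snd E) = 0"
    using v E verts fr by (auto simp: H1_0_def H1_def)
  have tr: "is_edge_trace k E v (edge_trace k E v)"
    by (rule edge_trace[OF ne vE(1)])
  show ?thesis
  proof (rule edge_trace_unique_scalar[OF ne _ _ _ _ x])
    show "(\<lambda>x. edge_trace k E v x $ i) \<in> bipoly (int k + 2)"
      using tr vpoly_component[of "edge_trace k E v"] by (simp add: is_edge_trace_def vpoly_real)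
    show "edge_trace k E v (fst E) $ i = 0" "edge_trace k E v (snd E) $ i = 0"
      using tr vE by (simp_all add: is_edge_trace_def)
    fix q assume "q \<in> bipoly (int k)"
    then have "(\<lambda>x. q x *\<^sub>R axis i (1::real)) \<in> vpoly (int k)"
      by (rule vpoly_scaleR_const)
    then have "edge_integral E (\<lambda>x. edge_trace k E v x \<bullet> (q x *\<^sub>R axis i 1)) = edge_integral E (\<lambda>x. h1_edge v E x \<bullet> (q x *\<^sub>R axis i 1))"
      by (rule tr[unfolded is_edge_trace_def, THEN conjunct2, THEN conjunct2, THEN conjunct2, rule_format])
    then show "edge_integral E (\<lambda>x. edge_trace k E v x $ i * q x) = 0"
      by (simp add: inner_axis mult.commute vE(2) edge_integral_def)
  qed
qed

text \<open>\<open>sym_grad\<close> is zero off the elements, so its squared norm is the sum of the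
  elementwise ones extended by zero. An element lies in \<Omega>, and not only in its closure,
  because \<Omega> is the interior of a closed set.\<close>

lemma l2norm_sym_grad:
  assumes \<Omega>: "open_polygon \<Omega>" and M: "polygonal_mesh \<Omega> M"
    and int: "\<And>T. T \<in> elems M \<Longrightarrow> (\<lambda>x. (norm (sym_grad_elem k M T v x))\<^sup>2) integrable_on T"
  shows "(l2norm \<Omega> (sym_grad k M v))\<^sup>2 = (\<Sum>T\<in>elems M. integral T (\<lambda>x. (norm (sym_grad_elem k M T v x))\<^sup>2))"
proof -
  have fin: "finite (elems M)" and disj: "pairwise disjnt (elems M)" and cover: "closure \<Omega> = (\<Union>T\<in>elems M. closure T)"
    and op: "\<And>T. T \<in> elems M \<Longrightarrow> open_polygon T"
    using polygonal_meshD[OF M] by blast+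
  let ?g = "\<lambda>T x. (norm (sym_grad_elem k M T v x))\<^sup>2"
  have sub: "T \<subseteq> \<Omega>" if T: "T \<in> elems M" for T
  proof -
    obtain F where F: "finite F" "\<And>\<tau>. \<tau> \<in> F \<Longrightarrow> 2 simplex \<tau>" "\<Omega> = interior (\<Union>F)"
      using \<Omega> unfolding open_polygon_def by blast
    have "closed (\<Union>F)"
      using F(1,2) closed_simplex by (intro closed_Union) blast+
    then have "closure \<Omega> \<subseteq> \<Union>F"
      unfolding F(3) using interior_subset by (rule closure_minimal[rotated])
    moreover have "T \<subseteq> closure \<Omega>"
      unfolding cover using T closure_subset by blast
    ultimately have "T \<subseteq> interior (\<Union>F)"
      using open_polygonD(1)[OF op[OF T]] by (intro interior_maximal) auto
    then show ?thesis using F(3) by simp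
  qed
  have pt: "(norm (sym_grad k M v x))\<^sup>2 = (\<Sum>T\<in>elems M. if x \<in> T then ?g T x else 0)" for x
  proof (cases "\<exists>T\<in>elems M. x \<in> T")
    case True
    then obtain T where T: "T \<in> elems M" "x \<in> T" by blast
    have other: "x \<notin> T'" if "T' \<in> elems M - {T}" for T'
      using disj that T by (auto simp: pairwise_def disjnt_def)
    have "sym_grad k M v x = indicator T x *\<^sub>R sym_grad_elem k M T v x"
      unfolding sym_grad_def using other by (subst sum.remove[OF fin T(1)]) (auto intro!: sum.neutral)
    moreover have "(\<Sum>T\<in>elems M. if x \<in> T then ?g T x else 0) = ?g T x"
      using other T(2) by (subst sum.remove[OF fin T(1)]) (auto intro!: sum.neutral)
    ultimately show ?thesis using T(2) by simp
  next
    case False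
    then show ?thesis by (auto simp: sym_grad_def intro!: sum.neutral)
  qed
  have hi: "((\<lambda>x. if x \<in> T then ?g T x else 0) has_integral integral T (?g T)) \<Omega>" if T: "T \<in> elems M" for T
    unfolding has_integral_restrict[OF sub[OF T]] by (rule integrable_integral[OF int[OF T]])
  have "((\<lambda>x. (norm (sym_grad k M v x))\<^sup>2) has_integral (\<Sum>T\<in>elems M. integral T (?g T))) \<Omega>"
    unfolding pt by (rule has_integral_sum[OF fin hi])
  then have "integral \<Omega> (\<lambda>x. (norm (sym_grad k M v x))\<^sup>2) = (\<Sum>T\<in>elems M. integral T (?g T))"
    by (rule integral_unique)
  moreover have "0 \<le> (\<Sum>T\<in>elems M. integral T (?g T))"
    using int by (intro sum_nonneg integral_nonneg) auto
  ultimately show ?thesis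
    by (simp add: l2norm_def)
qed

theorem proposition3:
  fixes \<Omega> :: "(real^2) set" and \<rho> :: real and k :: nat
  assumes "open_polygon \<Omega>" and "0 < \<rho>" and "\<rho> < 1"
  shows "\<exists>C>0. \<forall>\<M>. regular_mesh_sequence \<Omega> \<rho> \<M> \<longrightarrow>
    (\<forall>n. \<forall>\<phi>\<in>H1_0 \<Omega> k (\<M> n).
       (rot_norm k (\<M> n) (discrete_grad k (\<M> n) \<phi>))\<^sup>2
       \<le> C * ((l2norm \<Omega> (sym_grad k (\<M> n) \<phi>))\<^sup>2
               + (\<Sum>T\<in>elems (\<M> n). stab1 k (\<M> n) T \<phi> \<phi> / (diameter T)\<^sup>2)))"
proof -
  from element_sup_bound[OF assms(2), of "int k + 1", where 'b = "real^2^2"]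
  obtain Csup where sup: "0 \<le> Csup \<and> (\<forall>Z :: real^2 \<Rightarrow> real^2^2. Z \<in> vpoly (int k + 1) \<longrightarrow>
    (\<forall>z h T. 0 < h \<longrightarrow> open T \<longrightarrow> bounded T \<longrightarrow> ball z (\<rho> * h) \<subseteq> T \<longrightarrow>
    (\<forall>x\<in>cball z h. (norm (Z x))\<^sup>2 \<le> Csup / h\<^sup>2 * integral T (\<lambda>x. (norm (Z x))\<^sup>2))))" ..
  note Csup = sup[THEN conjunct1] sup[THEN conjunct2, rule_format]
  from edge_inverse_inequality[of "int k + 2"]
  obtain Cinv where inv: "0 \<le> Cinv \<and> (\<forall>w::real^2 \<Rightarrow> real^2. w \<in> vpoly (int k + 2) \<longrightarrow> (\<forall>E. fst E \<noteq> snd E \<longrightarrow>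
    edge_integral E (\<lambda>x. (norm (dir_deriv (tangent E) w x))\<^sup>2)
      \<le> Cinv / (edge_length E)\<^sup>2 * edge_integral E (\<lambda>x. (norm (w x))\<^sup>2)))" ..
  note Cinv = inv[THEN conjunct1] inv[THEN conjunct2, rule_format]
  \<comment> \<open>All constants are fixed before any mesh is introduced; K is the factor from
    \<open>element_estimate\<close> with \<open>K\<^sub>1\<close> unfolded.\<close>
  define Ctr where "Ctr = 8 * Csup / \<rho>"
  define K where "K = ((18 + 4 * Ctr) * (Ctr + 1) + 8 * ((Ctr + 1) + (1 + Cinv) / \<rho>\<^sup>2) + 2 * Cinv / \<rho>\<^sup>2) / \<rho>\<^sup>2"
  have "0 \<le> K"
    using Csup(1) Cinv(1) assms(2) by (simp add: K_def Ctr_def)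
  have main: "(rot_norm k M (discrete_grad k M \<phi>))\<^sup>2
      \<le> (16 + K) * ((l2norm \<Omega> (sym_grad k M \<phi>))\<^sup>2 + (\<Sum>T\<in>elems M. stab1 k M T \<phi> \<phi> / (diameter T)\<^sup>2))"
    if M: "polygonal_mesh \<Omega> M" and reg: "regular_mesh \<Omega> \<rho> M" and \<phi>: "\<phi> \<in> H1_0 \<Omega> k M" for M \<phi>
  proof -
    have "\<phi> \<in> H1 k M" using \<phi> by (simp add: H1_0_def)
    have el: "\<exists>z. regular_element M T z (\<rho> * diameter T) k \<phi> (diameter T) \<rho> Ctr Cinv" if T: "T \<in> elems M" for T
      unfolding Ctr_def
      by (rule regular_element_mesh[OF M reg assms(2) T \<open>\<phi> \<in> H1 k M\<close> Csup(1) _ Cinv(1)]) (fact Csup(2) Cinv(2))+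
    define c where "c E = edge_integral E (\<lambda>x. edge_trace k E \<phi> x $ 1 * dir_deriv (tangent E) (edge_trace k E \<phi>) x $ 2)" for E
    define s where "s T = integral T (\<lambda>x. (norm (sym_grad_elem k M T \<phi> x))\<^sup>2)" for T
    define b where "b T = stab1 k M T \<phi> \<phi> / (diameter T)\<^sup>2" for T
    have local_est: "(rot_norm_elem k M T (discrete_grad k M \<phi>))\<^sup>2
        \<le> 16 * s T + K * b T - 8 * (\<Sum>E\<in>edges_of M T. sign_TE T E * c E)"
      and b_nonneg: "0 \<le> b T"
      and int: "(\<lambda>x. (norm (sym_grad_elem k M T \<phi> x))\<^sup>2) integrable_on T" and s_nonneg: "0 \<le> s T"
      if T: "T \<in> elems M" for T
    proof -
      obtain z where "regular_element M T z (\<rho> * diameter T) k \<phi> (diameter T) \<rho> Ctr Cinv"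
        using el[OF T] by blast
      then interpret regular_element M T z "\<rho> * diameter T" k \<phi> "diameter T" \<rho> Ctr Cinv .
      show "(rot_norm_elem k M T (discrete_grad k M \<phi>))\<^sup>2
        \<le> 16 * s T + K * b T - 8 * (\<Sum>E\<in>edges_of M T. sign_TE T E * c E)"
        using element_estimate unfolding s_def b_def K_def c_def K\<^sub>1_def J_def .
      have "0 \<le> \<rho>\<^sup>2 * (S / diameter T)"
        using S_nonneg h by simp
      then show "0 \<le> b T"
        using stab1_bound by (simp add: b_def)
      have "(\<lambda>x. (norm (sym_part (G x)))\<^sup>2) integrable_on T"
        by (rule integrable_on_bounded_open(2)[OF open_T bounded_T cont_norm[OF sym_part_vpoly]])
      then show int: "(\<lambda>x. (norm (sym_grad_elem k M T \<phi> x))\<^sup>2) integrable_on T"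
        by (rule integrable_eq) (simp add: sym_grad_elem_def grad_elem_eq restr_eq(1) sym_part_def)
      show "0 \<le> s T"
        unfolding s_def by (rule integral_nonneg[OF int]) simp
    qed
    \<comment> \<open>The sum of the terms \<open>J\<close> of all elements: c sees only the edge
      trace, which neighbouring elements share and which vanishes on boundary edges.\<close>
    have "(\<Sum>T\<in>elems M. \<Sum>E\<in>edges_of M T. sign_TE T E * c E) = 0"
    proof (rule sum_over_interfaces[OF M])
      show "\<exists>z r. star_polygon T z r (edges_of M T)" if "T \<in> elems M" for T
        using star_polygon_element[OF M reg assms(2) that] by blast
      fix E assume E: "E \<in> edges M" "seg E \<subseteq> frontier \<Omega>"
      have "fst E \<noteq> snd E"
        using polygonal_meshD(6)[OF M] E(1) by blast
      then have "c E = edge_integral E (\<lambda>x. 0)"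
        unfolding c_def using edge_trace_boundary[OF M \<phi> E] closure_subset[of "seg E"]
        by (intro l2_functional.I_cong[OF l2_functional_edge]) auto
      then show "c E = 0" by (simp add: edge_integral_def)
    qed
    moreover have "(rot_norm k M (discrete_grad k M \<phi>))\<^sup>2 = (\<Sum>T\<in>elems M. (rot_norm_elem k M T (discrete_grad k M \<phi>))\<^sup>2)"
      unfolding rot_norm_def by (simp add: sum_nonneg)
    moreover have "\<dots> \<le> (\<Sum>T\<in>elems M. 16 * s T + K * b T - 8 * (\<Sum>E\<in>edges_of M T. sign_TE T E * c E))"
      by (rule sum_mono) (rule local_est)
    ultimately have "(rot_norm k M (discrete_grad k M \<phi>))\<^sup>2 \<le> 16 * (\<Sum>T\<in>elems M. s T) + K * (\<Sum>T\<in>elems M. b T)"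
      by (simp add: sum.distrib sum_subtractf sum_distrib_left[symmetric])
    \<comment> \<open>\<open>16 + K\<close> dominates both factors and is positive even for K =
      0.\<close>
    also have "\<dots> \<le> (16 + K) * (\<Sum>T\<in>elems M. s T) + (16 + K) * (\<Sum>T\<in>elems M. b T)"
      using \<open>0 \<le> K\<close> b_nonneg s_nonneg by (intro add_mono mult_right_mono sum_nonneg) auto
    also have "(\<Sum>T\<in>elems M. s T) = (l2norm \<Omega> (sym_grad k M \<phi>))\<^sup>2"
      unfolding s_def by (rule l2norm_sym_grad[OF assms(1) M int, symmetric])
    finally show ?thesis
      by (simp add: b_def distrib_left)
  qed
  show ?thesis
    using main \<open>0 \<le> K\<close> by (intro exI[of _ "16 + K"]) (auto simp: regular_mesh_sequence_def)
qed

end
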